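(* For $i=1,2$ let $G_i\subset\mathrm{GL}(V_i)$ be a finite complex reflection group and $D_i\subset V_i$ the union of its reflection hyperplanes. Then any isomorphism of orbit spaces $f:G_1\backslash V_1\to G_2\backslash V_2$ which maps $G_1\backslash D_1$ onto $G_2\backslash D_2$ and is $\mathbb C^\times$-equivariant relative to the natural effective $\mathbb C^\times$-actions on domain and range is obtained from the developing map of a $G_1$-invariant Dunkl connection on $V_1\setminus D_1$ (and then likewise for $f^{-1}$, with the roles of $1$ and $2$ interchanged).
   Context: Each $V_i$ is a finite dimensional complex vector space; the collection $\mathcal H_i$ of reflection hyperplanes of $G_i$ is assumed to be irreducible (there is no partition $\mathcal H_i=\mathcal H'\sqcup\mathcal H''$ into nonempty subsets with $\bigcap_{H\in\mathcal H'}H+\bigcap_{H\in\mathcal H''}H=V_i$) with common intersection $\{0\}$. The natural effective $\mathbb C^\times$-action on $G_i\backslash V_i$ is the action induced by scalar multiplication on $V_i$, made effective by dividing $\mathbb C^\times$ by the finite subgroup acting trivially on $G_i\backslash V_i$. A Dunkl connection on the complement $V^\circ$ of a finite set $\mathcal H$ of linear hyperplanes in a complex vector space $V$ is a flat (automatically torsion free) connection on the tangent bundle of $V^\circ$ of the form $\nabla^0-\sum_{H\in\mathcal H}\omega_H\otimes\kappa_H\pi_H$, where $\nabla^0$ is the translation invariant connection, $\omega_H=\phi_H^{-1}d\phi_H$ with $\phi_H$ a linear equation for $H$, $\kappa_H\in\mathbb C$, and $\pi_H$ is the orthogonal projection with kernel $H$ for some positive definite hermitian inner product on $V$ (the same for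 all $H$). The developing map of such a connection $\nabla$ is the multivalued map from $V^\circ$ to an affine space $A$ of dimension $\dim V$ whose affine coordinates are the (multivalued) functions with $\nabla$-flat differential. That $f$ is obtained from the developing map of $\nabla$ means: $\nabla$ is the lift to $V_1\setminus D_1$ of the pull-back under $f$ of the flat connection on $G_2\backslash(V_2\setminus D_2)$ to which the translation invariant connection of $V_2$ descends; so, after identifying $A$ with $V_2$, the composite of $V_1\setminus D_1\to G_1\backslash V_1$ with $f$ is the composite of the (multivalued) developing map of $\nabla$ with $V_2\to G_2\backslash V_2$. *)

theory Defs
  imports "HOL-Analysis.Analysis"
begin

section \<open>Finite complex reflection groups\<close>

definition linear_hyperplane :: "(complex^'n) set \<Rightarrow> bool" where
  "linear_hyperplane H \<longleftrightarrow> vec.subspace H \<and> vec.dim H = CARD('n) - 1"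

definition matrix_group :: "(complex^'n^'n) set \<Rightarrow> bool" where
  "matrix_group G \<longleftrightarrow>
     mat 1 \<in> G \<and> (\<forall>g\<in>G. \<forall>h\<in>G. g ** h \<in> G) \<and>
     (\<forall>g\<in>G. invertible g \<and> matrix_inv g \<in> G)"

definition fixed_space :: "complex^'n^'n \<Rightarrow> (complex^'n) set" where
  "fixed_space s = {v. s *v v = v}"

text \<open>In a finite group every element has finite order, so that the complex reflections in it are
  exactly the elements whose fixed space is a hyperplane.\<close>

definition reflections :: "(complex^'n^'n) set \<Rightarrow> (complex^'n^'n) set" where
  "reflections G = {s\<in>G. linear_hyperplane (fixed_space s)}"

definition finite_reflection_group :: "(complex^'n^'n) set \<Rightarrow> bool" where
  "finite_reflection_group G \<longleftrightarrow>
     finite G \<and> matrix_group G \<and> matrix_group hull (reflections G) = G"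

definition reflection_hyperplanes :: "(complex^'n^'n) set \<Rightarrow> (complex^'n) set set" where
  "reflection_hyperplanes G = fixed_space ` reflections G"

definition discriminant_locus :: "(complex^'n^'n) set \<Rightarrow> (complex^'n) set" where
  "discriminant_locus G = \<Union>(reflection_hyperplanes G)"

definition irreducible_arrangement :: "(complex^'n) set set \<Rightarrow> bool" where
  "irreducible_arrangement \<H> \<longleftrightarrow>
     \<not> (\<exists>\<A> \<B>. \<A> \<noteq> {} \<and> \<B> \<noteq> {} \<and> \<A> \<inter> \<B> = {} \<and> \<A> \<union> \<B> = \<H> \<and>
            {a + b |a b. a \<in> \<Inter>\<A> \<and> b \<in> \<Inter>\<B>} = UNIV)"


section \<open>Orbit spaces as complex analytic spaces\<close>

definition mat_orbit :: "(complex^'n^'n) set \<Rightarrow> complex^'n \<Rightarrow> (complex^'n) set" where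
  "mat_orbit G v = (\<lambda>g. g *v v) ` G"

definition orbit_space :: "(complex^'n^'n) set \<Rightarrow> (complex^'n) set set" where
  "orbit_space G = range (mat_orbit G)"

text \<open>Holomorphy in several variables: a complex linear Frechet derivative at every point. It is
  only used for open sets.\<close>

definition holo_on :: "(complex^'n \<Rightarrow> complex) \<Rightarrow> (complex^'n) set \<Rightarrow> bool" where
  "holo_on h U \<longleftrightarrow>
     (\<forall>z\<in>U. \<exists>h'. (h has_derivative h') (at z) \<and> Vector_Spaces.linear (*s) (*) h')"

text \<open>The orbit space carries the quotient topology, and its structure sheaf consists of the
  functions whose pull-back to the vector space is holomorphic.\<close>

definition orbit_open :: "(complex^'n^'n) set \<Rightarrow> (complex^'n) set set \<Rightarrow> bool" where
  "orbit_open G W \<longleftrightarrow> W \<subseteq> orbit_space G \<and> open (mat_orbit G -` W)"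

definition orbit_holo_on ::
    "(complex^'n^'n) set \<Rightarrow> ((complex^'n) set \<Rightarrow> complex) \<Rightarrow> (complex^'n) set set \<Rightarrow> bool" where
  "orbit_holo_on G h W \<longleftrightarrow> holo_on (\<lambda>v. h (mat_orbit G v)) (mat_orbit G -` W)"

definition orbit_morphism ::
    "(complex^'n^'n) set \<Rightarrow> (complex^'m^'m) set \<Rightarrow> ((complex^'n) set \<Rightarrow> (complex^'m) set) \<Rightarrow> bool"
  where
  "orbit_morphism G1 G2 f \<longleftrightarrow>
     f ` orbit_space G1 \<subseteq> orbit_space G2 \<and>
     (\<forall>W. orbit_open G2 W \<longrightarrow>
        orbit_open G1 (f -` W \<inter> orbit_space G1) \<and>
        (\<forall>h. orbit_holo_on G2 h W \<longrightarrow>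
           orbit_holo_on G1 (\<lambda>X. h (f X)) (f -` W \<inter> orbit_space G1)))"

definition orbit_iso ::
    "(complex^'n^'n) set \<Rightarrow> (complex^'m^'m) set \<Rightarrow> ((complex^'n) set \<Rightarrow> (complex^'m) set) \<Rightarrow> bool"
  where
  "orbit_iso G1 G2 f \<longleftrightarrow>
     bij_betw f (orbit_space G1) (orbit_space G2) \<and>
     orbit_morphism G1 G2 f \<and> orbit_morphism G2 G1 (inv_into (orbit_space G1) f)"


section \<open>The natural effective action of the multiplicative group\<close>

definition trivial_scalars :: "(complex^'n^'n) set \<Rightarrow> complex set" where
  "trivial_scalars G = {t. t \<noteq> 0 \<and> (\<forall>v. mat_orbit G (t *s v) = mat_orbit G v)}"

text \<open>The kernel of the action of the nonzero scalars is a finite group, hence the group of all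
  roots of unity of order \<open>e\<close>, with \<open>e\<close> its cardinality. The quotient is identified with the
  multiplicative group by \<open>t \<mapsto> t ^ e\<close>, so \<open>s\<close> acts as any \<open>t\<close> with \<open>t ^ e = s\<close>. All these \<open>t\<close>
  map an orbit to the same orbit, so that the union below is that orbit; this is the lemma
  \<open>effective_action_orbit\<close>.\<close>

definition effective_action ::
    "(complex^'n^'n) set \<Rightarrow> complex \<Rightarrow> (complex^'n) set \<Rightarrow> (complex^'n) set" where
  "effective_action G s X = (\<Union>t\<in>{t. t ^ card (trivial_scalars G) = s}. (\<lambda>v. t *s v) ` X)"

lemma mat_orbit_scale: "mat_orbit G (t *s v) = (\<lambda>v. t *s v) ` mat_orbit G v"
  unfolding mat_orbit_def image_image by (simp only: vector_scalar_commute)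

lemma finite_trivial_scalars:
  fixes G :: "(complex^'n^'n) set"
  assumes "finite G" "matrix_group G"
  shows "finite (trivial_scalars G)"
proof -
  let ?u = "1 :: complex^'n"
  have sub: "(\<lambda>t. t *s ?u) ` trivial_scalars G \<subseteq> mat_orbit G ?u"
  proof clarify
    fix t assume "t \<in> trivial_scalars G"
    moreover have "t *s ?u \<in> mat_orbit G (t *s ?u)"
      using assms(2) unfolding mat_orbit_def matrix_group_def by force
    ultimately show "t *s ?u \<in> mat_orbit G ?u"
      unfolding trivial_scalars_def by blast
  qed
  have "finite (mat_orbit G ?u)"
    using assms(1) by (simp add: mat_orbit_def)
  note fin = finite_subset[OF sub this]
  have "inj_on (\<lambda>t. t *s ?u) (trivial_scalars G)"
    by (simp add: inj_on_def vec_eq_iff)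
  with fin show ?thesis
    by (simp add: finite_image_iff)
qed

lemma trivial_scalars_eq_roots_of_unity:
  fixes G :: "(complex^'n^'n) set"
  assumes "finite G" "matrix_group G"
  shows "card (trivial_scalars G) > 0"
    and "trivial_scalars G = {t. t ^ card (trivial_scalars G) = 1}"
proof -
  let ?K = "trivial_scalars G" let ?e = "card ?K"
  have fin: "finite ?K" using finite_trivial_scalars[OF assms] .
  have one: "1 \<in> ?K" by (simp add: trivial_scalars_def)
  show pos: "?e > 0" using fin one by (auto simp: card_gt_0_iff)
  have mult: "s * t \<in> ?K" if "s \<in> ?K" "t \<in> ?K" for s t
  proof -
    have "mat_orbit G ((s * t) *s v) = mat_orbit G v" for v
      using that unfolding trivial_scalars_def vector_smult_assoc[symmetric] by blast
    then show ?thesis using that by (simp add: trivial_scalars_def)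
  qed
  have sub: "?K \<subseteq> {t. t ^ ?e = 1}"
  proof clarify
    fix t assume t: "t \<in> ?K"
    have t0: "t \<noteq> 0" using t by (simp add: trivial_scalars_def)
    have inj: "inj_on (\<lambda>s. t * s) ?K" using t0 by (auto simp: inj_on_def)
    have img: "(\<lambda>s. t * s) ` ?K = ?K"
      using mult t inj fin by (intro endo_inj_surj) auto
    have "\<Prod>?K = (\<Prod>s\<in>?K. t * s)"
      using prod.reindex[OF inj, of "\<lambda>x. x"] img by (simp add: o_def)
    also have "\<dots> = t ^ ?e * \<Prod>?K" by (simp add: prod.distrib)
    finally have "\<Prod>?K = t ^ ?e * \<Prod>?K" .
    moreover have "\<Prod>?K \<noteq> 0" using fin by (simp add: trivial_scalars_def)
    ultimately show "t ^ ?e = 1" by simp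
  qed
  have "card {t::complex. t ^ ?e = 1} = ?e" using pos by (rule card_roots_unity_eq)
  moreover have "finite {t::complex. t ^ ?e = 1}"
    using pos by (intro finite_roots_unity) auto
  ultimately show "?K = {t. t ^ ?e = 1}"
    using sub by (metis card_subset_eq)
qed

lemma effective_action_orbit:
  fixes G :: "(complex^'n^'n) set"
  assumes "finite G" "matrix_group G" "t \<noteq> 0"
  shows "effective_action G (t ^ card (trivial_scalars G)) (mat_orbit G v) = mat_orbit G (t *s v)"
proof -
  let ?e = "card (trivial_scalars G)"
  have "mat_orbit G (s *s v) = mat_orbit G (t *s v)" if "s ^ ?e = t ^ ?e" for s
  proof -
    have "(s / t) ^ ?e = 1" using that assms(3) by (simp add: power_divide)
    then have "s / t \<in> trivial_scalars G"
      using trivial_scalars_eq_roots_of_unity(2)[OF assms(1,2)] by blast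
    then have "mat_orbit G ((s / t) *s (t *s v)) = mat_orbit G (t *s v)"
      unfolding trivial_scalars_def by blast
    then show ?thesis using assms(3) by (simp add: vector_smult_assoc)
  qed
  then show ?thesis
    unfolding effective_action_def mat_orbit_scale[symmetric] by blast
qed

definition effectively_equivariant ::
    "(complex^'n^'n) set \<Rightarrow> (complex^'m^'m) set \<Rightarrow> ((complex^'n) set \<Rightarrow> (complex^'m) set) \<Rightarrow> bool"
  where
  "effectively_equivariant G1 G2 f \<longleftrightarrow>
     (\<forall>s X. s \<noteq> 0 \<longrightarrow> X \<in> orbit_space G1 \<longrightarrow>
        f (effective_action G1 s X) = effective_action G2 s (f X))"


section \<open>Connections on the tangent bundle and Dunkl connections\<close>

text \<open>A connection on the trivialized tangent bundle of an open subset is given by its form \<open>A\<close>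
  relative to the translation invariant connection: it is \<open>\<nabla>\<^sup>0 + A\<close>, where \<open>A z x\<close> is the
  endomorphism attached to the tangent vector \<open>x\<close> at \<open>z\<close>. Thus \<open>A = 0\<close> is the translation
  invariant connection.\<close>

type_synonym 'n connection_form =
  "complex^'n \<Rightarrow> complex^'n \<Rightarrow> complex^'n \<Rightarrow> complex^'n"

definition cov_deriv ::
    "'n connection_form \<Rightarrow> (complex^'n \<Rightarrow> complex^'n) \<Rightarrow> (complex^'n \<Rightarrow> complex^'n)
      \<Rightarrow> complex^'n \<Rightarrow> complex^'n" where
  "cov_deriv A X Y z = frechet_derivative Y (at z) (X z) + A z (X z) (Y z)"

text \<open>Vanishing of the curvature. As the curvature is a tensor, it is evaluated on constant vector
  fields, whose Lie brackets are zero.\<close>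

definition flat_on :: "(complex^'n) set \<Rightarrow> 'n connection_form \<Rightarrow> bool" where
  "flat_on U A \<longleftrightarrow>
     (\<forall>z\<in>U. \<forall>x y w.
        cov_deriv A (\<lambda>_. x) (cov_deriv A (\<lambda>_. y) (\<lambda>_. w)) z
      - cov_deriv A (\<lambda>_. y) (cov_deriv A (\<lambda>_. x) (\<lambda>_. w)) z = 0)"

definition hermitian_inner :: "(complex^'n \<Rightarrow> complex^'n \<Rightarrow> complex) \<Rightarrow> bool" where
  "hermitian_inner ip \<longleftrightarrow>
     (\<forall>x y z. ip (x + y) z = ip x z + ip y z) \<and>
     (\<forall>c x y. ip (c *s x) y = c * ip x y) \<and>
     (\<forall>x y. ip y x = cnj (ip x y)) \<and>
     (\<forall>x. x \<noteq> 0 \<longrightarrow> Re (ip x x) > 0)"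

definition orth_projection_with_kernel ::
    "(complex^'n \<Rightarrow> complex^'n \<Rightarrow> complex) \<Rightarrow> (complex^'n) set \<Rightarrow> (complex^'n \<Rightarrow> complex^'n) \<Rightarrow> bool"
  where
  "orth_projection_with_kernel ip H p \<longleftrightarrow> (\<forall>v. v - p v \<in> H \<and> (\<forall>h\<in>H. ip (p v) h = 0))"

text \<open>The form \<open>\<omega>\<^sub>H = \<phi>\<^sub>H\<inverse> d\<phi>\<^sub>H\<close> takes the value \<open>\<phi> H x / \<phi> H z\<close> on the tangent vector \<open>x\<close> at \<open>z\<close>.\<close>

definition dunkl_connection :: "(complex^'n) set set \<Rightarrow> 'n connection_form \<Rightarrow> bool" where
  "dunkl_connection \<H> A \<longleftrightarrow>
     finite \<H> \<and> (\<forall>H\<in>\<H>. linear_hyperplane H) \<and>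
     (\<exists>ip \<phi> \<kappa> \<pi>. hermitian_inner ip \<and>
        (\<forall>H\<in>\<H>. Vector_Spaces.linear (*s) (*) (\<phi> H) \<and> {v. \<phi> H v = 0} = H \<and>
                orth_projection_with_kernel ip H (\<pi> H)) \<and>
        (\<forall>z\<in>- \<Union>\<H>. \<forall>x y.
           A z x y = - (\<Sum>H\<in>\<H>. ((\<phi> H x / \<phi> H z) * \<kappa> H) *s \<pi> H y))) \<and>
     flat_on (- \<Union>\<H>) A"

text \<open>The pull-back of \<open>\<nabla>\<^sup>0 + B\<close> under a map \<open>F\<close> with invertible derivative: the covariant
  derivative of the constant field \<open>y\<close> along \<open>x\<close> is mapped by \<open>dF\<close> to the covariant derivative of
  \<open>dF y\<close> along \<open>x\<close>.\<close>

definition pullback_connection ::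
    "(complex^'n \<Rightarrow> complex^'m) \<Rightarrow> 'm connection_form \<Rightarrow> 'n connection_form" where
  "pullback_connection F B z x y =
     inv (frechet_derivative F (at z))
       (frechet_derivative (\<lambda>u. frechet_derivative F (at u) y) (at z) x
        + B (F z) (frechet_derivative F (at z) x) (frechet_derivative F (at z) y))"

definition invariant_connection ::
    "(complex^'n^'n) set \<Rightarrow> (complex^'n) set \<Rightarrow> 'n connection_form \<Rightarrow> bool" where
  "invariant_connection G U A \<longleftrightarrow>
     (\<forall>g\<in>G. \<forall>z\<in>U. \<forall>x y. pullback_connection (\<lambda>v. g *v v) A z x y = A z x y)"


section \<open>Developing maps\<close>

definition locally_biholomorphic :: "(complex^'n) set \<Rightarrow> (complex^'n \<Rightarrow> complex^'m) \<Rightarrow> bool" where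
  "locally_biholomorphic U F \<longleftrightarrow>
     open U \<and> (\<forall>i. holo_on (\<lambda>z. F z $ i) U) \<and> (\<forall>z\<in>U. bij (frechet_derivative F (at z)))"

text \<open>The differential of \<open>h\<close> is flat for the dual connection on the cotangent bundle.\<close>

definition flat_differential ::
    "'n connection_form \<Rightarrow> (complex^'n) set \<Rightarrow> (complex^'n \<Rightarrow> complex) \<Rightarrow> bool" where
  "flat_differential A U h \<longleftrightarrow>
     (\<forall>z\<in>U. \<forall>x y.
        frechet_derivative (\<lambda>u. frechet_derivative h (at u) y) (at z) x
      - frechet_derivative h (at z) (A z x y) = 0)"

text \<open>A univalued branch of the developing map, with its affine target space identified with a
  vector space.\<close>

definition developing_branch ::
    "'n connection_form \<Rightarrow> (complex^'n) set \<Rightarrow> (complex^'n \<Rightarrow> complex^'m) \<Rightarrow> bool" where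
  "developing_branch A U F \<longleftrightarrow>
     locally_biholomorphic U F \<and> (\<forall>i. flat_differential A U (\<lambda>z. F z $ i))"

text \<open>The multivalued developing map on the open set \<open>V\<close>, as the collection of all function
  elements arising by analytic continuation from one branch \<open>F\<^sub>0\<close> on \<open>U\<^sub>0\<close>. The domains are convex
  so that the overlaps are connected.\<close>

inductive developing_map ::
    "(complex^'n) set \<Rightarrow> 'n connection_form \<Rightarrow> (complex^'n) set \<Rightarrow> (complex^'n \<Rightarrow> complex^'m)
      \<Rightarrow> (complex^'n) set \<Rightarrow> (complex^'n \<Rightarrow> complex^'m) \<Rightarrow> bool"
  for V A U\<^sub>0 F\<^sub>0 where
  start: "convex U\<^sub>0 \<Longrightarrow> U\<^sub>0 \<subseteq> V \<Longrightarrow> developing_branch A U\<^sub>0 F\<^sub>0 \<Longrightarrow> developing_map V A U\<^sub>0 F\<^sub>0 U\<^sub>0 F\<^sub>0"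
| continue: "developing_map V A U\<^sub>0 F\<^sub>0 U F \<Longrightarrow> convex U' \<Longrightarrow> U' \<subseteq> V \<Longrightarrow>
    developing_branch A U' F' \<Longrightarrow> U \<inter> U' \<noteq> {} \<Longrightarrow> (\<And>z. z \<in> U \<inter> U' \<Longrightarrow> F z = F' z) \<Longrightarrow>
    developing_map V A U\<^sub>0 F\<^sub>0 U' F'"

text \<open>Off the reflection hyperplanes the orbit maps are local biholomorphisms, so local inverses of
  \<open>mat_orbit G2\<close> are charts in which the connection on the second orbit space is the translation
  invariant one. Its pull-back under \<open>f\<close>, lifted to the first vector space, is therefore locally the
  pull-back of the form \<open>0\<close> under the lifts \<open>F\<close> of \<open>f\<close>.\<close>

definition lift_of_pullback ::
    "(complex^'n^'n) set \<Rightarrow> (complex^'m^'m) set \<Rightarrow> ((complex^'n) set \<Rightarrow> (complex^'m) set)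
      \<Rightarrow> 'n connection_form \<Rightarrow> bool" where
  "lift_of_pullback G1 G2 f A \<longleftrightarrow>
     (\<forall>z w. z \<notin> discriminant_locus G1 \<longrightarrow> mat_orbit G2 w = f (mat_orbit G1 z) \<longrightarrow>
        (\<exists>U F. z \<in> U \<and> U \<subseteq> - discriminant_locus G1 \<and> F ` U \<subseteq> - discriminant_locus G2 \<and>
           F z = w \<and> locally_biholomorphic U F \<and>
           (\<forall>u\<in>U. mat_orbit G2 (F u) = f (mat_orbit G1 u)) \<and>
           (\<forall>u\<in>U. \<forall>x y. A u x y = pullback_connection F (\<lambda>_ _ _. 0) u x y)))"

definition obtained_from_developing_map ::
    "(complex^'n^'n) set \<Rightarrow> (complex^'m^'m) set \<Rightarrow> ((complex^'n) set \<Rightarrow> (complex^'m) set)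
      \<Rightarrow> 'n connection_form \<Rightarrow> bool" where
  "obtained_from_developing_map G1 G2 f A \<longleftrightarrow>
     lift_of_pullback G1 G2 f A \<and>
     (\<exists>U\<^sub>0 F\<^sub>0.
        (\<forall>z\<in>- discriminant_locus G1.
           \<exists>U F. developing_map (- discriminant_locus G1) A U\<^sub>0 F\<^sub>0 U F \<and> z \<in> U) \<and>
        (\<forall>U F. developing_map (- discriminant_locus G1) A U\<^sub>0 F\<^sub>0 U F \<longrightarrow>
           (\<forall>z\<in>U. mat_orbit G2 (F z) = f (mat_orbit G1 z))))"

end

theory Submission
  imports Defs "HOL-Complex_Analysis.Complex_Analysis"
begin

text \<open>The isomorphism is used through the relation \<open>R\<close> that holds between vectors whose orbits
  correspond. The assumptions on \<open>R\<close> in the locale \<open>correspondence\<close> are symmetric in the two groups, so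
  that every result about it also holds with the groups interchanged; in particular the second half
  of the theorem is the first half for the inverse relation.

  The connection. A point with trivial stabilizer has a neighbourhood that the orbit map identifies
  with an open subset of the orbit space. Hence near a regular point, that is one with trivial
  stabilizer, \<open>R\<close> is the graph of a local biholomorphism, a lift, as soon as the related points are
  regular too. They are: the inverse relation is there a holomorphic function, invariant under the
  stabilizer, and its derivative is injective. The derivative is invertible
  away from the fixed spaces of nontrivial group elements; off the discriminant none of these is a hyperplane,
  and the entries of the inverse derivative stay bounded across subspaces of codimension at least two
  by the maximum principle. So regular points correspond to regular points (\<open>regular_iff\<close>). Two lifts
  differ by an element of the second group, which is linear, and therefore pull back the translation
  invariant connection to the same form \<open>lift_connection\<close>. It is flat and invariant under the first
  group. Since \<open>R\<close> is compatible with scalar multiplication, up to a power, it is homogeneous of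
  degree \<open>-1\<close>.

  The poles. Consider a point of a reflection hyperplane that is generic and is related to a generic
  point of a reflection hyperplane of the second group. On both sides a power of a linear equation
  (of exponent \<open>e\<close> and \<open>e'\<close>, the orders of the pointwise stabilizers) and the linear coordinates along
  the hyperplane are coordinates of the orbit space. The equation of the second hyperplane, to
  the power \<open>e'\<close>, becomes the \<open>e\<close>-th power of the equation \<open>\<phi>\<close> of the first times a unit.
  Differentiating this twice logarithmically shows that \<open>lift_connection\<close> at \<open>z\<close>, evaluated at \<open>x\<close> and
  \<open>y\<close>, differs from \<open>(e / e' - 1) \<phi> x \<phi> y / \<phi> z\<close> times the normal vector by a bounded term
  (\<open>good_point_estimate\<close>). By invariance of dimension such points are dense in the hyperplane
  (\<open>good_point_dense\<close>). The factor \<open>e / e' - 1\<close> is a residue, which depends continuously on the point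
  and takes finitely many values on a dense subset; so it is the same along the entire hyperplane.

  The Dunkl form. Subtracting these poles for all hyperplanes leaves a form that is bounded near a
  dense set of points of each hyperplane, hence, again by the maximum principle, near the origin
  (\<open>bounded_near_subspaces\<close>). Being homogeneous of degree \<open>-1\<close> it vanishes. Thus \<open>lift_connection\<close> is
  a Dunkl form for the inner product that is averaged over the group.

  The developing map. The Dunkl form is holomorphic off the discriminant. The differential of a lift
  satisfies a linear differential equation along rays with these holomorphic coefficients, so it
  extends over a ball whose radius does not depend on the point at which the lift is given, and
  Euler's identity recovers the lift from its differential. Therefore lifts exist near every point
  off the discriminant. They are the branches of the developing map, and as the complement of the
  discriminant is connected, continuation of one of them reaches every point.\<close>

section \<open>Holomorphic functions of several variables\<close>

abbreviation dif :: "('a::real_normed_vector \<Rightarrow> 'b::real_normed_vector) \<Rightarrow> 'a \<Rightarrow> 'a \<Rightarrow> 'b" where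
  "dif h z \<equiv> frechet_derivative h (at z)"

lemma norm_vector_smult: "norm (c *s x) = cmod c * norm (x :: complex^'n)"
  by (simp add: norm_vec_def norm_mult L2_set_right_distrib)

lemma bounded_linear_vsmult_left: "bounded_linear (\<lambda>c. c *s (x :: complex^'n))"
  by (rule bounded_linear_intro[where K = "norm x"])
     (auto simp: norm_vector_smult vec_eq_iff algebra_simps)

lemma bounded_linear_vsmult_right: "bounded_linear (\<lambda>x :: complex^'n. c *s x)"
  by (rule bounded_linear_intro[where K = "cmod c"])
     (auto simp: norm_vector_smult vec_eq_iff algebra_simps)

lemma clinear_iff:
  "Vector_Spaces.linear (*s) (*) (h :: complex^'n \<Rightarrow> complex) \<longleftrightarrow>
     (\<forall>x y. h (x + y) = h x + h y) \<and> (\<forall>c x. h (c *s x) = c * h x)"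
  by (auto simp: Vector_Spaces.linear_def module_hom_def module_hom_axioms_def
      vec.module_axioms vec.vector_space_axioms vector_space_over_itself.module_axioms
      vector_space_over_itself.vector_space_axioms)

lemma bounded_linear_clinear:
  assumes "Vector_Spaces.linear (*s) (*) (h :: complex^'n \<Rightarrow> complex)"
  shows "bounded_linear h"
proof -
  have "h (r *\<^sub>R x) = r *\<^sub>R h x" for r x
  proof -
    have "r *\<^sub>R x = complex_of_real r *s x" by (simp add: vec_eq_iff) (simp add: scaleR_conv_of_real)
    then show ?thesis using assms by (simp add: clinear_iff scaleR_conv_of_real)
  qed
  then have "linear h" using assms by (auto simp: clinear_iff intro!: linearI)
  then show ?thesis by (simp add: linear_conv_bounded_linear)
qed

lemma clinear_expand:
  assumes "Vector_Spaces.linear (*s) (*) (h :: complex^'n \<Rightarrow> complex)"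
  shows "h x = (\<Sum>i\<in>UNIV. x $ i * h (axis i 1))"
proof -
  have l: "linear h" using bounded_linear_clinear[OF assms] by (simp add: linear_conv_bounded_linear)
  have "h x = h (\<Sum>i\<in>UNIV. x $ i *s axis i 1)" by (simp only: basis_expansion)
  also have "\<dots> = (\<Sum>i\<in>UNIV. h (x $ i *s axis i 1))" by (rule linear_sum[OF l])
  finally show ?thesis using assms by (simp add: clinear_iff)
qed


lemma holo_onI:
  assumes "\<And>z. z \<in> U \<Longrightarrow> (h has_derivative h' z) (at z)"
    and "\<And>z x c. z \<in> U \<Longrightarrow> h' z (c *s x) = c * h' z x"
  shows "holo_on h U"
  unfolding holo_on_def clinear_iff
  using assms by (meson bounded_linear.linear has_derivative_bounded_linear linear_add)

lemma holo_on_D: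
  assumes "holo_on h U" "z \<in> U"
  shows "(h has_derivative dif h z) (at z)"
    and "Vector_Spaces.linear (*s) (*) (dif h z)"
    and "dif h z (c *s x) = c * dif h z x"
    and "dif h z (x + y) = dif h z x + dif h z y"
    and "dif h z (x - y) = dif h z x - dif h z y"
    and "dif h z 0 = 0"
proof -
  obtain h' where h': "(h has_derivative h') (at z)" "Vector_Spaces.linear (*s) (*) h'"
    using assms by (auto simp: holo_on_def)
  have [simp]: "dif h z = h'" using frechet_derivative_at[OF h'(1)] by simp
  show a: "(h has_derivative dif h z) (at z)" "Vector_Spaces.linear (*s) (*) (dif h z)"
    using h' by simp_all
  show "dif h z (c *s x) = c * dif h z x" "dif h z (x + y) = dif h z x + dif h z y"
    using h'(2) by (auto simp: clinear_iff)
  show "dif h z (x - y) = dif h z x - dif h z y" "dif h z 0 = 0"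
    using has_derivative_bounded_linear[OF h'(1)] by (auto simp: bounded_linear.linear linear_diff linear_0)
qed

lemma dif_eqI: "(h has_derivative h') (at z) \<Longrightarrow> dif h z = h'"
  using frechet_derivative_at by metis

lemma holo_on_subset: "holo_on h U \<Longrightarrow> W \<subseteq> U \<Longrightarrow> holo_on h W"
  by (auto simp: holo_on_def)

lemma holo_on_local: "(\<And>z. z \<in> U \<Longrightarrow> \<exists>W. z \<in> W \<and> holo_on h W) \<Longrightarrow> holo_on h U"
  by (meson holo_on_def)

lemma holo_on_continuous: "holo_on h U \<Longrightarrow> continuous_on U h"
  by (meson continuous_at_imp_continuous_on has_derivative_continuous holo_on_D(1))

lemma dif_cong_open:
  assumes "open U" "z \<in> U" "\<And>u. u \<in> U \<Longrightarrow> h u = k u"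
  shows "dif h z = dif k z"
proof -
  have "(h has_derivative D) (at z) \<longleftrightarrow> (k has_derivative D) (at z)" for D
    using assms has_derivative_transform_within_open[of h D z UNIV U k]
      has_derivative_transform_within_open[of k D z UNIV U h] by auto
  then show ?thesis by (simp add: frechet_derivative_def)
qed

lemma holo_on_cong:
  assumes "open U" "\<And>u. u \<in> U \<Longrightarrow> h u = k u" "holo_on h U"
  shows "holo_on k U"
proof -
  have "(k has_derivative dif h z) (at z)" if "z \<in> U" for z
    using has_derivative_transform_within_open[OF holo_on_D(1)[OF assms(3) that] assms(1) that assms(2)]
    by simp
  then show ?thesis by (auto intro!: holo_onI holo_on_D[OF assms(3)])
qed

lemma
  assumes "holo_on h U" "holo_on k U"
  shows holo_on_add: "holo_on (\<lambda>z. h z + k z) U"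
    and holo_on_diff: "holo_on (\<lambda>z. h z - k z) U"
    and holo_on_mult: "holo_on (\<lambda>z. h z * k z) U"
    and dif_add: "z \<in> U \<Longrightarrow> dif (\<lambda>z. h z + k z) z x = dif h z x + dif k z x"
    and dif_diff: "z \<in> U \<Longrightarrow> dif (\<lambda>z. h z - k z) z x = dif h z x - dif k z x"
    and dif_mult: "z \<in> U \<Longrightarrow> dif (\<lambda>z. h z * k z) z x = h z * dif k z x + dif h z x * k z"
proof -
  note D = holo_on_D[OF assms(1)] holo_on_D[OF assms(2)]
  show "holo_on (\<lambda>z. h z + k z) U"
    by (rule holo_onI, rule has_derivative_add[OF D(1) D(7)]) (auto simp: D algebra_simps)
  show "holo_on (\<lambda>z. h z - k z) U"
    by (rule holo_onI, rule has_derivative_diff[OF D(1) D(7)]) (auto simp: D algebra_simps)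
  show "holo_on (\<lambda>z. h z * k z) U"
    by (rule holo_onI, rule has_derivative_mult[OF D(1) D(7)]) (auto simp: D algebra_simps)
  show "dif (\<lambda>z. h z + k z) z x = dif h z x + dif k z x" if "z \<in> U"
    by (subst dif_eqI[OF has_derivative_add[OF D(1) D(7)]]) (use that in auto)
  show "dif (\<lambda>z. h z - k z) z x = dif h z x - dif k z x" if "z \<in> U"
    by (subst dif_eqI[OF has_derivative_diff[OF D(1) D(7)]]) (use that in auto)
  show "dif (\<lambda>z. h z * k z) z x = h z * dif k z x + dif h z x * k z" if "z \<in> U"
    by (subst dif_eqI[OF has_derivative_mult[OF D(1) D(7)]]) (use that in auto)
qed

lemma holo_on_const: "holo_on (\<lambda>z. c) U"
  by (rule holo_onI[where h' = "\<lambda>_ _. 0"]) auto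

lemma holo_on_linear: "Vector_Spaces.linear (*s) (*) h \<Longrightarrow> holo_on h U"
  by (rule holo_onI[where h' = "\<lambda>_. h"])
     (simp_all add: bounded_linear_imp_has_derivative bounded_linear_clinear, simp add: clinear_iff)

lemma dif_linear: "bounded_linear h \<Longrightarrow> dif h z = h"
  by (rule dif_eqI) (rule bounded_linear_imp_has_derivative)

lemma clinear_nth: "Vector_Spaces.linear (*s) (*) (\<lambda>z :: complex^'n. z $ i)"
  by (simp add: clinear_iff)

lemma holo_on_nth: "holo_on (\<lambda>z. z $ i) U"
  by (rule holo_on_linear[OF clinear_nth])

lemma
  assumes "\<And>i. i \<in> I \<Longrightarrow> holo_on (h i) U"
  shows holo_on_sum: "holo_on (\<lambda>z. \<Sum>i\<in>I. h i z) U"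
    and dif_sum: "z \<in> U \<Longrightarrow> dif (\<lambda>z. \<Sum>i\<in>I. h i z) z x = (\<Sum>i\<in>I. dif (h i) z x)"
proof -
  have D: "((\<lambda>z. \<Sum>i\<in>I. h i z) has_derivative (\<lambda>x. \<Sum>i\<in>I. dif (h i) z x)) (at z)" if "z \<in> U" for z
    by (rule has_derivative_sum) (rule holo_on_D(1)[OF assms that])
  show "holo_on (\<lambda>z. \<Sum>i\<in>I. h i z) U"
    by (rule holo_onI[OF D]) (auto simp: holo_on_D(3)[OF assms] sum_distrib_left)
  show "dif (\<lambda>z. \<Sum>i\<in>I. h i z) z x = (\<Sum>i\<in>I. dif (h i) z x)" if "z \<in> U"
    using dif_eqI[OF D[OF that]] by simp
qed

text \<open>Composition with a holomorphic function of one variable.\<close>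

lemma
  assumes "holo_on h U" "\<And>z. z \<in> U \<Longrightarrow> (g has_field_derivative g' (h z)) (at (h z))"
  shows holo_on_compose1: "holo_on (\<lambda>z. g (h z)) U"
    and dif_compose1: "z \<in> U \<Longrightarrow> dif (\<lambda>z. g (h z)) z x = g' (h z) * dif h z x"
proof -
  have D: "((\<lambda>z. g (h z)) has_derivative (\<lambda>x. g' (h z) * dif h z x)) (at z)" if "z \<in> U" for z
    using has_derivative_compose[OF holo_on_D(1)[OF assms(1) that] assms(2)[OF that, unfolded has_field_derivative_def]] .
  show "holo_on (\<lambda>z. g (h z)) U"
    by (rule holo_onI[OF D]) (auto simp: holo_on_D(3)[OF assms(1)])
  show "dif (\<lambda>z. g (h z)) z x = g' (h z) * dif h z x" if "z \<in> U"
    using dif_eqI[OF D[OF that]] by simp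
qed

lemma
  assumes "holo_on h U" "\<And>z. z \<in> U \<Longrightarrow> h z \<noteq> 0"
  shows holo_on_inverse: "holo_on (\<lambda>z. inverse (h z)) U"
    and dif_inverse: "z \<in> U \<Longrightarrow> dif (\<lambda>z. inverse (h z)) z x = - dif h z x / (h z)\<^sup>2"
proof -
  have *: "(inverse has_field_derivative - (inverse (h z) ^ Suc (Suc 0))) (at (h z))" if "z \<in> U" for z
    using DERIV_inverse[OF assms(2)[OF that]] by blast
  show "holo_on (\<lambda>z. inverse (h z)) U"
    by (rule holo_on_compose1[OF assms(1), where g' = "\<lambda>w. - (inverse w ^ Suc (Suc 0))"]) (rule *)
  show "dif (\<lambda>z. inverse (h z)) z x = - dif h z x / (h z)\<^sup>2" if "z \<in> U"
    using dif_compose1[OF assms(1), where g' = "\<lambda>w. - (inverse w ^ Suc (Suc 0))", OF * that, of x]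
    by (simp add: field_simps power2_eq_square)
qed

lemma holo_on_divide:
  assumes "holo_on h U" "holo_on k U" "\<And>z. z \<in> U \<Longrightarrow> k z \<noteq> 0"
  shows "holo_on (\<lambda>z. h z / k z) U"
  using holo_on_mult[OF assms(1) holo_on_inverse[OF assms(2,3)]] by (simp add: divide_inverse)

lemma
  assumes "holo_on h U"
  shows holo_on_power: "holo_on (\<lambda>z. h z ^ k) U"
    and dif_power: "z \<in> U \<Longrightarrow> dif (\<lambda>z. h z ^ k) z x = of_nat k * h z ^ (k - 1) * dif h z x"
proof -
  have *: "((\<lambda>w. w ^ k) has_field_derivative of_nat k * h z ^ (k - 1)) (at (h z))" for z
    by (auto intro!: derivative_eq_intros)
  show "holo_on (\<lambda>z. h z ^ k) U"
    by (rule holo_on_compose1[OF assms, where g' = "\<lambda>w. of_nat k * w ^ (k - 1)"]) (rule *)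
  show "dif (\<lambda>z. h z ^ k) z x = of_nat k * h z ^ (k - 1) * dif h z x" if "z \<in> U"
    by (rule dif_compose1[OF assms, where g' = "\<lambda>w. of_nat k * w ^ (k - 1)", OF * that])
qed

definition vholo_on :: "(complex^'n \<Rightarrow> complex^'m) \<Rightarrow> (complex^'n) set \<Rightarrow> bool" where
  "vholo_on F U \<longleftrightarrow> (\<forall>i. holo_on (\<lambda>z. F z $ i) U)"

lemma
  assumes "vholo_on F U" "z \<in> U"
  shows vholo_on_has_derivative: "(F has_derivative dif F z) (at z)"
    and dif_nth: "dif F z x $ i = dif (\<lambda>z. F z $ i) z x"
    and vdif_scale: "dif F z (c *s x) = c *s dif F z x"
    and vdif_add: "dif F z (x + y) = dif F z x + dif F z y"
    and vdif_diff: "dif F z (x - y) = dif F z x - dif F z y"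
proof -
  let ?D = "\<lambda>x. \<Sum>i\<in>UNIV. dif (\<lambda>z. F z $ i) z x *s (axis i 1 :: complex^'b)"
  have hi: "holo_on (\<lambda>z. F z $ i) U" for i using assms by (simp add: vholo_on_def)
  have "((\<lambda>z. \<Sum>i\<in>UNIV. F z $ i *s axis i 1) has_derivative ?D) (at z)"
    by (intro has_derivative_sum bounded_linear.has_derivative[OF bounded_linear_vsmult_left]
        holo_on_D(1)[OF hi] assms)
  then have D: "(F has_derivative ?D) (at z)" by (simp add: basis_expansion)
  then show "(F has_derivative dif F z) (at z)" using dif_eqI by fastforce
  have "dif F z x = ?D x" for x using dif_eqI[OF D] by simp
  then have n: "dif F z x $ i = dif (\<lambda>z. F z $ i) z x" for x i
    by (simp add: axis_def if_distrib[where f = "(*) _"] cong: if_cong)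
  then show "dif F z x $ i = dif (\<lambda>z. F z $ i) z x" by simp
  show "dif F z (c *s x) = c *s dif F z x"
    "dif F z (x + y) = dif F z x + dif F z y" "dif F z (x - y) = dif F z x - dif F z y"
    by (auto simp: vec_eq_iff n holo_on_D[OF hi assms(2)])
qed

lemma vholo_on_subset: "vholo_on F U \<Longrightarrow> W \<subseteq> U \<Longrightarrow> vholo_on F W"
  by (auto simp: vholo_on_def intro: holo_on_subset)

lemma vholo_on_continuous: "vholo_on F U \<Longrightarrow> continuous_on U F"
  by (meson continuous_at_imp_continuous_on has_derivative_continuous vholo_on_has_derivative)

lemma vholo_on_cong:
  assumes "open U" "\<And>u. u \<in> U \<Longrightarrow> h u = k u" "vholo_on h U"
  shows "vholo_on k U"
  unfolding vholo_on_def
proof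
  fix i show "holo_on (\<lambda>z. k z $ i) U"
    by (rule holo_on_cong[OF assms(1), where h = "\<lambda>z. h z $ i"]) (use assms in \<open>auto simp: vholo_on_def\<close>)
qed

lemma
  assumes "holo_on h W" "vholo_on F U" "F ` U \<subseteq> W"
  shows holo_on_compose: "holo_on (\<lambda>z. h (F z)) U"
    and dif_compose: "z \<in> U \<Longrightarrow> dif (\<lambda>z. h (F z)) z x = dif h (F z) (dif F z x)"
proof -
  have D: "((\<lambda>z. h (F z)) has_derivative (\<lambda>x. dif h (F z) (dif F z x))) (at z)" if "z \<in> U" for z
    using has_derivative_compose[OF vholo_on_has_derivative[OF assms(2) that] holo_on_D(1)[OF assms(1)]]
      assms(3) that by blast
  show "holo_on (\<lambda>z. h (F z)) U"
    by (rule holo_onI[OF D])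
       (use assms in \<open>auto simp: vdif_scale[OF assms(2)] image_subset_iff holo_on_D(3)[OF assms(1)]\<close>)
  show "dif (\<lambda>z. h (F z)) z x = dif h (F z) (dif F z x)" if "z \<in> U"
    using dif_eqI[OF D[OF that]] by simp
qed

lemma
  assumes "vholo_on H W" "vholo_on F U" "F ` U \<subseteq> W"
  shows vholo_on_compose: "vholo_on (\<lambda>z. H (F z)) U"
    and vdif_compose: "z \<in> U \<Longrightarrow> dif (\<lambda>z. H (F z)) z x = dif H (F z) (dif F z x)"
proof -
  show "vholo_on (\<lambda>z. H (F z)) U"
    unfolding vholo_on_def
  proof
    fix i
    have "holo_on (\<lambda>w. H w $ i) W" using assms(1) by (simp add: vholo_on_def)
    from holo_on_compose[OF this assms(2,3)] show "holo_on (\<lambda>z. H (F z) $ i) U" .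
  qed
  show "dif (\<lambda>z. H (F z)) z x = dif H (F z) (dif F z x)" if "z \<in> U"
  proof -
    have "F z \<in> W" using that assms by auto
    then have "((\<lambda>z. H (F z)) has_derivative (\<lambda>x. dif H (F z) (dif F z x))) (at z)"
      by (rule has_derivative_compose[OF vholo_on_has_derivative[OF assms(2) that] vholo_on_has_derivative[OF assms(1)]])
    then show ?thesis by (simp add: dif_eqI)
  qed
qed

lemma vholo_on_matrix: "vholo_on (\<lambda>v. (g :: complex^'n^'m) *v v) U"
  unfolding vholo_on_def
  by (intro allI holo_on_linear)
     (simp add: clinear_iff matrix_vector_right_distrib vector_scalar_commute)

lemma bounded_linear_matrix: "bounded_linear (\<lambda>v. (g :: complex^'n^'m) *v v)"
  by (simp add: matrix_vector_mul_bounded_linear)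

lemma dif_matrix: "dif (\<lambda>v. (g :: complex^'n^'m) *v v) z = (\<lambda>v. g *v v)"
  by (rule dif_linear[OF bounded_linear_matrix])

lemma
  fixes a :: "complex^'n"
  shows vholo_on_affine: "vholo_on (\<lambda>v. a + c *s v) U"
    and dif_affine: "dif (\<lambda>v. a + c *s v) z x = c *s x"
proof -
  show "vholo_on (\<lambda>v. a + c *s v) U"
    unfolding vholo_on_def by (auto intro!: holo_on_add holo_on_mult holo_on_const holo_on_nth)
  have "((\<lambda>v. a + c *s v) has_derivative (\<lambda>x. 0 + c *s x)) (at z)"
    by (intro has_derivative_add has_derivative_const bounded_linear_imp_has_derivative bounded_linear_vsmult_right)
  then show "dif (\<lambda>v. a + c *s v) z x = c *s x" by (simp add: dif_eqI)
qed

lemma holo_on_line: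
  assumes "holo_on h U" "a + t *s x \<in> U"
  shows "((\<lambda>t. h (a + t *s x)) has_field_derivative dif h (a + t *s x) x) (at t)"
proof -
  have "((\<lambda>t. a + t *s x) has_derivative (\<lambda>t. 0 + t *s x)) (at t)"
    by (intro has_derivative_add has_derivative_const bounded_linear_imp_has_derivative bounded_linear_vsmult_left)
  from has_derivative_compose[OF this holo_on_D(1)[OF assms]]
  show ?thesis by (simp add: has_field_derivative_def holo_on_D(3)[OF assms] mult.commute[of _ "dif h _ x"])
qed



lemma open_line:
  assumes "open U"
  shows "open {t. a + t *s (x :: complex^'n) \<in> U}"
proof -
  have "continuous_on UNIV (\<lambda>t. a + t *s x)"
    by (intro continuous_intros bounded_linear.continuous_on[OF bounded_linear_vsmult_left])
  then have "open ((\<lambda>t. a + t *s x) -` U)" using assms by (simp add: continuous_on_open_vimage open_vimage)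
  then show ?thesis by (simp add: vimage_def)
qed

lemma convex_line:
  assumes "convex U"
  shows "convex {t. a + t *s (x :: complex^'n) \<in> U}"
proof (rule convexI)
  fix s t and p q :: real
  assume *: "s \<in> {t. a + t *s x \<in> U}" "t \<in> {t. a + t *s x \<in> U}" "0 \<le> p" "0 \<le> q" "p + q = 1"
  have "complex_of_real p + complex_of_real q = 1" using *(5) by (metis of_real_1 of_real_add)
  then have q: "complex_of_real q = 1 - complex_of_real p" by (simp add: algebra_simps)
  have "a + (p *\<^sub>R s + q *\<^sub>R t) *s x = p *\<^sub>R (a + s *s x) + q *\<^sub>R (a + t *s x)"
    by (simp add: vec_eq_iff) (simp add: scaleR_conv_of_real q algebra_simps)
  moreover have "\<dots> \<in> U" using assms * by (intro convexD) auto
  ultimately show "p *\<^sub>R s + q *\<^sub>R t \<in> {t. a + t *s x \<in> U}" by simp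
qed

lemma holo_on_line_holomorphic:
  assumes "holo_on h U" "\<And>t. t \<in> T \<Longrightarrow> a + t *s x \<in> U"
  shows "(\<lambda>t. h (a + t *s x)) holomorphic_on T"
proof (rule holomorphic_onI)
  fix t assume "t \<in> T"
  then have "((\<lambda>t. h (a + t *s x)) has_field_derivative dif h (a + t *s x) x) (at t)"
    by (intro holo_on_line[OF assms(1)] assms(2))
  then show "(\<lambda>t. h (a + t *s x)) field_differentiable at t within T"
    using field_differentiable_at_within field_differentiable_def by blast
qed

text \<open>Cauchy's inequality on the disc that the ball cuts out of the complex line through the centre
  in the given direction.\<close>

lemma holo_on_cauchy_bound:
  assumes "holo_on h U" "r > 0" "cball v r \<subseteq> U" "\<And>w. w \<in> cball v r \<Longrightarrow> cmod (h w) \<le> M"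
  shows "cmod (dif h v x) \<le> M / r * norm x"
proof (cases "x = 0")
  case True
  have "v \<in> U" using assms(2,3) by auto
  then show ?thesis using holo_on_D(6)[OF assms(1)] True by simp
next
  case False
  define \<rho> where "\<rho> = r / norm x"
  have \<rho>: "\<rho> > 0" using assms(2) False by (simp add: \<rho>_def)
  have inb: "v + t *s x \<in> cball v r" if "cmod t \<le> \<rho>" for t
    using that False by (simp add: dist_norm norm_vector_smult \<rho>_def field_simps)
  let ?q = "\<lambda>t. h (v + t *s x)"
  have hol: "?q holomorphic_on cball 0 \<rho>"
    by (rule holo_on_line_holomorphic[OF assms(1)]) (use inb assms(3) in auto)
  have "norm ((deriv ^^ 1) ?q 0) \<le> fact 1 * M / \<rho> ^ 1"
  proof (rule Cauchy_inequality)
    show "?q holomorphic_on ball 0 \<rho>" using hol holomorphic_on_subset ball_subset_cball by blast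
    show "continuous_on (cball 0 \<rho>) ?q" using hol holomorphic_on_imp_continuous_on by blast
    show "0 < \<rho>" by fact
    fix t :: complex assume "norm (0 - t) = \<rho>"
    then show "norm (?q t) \<le> M" by (intro assms(4) inb) simp
  qed
  moreover have "deriv ?q 0 = dif h v x"
    using holo_on_line[OF assms(1), of v 0 x] subsetD[OF assms(3), of v] assms(2) by (intro DERIV_imp_deriv) auto
  ultimately show ?thesis by (simp add: \<rho>_def)
qed

text \<open>By the Cauchy bound, uniform convergence of holomorphic functions forces locally uniform
  convergence of their derivatives.\<close>

lemma holo_on_uniform_limit:
  fixes h :: "nat \<Rightarrow> complex^'n \<Rightarrow> complex"
  assumes "open U" "\<And>k. holo_on (h k) U" "uniform_limit U h g sequentially"
  shows "holo_on g U" and "z \<in> U \<Longrightarrow> (\<lambda>k. dif (h k) z x) \<longlonglongrightarrow> dif g z x"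
proof -
  have main: "\<exists>D. (g has_derivative D) (at z) \<and> (\<forall>x. (\<lambda>k. dif (h k) z x) \<longlonglongrightarrow> D x)" if "z \<in> U" for z
  proof -
    obtain r where r: "r > 0" "cball z (2 * r) \<subseteq> U"
    proof -
      obtain s where "s > 0" "cball z s \<subseteq> U" using assms(1) \<open>z \<in> U\<close> by (auto simp: open_contains_cball)
      then show ?thesis using that[of "s / 2"] by simp
    qed
    have cb: "cball v r \<subseteq> U" if "v \<in> ball z r" for v
    proof
      fix w assume "w \<in> cball v r"
      then have "dist z w \<le> 2 * r" using that dist_triangle[of z w v] by (simp add: dist_commute)
      then show "w \<in> U" using r by auto
    qed
    have cauchy: "\<exists>N. \<forall>k\<ge>N. \<forall>l\<ge>N. \<forall>v\<in>ball z r. \<forall>x. cmod (dif (h k) v x - dif (h l) v x) \<le> e * norm x"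
      if "e > 0" for e
    proof -
      have "uniformly_Cauchy_on U h"
        using assms(3) by (meson uniformly_convergent_Cauchy uniformly_convergent_on_def)
      then obtain N where N: "\<And>w k l. w \<in> U \<Longrightarrow> k \<ge> N \<Longrightarrow> l \<ge> N \<Longrightarrow> dist (h k w) (h l w) < e * r"
        using mult_pos_pos[OF \<open>e > 0\<close> r(1)] unfolding uniformly_Cauchy_on_def by fast
      have "cmod (dif (h k) v x - dif (h l) v x) \<le> e * norm x"
        if "k \<ge> N" "l \<ge> N" "v \<in> ball z r" for k l v x
      proof -
        have vU: "v \<in> U" using cb[OF that(3)] r(1) by auto
        have "cmod (dif (\<lambda>w. h k w - h l w) v x) \<le> e * r / r * norm x"
          by (rule holo_on_cauchy_bound[OF holo_on_diff[OF assms(2) assms(2)] r(1) cb[OF that(3)]])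
             (use N that(1,2) cb[OF that(3)] in \<open>force simp: dist_norm\<close>)
        then show ?thesis using r(1) by (simp add: dif_diff[OF assms(2) assms(2) vU])
      qed
      then show ?thesis by blast
    qed
    have conv: "convergent (\<lambda>k. dif (h k) v x)" if "v \<in> ball z r" for v x
    proof -
      have "Cauchy (\<lambda>k. dif (h k) v x)"
      proof (rule metric_CauchyI)
        fix e :: real assume e: "e > 0"
        define e' where "e' = e / (norm x + 1)"
        have "e' > 0" using e by (simp add: e'_def add_nonneg_pos)
        from cauchy[OF this] that
        obtain N where N: "\<And>k l. k \<ge> N \<Longrightarrow> l \<ge> N \<Longrightarrow> cmod (dif (h k) v x - dif (h l) v x) \<le> e' * norm x"
          by blast
        have "e' * norm x < e" using e by (simp add: e'_def field_simps add_pos_nonneg)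
        then show "\<exists>M. \<forall>m\<ge>M. \<forall>n\<ge>M. dist (dif (h m) v x) (dif (h n) v x) < e"
          using N unfolding dist_norm by (meson le_less_trans)
      qed
      then show ?thesis by (simp add: Cauchy_convergent_iff)
    qed
    define D where "D v x = lim (\<lambda>k. dif (h k) v x)" for v x
    have Dlim: "(\<lambda>k. dif (h k) v x) \<longlonglongrightarrow> D v x" if "v \<in> ball z r" for v x
      using conv[OF that] by (simp add: D_def convergent_LIMSEQ_iff)
    have "\<exists>g'. \<forall>v\<in>ball z r. (\<lambda>k. h k v) \<longlonglongrightarrow> g' v \<and> (g' has_derivative D v) (at v within ball z r)"
    proof (rule has_derivative_sequence)
      show "convex (ball z r)" by simp
      show "(h k has_derivative dif (h k) v) (at v within ball z r)" if "v \<in> ball z r" for k v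
        using holo_on_D(1)[OF assms(2), of v k] cb[OF that] r(1)
        by (meson centre_in_cball has_derivative_at_withinI less_eq_real_def subsetD)
      show "\<forall>\<^sub>F k in sequentially. \<forall>v\<in>ball z r. \<forall>x. norm (dif (h k) v x - D v x) \<le> e * norm x"
        if e: "e > 0" for e
      proof -
        obtain N where N: "\<And>k l v x. k \<ge> N \<Longrightarrow> l \<ge> N \<Longrightarrow> v \<in> ball z r \<Longrightarrow>
            cmod (dif (h k) v x - dif (h l) v x) \<le> e * norm x"
          using cauchy[OF e] by blast
        have "norm (dif (h k) v x - D v x) \<le> e * norm x" if "k \<ge> N" "v \<in> ball z r" for k v x
        proof (rule tendsto_upperbound)
          show "(\<lambda>l. norm (dif (h k) v x - dif (h l) v x)) \<longlonglongrightarrow> norm (dif (h k) v x - D v x)"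
            by (intro tendsto_intros Dlim that)
          show "\<forall>\<^sub>F l in sequentially. norm (dif (h k) v x - dif (h l) v x) \<le> e * norm x"
            using N that unfolding eventually_sequentially by blast
        qed simp
        then show ?thesis unfolding eventually_sequentially by blast
      qed
      show "z \<in> ball z r" using r by simp
      show "(\<lambda>k. h k z) \<longlonglongrightarrow> g z" using tendsto_uniform_limitI[OF assms(3)] that by blast
    qed
    then obtain g' where g': "\<And>v. v \<in> ball z r \<Longrightarrow> (\<lambda>k. h k v) \<longlonglongrightarrow> g' v"
      "\<And>v. v \<in> ball z r \<Longrightarrow> (g' has_derivative D v) (at v within ball z r)" by blast
    have "g' v = g v" if "v \<in> ball z r" for v
      using LIMSEQ_unique[OF g'(1)[OF that] tendsto_uniform_limitI[OF assms(3), of v]]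
        subsetD[OF cb[OF that], of v] r(1) by simp
    moreover have zz: "z \<in> ball z r" using r by simp
    moreover have "(g' has_derivative D z) (at z)"
      using g'(2)[OF zz] by (simp add: at_within_open[OF zz])
    ultimately have "(g has_derivative D z) (at z)"
      using has_derivative_transform_within_open[of g' "D z" z UNIV "ball z r" g] by auto
    then show ?thesis using Dlim[OF zz] by blast
  qed
  have lim: "(\<lambda>k. dif (h k) z x) \<longlonglongrightarrow> dif g z x" if "z \<in> U" for z x
    using main[OF that] dif_eqI by metis
  show "z \<in> U \<Longrightarrow> (\<lambda>k. dif (h k) z x) \<longlonglongrightarrow> dif g z x" by (rule lim)
  show "holo_on g U"
  proof (rule holo_onI[where h' = "\<lambda>z. dif g z"])
    show "(g has_derivative dif g z) (at z)" if "z \<in> U" for z using main[OF that] dif_eqI by metis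
    show "dif g z (c *s x) = c * dif g z x" if "z \<in> U" for z x c
    proof (rule LIMSEQ_unique[OF lim[OF that]])
      have "(\<lambda>k. c * dif (h k) z x) \<longlonglongrightarrow> c * dif g z x" by (intro tendsto_intros lim that)
      then show "(\<lambda>k. dif (h k) z (c *s x)) \<longlonglongrightarrow> c * dif g z x"
        by (simp add: holo_on_D(3)[OF assms(2) that])
    qed
  qed
qed

text \<open>Taylor's formula of order two. Cauchy's inequality on discs of radius \<open>\<rho> / 2\<close> about the points
  of the disc of radius \<open>\<rho>\<close> bounds the second derivative.\<close>

lemma difference_quotient_bound:
  fixes q :: "complex \<Rightarrow> complex"
  assumes "\<rho> > 0" "q holomorphic_on ball 0 (2 * \<rho>)" "\<And>t. t \<in> ball 0 (2 * \<rho>) \<Longrightarrow> cmod (q t) \<le> M"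
    and "t \<noteq> 0" "cmod t \<le> \<rho>"
  shows "cmod ((q t - q 0) / t - deriv q 0) \<le> 8 * M / \<rho>\<^sup>2 * cmod t"
proof -
  have M: "M \<ge> 0" using assms(3)[of 0] assms(1) norm_ge_zero order_trans by (metis centre_in_ball mult_pos_pos zero_less_numeral)
  have "cmod ((deriv ^^ 0) q t - (\<Sum>i\<le>1. (deriv ^^ i) q 0 * (t - 0) ^ i / fact i)) \<le> (8 * M / \<rho>\<^sup>2) * cmod (t - 0) ^ Suc 1 / fact 1"
  proof (rule complex_Taylor[where S = "cball 0 \<rho>" and f = "\<lambda>i. (deriv ^^ i) q"])
    show "convex (cball (0::complex) \<rho>)" by simp
    show "t \<in> cball 0 \<rho>" "0 \<in> cball 0 \<rho>" using assms by auto
    show "((deriv ^^ i) q has_field_derivative (deriv ^^ Suc i) q x) (at x within cball 0 \<rho>)"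
      if "x \<in> cball 0 \<rho>" "i \<le> 1" for i x
    proof -
      have "(deriv ^^ i) q holomorphic_on ball 0 (2 * \<rho>)"
        by (rule holomorphic_higher_deriv[OF assms(2)]) simp
      then have "((deriv ^^ i) q has_field_derivative deriv ((deriv ^^ i) q) x) (at x)"
        by (rule holomorphic_derivI) (use that assms(1) in auto)
      then show ?thesis by (simp add: has_field_derivative_at_within)
    qed
    show "cmod ((deriv ^^ Suc 1) q x) \<le> 8 * M / \<rho>\<^sup>2" if "x \<in> cball 0 \<rho>" for x
    proof -
      have sub: "cball x (\<rho> / 2) \<subseteq> ball 0 (2 * \<rho>)"
      proof
        fix y assume "y \<in> cball x (\<rho> / 2)"
        then have "cmod y \<le> \<rho> + \<rho> / 2"
          using that norm_triangle_ineq[of x "y - x"] by (simp add: dist_norm norm_minus_commute)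
        then show "y \<in> ball 0 (2 * \<rho>)" using assms(1) by simp
      qed
      have "norm ((deriv ^^ 2) q x) \<le> fact 2 * M / (\<rho> / 2) ^ 2"
      proof (rule Cauchy_inequality)
        show "q holomorphic_on ball x (\<rho> / 2)"
          using assms(2) sub ball_subset_cball holomorphic_on_subset by blast
        show "continuous_on (cball x (\<rho> / 2)) q"
          using assms(2) sub holomorphic_on_subset holomorphic_on_imp_continuous_on by blast
        show "norm (q y) \<le> M" if "norm (x - y) = \<rho> / 2" for y
          using assms(3) sub that by (auto simp: dist_norm)
      qed (use assms in auto)
      then show ?thesis by (simp add: numeral_2_eq_2 power2_eq_square field_simps)
    qed
  qed
  then have *: "cmod (q t - q 0 - deriv q 0 * t) \<le> 8 * M / \<rho>\<^sup>2 * cmod t * cmod t"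
    by (simp add: power2_eq_square algebra_simps)
  have "cmod ((q t - q 0) / t - deriv q 0) = cmod (q t - q 0 - deriv q 0 * t) / cmod t"
    using assms(4) by (simp add: norm_divide[symmetric] field_simps)
  also have "\<dots> \<le> 8 * M / \<rho>\<^sup>2 * cmod t * cmod t / cmod t" by (intro divide_right_mono *) simp
  finally show ?thesis using assms(4) by simp
qed

text \<open>Difference quotients converge uniformly to the directional derivative. Hence the latter is
  holomorphic, and its derivative is the limit of difference quotients of the derivative, which
  makes second derivatives symmetric.\<close>

lemma
  assumes "open U" "holo_on h U"
  shows holo_on_dif: "holo_on (\<lambda>z. dif h z y) U"
    and dif_dif_commute: "z \<in> U \<Longrightarrow> dif (\<lambda>u. dif h u y) z x = dif (\<lambda>u. dif h u x) z y"
proof -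
  have main: "\<exists>W D. z \<in> W \<and> open W \<and> W \<subseteq> U \<and> holo_on (\<lambda>u. dif h u y) W \<and> filterlim D (at 0) sequentially \<and>
      (\<forall>x. (\<lambda>k. (dif h (z + D k *s y) x - dif h z x) / D k) \<longlonglongrightarrow> dif (\<lambda>u. dif h u y) z x)"
    if z: "z \<in> U" for z y
  proof -
    obtain r where r: "r > 0" "cball z (2 * r) \<subseteq> U"
    proof -
      obtain r where "r > 0" "cball z r \<subseteq> U" using assms(1) z open_contains_cball by blast
      then show ?thesis using that[of "r / 2"] by simp
    qed
    have "compact (h ` cball z (2 * r))"
      using holo_on_continuous[OF assms(2)] r(2) continuous_on_subset compact_continuous_image compact_cball by blast
    then obtain M where M: "\<And>w. w \<in> cball z (2 * r) \<Longrightarrow> cmod (h w) \<le> M"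
      using compact_imp_bounded bounded_iff by (metis (no_types, lifting) image_eqI)
    define \<rho> where "\<rho> = r / (2 * (norm y + 1))"
    have \<rho>: "\<rho> > 0" using r(1) by (simp add: \<rho>_def add_nonneg_pos)
    have small: "v + t *s y \<in> cball z (2 * r)" if "v \<in> ball z r" "cmod t \<le> 2 * \<rho>" for v t
    proof -
      have "cmod t * norm y \<le> 2 * \<rho> * (norm y + 1)"
        using that(2) \<rho> by (intro mult_mono) auto
      also have "\<dots> = r" using add_nonneg_pos[of "norm y" 1] by (simp add: \<rho>_def field_simps)
      finally have "norm (t *s y) \<le> r" by (simp add: norm_vector_smult)
      moreover have "dist z (v + t *s y) \<le> dist z v + norm (t *s y)"
        using dist_triangle[of z "v + t *s y" v] by (simp add: dist_norm)
      ultimately show ?thesis using that(1) by simp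
    qed
    define D where "D k = complex_of_real (\<rho> / (real k + 1))" for k
    have D0: "D k \<noteq> 0" for k
      using \<rho> unfolding D_def of_real_eq_0_iff by (simp add: add_nonneg_pos pos_add_strict)
    have Dn: "cmod (D k) = \<rho> / (real k + 1)" for k
      unfolding D_def norm_of_real using \<rho> by (simp add: abs_of_pos)
    have D\<rho>: "cmod (D k) \<le> \<rho>" for k using \<rho> by (simp add: Dn field_simps)
    have Dlim: "D \<longlonglongrightarrow> 0"
    proof (rule tendsto_norm_zero_cancel)
      have "(\<lambda>k. \<rho> * inverse (real (Suc k))) \<longlonglongrightarrow> \<rho> * 0"
        by (intro tendsto_intros LIMSEQ_inverse_real_of_nat)
      then show "(\<lambda>k. cmod (D k)) \<longlonglongrightarrow> 0" by (simp add: Dn field_simps)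
    qed
    define Q where "Q k v = (h (v + D k *s y) - h v) / D k" for k v
    have sub: "ball z r \<subseteq> U" using r by (auto simp: subset_iff)
    have im: "(\<lambda>v. v + D k *s y) ` ball z r \<subseteq> U" for k
      using small[of _ "D k"] D\<rho>[of k] \<rho> r(2) by (force simp: subset_iff)
    have aff: "vholo_on (\<lambda>v. v + D k *s y) W" and daff: "dif (\<lambda>v. v + D k *s y) v x = x" for k W v x
      using vholo_on_affine[of "D k *s y" 1] dif_affine[of "D k *s y" 1] by (simp_all add: add.commute)
    note sh = holo_on_compose[OF assms(2) aff im] and dsh = dif_compose[OF assms(2) aff im]
    have Qhol: "holo_on (Q k) (ball z r)" for k
      unfolding Q_def divide_inverse
      by (intro holo_on_mult holo_on_diff sh holo_on_subset[OF assms(2) sub] holo_on_const)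
    have Qd: "dif (Q k) z x = (dif h (z + D k *s y) x - dif h z x) / D k" for k x
    proof -
      have zz: "z \<in> ball z r" using r by simp
      have "dif (\<lambda>v. (h (v + D k *s y) - h v) * inverse (D k)) z x
          = (dif h (z + D k *s y) x - dif h z x) * inverse (D k)"
        using dif_mult[OF holo_on_diff[OF sh holo_on_subset[OF assms(2) sub]] holo_on_const[of "inverse (D k)"] zz]
          dif_diff[OF sh holo_on_subset[OF assms(2) sub] zz] dsh[OF zz] daff
        by (simp add: dif_linear)
      then show ?thesis by (simp add: Q_def[abs_def] divide_inverse)
    qed
    have "uniform_limit (ball z r) Q (\<lambda>u. dif h u y) sequentially"
    proof (rule uniform_limitI)
      fix e :: real assume e: "e > 0"
      have "(\<lambda>k. 8 * M / \<rho>\<^sup>2 * cmod (D k)) \<longlonglongrightarrow> 8 * M / \<rho>\<^sup>2 * 0"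
        by (intro tendsto_intros tendsto_norm_zero Dlim)
      then have ev: "\<forall>\<^sub>F k in sequentially. 8 * M / \<rho>\<^sup>2 * cmod (D k) < e"
        using e by (intro order_tendstoD(2)) auto
      have "dist (Q k v) (dif h v y) \<le> 8 * M / \<rho>\<^sup>2 * cmod (D k)" if v: "v \<in> ball z r" for k v
      proof -
        let ?q = "\<lambda>t. h (v + t *s y)"
        have "cmod ((?q (D k) - ?q 0) / D k - deriv ?q 0) \<le> 8 * M / \<rho>\<^sup>2 * cmod (D k)"
        proof (rule difference_quotient_bound[OF \<rho>])
          show "?q holomorphic_on ball 0 (2 * \<rho>)"
            by (rule holo_on_line_holomorphic[OF assms(2)]) (use small[OF v] r(2) in auto)
          show "cmod (?q t) \<le> M" if "t \<in> ball 0 (2 * \<rho>)" for t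
            using that by (intro M small[OF v]) simp
        qed (use D0 D\<rho> in auto)
        moreover have "deriv ?q 0 = dif h v y"
          using holo_on_line[OF assms(2), of v 0 y] v sub by (intro DERIV_imp_deriv) auto
        ultimately show ?thesis by (simp add: Q_def dist_norm)
      qed
      with ev show "\<forall>\<^sub>F k in sequentially. \<forall>v\<in>ball z r. dist (Q k v) (dif h v y) < e"
        by (elim eventually_mono) (meson le_less_trans)
    qed
    note ul = holo_on_uniform_limit[OF open_ball Qhol this]
    have "filterlim D (at 0) sequentially" using Dlim D0 by (simp add: filterlim_at)
    moreover have "(\<lambda>k. (dif h (z + D k *s y) x - dif h z x) / D k) \<longlonglongrightarrow> dif (\<lambda>u. dif h u y) z x" for x
      using ul(2)[of z x] r(1) by (simp add: Qd)
    ultimately show ?thesis using ul(1) sub r(1)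
      by (intro exI[of _ "ball z r"] exI[of _ D]) auto
  qed
  have hd: "holo_on (\<lambda>z. dif h z y) U" for y by (rule holo_on_local) (use main in meson)
  then show "holo_on (\<lambda>z. dif h z y) U" .
  assume z: "z \<in> U"
  obtain D where D: "filterlim D (at 0) sequentially"
    "(\<lambda>k. (dif h (z + D k *s y) x - dif h z x) / D k) \<longlonglongrightarrow> dif (\<lambda>u. dif h u y) z x"
    using main[OF z, of y] by blast
  have "((\<lambda>t. dif h (z + t *s y) x) has_field_derivative dif (\<lambda>u. dif h u x) z y) (at 0)"
    using holo_on_line[OF hd[of x], of z 0 y] z by simp
  then have "((\<lambda>t. (dif h (z + t *s y) x - dif h z x) / t) \<longlongrightarrow> dif (\<lambda>u. dif h u x) z y) (at 0)"
    by (simp add: has_field_derivative_iff)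
  from filterlim_compose[OF this D(1)] show "dif (\<lambda>u. dif h u y) z x = dif (\<lambda>u. dif h u x) z y"
    using D(2) LIMSEQ_unique by blast
qed

text \<open>The identity theorem in one variable, on the complex line that joins the point to a point of
  the smaller set. The line meets a convex set in a connected set.\<close>

lemma holo_on_identity:
  assumes "convex U" "open U" "holo_on h U" "open W" "W \<noteq> {}" "W \<subseteq> U" "\<And>z. z \<in> W \<Longrightarrow> h z = 0" "z \<in> U"
  shows "h z = 0"
proof -
  obtain u where u: "u \<in> W" using assms(5) by blast
  define T where "T = {t. u + t *s (z - u) \<in> U}"
  define T' where "T' = {t. u + t *s (z - u) \<in> W}"
  have conv: "convex T" unfolding T_def by (rule convex_line[OF assms(1)])
  have "(\<lambda>t. h (u + t *s (z - u))) 1 = (\<lambda>t. 0) (1::complex)"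
  proof (rule analytic_continuation_open[where s = T' and s' = T and z = 1 and f = "\<lambda>t. h (u + t *s (z - u))" and g = "\<lambda>_. 0"])
    show "open T'" "open T" unfolding T_def T'_def by (intro open_line assms)+
    show "T' \<noteq> {}" using u by (auto simp: T'_def intro!: exI[of _ 0])
    show "connected T" using conv by (rule convex_connected)
    show "T' \<subseteq> T" using assms(6) by (auto simp: T_def T'_def)
    show "(\<lambda>t. h (u + t *s (z - u))) holomorphic_on T"
      by (rule holo_on_line_holomorphic[OF assms(3)]) (simp add: T_def)
    show "h (u + t *s (z - u)) = 0" if "t \<in> T'" for t using that by (intro assms(7)) (simp add: T'_def)
    show "1 \<in> T" using assms(8) by (simp add: T_def)
  qed simp
  then show ?thesis by simp
qed

text \<open>The error depends only on a modulus of continuity. So the Riemann sums of a continuous function of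
  an additional parameter converge uniformly for the parameter in a compact set, which makes
  integrals over a parameter holomorphic.\<close>

lemma riemann_sum_bound:
  fixes g :: "real \<Rightarrow> complex"
  assumes "continuous_on {0..1} g" "N > 0"
    and "\<And>s t. s \<in> {0..1} \<Longrightarrow> t \<in> {0..1} \<Longrightarrow> \<bar>s - t\<bar> \<le> 1 / real N \<Longrightarrow> cmod (g s - g t) \<le> e"
  shows "cmod (integral {0..1} g - (\<Sum>i<N. g (real i / real N)) / of_nat N) \<le> e"
proof -
  have "cmod (integral {0..real m / real N} g - (\<Sum>i<m. g (real i / real N)) / of_nat N) \<le> real m * e / real N"
    if "m \<le> N" for m
    using that
  proof (induction m)
    case 0 then show ?case by simp
  next
    case (Suc m)
    let ?a = "real m / real N" and ?b = "real (Suc m) / real N"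
    have ab: "0 \<le> ?a" "?a \<le> ?b" "?b \<le> 1" using Suc.prems assms(2) by (auto simp: divide_simps)
    have int: "g integrable_on {0..?b}"
      by (rule integrable_continuous_real) (use assms(1) ab in \<open>auto elim: continuous_on_subset\<close>)
    have abs: "{?a..?b} \<subseteq> {0..1}" using ab by (meson atLeastatMost_subset_iff)
    have int2: "g integrable_on {?a..?b}"
      by (rule integrable_continuous_real) (rule continuous_on_subset[OF assms(1) abs])
    have split: "integral {0..?b} g = integral {0..?a} g + integral {?a..?b} g"
      using Henstock_Kurzweil_Integration.integral_combine[OF ab(1,2) int] by simp
    have len: "?b - ?a = 1 / real N" using assms(2) by (simp add: field_simps)
    have "cmod (integral {?a..?b} (\<lambda>s. g s - g ?a)) \<le> e * (?b - ?a)"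
    proof (rule integral_bound)
      show "?a \<le> ?b" by (rule ab)
      show "continuous_on {?a..?b} (\<lambda>s. g s - g ?a)"
        by (intro continuous_intros continuous_on_subset[OF assms(1) abs])
      show "cmod (g s - g ?a) \<le> e" if "s \<in> {?a..?b}" for s
      proof (rule assms(3))
        show "s \<in> {0..1}" using that abs by blast
        show "?a \<in> {0..1}" using ab by simp
        show "\<bar>s - ?a\<bar> \<le> 1 / real N" using that len by (simp del: of_nat_Suc)
      qed
    qed
    moreover have "integral {?a..?b} (\<lambda>s. g s - g ?a) = integral {?a..?b} g - g ?a / of_nat N"
    proof -
      have "integral {?a..?b} (\<lambda>s. g s - g ?a) = integral {?a..?b} g - integral {?a..?b} (\<lambda>s. g ?a)"
        by (rule Henstock_Kurzweil_Integration.integral_diff[OF int2]) (rule integrable_const_ivl)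
      also have "integral {?a..?b} (\<lambda>s. g ?a) = (?b - ?a) *\<^sub>R g ?a" using ab by simp
      finally show ?thesis unfolding len by (simp add: scaleR_conv_of_real)
    qed
    ultimately have 1: "cmod (integral {?a..?b} g - g ?a / of_nat N) \<le> e / real N" by (simp only: len) simp
    have "cmod (integral {0..?b} g - (\<Sum>i<Suc m. g (real i / real N)) / of_nat N)
        = cmod ((integral {0..?a} g - (\<Sum>i<m. g (real i / real N)) / of_nat N) + (integral {?a..?b} g - g ?a / of_nat N))"
      unfolding split by (simp add: add_divide_distrib algebra_simps)
    also have "\<dots> \<le> real m * e / real N + e / real N"
      by (rule norm_triangle_mono[OF Suc.IH 1]) (use Suc.prems in simp)
    also have "\<dots> = real (Suc m) * e / real N" by (simp add: add_divide_distrib algebra_simps)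
    finally show ?case .
  qed
  from this[of N] assms(2) show ?thesis by simp
qed

lemma holo_on_integral:
  fixes k :: "real \<Rightarrow> complex^'n \<Rightarrow> complex"
  assumes "open U" "continuous_on ({0..1} \<times> U) (\<lambda>(s, v). k s v)" "\<And>s. s \<in> {0..1} \<Longrightarrow> holo_on (k s) U"
  shows "holo_on (\<lambda>v. integral {0..1} (\<lambda>s. k s v)) U"
proof (rule holo_on_local)
  fix z assume z: "z \<in> U"
  then obtain r where r: "r > 0" "cball z r \<subseteq> U" using assms(1) by (auto simp: open_contains_cball)
  define R where "R N v = (\<Sum>i<Suc N. k (real i / real (Suc N)) v) / of_nat (Suc N)" for N v
  have bU: "ball z r \<subseteq> U" using r by (auto simp: subset_iff)
  have Rh: "holo_on (R N) (ball z r)" for N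
    unfolding R_def divide_inverse
    by (intro holo_on_mult holo_on_sum holo_on_const holo_on_subset[OF assms(3) bU])
       (auto simp: divide_simps)
  have "compact ({0..1::real} \<times> cball z r)" by (intro compact_Times compact_cball) (rule compact_Icc)
  moreover have "continuous_on ({0..1} \<times> cball z r) (\<lambda>(s, v). k s v)"
    by (rule continuous_on_subset[OF assms(2)]) (use r in auto)
  ultimately have uc: "uniformly_continuous_on ({0..1} \<times> cball z r) (\<lambda>(s, v). k s v)"
    by (rule compact_uniformly_continuous[rotated])
  have "uniform_limit (ball z r) R (\<lambda>v. integral {0..1} (\<lambda>s. k s v)) sequentially"
  proof (rule uniform_limitI)
    fix e :: real assume e: "e > 0"
    obtain d where d: "d > 0" "\<And>x y. x \<in> {0..1} \<times> cball z r \<Longrightarrow> y \<in> {0..1} \<times> cball z r \<Longrightarrow> dist y x < d \<Longrightarrow>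
        dist ((\<lambda>(s, v). k s v) y) ((\<lambda>(s, v). k s v) x) < e / 2"
      using uc e unfolding uniformly_continuous_on_def by (metis half_gt_zero)
    obtain N0 where N0: "1 / real (Suc N0) < d" using nat_approx_posE[OF d(1)] by blast
    have "dist (R N v) (integral {0..1} (\<lambda>s. k s v)) < e" if "N \<ge> N0" "v \<in> ball z r" for N v
    proof -
      have "1 / real (Suc N) \<le> 1 / real (Suc N0)" using that(1) by (simp add: frac_le)
      then have small: "1 / real (Suc N) < d" using N0 by simp
      have "cmod (integral {0..1} (\<lambda>s. k s v) - (\<Sum>i<Suc N. k (real i / real (Suc N)) v) / of_nat (Suc N)) \<le> e / 2"
      proof (rule riemann_sum_bound)
        show "continuous_on {0..1} (\<lambda>s. k s v)"
        proof -
          have "continuous_on {0..1} ((\<lambda>(s, v). k s v) \<circ> (\<lambda>s. (s, v)))"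
            by (rule continuous_on_compose) (use assms(2) that(2) bU in \<open>auto intro!: continuous_intros elim!: continuous_on_subset\<close>)
          then show ?thesis by (simp add: o_def)
        qed
        show "cmod (k s v - k t v) \<le> e / 2"
          if "s \<in> {0..1}" "t \<in> {0..1}" "\<bar>s - t\<bar> \<le> 1 / real (Suc N)" for s t
          using d(2)[of "(t, v)" "(s, v)"] that small \<open>v \<in> ball z r\<close> by (simp add: dist_norm)
      qed simp
      then show ?thesis using e unfolding R_def dist_norm by (simp add: norm_minus_commute)
    qed
    then show "\<forall>\<^sub>F N in sequentially. \<forall>v\<in>ball z r. dist (R N v) (integral {0..1} (\<lambda>s. k s v)) < e"
      unfolding eventually_sequentially by blast
  qed
  from holo_on_uniform_limit(1)[OF open_ball Rh this] r(1)
  show "\<exists>W. z \<in> W \<and> holo_on (\<lambda>v. integral {0..1} (\<lambda>s. k s v)) W" by (intro exI[of _ "ball z r"]) auto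
qed


section \<open>Boundedness across hyperplanes and across codimension two\<close>

text \<open>The exceptional points are removable singularities, so that the maximum principle applies to
  the extended function.\<close>

lemma maximum_modulus_punctured:
  assumes "finite Z" "Z \<subseteq> ball 0 r" "continuous_on (cball 0 r - Z) q" "q holomorphic_on (ball 0 r - Z)"
    and "\<And>a. a \<in> Z \<Longrightarrow> \<exists>B. eventually (\<lambda>t. cmod (q t) \<le> B) (at a)"
    and "\<And>t. cmod t = r \<Longrightarrow> cmod (q t) \<le> M" "r > 0"
    and "t \<in> cball 0 r - Z"
  shows "cmod (q t) \<le> M"
  using assms
proof (induction Z arbitrary: q t rule: finite_induct)
  case empty
  show ?case
  proof (rule maximum_modulus_frontier[of q "cball 0 r"])
    show "q holomorphic_on interior (cball 0 r)" "continuous_on (closure (cball 0 r)) q" using empty by auto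
    show "cmod (q z) \<le> M" if "z \<in> frontier (cball 0 r)" for z
      using that empty.prems(5,6) by simp
    show "bounded (cball (0::complex) r)" "t \<in> cball 0 r" using empty by auto
  qed
next
  case (insert a Z)
  define S where "S = ball 0 r - Z"
  have S: "open S" using insert.hyps(1) by (simp add: S_def open_Diff finite_imp_closed)
  have aS: "a \<in> S" using insert by (auto simp: S_def)
  have "S - {a} = ball 0 r - insert a Z" by (auto simp: S_def)
  then have hol: "q holomorphic_on S - {a}" using insert.prems(3) by simp
  obtain g where g: "g holomorphic_on S" "\<And>z. z \<in> S - {a} \<Longrightarrow> g z = q z"
    using holomorphic_on_extend_bounded[OF hol] aS S insert.prems(4)[of a] by (auto simp: interior_open)
  define q' where "q' = (\<lambda>z. if z = a then g a else q z)"
  have q'g: "q' z = g z" if "z \<in> S" for z using g(2) that by (auto simp: q'_def)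
  have q'hol: "q' holomorphic_on S" using g(1) q'g by (simp cong: holomorphic_cong)
  have "cmod (q' t) \<le> M"
  proof (rule insert.IH[where q = q' and t = t])
    show "Z \<subseteq> ball 0 r" "r > 0" using insert by auto
    show "q' holomorphic_on ball 0 r - Z" using q'hol by (simp add: S_def)
    show "t \<in> cball 0 r - Z" using insert by auto
    show "cmod (q' t) \<le> M" if "cmod t = r" for t
      using that insert.prems(1,5) by (auto simp: q'_def)
    show "\<exists>B. eventually (\<lambda>t. cmod (q' t) \<le> B) (at b)" if "b \<in> Z" for b
    proof -
      obtain B where B: "eventually (\<lambda>t. cmod (q t) \<le> B) (at b)" using insert.prems(4)[of b] \<open>b \<in> Z\<close> by auto
      have "b \<noteq> a" using \<open>b \<in> Z\<close> insert by auto
      then have "eventually (\<lambda>t. t \<noteq> a) (at b)" by (auto simp: eventually_neq_at_within)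
      with B have "eventually (\<lambda>t. cmod (q' t) \<le> B) (at b)"
        by eventually_elim (simp add: q'_def)
      then show ?thesis by blast
    qed
    show "continuous_on (cball 0 r - Z) q'"
    proof -
      have "continuous (at x within cball 0 r - Z) q'" if x: "x \<in> cball 0 r - Z" for x
      proof (cases "x = a")
        case True
        then show ?thesis using q'hol S aS
          by (meson continuous_at_imp_continuous_within continuous_on_eq_continuous_at holomorphic_on_imp_continuous_on)
      next
        case False
        have "continuous (at x within (cball 0 r - insert a Z)) q"
          using insert.prems(2) x False by (simp add: continuous_on_eq_continuous_within)
        moreover have "at x within (cball 0 r - insert a Z) = at x within (cball 0 r - Z)"
          by (rule at_within_nhd[of x "- {a}"]) (use False in auto)
        ultimately have "continuous (at x within (cball 0 r - Z)) q" by simp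
        moreover have "eventually (\<lambda>y. q y = q' y) (at x within cball 0 r - Z)"
          by (rule eventually_mono[OF eventually_neq_at_within[of a]]) (simp add: q'_def)
        ultimately show ?thesis using False unfolding continuous_within q'_def
          using tendsto_cong by force
      qed
      then show ?thesis by (simp add: continuous_on_eq_continuous_within)
    qed
  qed
  then show ?case using insert.prems(7) by (auto simp: q'_def split: if_splits)
qed


lemma csubspace_imp_subspace:
  assumes "vec.subspace (L :: (complex^'n) set)"
  shows "subspace L"
proof -
  have "r *\<^sub>R x = complex_of_real r *s x" for r and x :: "complex^'n"
    by (simp add: vec_eq_iff) (simp add: scaleR_conv_of_real)
  then show ?thesis using assms by (simp add: subspace_def vec.subspace_def)
qed

lemma csubspace_closed: "vec.subspace (L :: (complex^'n) set) \<Longrightarrow> closed L"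
  by (simp add: closed_subspace csubspace_imp_subspace)

lemma csubspace_eq_UNIV_if_ball:
  assumes "vec.subspace (L :: (complex^'n) set)" "ball p e \<subseteq> L" "e > 0"
  shows "L = UNIV"
proof -
  note L = csubspace_imp_subspace[OF assms(1)]
  have p: "p \<in> L" using assms by auto
  have "x \<in> L" for x
  proof (cases "x = 0")
    case True then show ?thesis using L by (simp add: subspace_0)
  next
    case False
    define c where "c = e / (2 * norm x)"
    have c: "c > 0" using False assms(3) by (simp add: c_def)
    have "norm (c *\<^sub>R x) < e" using False assms(3) by (simp add: c_def)
    then have "p + c *\<^sub>R x \<in> L" using assms(2) by (auto simp: dist_norm)
    then have "c *\<^sub>R x \<in> L" using subspace_diff[OF L _ p] by fastforce
    then have "(1 / c) *\<^sub>R (c *\<^sub>R x) \<in> L" using L subspace_scale by blast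
    then show ?thesis using c by simp
  qed
  then show ?thesis by blast
qed

lemma open_avoid_csubspaces:
  assumes "finite \<L>" "\<And>L. L \<in> \<L> \<Longrightarrow> vec.subspace L \<and> L \<noteq> UNIV" "open U" "U \<noteq> {}"
  shows "\<exists>p\<in>U. (p :: complex^'n) \<notin> \<Union>\<L>"
  using assms
proof (induction \<L> arbitrary: U rule: finite_induct)
  case empty then show ?case by auto
next
  case (insert L \<L>)
  have L: "vec.subspace L" "L \<noteq> UNIV" using insert.prems(1) by auto
  have "open (U - L)" using csubspace_closed[OF L(1)] insert.prems by auto
  moreover have "U - L \<noteq> {}"
  proof
    assume "U - L = {}"
    obtain p e where "e > 0" "ball p e \<subseteq> U" using insert.prems(2,3) by (meson ex_in_conv open_contains_ball)
    with \<open>U - L = {}\<close> have "L = UNIV" using csubspace_eq_UNIV_if_ball[OF L(1)] by blast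
    with L show False by simp
  qed
  ultimately obtain p where "p \<in> U - L" "p \<notin> \<Union>\<L>" using insert.IH[of "U - L"] insert.prems(1) by auto
  then show ?case by auto
qed

lemma hyperplane_functional:
  fixes H :: "(complex^'n) set"
  assumes "linear_hyperplane H" "d \<notin> H"
  obtains \<phi> where "Vector_Spaces.linear (*s) (*) \<phi>" "\<phi> d = 1" "\<And>v. \<phi> v = 0 \<longleftrightarrow> v \<in> H"
proof -
  have sub: "vec.subspace H" and dim: "vec.dim H = CARD('n) - 1"
    using assms(1) by (auto simp: linear_hyperplane_def)
  have dH: "d \<notin> vec.span H" using assms(2) sub by (simp add: vec.span_eq_iff[THEN iffD2])
  have "vec.dim (insert d H) = CARD('n)"
    using dH dim zero_less_card_finite[where 'a = 'n] by (simp add: vec.dim_insert)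
  then have "vec.span (insert d H) = UNIV"
    using vec.dim_eq_full[of "insert d H"] by (simp add: vec.dimension_def card_cart_basis)
  then have ex: "\<exists>c. x - c *s d \<in> H" for x
    using vec.span_breakdown_eq[of x d H] sub by (auto simp: vec.span_eq_iff[THEN iffD2])
  have uniq: "c = c'" if "x - c *s d \<in> H" "x - c' *s d \<in> H" for x c c'
  proof (rule ccontr)
    assume ne: "c \<noteq> c'"
    have "(x - c' *s d) - (x - c *s d) \<in> H" by (rule vec.subspace_diff[OF sub that(2,1)])
    then have "(c - c') *s d \<in> H" by (simp add: vec.scale_left_diff_distrib)
    then have "inverse (c - c') *s ((c - c') *s d) \<in> H" by (rule vec.subspace_scale[OF sub])
    then show False using ne assms(2)
      by (metis left_inverse right_minus_eq vector_smult_assoc vector_smult_lid)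
  qed
  define \<phi> where "\<phi> x = (THE c. x - c *s d \<in> H)" for x
  have \<phi>: "\<phi> x = c \<longleftrightarrow> x - c *s d \<in> H" for x c
  proof -
    obtain c0 where c0: "x - c0 *s d \<in> H" using ex by blast
    then have "\<phi> x = c0" unfolding \<phi>_def by (rule the_equality) (rule uniq[OF _ c0])
    then show ?thesis using c0 uniq by blast
  qed
  show thesis
  proof
    have "\<phi> (x + y) = \<phi> x + \<phi> y" for x y
    proof -
      have "(x - \<phi> x *s d) + (y - \<phi> y *s d) \<in> H"
        by (intro vec.subspace_add[OF sub]) (simp_all add: \<phi>[symmetric])
      then show ?thesis by (simp add: \<phi> vec.scale_left_distrib algebra_simps)
    qed
    moreover have "\<phi> (c *s x) = c * \<phi> x" for x c
    proof -
      have "c *s (x - \<phi> x *s d) \<in> H"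
        by (intro vec.subspace_scale[OF sub]) (simp add: \<phi>[symmetric])
      then show ?thesis by (simp add: \<phi> vec.scale_right_diff_distrib vector_smult_assoc)
    qed
    ultimately show "Vector_Spaces.linear (*s) (*) \<phi>" by (simp add: clinear_iff)
    show "\<phi> d = 1" using sub by (simp add: \<phi> vec.subspace_0)
    show "\<phi> v = 0 \<longleftrightarrow> v \<in> H" for v by (simp add: \<phi>)
  qed
qed

text \<open>Translation in one direction sweeps out only a proper subspace from a subspace of codimension at
  least two. A parallel disc through a point outside that subspace misses the original subspace.\<close>

lemma csubspace_span_insert_neq_UNIV:
  fixes L :: "(complex^'n) set"
  assumes "vec.subspace L" "L \<noteq> UNIV" "\<not> linear_hyperplane L"
  shows "vec.span (insert d L) \<noteq> UNIV"
proof
  assume "vec.span (insert d L) = UNIV"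
  then have 1: "vec.dim (insert d L) = CARD('n)"
    using vec.dim_eq_full[of "insert d L"] by (simp add: vec.dimension_def card_cart_basis)
  have sp: "vec.span L = L" using assms(1) by (simp add: vec.span_eq_iff[THEN iffD2])
  have 2: "vec.dim L \<noteq> CARD('n)"
    using vec.dim_eq_full[of L] assms(2) sp by (auto simp: vec.dimension_def card_cart_basis)
  have 3: "vec.dim L \<noteq> CARD('n) - 1" using assms(1,3) by (simp add: linear_hyperplane_def)
  show False using 1 2 3 by (auto simp: vec.dim_insert split: if_splits)
qed

lemma line_meets_csubspace_once:
  assumes "vec.subspace L" "d \<notin> L" "a + s *s d \<in> L" "a + t *s d \<in> L"
  shows "s = t"
proof (rule ccontr)
  assume ne: "s \<noteq> t"
  have "(a + s *s d) - (a + t *s d) \<in> L" by (rule vec.subspace_diff[OF assms(1,3,4)])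
  then have "(s - t) *s d \<in> L" by (simp add: vec.scale_left_diff_distrib)
  then have "inverse (s - t) *s ((s - t) *s d) \<in> L" by (rule vec.subspace_scale[OF assms(1)])
  then show False using ne assms(2)
    by (metis left_inverse right_minus_eq vector_smult_assoc vector_smult_lid)
qed

lemma finite_line_meets_csubspaces:
  assumes "finite \<L>" "\<And>L. L \<in> \<L> \<Longrightarrow> vec.subspace L" "d \<notin> \<Union>\<L>"
  shows "finite {t. a + t *s d \<in> \<Union>\<L>}"
proof -
  have "finite {t. a + t *s d \<in> L}" if "L \<in> \<L>" for L
  proof (cases "{t. a + t *s d \<in> L} = {}")
    case False
    then obtain s where "a + s *s d \<in> L" by blast
    then have "{t. a + t *s d \<in> L} \<subseteq> {s}"
      using line_meets_csubspace_once[OF assms(2)[OF that], of d a] assms(3) that by auto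
    then show ?thesis by (rule finite_subset) simp
  qed simp
  moreover have "{t. a + t *s d \<in> \<Union>\<L>} = (\<Union>L\<in>\<L>. {t. a + t *s d \<in> L})" by auto
  ultimately show ?thesis using assms(1) by simp
qed

lemma finite_line_meets_csubspaces_outside:
  fixes u v :: "complex^'n"
  assumes "finite \<L>" "\<And>L. L \<in> \<L> \<Longrightarrow> vec.subspace L" "u \<notin> \<Union>\<L>"
  shows "finite {t. u + t *s (v - u) \<in> \<Union>\<L>}"
proof -
  have "finite {t. u + t *s (v - u) \<in> L}" if L: "L \<in> \<L>" for L
  proof (cases "\<exists>s. u + s *s (v - u) \<in> L")
    case True
    then obtain s where s: "u + s *s (v - u) \<in> L" by blast
    have "v - u \<notin> L"
    proof
      assume "v - u \<in> L"
      then have "(u + s *s (v - u)) - s *s (v - u) \<in> L"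
        using assms(2)[OF L] s vec.subspace_diff vec.subspace_scale by blast
      then show False using assms(3) L by auto
    qed
    then have "{t. u + t *s (v - u) \<in> L} \<subseteq> {s}"
      using line_meets_csubspace_once[OF assms(2)[OF L] _ _ s] by blast
    then show ?thesis by (rule finite_subset) simp
  qed auto
  moreover have "{t. u + t *s (v - u) \<in> \<Union>\<L>} = (\<Union>L\<in>\<L>. {t. u + t *s (v - u) \<in> L})" by auto
  ultimately show ?thesis using assms(1) by simp
qed

lemma continuous_on_vsmult:
  assumes "continuous_on S f" "continuous_on S g"
  shows "continuous_on S (\<lambda>x. f x *s (g x :: complex^'n))"
proof -
  have "continuous_on S (\<lambda>x. (f x *s g x) $ i)" for i
    using assms by (auto intro!: continuous_intros)
  then show ?thesis using continuous_on_vec_lambda[of S "\<lambda>i x. (f x *s g x) $ i"] by (simp only: vec_nth_inverse)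
qed

text \<open>A disc through the given point in a direction transversal to all the subspaces has its
  boundary away from them. The nearby generic parallel discs miss the subspaces of codimension at
  least two and meet the hyperplanes in points near which the function is bounded, so that the
  maximum principle applies to them. The bound on the boundaries is uniform, and if it were violated
  somewhere, it would be violated on an open set and hence at the centre of a generic disc.\<close>

proposition bounded_near_subspaces:
  fixes g :: "complex^'n \<Rightarrow> complex"
  assumes fin: "finite \<L>" and sub: "\<And>L. L \<in> \<L> \<Longrightarrow> vec.subspace L \<and> L \<noteq> UNIV"
    and O: "open O'" "p0 \<in> O'" and hol: "holo_on g (O' - \<Union>\<L>)"
    and good: "\<And>H W. H \<in> \<L> \<Longrightarrow> linear_hyperplane H \<Longrightarrow> open W \<Longrightarrow> W \<inter> H \<noteq> {} \<Longrightarrow> W \<subseteq> O' \<Longrightarrow>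
      \<exists>x\<in>W \<inter> H. \<exists>e>0. \<exists>B. \<forall>z\<in>ball x e - \<Union>\<L>. cmod (g z) \<le> B"
  shows "\<exists>e>0. \<exists>M. ball p0 e \<subseteq> O' \<and> (\<forall>z\<in>ball p0 e - \<Union>\<L>. cmod (g z) \<le> M)"
proof -
  have clU: "closed (\<Union>\<L>)" using fin sub csubspace_closed by (intro closed_Union) auto
  define \<Omega> where "\<Omega> = O' - \<Union>\<L>"
  have \<Omega>: "open \<Omega>" using O clU by (auto simp: \<Omega>_def)
  obtain d :: "complex^'n" where d: "d \<notin> \<Union>\<L>"
    using open_avoid_csubspaces[OF fin sub, of UNIV] by auto
  have finl: "finite {t. a + t *s d \<in> \<Union>\<L>}" for a
    by (rule finite_line_meets_csubspaces[OF fin _ d]) (use sub in auto)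
  obtain r0 where r0: "r0 > 0" "ball 0 r0 \<subseteq> {t. p0 + t *s d \<in> O'}"
    using open_line[OF O(1), of p0 d] O(2) by (metis (no_types, lifting) add.right_neutral mem_Collect_eq open_contains_ball vector_smult_lzero)
  have "infinite {0<..<r0}" using r0(1) by (rule infinite_Ioo)
  moreover have "finite (cmod ` {t. p0 + t *s d \<in> \<Union>\<L>})" using finl by simp
  ultimately have "{0<..<r0} - cmod ` {t. p0 + t *s d \<in> \<Union>\<L>} \<noteq> {}"
    by (metis Diff_eq_empty_iff finite_subset)
  then obtain r where "r \<in> {0<..<r0}" "r \<notin> cmod ` {t. p0 + t *s d \<in> \<Union>\<L>}" by blast
  then have r: "r > 0" "r < r0" "\<And>t. p0 + t *s d \<in> \<Union>\<L> \<Longrightarrow> cmod t \<noteq> r"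
    by simp_all blast
  have cont: "continuous_on S (\<lambda>(p, t). p + t *s d)" for S
    by (simp add: case_prod_unfold) (intro continuous_intros continuous_on_vsmult)
  have cont1: "continuous_on S (\<lambda>t. p0 + t *s d)" for S
    by (intro continuous_intros continuous_on_vsmult)
  have 1: "compact ((\<lambda>t. p0 + t *s d) ` sphere 0 r)" "compact ((\<lambda>t. p0 + t *s d) ` cball 0 r)"
    by (intro compact_continuous_image cont1; simp)+
  have 2: "(\<lambda>t. p0 + t *s d) ` sphere 0 r \<subseteq> \<Omega>" "(\<lambda>t. p0 + t *s d) ` cball 0 r \<subseteq> O'"
  proof -
    show im: "(\<lambda>t. p0 + t *s d) ` cball 0 r \<subseteq> O'" using r(2) r0 by (auto simp: subset_iff)
    show "(\<lambda>t. p0 + t *s d) ` sphere 0 r \<subseteq> \<Omega>"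
    proof
      fix w assume "w \<in> (\<lambda>t. p0 + t *s d) ` sphere 0 r"
      then obtain t where t': "w = p0 + t *s d" "t \<in> sphere 0 r" by (rule imageE)
      then have t: "w = p0 + t *s d" "cmod t = r" by simp_all
      then have "t \<in> cball 0 r" by simp
      then have "w \<in> O'" using im t(1) by blast
      then show "w \<in> \<Omega>" using r(3)[of t] t by (auto simp: \<Omega>_def)
    qed
  qed
  obtain e1 where e1: "e1 > 0" "(\<Union>x\<in>(\<lambda>t. p0 + t *s d) ` sphere 0 r. cball x e1) \<subseteq> \<Omega>"
    using compact_subset_open_imp_cball_epsilon_subset[OF 1(1) \<Omega> 2(1)] by blast
  obtain e2 where e2: "e2 > 0" "(\<Union>x\<in>(\<lambda>t. p0 + t *s d) ` cball 0 r. cball x e2) \<subseteq> O'"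
    using compact_subset_open_imp_cball_epsilon_subset[OF 1(2) O(1) 2(2)] by blast
  define e where "e = min e1 e2"
  have e: "e > 0" using e1 e2 by (simp add: e_def)
  have shift: "dist (p0 + t *s d) (p + t *s d) = dist p0 p" for p t by simp
  have sph: "p + t *s d \<in> \<Omega>" if "p \<in> cball p0 e" "cmod t = r" for p t
  proof -
    have "p + t *s d \<in> cball (p0 + t *s d) e1" using that by (simp add: e_def)
    moreover have "p0 + t *s d \<in> (\<lambda>t. p0 + t *s d) ` sphere 0 r" using that(2) by (intro imageI) simp
    ultimately show ?thesis using e1(2) by blast
  qed
  have disc: "p + t *s d \<in> O'" if "p \<in> cball p0 e" "cmod t \<le> r" for p t
  proof -
    have "p + t *s d \<in> cball (p0 + t *s d) e2" using that by (simp add: e_def)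
    moreover have "p0 + t *s d \<in> (\<lambda>t. p0 + t *s d) ` cball 0 r" using that(2) by (intro imageI) simp
    ultimately show ?thesis using e2(2) by blast
  qed
  define K where "K = (\<lambda>(p, t). p + t *s d) ` (cball p0 e \<times> sphere 0 r)"
  have "compact K" unfolding K_def
    by (intro compact_continuous_image cont compact_Times compact_cball compact_sphere)
  moreover have K\<Omega>: "K \<subseteq> \<Omega>" using sph by (auto simp: K_def)
  moreover have "continuous_on K g"
    by (rule continuous_on_subset[OF holo_on_continuous[OF hol]]) (use K\<Omega> in \<open>simp add: \<Omega>_def\<close>)
  ultimately have "compact (g ` K)" using compact_continuous_image by blast
  then obtain M where M: "\<And>w. w \<in> K \<Longrightarrow> cmod (g w) \<le> M"
    using compact_imp_bounded bounded_iff by (metis (no_types, lifting) image_eqI)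
  \<comment> \<open>The disc about \<open>p\<close> meets \<open>L\<close> only in points near which the function is bounded.\<close>
  define P where "P L p \<longleftrightarrow> (\<forall>t. cmod t \<le> r \<and> p + t *s d \<in> L \<longrightarrow>
    (\<exists>\<epsilon>>0. \<exists>B. \<forall>z\<in>ball (p + t *s d) \<epsilon> - \<Union>\<L>. cmod (g z) \<le> B))" for L p
  have step: "\<exists>U'. open U' \<and> U' \<noteq> {} \<and> U' \<subseteq> U \<and> (\<forall>p\<in>U'. P L p)"
    if U: "open U" "U \<noteq> {}" "U \<subseteq> ball p0 e" and L: "L \<in> \<L>" for U L
  proof (cases "linear_hyperplane L")
    case False
    let ?L = "vec.span (insert d L)"
    have "?L \<noteq> UNIV" using csubspace_span_insert_neq_UNIV sub[OF L] False by blast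
    then obtain p where p: "p \<in> U" "p \<notin> ?L"
      using open_avoid_csubspaces[of "{?L}" U] U by auto
    have "P L q" if "q \<notin> ?L" for q
    proof -
      have "q + t *s d \<notin> L" for t
      proof
        assume "q + t *s d \<in> L"
        then have "(q + t *s d) - t *s d \<in> ?L"
          by (intro vec.span_diff vec.span_scale vec.span_base) auto
        with that show False by simp
      qed
      then show ?thesis by (simp add: P_def)
    qed
    then show ?thesis using p U csubspace_closed[of ?L]
      by (intro exI[of _ "U - ?L"]) auto
  next
    case True
    have "d \<notin> L" using d L by auto
    then obtain \<phi> where \<phi>: "Vector_Spaces.linear (*s) (*) \<phi>" "\<phi> d = 1" "\<And>v. \<phi> v = 0 \<longleftrightarrow> v \<in> L"
      using hyperplane_functional[OF True] by metis
    have \<phi>c: "continuous_on S \<phi>" for S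
      using bounded_linear_clinear[OF \<phi>(1)] by (simp add: linear_continuous_on)
    have on: "p + t *s d \<in> L \<longleftrightarrow> t = - \<phi> p" for p t
    proof -
      have "\<phi> (p + t *s d) = \<phi> p + t" using \<phi>(1,2) by (simp add: clinear_iff)
      then show ?thesis using \<phi>(3)[of "p + t *s d"] by (auto simp: add_eq_0_iff)
    qed
    show ?thesis
    proof (cases "\<exists>p\<in>U. cmod (\<phi> p) > r")
      case True
      have "open (U \<inter> {p. r < cmod (\<phi> p)})"
        by (intro open_Int U open_Collect_less continuous_intros \<phi>c)
      moreover have "P L p" if "cmod (\<phi> p) > r" for p using that by (auto simp: P_def on)
      ultimately show ?thesis using True by (intro exI[of _ "U \<inter> {p. r < cmod (\<phi> p)}"]) auto
    next
      case F: False
      obtain p where p: "p \<in> U" using U by blast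
      define x where "x = p + (- \<phi> p) *s d"
      have xL: "x \<in> L" using on[of p "- \<phi> p"] by (simp add: x_def)
      have xO: "x \<in> O'" unfolding x_def using p U F by (intro disc) auto
      define W where "W = {y \<in> O'. p + (y - x) \<in> U}"
      have W: "open W"
      proof -
        have "open ((\<lambda>y. p + (y - x)) -` U)"
          by (intro open_vimage U continuous_intros)
        then have "open (O' \<inter> (\<lambda>y. p + (y - x)) -` U)" using O by blast
        moreover have "W = O' \<inter> (\<lambda>y. p + (y - x)) -` U" by (auto simp: W_def)
        ultimately show ?thesis by simp
      qed
      have "x \<in> W \<inter> L" using xL xO p by (simp add: W_def)
      then have "W \<inter> L \<noteq> {}" "W \<subseteq> O'" by (auto simp: W_def)
      from good[OF L True W this]
      obtain x' \<epsilon> B where x': "x' \<in> W" "x' \<in> L" "\<epsilon> > 0" "\<And>z. z \<in> ball x' \<epsilon> - \<Union>\<L> \<Longrightarrow> cmod (g z) \<le> B" by blast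
      define \<pi> where "\<pi> q = q + (- \<phi> q) *s d" for q
      have \<pi>c: "continuous_on UNIV \<pi>"
        unfolding \<pi>_def by (intro continuous_intros continuous_on_vsmult \<phi>c)
      define p' where "p' = p + (x' - x)"
      have "\<phi> (x' - x) = 0" using xL x'(2) \<phi>(3) sub[OF L] vec.subspace_diff by blast
      then have "\<phi> p' = \<phi> p" using \<phi>(1) by (simp add: p'_def clinear_iff)
      then have \<pi>p': "\<pi> p' = x'" by (simp add: \<pi>_def p'_def x_def)
      define U' where "U' = U \<inter> \<pi> -` ball x' \<epsilon>"
      have "open U'" unfolding U'_def using U \<pi>c by (intro open_Int open_vimage) auto
      moreover have "p' \<in> U'" using x' \<pi>p' by (simp add: U'_def W_def p'_def)
      moreover have "P L q" if "q \<in> U'" for q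
        unfolding P_def
      proof (intro allI impI)
        fix t assume t: "cmod t \<le> r \<and> q + t *s d \<in> L"
        then have qt: "q + t *s d = \<pi> q" using on by (simp add: \<pi>_def)
        have "\<pi> q \<in> ball x' \<epsilon>" using that by (simp add: U'_def)
        then obtain \<delta> where "\<delta> > 0" "ball (\<pi> q) \<delta> \<subseteq> ball x' \<epsilon>" using open_contains_ball open_ball by blast
        then show "\<exists>\<epsilon>>0. \<exists>B. \<forall>z\<in>ball (q + t *s d) \<epsilon> - \<Union>\<L>. cmod (g z) \<le> B"
          unfolding qt using x'(4) by blast
      qed
      ultimately show ?thesis by (intro exI[of _ U']) (auto simp: U'_def)
    qed
  qed
  have generic: "\<exists>U'. open U' \<and> U' \<noteq> {} \<and> U' \<subseteq> U \<and> (\<forall>L\<in>\<M>. \<forall>p\<in>U'. P L p)"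
    if "finite \<M>" "\<M> \<subseteq> \<L>" "open U" "U \<noteq> {}" "U \<subseteq> ball p0 e" for U \<M>
    using that
  proof (induction \<M> arbitrary: U rule: finite_induct)
    case empty then show ?case by auto
  next
    case (insert L \<M>)
    obtain U1 where U1: "open U1" "U1 \<noteq> {}" "U1 \<subseteq> U" "\<forall>p\<in>U1. P L p"
      using step[of U L] insert.prems by auto
    obtain U2 where "open U2" "U2 \<noteq> {}" "U2 \<subseteq> U1" "\<forall>L\<in>\<M>. \<forall>p\<in>U2. P L p"
      using insert.IH[of U1] U1 insert.prems by auto
    with U1 show ?case by (intro exI[of _ U2]) auto
  qed
  have bound: "cmod (g p) \<le> M" if p: "p \<in> ball p0 e" "p \<notin> \<Union>\<L>" "\<And>L. L \<in> \<L> \<Longrightarrow> P L p" for p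
  proof -
    define Z where "Z = {t. p + t *s d \<in> \<Union>\<L>} \<inter> cball 0 r"
    have pc: "p \<in> cball p0 e" using p by simp
    have dom: "p + t *s d \<in> O' - \<Union>\<L>" if "t \<in> cball 0 r - Z" for t
      using that disc[OF pc] by (auto simp: Z_def)
    have "cmod (g (p + 0 *s d)) \<le> M"
    proof (rule maximum_modulus_punctured[where Z = Z and q = "\<lambda>t. g (p + t *s d)" and r = r and t = 0])
      show "finite Z" using finl by (simp add: Z_def)
      show "Z \<subseteq> ball 0 r"
      proof
        fix t assume t: "t \<in> Z"
        have "cmod t \<noteq> r" using sph[OF pc] t by (auto simp: Z_def \<Omega>_def)
        then show "t \<in> ball 0 r" using t by (simp add: Z_def)
      qed
      have *: "(\<lambda>t. g (p + t *s d)) holomorphic_on (cball 0 r - Z)"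
        by (rule holo_on_line_holomorphic[OF hol dom])
      then show "continuous_on (cball 0 r - Z) (\<lambda>t. g (p + t *s d))" by (rule holomorphic_on_imp_continuous_on)
      show "(\<lambda>t. g (p + t *s d)) holomorphic_on (ball 0 r - Z)"
        using * by (rule holomorphic_on_subset) auto
      show "cmod (g (p + t *s d)) \<le> M" if "cmod t = r" for t
        by (rule M) (use that pc in \<open>force simp: K_def\<close>)
      show "0 \<in> cball 0 r - Z" using p(2) r(1) by (simp add: Z_def)
      show "\<exists>B. \<forall>\<^sub>F t in at a. cmod (g (p + t *s d)) \<le> B" if a: "a \<in> Z" for a
      proof -
        obtain L where L: "L \<in> \<L>" "p + a *s d \<in> L" using a by (auto simp: Z_def)
        moreover have "cmod a \<le> r" using a by (simp add: Z_def)
        ultimately obtain \<epsilon> B where B: "\<epsilon> > 0" "\<And>z. z \<in> ball (p + a *s d) \<epsilon> - \<Union>\<L> \<Longrightarrow> cmod (g z) \<le> B"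
          using p(3)[OF L(1)] unfolding P_def by blast
        have "open ({t. p + t *s d \<in> ball (p + a *s d) \<epsilon>} - ({t. p + t *s d \<in> \<Union>\<L>} - {a}))"
          by (intro open_Diff open_line open_ball finite_imp_closed) (use finl in auto)
        moreover have "a \<in> {t. p + t *s d \<in> ball (p + a *s d) \<epsilon>} - ({t. p + t *s d \<in> \<Union>\<L>} - {a})"
          using B(1) by simp
        ultimately have "\<forall>\<^sub>F t in at a. t \<in> {t. p + t *s d \<in> ball (p + a *s d) \<epsilon>} - ({t. p + t *s d \<in> \<Union>\<L>} - {a})"
          by (rule eventually_at_in_open')
        moreover have "\<forall>\<^sub>F t in at a. t \<noteq> a" by (simp add: eventually_neq_at_within)
        ultimately have "\<forall>\<^sub>F t in at a. cmod (g (p + t *s d)) \<le> B"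
          by eventually_elim (rule B(2), auto)
        then show ?thesis by blast
      qed
    qed (rule r(1))
    then show ?thesis by simp
  qed
  have "cmod (g z) \<le> M" if z: "z \<in> ball p0 e - \<Union>\<L>" for z
  proof (rule ccontr)
    assume c: "\<not> cmod (g z) \<le> M"
    have zb: "ball p0 e \<subseteq> O'" using disc[of _ 0] r(1) by auto
    have op: "open (ball p0 e - \<Union>\<L>)" using clU by auto
    define U where "U = (\<lambda>z. cmod (g z)) -` {M<..} \<inter> (ball p0 e - \<Union>\<L>)"
    have "continuous_on (ball p0 e - \<Union>\<L>) (\<lambda>z. cmod (g z))"
      using continuous_on_subset[OF holo_on_continuous[OF hol], of "ball p0 e - \<Union>\<L>"] zb
      by (auto intro: continuous_on_norm)
    then have "open U" unfolding U_def
      using continuous_on_open_vimage[OF op] by (metis open_greaterThan)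
    moreover have "z \<in> U" using z c by (simp add: U_def)
    moreover have "U \<subseteq> ball p0 e" by (auto simp: U_def)
    ultimately obtain U' where U': "U' \<noteq> {}" "U' \<subseteq> U" "\<forall>L\<in>\<L>. \<forall>p\<in>U'. P L p"
      using generic[OF fin subset_refl, of U] by blast
    then obtain p where p: "p \<in> U'" by blast
    then have "p \<in> ball p0 e" "p \<notin> \<Union>\<L>" "cmod (g p) > M" using U'(2) by (auto simp: U_def)
    with bound[of p] U'(3) p show False by auto
  qed
  moreover have "ball p0 e \<subseteq> O'" using disc[of _ 0] r(1) by auto
  ultimately show ?thesis using e by blast
qed

section \<open>Finite matrix groups\<close>

text \<open>Two points of the set lie on a complex line that meets each subspace at most once, and a convex
  open subset of a line remains connected when finitely many points are removed.\<close>

lemma connected_convex_minus_subspaces: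
  fixes C :: "(complex^'n) set"
  assumes "convex C" "open C" "finite \<L>" "\<And>L. L \<in> \<L> \<Longrightarrow> vec.subspace L"
  shows "connected (C - \<Union>\<L>)"
proof (cases "C - \<Union>\<L> = {}")
  case False
  then obtain u where u: "u \<in> C" "u \<notin> \<Union>\<L>" by blast
  define S where "S v = (\<lambda>t. u + t *s (v - u)) ` ({t. u + t *s (v - u) \<in> C} - {t. u + t *s (v - u) \<in> \<Union>\<L>})" for v
  have conn: "connected (S v)" for v
    unfolding S_def
  proof (rule connected_continuous_image)
    show "continuous_on ({t. u + t *s (v - u) \<in> C} - {t. u + t *s (v - u) \<in> \<Union>\<L>}) (\<lambda>t. u + t *s (v - u))"
      by (intro continuous_intros continuous_on_vsmult)
    show "connected ({t. u + t *s (v - u) \<in> C} - {t. u + t *s (v - u) \<in> \<Union>\<L>})"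
    proof (rule connected_open_diff_countable)
      show "2 \<le> DIM(complex)" by simp
      show "open {t. u + t *s (v - u) \<in> C}" by (rule open_line[OF assms(2)])
      show "connected {t. u + t *s (v - u) \<in> C}" by (rule convex_connected[OF convex_line[OF assms(1)]])
      show "countable {t. u + t *s (v - u) \<in> \<Union>\<L>}"
        by (rule countable_finite[OF finite_line_meets_csubspaces_outside[OF assms(3,4) u(2)]])
    qed
  qed
  have "connected (\<Union>(S ` (C - \<Union>\<L>)))"
  proof (rule connected_Union)
    have "u \<in> S v" for v unfolding S_def by (rule image_eqI[of _ _ 0]) (use u in auto)
    then show "\<Inter>(S ` (C - \<Union>\<L>)) \<noteq> {}" by blast
  qed (use conn in auto)
  moreover have "\<Union>(S ` (C - \<Union>\<L>)) = C - \<Union>\<L>"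
  proof
    show "\<Union>(S ` (C - \<Union>\<L>)) \<subseteq> C - \<Union>\<L>" by (auto simp: S_def)
    show "C - \<Union>\<L> \<subseteq> \<Union>(S ` (C - \<Union>\<L>))"
    proof
      fix v assume v: "v \<in> C - \<Union>\<L>"
      have "v \<in> S v" unfolding S_def by (rule image_eqI[of _ _ 1]) (use v in auto)
      then show "v \<in> \<Union>(S ` (C - \<Union>\<L>))" using v by blast
    qed
  qed
  ultimately show ?thesis by simp
qed (simp only: connected_empty)

text \<open>Multiplication by an element permutes the set, so that it multiplies the product of all elements
  both by \<open>1\<close> and by the power of the element whose exponent is the cardinality.\<close>

lemma finite_mult_closed_eq_roots_of_unity:
  fixes K :: "complex set"
  assumes "finite K" "0 \<notin> K" "1 \<in> K" "\<And>s t. s \<in> K \<Longrightarrow> t \<in> K \<Longrightarrow> s * t \<in> K"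
  shows "K = {t. t ^ card K = 1}"
proof -
  have pos: "card K > 0" using assms by (auto simp: card_gt_0_iff)
  have sub: "K \<subseteq> {t. t ^ card K = 1}"
  proof clarify
    fix t assume t: "t \<in> K"
    have t0: "t \<noteq> 0" using t assms(2) by auto
    have inj: "inj_on ((*) t) K" using t0 by (auto simp: inj_on_def)
    have img: "(*) t ` K = K" using assms t inj by (intro endo_inj_surj) auto
    have "\<Prod>K = (\<Prod>s\<in>K. t * s)"
      using prod.reindex[OF inj, of "\<lambda>x. x"] img by (simp add: o_def)
    also have "\<dots> = t ^ card K * \<Prod>K" by (simp add: prod.distrib)
    finally have "\<Prod>K = t ^ card K * \<Prod>K" .
    moreover have "\<Prod>K \<noteq> 0" using assms by (simp add: prod_zero_iff)
    ultimately show "t ^ card K = 1" by simp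
  qed
  have "card {t::complex. t ^ card K = 1} = card K" using pos by (rule card_roots_unity_eq)
  moreover have "finite {t::complex. t ^ card K = 1}"
    using pos by (intro finite_roots_unity) auto
  ultimately show ?thesis using sub by (metis card_subset_eq)
qed

definition stab :: "(complex^'n^'n) set \<Rightarrow> complex^'n \<Rightarrow> (complex^'n^'n) set" where
  "stab G v = {g\<in>G. g *v v = v}"

definition regular_points :: "(complex^'n^'n) set \<Rightarrow> (complex^'n) set" where
  "regular_points G = {v. \<forall>g\<in>G. g *v v = v \<longrightarrow> g = mat 1}"

definition fixed_subspaces :: "(complex^'n^'n) set \<Rightarrow> (complex^'n) set set" where
  "fixed_subspaces G = fixed_space ` (G - {mat 1})"

text \<open>A slice is stable under the stabilizer of its centre, and two of its points in the same orbit
  of the group are in the same orbit of the stabilizer. So it models a neighbourhood in the orbit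
  space.\<close>

definition slice :: "(complex^'n^'n) set \<Rightarrow> complex^'n \<Rightarrow> (complex^'n) set \<Rightarrow> bool" where
  "slice G v B \<longleftrightarrow> open B \<and> v \<in> B \<and> (\<forall>g\<in>stab G v. \<forall>x\<in>B. g *v x \<in> B) \<and>
     (\<forall>g\<in>G. \<forall>x\<in>B. g *v x \<in> B \<longrightarrow> g \<in> stab G v)"

definition pointwise_stab :: "(complex^'n^'n) set \<Rightarrow> (complex^'n) set \<Rightarrow> (complex^'n^'n) set" where
  "pointwise_stab G H = {g\<in>G. \<forall>h\<in>H. g *v h = h}"

definition averaged_inner :: "(complex^'n^'n) set \<Rightarrow> complex^'n \<Rightarrow> complex^'n \<Rightarrow> complex" where
  "averaged_inner G x y = (\<Sum>g\<in>G. \<Sum>i\<in>UNIV. (g *v x) $ i * cnj ((g *v y) $ i))"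

text \<open>The function is an equation of the hyperplane, and the vector spans the orthogonal complement and
  has equation value \<open>1\<close>. The last two clauses say that the pointwise stabilizer of the hyperplane is
  the cyclic group of all rotations about it whose order divides the cardinality of the stabilizer.\<close>

definition hyperplane_frame :: "(complex^'n^'n) set \<Rightarrow> (complex^'n) set \<Rightarrow> (complex^'n \<Rightarrow> complex) \<Rightarrow> complex^'n \<Rightarrow> bool" where
  "hyperplane_frame G H \<phi> \<alpha> \<longleftrightarrow> Vector_Spaces.linear (*s) (*) \<phi> \<and> \<phi> \<alpha> = 1 \<and> (\<forall>v. \<phi> v = 0 \<longleftrightarrow> v \<in> H) \<and>
     (\<forall>h\<in>H. averaged_inner G \<alpha> h = 0) \<and> card (pointwise_stab G H) \<ge> 2 \<and>
     (\<forall>g\<in>pointwise_stab G H. \<exists>\<zeta>. \<zeta> ^ card (pointwise_stab G H) = 1 \<and> (\<forall>v. \<phi> (g *v v) = \<zeta> * \<phi> v) \<and>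
        (\<forall>v. g *v v - \<phi> (g *v v) *s \<alpha> = v - \<phi> v *s \<alpha>)) \<and>
     (\<forall>\<zeta>. \<zeta> ^ card (pointwise_stab G H) = 1 \<longrightarrow>
        (\<exists>g\<in>pointwise_stab G H. \<forall>v. g *v v = (v - \<phi> v *s \<alpha>) + (\<zeta> * \<phi> v) *s \<alpha>))"

lemma vec_subspace_fixed_space: "vec.subspace (fixed_space (g :: complex^'n^'n))"
  by (auto simp: vec.subspace_def fixed_space_def matrix_vector_right_distrib vector_scalar_commute)

lemma fixed_space_eq_UNIV: "fixed_space (g :: complex^'n^'n) = UNIV \<longleftrightarrow> g = mat 1"
  by (auto simp: fixed_space_def set_eq_iff matrix_eq)

lemma not_linear_hyperplane_UNIV: "\<not> linear_hyperplane (UNIV :: (complex^'n) set)"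
proof -
  have "CARD('n) \<noteq> CARD('n) - 1" using zero_less_card_finite[where 'a = 'n] by linarith
  then show ?thesis by (simp add: linear_hyperplane_def vec_dim_card card_cart_basis)
qed

lemma linear_hyperplane_subset_eq:
  assumes "linear_hyperplane H" "vec.subspace L" "L \<noteq> UNIV" "H \<subseteq> L"
  shows "L = H"
proof (rule ccontr)
  assume "L \<noteq> H"
  then obtain d where d: "d \<in> L" "d \<notin> H" using assms(4) by blast
  obtain \<phi> where \<phi>: "Vector_Spaces.linear (*s) (*) \<phi>" "\<phi> d = 1" "\<And>v. \<phi> v = 0 \<longleftrightarrow> v \<in> H"
    using hyperplane_functional[OF assms(1) d(2)] by metis
  have "v \<in> L" for v
  proof -
    have "\<phi> (v + (- \<phi> v) *s d) = \<phi> v + (- \<phi> v) * \<phi> d"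
      using \<phi>(1) unfolding clinear_iff by metis
    then have "v + (- \<phi> v) *s d \<in> L" using \<phi>(2,3) assms(4) by auto
    then have "(v + (- \<phi> v) *s d) + \<phi> v *s d \<in> L"
      using assms(2) d(1) vec.subspace_add vec.subspace_scale by blast
    then show ?thesis by simp
  qed
  then show False using assms(3) by blast
qed

locale finite_matrix_group =
  fixes G :: "(complex^'n^'n) set"
  assumes finite_G: "finite G" and group_G: "matrix_group G"
begin

lemma one_mem: "mat 1 \<in> G" and mult_mem: "g \<in> G \<Longrightarrow> h \<in> G \<Longrightarrow> g ** h \<in> G"
  and inv_mem: "g \<in> G \<Longrightarrow> matrix_inv g \<in> G"
  using group_G by (auto simp: matrix_group_def)

lemma inv_mult: "g \<in> G \<Longrightarrow> matrix_inv g ** g = mat 1" "g \<in> G \<Longrightarrow> g ** matrix_inv g = mat 1"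
proof -
  have "g ** matrix_inv g = mat 1 \<and> matrix_inv g ** g = mat 1" if "g \<in> G" for g
  proof -
    have "\<exists>A'. g ** A' = mat 1 \<and> A' ** g = mat 1"
      using that group_G unfolding matrix_group_def invertible_def by blast
    then show ?thesis unfolding matrix_inv_def by (rule someI_ex)
  qed
  then show "g \<in> G \<Longrightarrow> matrix_inv g ** g = mat 1" "g \<in> G \<Longrightarrow> g ** matrix_inv g = mat 1" by auto
qed

lemma inv_apply: "g \<in> G \<Longrightarrow> matrix_inv g *v (g *v x) = x" "g \<in> G \<Longrightarrow> g *v (matrix_inv g *v x) = x"
  by (simp_all add: matrix_vector_mul_assoc inv_mult)

lemma mem_inj: "g \<in> G \<Longrightarrow> g *v x = g *v y \<longleftrightarrow> x = y"
  by (metis inv_apply(1))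

lemma mem_orbit_iff: "w \<in> mat_orbit G v \<longleftrightarrow> (\<exists>g\<in>G. w = g *v v)"
  by (auto simp: mat_orbit_def)

lemma self_mem_orbit: "v \<in> mat_orbit G v"
  using one_mem by (auto simp: mem_orbit_iff intro!: bexI[of _ "mat 1"])

lemma mat_orbit_mult: "g \<in> G \<Longrightarrow> mat_orbit G (g *v v) = mat_orbit G v"
proof (intro set_eqI iffI)
  fix x assume g: "g \<in> G"
  show "x \<in> mat_orbit G v" if "x \<in> mat_orbit G (g *v v)"
    using that g mult_mem by (auto simp: mem_orbit_iff matrix_vector_mul_assoc)
  assume "x \<in> mat_orbit G v"
  then obtain h where h: "h \<in> G" "x = h *v v" by (auto simp: mem_orbit_iff)
  have "x = (h ** matrix_inv g) *v (g *v v)"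
    using h g by (simp add: matrix_vector_mul_assoc[symmetric] inv_apply)
  then show "x \<in> mat_orbit G (g *v v)" using h g mult_mem inv_mem by (auto simp: mem_orbit_iff)
qed

lemma mat_orbit_eq_iff: "mat_orbit G v = mat_orbit G w \<longleftrightarrow> (\<exists>g\<in>G. w = g *v v)"
  using mat_orbit_mult mem_orbit_iff self_mem_orbit by metis

lemma hermitian_averaged_inner: "hermitian_inner (averaged_inner G)"
  unfolding hermitian_inner_def
proof (intro conjI allI impI)
  fix x y z :: "complex^'n" and c :: complex
  show "averaged_inner G (x + y) z = averaged_inner G x z + averaged_inner G y z"
    by (simp add: averaged_inner_def matrix_vector_right_distrib algebra_simps sum.distrib)
  show "averaged_inner G (c *s x) y = c * averaged_inner G x y"
    by (simp add: averaged_inner_def vector_scalar_commute sum_distrib_left mult.assoc)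
  show "averaged_inner G y x = cnj (averaged_inner G x y)"
    by (simp add: averaged_inner_def mult.commute)
  assume x: "x \<noteq> 0"
  have re: "Re (averaged_inner G x x) = (\<Sum>g\<in>G. \<Sum>i\<in>UNIV. (cmod ((g *v x) $ i))\<^sup>2)"
    by (simp add: averaged_inner_def complex_norm_square[symmetric] del: of_real_power)
  have "0 < (\<Sum>i\<in>UNIV. (cmod ((mat 1 *v x) $ i))\<^sup>2)"
  proof -
    obtain i where i: "x $ i \<noteq> 0" using x by (auto simp: vec_eq_iff)
    have "0 < (cmod (x $ i))\<^sup>2" using i by simp
    also have "\<dots> \<le> (\<Sum>i\<in>UNIV. (cmod (x $ i))\<^sup>2)" by (rule member_le_sum) auto
    finally show ?thesis by simp
  qed
  also have "\<dots> \<le> (\<Sum>g\<in>G. \<Sum>i\<in>UNIV. (cmod ((g *v x) $ i))\<^sup>2)"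
    by (rule member_le_sum[of _ _ "\<lambda>g. \<Sum>i\<in>UNIV. (cmod ((g *v x) $ i))\<^sup>2"])
       (auto simp: one_mem finite_G intro: sum_nonneg)
  finally show "0 < Re (averaged_inner G x x)" using re by simp
qed

lemma averaged_inner_add: "averaged_inner G (x + y) z = averaged_inner G x z + averaged_inner G y z"
  and averaged_inner_scale: "averaged_inner G (c *s x) y = c * averaged_inner G x y"
  and averaged_inner_pos: "x \<noteq> 0 \<Longrightarrow> Re (averaged_inner G x x) > 0"
  using hermitian_averaged_inner unfolding hermitian_inner_def by blast+

lemma averaged_inner_diff: "averaged_inner G (x - y) z = averaged_inner G x z - averaged_inner G y z"
  using averaged_inner_add[of "x - y" y z] by simp

lemma averaged_inner_invariant:
  assumes "k \<in> G"
  shows "averaged_inner G (k *v x) (k *v y) = averaged_inner G x y"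
proof -
  have "bij_betw (\<lambda>g. g ** k) G G"
    by (rule bij_betwI[where g = "\<lambda>g. g ** matrix_inv k"])
       (use assms mult_mem inv_mem in \<open>auto simp: matrix_mul_assoc[symmetric] inv_mult\<close>)
  from sum.reindex_bij_betw[OF this, of "\<lambda>g. \<Sum>i\<in>UNIV. (g *v x) $ i * cnj ((g *v y) $ i)"]
  show ?thesis by (simp add: averaged_inner_def matrix_vector_mul_assoc)
qed

lemma open_saturation: "open N \<Longrightarrow> open (\<Union>g\<in>G. (\<lambda>w. g *v w) -` N)"
  by (intro open_UN ballI open_vimage linear_continuous_on bounded_linear_matrix)

lemma saturation_invariant:
  assumes "g \<in> G" "w \<in> (\<Union>g\<in>G. (\<lambda>w. g *v w) -` N)"
  shows "g *v w \<in> (\<Union>g\<in>G. (\<lambda>w. g *v w) -` N)"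
proof -
  obtain k where k: "k \<in> G" "k *v w \<in> N" using assms(2) by auto
  then have "(k ** matrix_inv g) *v (g *v w) \<in> N"
    using assms(1) by (simp add: matrix_vector_mul_assoc[symmetric] inv_apply)
  moreover have "k ** matrix_inv g \<in> G" using k assms(1) mult_mem inv_mem by blast
  ultimately show ?thesis by blast
qed

lemma finite_stab: "finite (stab G v)" and one_mem_stab: "mat 1 \<in> stab G v"
  using finite_G one_mem by (auto simp: stab_def)

lemma stab_mult: "g \<in> stab G v \<Longrightarrow> h \<in> stab G v \<Longrightarrow> g ** h \<in> stab G v"
  by (auto simp: stab_def mult_mem matrix_vector_mul_assoc[symmetric])

lemma regular_iff_stab: "v \<in> regular_points G \<longleftrightarrow> stab G v = {mat 1}"
  using one_mem by (auto simp: regular_points_def stab_def)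

lemma regular_eq: "regular_points G = - \<Union>(fixed_subspaces G)"
  by (auto simp: regular_points_def fixed_subspaces_def fixed_space_def)

lemma finite_fixed_subspaces: "finite (fixed_subspaces G)"
  using finite_G by (simp add: fixed_subspaces_def)

lemma fixed_subspaces_proper: "L \<in> fixed_subspaces G \<Longrightarrow> vec.subspace L \<and> L \<noteq> UNIV"
  using vec_subspace_fixed_space fixed_space_eq_UNIV by (auto simp: fixed_subspaces_def)

lemma fixed_subspaces_hyperplane_iff:
  "L \<in> fixed_subspaces G \<and> linear_hyperplane L \<longleftrightarrow> L \<in> reflection_hyperplanes G"
proof -
  have "g \<noteq> mat 1" if "linear_hyperplane (fixed_space g)" for g :: "complex^'n^'n"
    using that not_linear_hyperplane_UNIV fixed_space_eq_UNIV by metis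
  then show ?thesis by (auto simp: fixed_subspaces_def reflection_hyperplanes_def reflections_def)
qed

lemma open_regular: "open (regular_points G)"
  unfolding regular_eq
  using finite_fixed_subspaces fixed_subspaces_proper csubspace_closed by (intro open_Compl closed_Union) auto

lemma regular_dense: "open U \<Longrightarrow> U \<noteq> {} \<Longrightarrow> \<exists>u\<in>U. u \<in> regular_points G"
  using open_avoid_csubspaces[OF finite_fixed_subspaces fixed_subspaces_proper] by (auto simp: regular_eq)

lemma finite_reflection_hyperplanes: "finite (reflection_hyperplanes G)"
  using finite_G by (simp add: reflection_hyperplanes_def reflections_def)

lemma linear_hyperplane_reflection: "H \<in> reflection_hyperplanes G \<Longrightarrow> linear_hyperplane H"
  by (auto simp: reflection_hyperplanes_def reflections_def)

lemma open_complement_discriminant: "open (- discriminant_locus G)"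
  unfolding discriminant_locus_def
  using finite_reflection_hyperplanes linear_hyperplane_reflection csubspace_closed
  by (intro open_Compl closed_Union) (auto simp: linear_hyperplane_def)

lemma regular_subset: "regular_points G \<subseteq> - discriminant_locus G"
  unfolding regular_eq discriminant_locus_def using fixed_subspaces_hyperplane_iff by blast

lemma connected_complement_discriminant: "connected (- discriminant_locus G)"
  using connected_convex_minus_subspaces[of UNIV "reflection_hyperplanes G"]
    finite_reflection_hyperplanes linear_hyperplane_reflection
  by (simp add: discriminant_locus_def Compl_eq_Diff_UNIV linear_hyperplane_def)

lemma connected_regular_convex: "convex C \<Longrightarrow> open C \<Longrightarrow> connected (C \<inter> regular_points G)"
  using connected_convex_minus_subspaces[of C "fixed_subspaces G"] finite_fixed_subspaces fixed_subspaces_proper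
  by (simp add: regular_eq Diff_eq)

lemma continuous_on_matrix: "continuous_on S (\<lambda>v. (g :: complex^'n^'n) *v v)"
  by (rule linear_continuous_on[OF bounded_linear_matrix])

text \<open>An element outside the stabilizer moves the point, and therefore a small ball about it off
  itself. The intersection of the translates of such a ball under the stabilizer is stable.\<close>

lemma ex_slice:
  assumes "open U" "v \<in> U"
  obtains B where "slice G v B" "B \<subseteq> U"
proof -
  have "\<exists>e>0. \<forall>x\<in>ball v e. \<forall>y\<in>ball v e. g *v x = y \<longrightarrow> g \<in> stab G v" if g: "g \<in> G" for g
  proof (cases "g *v v = v")
    case True then show ?thesis using g by (auto simp: stab_def intro!: exI[of _ 1])
  next
    case False
    obtain A C where AC: "open A" "open C" "g *v v \<in> A" "v \<in> C" "A \<inter> C = {}"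
      using hausdorff[OF False] by blast
    have "open ((\<lambda>x. g *v x) -` A)" by (rule open_vimage[OF AC(1) continuous_on_matrix])
    then have "open ((\<lambda>x. g *v x) -` A \<inter> C)" using AC by blast
    moreover have "v \<in> (\<lambda>x. g *v x) -` A \<inter> C" using AC by simp
    ultimately obtain e where "e > 0" "ball v e \<subseteq> (\<lambda>x. g *v x) -` A \<inter> C" using open_contains_ball by blast
    then show ?thesis using AC(5) by (intro exI[of _ e]) blast
  qed
  then obtain e where e: "\<And>g. g \<in> G \<Longrightarrow> e g > 0"
    "\<And>g x y. g \<in> G \<Longrightarrow> x \<in> ball v (e g) \<Longrightarrow> y \<in> ball v (e g) \<Longrightarrow> g *v x = y \<Longrightarrow> g \<in> stab G v" by metis
  obtain r where r: "r > 0" "ball v r \<subseteq> U" using assms open_contains_ball by blast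
  define \<epsilon> where "\<epsilon> = min r (Min (e ` G))"
  have ne: "G \<noteq> {}" using one_mem by auto
  have \<epsilon>: "\<epsilon> > 0" using e(1) r finite_G ne by (simp add: \<epsilon>_def)
  have \<epsilon>e: "\<epsilon> \<le> e g" if "g \<in> G" for g using finite_G that by (simp add: \<epsilon>_def min.coboundedI2)
  have sep: "g \<in> stab G v" if "g \<in> G" "x \<in> ball v \<epsilon>" "g *v x \<in> ball v \<epsilon>" for g x
    using e(2)[OF that(1), of x "g *v x"] that \<epsilon>e[OF that(1)] by auto
  define B where "B = (\<Inter>k\<in>stab G v. (\<lambda>x. k *v x) -` ball v \<epsilon>)"
  have Bsub: "B \<subseteq> ball v \<epsilon>" using one_mem_stab by (force simp: B_def)
  have "slice G v B"
    unfolding slice_def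
  proof (intro conjI ballI impI)
    show "open B" unfolding B_def
      by (intro open_INT finite_stab ballI open_vimage open_ball continuous_on_matrix)
    show "v \<in> B" using \<epsilon> by (auto simp: B_def stab_def)
    show "g *v x \<in> B" if "g \<in> stab G v" "x \<in> B" for g x
      using that stab_mult by (auto simp: B_def matrix_vector_mul_assoc)
    show "g \<in> stab G v" if "g \<in> G" "x \<in> B" "g *v x \<in> B" for g x
      using that Bsub by (intro sep) auto
  qed
  moreover have "ball v \<epsilon> \<subseteq> ball v r" by (intro subset_ball) (simp add: \<epsilon>_def)
  then have "B \<subseteq> U" using Bsub r(2) by blast
  ultimately show thesis using that by blast
qed

lemma slice_stab_subset:
  assumes "slice G v B" "x \<in> B"
  shows "stab G x \<subseteq> stab G v"
proof
  fix g assume "g \<in> stab G x"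
  then have "g \<in> G" "g *v x = x" by (auto simp: stab_def)
  then show "g \<in> stab G v" using assms unfolding slice_def by metis
qed

lemma slice_regular: "slice G v B \<Longrightarrow> v \<in> regular_points G \<Longrightarrow> x \<in> B \<Longrightarrow> x \<in> regular_points G"
  using slice_stab_subset[of v B x] one_mem_stab[of x] by (auto simp: regular_iff_stab)

lemma pointwise_stab_group:
  "mat 1 \<in> pointwise_stab G H" "finite (pointwise_stab G H)"
  "g \<in> pointwise_stab G H \<Longrightarrow> h \<in> pointwise_stab G H \<Longrightarrow> g ** h \<in> pointwise_stab G H"
  "g \<in> pointwise_stab G H \<Longrightarrow> matrix_inv g \<in> pointwise_stab G H"
  using finite_G one_mem mult_mem inv_mem
  by (auto simp: pointwise_stab_def matrix_vector_mul_assoc[symmetric]) (metis inv_apply(1))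

text \<open>The average of a vector over the pointwise stabilizer is fixed by a reflection about the
  hyperplane and so lies in it. The average has the same inner products with the hyperplane as the vector.\<close>

lemma ex_normal_vector:
  assumes "H \<in> reflection_hyperplanes G"
  obtains \<alpha> where "\<alpha> \<notin> H" "\<And>h. h \<in> H \<Longrightarrow> averaged_inner G \<alpha> h = 0"
proof -
  define K where "K = pointwise_stab G H"
  obtain s where s: "s \<in> G" "H = fixed_space s" "linear_hyperplane H"
    using assms by (auto simp: reflection_hyperplanes_def reflections_def)
  have sK: "s \<in> K" using s by (auto simp: K_def pointwise_stab_def fixed_space_def)
  have "H \<noteq> UNIV" using not_linear_hyperplane_UNIV s(3) by metis
  then obtain v where v: "v \<notin> H" by blast
  define P where "P = (1 / of_nat (card K)) *s (\<Sum>k\<in>K. k *v v)"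
  have finK: "finite K" "K \<noteq> {}" using pointwise_stab_group(1,2)[of H] by (auto simp: K_def)
  have KG: "K \<subseteq> G" by (auto simp: K_def pointwise_stab_def)
  have c: "of_nat (card K) \<noteq> (0::complex)" using finK by simp
  have sum: "(\<Sum>k\<in>K. (s ** k) *v v) = (\<Sum>k\<in>K. k *v v)"
  proof -
    have "bij_betw (\<lambda>k. s ** k) K K"
      by (rule bij_betwI[where g = "\<lambda>k. matrix_inv s ** k"])
         (use sK s(1) pointwise_stab_group(3,4)[of _ H] in \<open>auto simp: matrix_mul_assoc inv_mult K_def\<close>)
    from sum.reindex_bij_betw[OF this, of "\<lambda>k. k *v v"] show ?thesis by simp
  qed
  have "s *v P = P"
    unfolding P_def
    by (simp add: vector_scalar_commute linear_sum[OF bounded_linear.linear[OF bounded_linear_matrix]] matrix_vector_mul_assoc sum)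
  then have PH: "P \<in> H" using s(2) by (simp add: fixed_space_def)
  show thesis
  proof
    show "v - P \<notin> H" using v PH s(3) vec.subspace_add[of H "v - P" P] by (auto simp: linear_hyperplane_def)
    fix h assume h: "h \<in> H"
    have inv: "averaged_inner G (k *v v) h = averaged_inner G v h" if "k \<in> K" for k
      using averaged_inner_invariant[of k v h] that h KG by (auto simp: K_def pointwise_stab_def)
    have sums: "averaged_inner G (\<Sum>k\<in>K'. k *v v) h = (\<Sum>k\<in>K'. averaged_inner G (k *v v) h)" if "finite K'" for K'
      using that by (induction K' rule: finite_induct)
        (use averaged_inner_scale[of 0 0 h] in \<open>auto simp: averaged_inner_add\<close>)
    have "averaged_inner G P h = averaged_inner G v h"
      unfolding P_def averaged_inner_scale sums[OF finK(1)] using inv c by simp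
    then show "averaged_inner G (v - P) h = 0" by (simp add: averaged_inner_diff)
  qed
qed

text \<open>The normal line of the hyperplane is preserved by the pointwise stabilizer, which acts on it
  faithfully by scalars. A finite group of scalars is the group of all roots of unity of its order.\<close>

lemma ex_hyperplane_frame:
  assumes "H \<in> reflection_hyperplanes G"
  shows "\<exists>\<phi> \<alpha>. hyperplane_frame G H \<phi> \<alpha>"
proof -
  define K where "K = pointwise_stab G H"
  have lh: "linear_hyperplane H" by (rule linear_hyperplane_reflection[OF assms])
  obtain \<alpha> where \<alpha>: "\<alpha> \<notin> H" "\<And>h. h \<in> H \<Longrightarrow> averaged_inner G \<alpha> h = 0" using ex_normal_vector[OF assms] by metis
  obtain \<phi> where \<phi>: "Vector_Spaces.linear (*s) (*) \<phi>" "\<phi> \<alpha> = 1" "\<And>v. \<phi> v = 0 \<longleftrightarrow> v \<in> H"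
    using hyperplane_functional[OF lh \<alpha>(1)] by metis
  have \<phi>l: "\<phi> (x + y) = \<phi> x + \<phi> y" "\<phi> (c *s x) = c * \<phi> x" for x y c using \<phi>(1) by (auto simp: clinear_iff)
  have \<phi>d: "\<phi> (x - y) = \<phi> x - \<phi> y" for x y using \<phi>l(1)[of "x - y" y] by simp
  have inH: "v - \<phi> v *s \<alpha> \<in> H" for v by (simp add: \<phi>(3)[symmetric] \<phi>d \<phi>l \<phi>(2))
  have KG: "K \<subseteq> G" by (auto simp: K_def pointwise_stab_def)
  have g\<alpha>: "g *v \<alpha> = \<phi> (g *v \<alpha>) *s \<alpha>" if g: "g \<in> K" for g
  proof -
    let ?h = "g *v \<alpha> - \<phi> (g *v \<alpha>) *s \<alpha>"
    have fx: "g *v ?h = ?h" using g inH by (simp add: K_def pointwise_stab_def)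
    have "averaged_inner G (g *v \<alpha>) ?h = averaged_inner G (g *v \<alpha>) (g *v ?h)" using fx by simp
    also have "\<dots> = averaged_inner G \<alpha> ?h" using averaged_inner_invariant g KG by blast
    also have "\<dots> = 0" by (rule \<alpha>(2)[OF inH])
    finally have "averaged_inner G ?h ?h = 0"
      by (simp add: averaged_inner_diff averaged_inner_scale \<alpha>(2)[OF inH])
    then have "?h = 0" using averaged_inner_pos[of ?h] by fastforce
    then show ?thesis by simp
  qed
  define \<zeta> where "\<zeta> g = \<phi> (g *v \<alpha>)" for g
  have act: "g *v v = (v - \<phi> v *s \<alpha>) + (\<zeta> g * \<phi> v) *s \<alpha>" if g: "g \<in> K" for g v
  proof -
    have "g *v v = g *v ((v - \<phi> v *s \<alpha>) + \<phi> v *s \<alpha>)" by simp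
    also have "\<dots> = g *v (v - \<phi> v *s \<alpha>) + \<phi> v *s (g *v \<alpha>)"
      by (simp only: matrix_vector_right_distrib vector_scalar_commute)
    also have "g *v (v - \<phi> v *s \<alpha>) = v - \<phi> v *s \<alpha>" using g inH by (simp add: K_def pointwise_stab_def)
    also have "\<phi> v *s (g *v \<alpha>) = (\<zeta> g * \<phi> v) *s \<alpha>"
      by (subst g\<alpha>[OF g]) (simp add: vector_smult_assoc \<zeta>_def mult.commute)
    finally show ?thesis .
  qed
  have \<phi>act: "\<phi> (g *v v) = \<zeta> g * \<phi> v" if "g \<in> K" for g v
    by (subst act[OF that]) (simp add: \<phi>l \<phi>d \<phi>(2))
  have inj: "inj_on \<zeta> K"
  proof (rule inj_onI)
    fix g h assume *: "g \<in> K" "h \<in> K" "\<zeta> g = \<zeta> h"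
    have "g *v v = h *v v" for v by (subst act[OF *(1)], subst act[OF *(2)]) (simp add: *(3))
    then show "g = h" by (simp add: matrix_eq)
  qed
  have "\<zeta> ` K = {t. t ^ card (\<zeta> ` K) = 1}"
  proof (rule finite_mult_closed_eq_roots_of_unity)
    show "finite (\<zeta> ` K)" using pointwise_stab_group(2) by (simp add: K_def)
    show "1 \<in> \<zeta> ` K" using pointwise_stab_group(1)[of H] \<phi>(2)
      by (intro image_eqI[of _ _ "mat 1"]) (auto simp: K_def \<zeta>_def)
    show "0 \<notin> \<zeta> ` K"
    proof
      assume "0 \<in> \<zeta> ` K"
      then obtain g where g: "g \<in> K" "\<zeta> g = 0" by auto
      then have "g *v \<alpha> = 0" using g\<alpha>[OF g(1)] by (simp add: \<zeta>_def)
      then have "g *v \<alpha> = g *v 0" by simp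
      then have "\<alpha> = 0" using mem_inj g(1) KG by blast
      then show False using \<phi>(2) \<phi>l(2)[of 0 0] by simp
    qed
    show "s * t \<in> \<zeta> ` K" if st: "s \<in> \<zeta> ` K" "t \<in> \<zeta> ` K" for s t
    proof -
      obtain g h where gh: "g \<in> K" "h \<in> K" "s = \<zeta> g" "t = \<zeta> h" using st by auto
      have "\<zeta> (g ** h) = s * t"
        using \<phi>act[OF gh(1), of "h *v \<alpha>"] by (simp add: \<zeta>_def gh matrix_vector_mul_assoc)
      then show ?thesis using gh pointwise_stab_group(3) by (metis K_def image_eqI)
    qed
  qed
  then have \<zeta>K: "\<zeta> ` K = {t. t ^ card K = 1}" using card_image[OF inj] by simp
  have "hyperplane_frame G H \<phi> \<alpha>"
    unfolding hyperplane_frame_def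
  proof (intro conjI allI ballI impI)
    obtain s where s: "s \<in> G" "H = fixed_space s"
      using assms by (auto simp: reflection_hyperplanes_def reflections_def)
    have "s \<noteq> mat 1" using s lh not_linear_hyperplane_UNIV fixed_space_eq_UNIV by metis
    moreover have "s \<in> K" using s by (auto simp: K_def pointwise_stab_def fixed_space_def)
    moreover have "mat 1 \<in> K" using pointwise_stab_group(1) by (simp add: K_def)
    ultimately have "card {s, mat 1} = 2" "{s, mat 1} \<subseteq> K" by auto
    then show "2 \<le> card (pointwise_stab G H)"
      using card_mono[OF pointwise_stab_group(2)] by (metis K_def)
    show "\<exists>\<zeta>. \<zeta> ^ card (pointwise_stab G H) = 1 \<and> (\<forall>v. \<phi> (g *v v) = \<zeta> * \<phi> v) \<and>
        (\<forall>v. g *v v - \<phi> (g *v v) *s \<alpha> = v - \<phi> v *s \<alpha>)" if g: "g \<in> pointwise_stab G H" for g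
    proof (intro exI[of _ "\<zeta> g"] conjI allI)
      have gK: "g \<in> K" using g by (simp add: K_def)
      show "\<zeta> g ^ card (pointwise_stab G H) = 1" using \<zeta>K gK by (auto simp: K_def)
      show "\<phi> (g *v v) = \<zeta> g * \<phi> v" for v by (rule \<phi>act[OF gK])
      show "g *v v - \<phi> (g *v v) *s \<alpha> = v - \<phi> v *s \<alpha>" for v
        unfolding \<phi>act[OF gK] by (subst act[OF gK]) simp
    qed
    show "\<exists>g\<in>pointwise_stab G H. \<forall>v. g *v v = (v - \<phi> v *s \<alpha>) + (\<zeta> * \<phi> v) *s \<alpha>"
      if z: "\<zeta> ^ card (pointwise_stab G H) = 1" for \<zeta>
    proof -
      have "\<zeta> \<in> {t. t ^ card K = 1}" using z by (simp add: K_def)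
      then have "\<zeta> \<in> (\<lambda>g. \<phi> (g *v \<alpha>)) ` K" using \<zeta>K unfolding \<zeta>_def by simp
      then obtain g where "g \<in> K" "\<zeta> = \<phi> (g *v \<alpha>)" by (rule imageE)
      then show ?thesis using act unfolding \<zeta>_def K_def by blast
    qed
  qed (use \<phi> \<alpha> in auto)
  then show ?thesis by blast
qed

end

section \<open>Holomorphic correspondences between finite group quotients\<close>

text \<open>The relation between vectors with corresponding orbits. Being an isomorphism of ringed spaces is
  expressed by the transfer of invariant open sets and of invariant holomorphic functions on them,
  in both directions. The numbers \<open>e1\<close> and \<open>e2\<close> stand for the orders of the groups of scalars that
  act trivially on the two orbit spaces: a scalar \<open>s\<close> acts effectively on the first as scalar
  multiplication by an \<open>e1\<close>-th root of \<open>s\<close>. For \<open>s = t ^ (e1 * e2)\<close> the roots on the two sides are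
  \<open>t ^ e2\<close> and \<open>t ^ e1\<close>.\<close>

locale correspondence = A: finite_matrix_group G1 + B: finite_matrix_group G2
  for G1 :: "(complex^'n^'n) set" and G2 :: "(complex^'m^'m) set" +
  fixes R :: "complex^'n \<Rightarrow> complex^'m \<Rightarrow> bool" and e1 e2 :: nat
  assumes total1: "\<exists>w. R z w" and total2: "\<exists>z. R z w"
    and orbit1: "R z w \<Longrightarrow> R z' w \<longleftrightarrow> (\<exists>g\<in>G1. z' = g *v z)"
    and orbit2: "R z w \<Longrightarrow> R z w' \<longleftrightarrow> (\<exists>g\<in>G2. w' = g *v w)"
    and pull_open1: "open Z \<Longrightarrow> (\<And>g z. g \<in> G1 \<Longrightarrow> z \<in> Z \<Longrightarrow> g *v z \<in> Z) \<Longrightarrow> open {w. \<exists>z\<in>Z. R z w}"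
    and pull_open2: "open W \<Longrightarrow> (\<And>g w. g \<in> G2 \<Longrightarrow> w \<in> W \<Longrightarrow> g *v w \<in> W) \<Longrightarrow> open {z. \<exists>w\<in>W. R z w}"
    and pull_holo1: "open Z \<Longrightarrow> (\<And>g z. g \<in> G1 \<Longrightarrow> z \<in> Z \<Longrightarrow> g *v z \<in> Z) \<Longrightarrow> holo_on h Z \<Longrightarrow>
      (\<And>g z. g \<in> G1 \<Longrightarrow> z \<in> Z \<Longrightarrow> h (g *v z) = h z) \<Longrightarrow> (\<And>z w. R z w \<Longrightarrow> z \<in> Z \<Longrightarrow> K w = h z) \<Longrightarrow>
      holo_on K {w. \<exists>z\<in>Z. R z w}"
    and pull_holo2: "open W \<Longrightarrow> (\<And>g w. g \<in> G2 \<Longrightarrow> w \<in> W \<Longrightarrow> g *v w \<in> W) \<Longrightarrow> holo_on h' W \<Longrightarrow>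
      (\<And>g w. g \<in> G2 \<Longrightarrow> w \<in> W \<Longrightarrow> h' (g *v w) = h' w) \<Longrightarrow> (\<And>z w. R z w \<Longrightarrow> w \<in> W \<Longrightarrow> K' z = h' w) \<Longrightarrow>
      holo_on K' {z. \<exists>w\<in>W. R z w}"
    and discriminant_iff: "R z w \<Longrightarrow> z \<in> discriminant_locus G1 \<longleftrightarrow> w \<in> discriminant_locus G2"
    and scaling: "R z w \<Longrightarrow> t \<noteq> 0 \<Longrightarrow> R (t ^ e2 *s z) (t ^ e1 *s w)"
    and e_pos: "e1 > 0" "e2 > 0"
begin

lemma swap: "correspondence G2 G1 (\<lambda>w z. R z w) e2 e1"
proof (unfold_locales, goal_cases)
  case (5 Z) then show ?case by (rule pull_open2)
next
  case (6 W) then show ?case by (rule pull_open1)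
next
  case (7 Z h K) then show ?case by (rule pull_holo2)
next
  case (8 W h K) then show ?case by (rule pull_holo1)
next
  case 1 show ?case by (rule total2)
next
  case 2 show ?case by (rule total1)
next
  case 3 then show ?case by (rule orbit2)
next
  case 4 then show ?case by (rule orbit1)
next
  case 9 then show ?case using discriminant_iff by blast
next
  case 10 then show ?case using scaling by blast
qed (rule e_pos)+

lemma act1: "R z w \<Longrightarrow> g \<in> G1 \<Longrightarrow> R (g *v z) w"
  using orbit1 by blast

lemma act2: "R z w \<Longrightarrow> g \<in> G2 \<Longrightarrow> R z (g *v w)"
  using orbit2 by blast

lemma open_related: assumes "open N" shows "open {z. \<exists>w\<in>N. R z w}"
proof -
  define W where "W = (\<Union>g\<in>G2. (\<lambda>w. g *v w) -` N)"
  have "open {z. \<exists>w\<in>W. R z w}"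
    unfolding W_def by (rule pull_open2[OF B.open_saturation[OF assms] B.saturation_invariant])
  moreover have "{z. \<exists>w\<in>W. R z w} = {z. \<exists>w\<in>N. R z w}"
  proof (intro Collect_cong iffI)
    fix z assume "\<exists>w\<in>W. R z w"
    then show "\<exists>w\<in>N. R z w" using act2 by (auto simp: W_def)
  next
    fix z assume "\<exists>w\<in>N. R z w"
    then show "\<exists>w\<in>W. R z w" using B.one_mem by (force simp: W_def)
  qed
  ultimately show ?thesis by simp
qed

text \<open>Stabilizer invariant functions on a slice are the local functions on the second quotient, so
  they become holomorphic functions on the first vector space.\<close>

lemma transfer:
  assumes "slice G2 w0 B" "holo_on k B" "\<And>g w. g \<in> stab G2 w0 \<Longrightarrow> w \<in> B \<Longrightarrow> k (g *v w) = k w"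
  obtains K where "holo_on K {z. \<exists>w\<in>B. R z w}" "\<And>z w. w \<in> B \<Longrightarrow> R z w \<Longrightarrow> K z = k w"
proof -
  have B: "open B" "w0 \<in> B" "\<And>g x. g \<in> stab G2 w0 \<Longrightarrow> x \<in> B \<Longrightarrow> g *v x \<in> B"
    "\<And>g x. g \<in> G2 \<Longrightarrow> x \<in> B \<Longrightarrow> g *v x \<in> B \<Longrightarrow> g \<in> stab G2 w0"
    using assms(1) by (auto simp: slice_def)
  define W where "W = (\<Union>g\<in>G2. (\<lambda>w. g *v w) -` B)"
  have openW: "open W" unfolding W_def by (rule B.open_saturation[OF B(1)])
  have invW: "g *v w \<in> W" if "g \<in> G2" "w \<in> W" for g w
    using that unfolding W_def by (rule B.saturation_invariant)
  have same: "k x = k y" if "x \<in> B" "y \<in> B" "g \<in> G2" "y = g *v x" for x y g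
    using assms(3)[of g x] B(4)[of g x] that by auto
  define h where "h w = k ((SOME g. g \<in> G2 \<and> g *v w \<in> B) *v w)" for w
  have h: "h w = k (g *v w)" if "g \<in> G2" "g *v w \<in> B" for g w
  proof -
    let ?g = "SOME g. g \<in> G2 \<and> g *v w \<in> B"
    have s: "?g \<in> G2 \<and> ?g *v w \<in> B" by (rule someI[of _ g]) (use that in auto)
    have "g *v w = (g ** matrix_inv ?g) *v (?g *v w)"
      using s by (simp add: matrix_vector_mul_assoc[symmetric] B.inv_apply)
    then have "k (?g *v w) = k (g *v w)"
      using s that B.mult_mem B.inv_mem by (intro same) auto
    then show ?thesis by (simp add: h_def)
  qed
  have hW: "holo_on h W"
  proof (rule holo_on_local)
    fix w assume "w \<in> W"
    then obtain g where g: "g \<in> G2" "g *v w \<in> B" by (auto simp: W_def)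
    have o: "open ((\<lambda>w. g *v w) -` B)" by (intro open_vimage B B.continuous_on_matrix)
    have "holo_on (\<lambda>w. k (g *v w)) ((\<lambda>w. g *v w) -` B)"
      by (rule holo_on_compose[OF assms(2) vholo_on_matrix]) auto
    from holo_on_cong[OF o _ this] have "holo_on h ((\<lambda>w. g *v w) -` B)"
      using h[OF g(1)] by auto
    then show "\<exists>V. w \<in> V \<and> holo_on h V" using g(2) by blast
  qed
  have hinv: "h (g *v w) = h w" if "g \<in> G2" "w \<in> W" for g w
  proof -
    obtain k' where k: "k' \<in> G2" "k' *v w \<in> B" using \<open>w \<in> W\<close> by (auto simp: W_def)
    have "(k' ** matrix_inv g) *v (g *v w) = k' *v w"
      using \<open>g \<in> G2\<close> by (simp add: matrix_vector_mul_assoc[symmetric] B.inv_apply)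
    then have "h (g *v w) = k (k' *v w)"
      using h[of "k' ** matrix_inv g" "g *v w"] k \<open>g \<in> G2\<close> B.mult_mem B.inv_mem by simp
    then show ?thesis using h[OF k] by simp
  qed
  define K where "K z = h (SOME w. w \<in> W \<and> R z w)" for z
  have K: "K z = h w" if Rzw: "R z w" and wW: "w \<in> W" for z w
  proof -
    let ?w = "SOME w. w \<in> W \<and> R z w"
    have s: "?w \<in> W \<and> R z ?w" by (rule someI[of _ w]) (use that in auto)
    then obtain g where "g \<in> G2" "?w = g *v w" using orbit2[OF Rzw] by blast
    then show ?thesis using hinv wW by (simp add: K_def)
  qed
  have "holo_on K {z. \<exists>w\<in>W. R z w}"
    by (rule pull_holo2[OF openW invW hW hinv K])
  moreover have BW: "w \<in> W" if "w \<in> B" for w using that B.one_mem by (force simp: W_def)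
  then have "{z. \<exists>w\<in>B. R z w} \<subseteq> {z. \<exists>w\<in>W. R z w}" by blast
  ultimately have "holo_on K {z. \<exists>w\<in>B. R z w}" by (rule holo_on_subset)
  moreover have "K z = k w" if "w \<in> B" "R z w" for z w
  proof -
    have "h w = k w" using h[OF B.one_mem, of w] that(1) by simp
    then show ?thesis using K[OF that(2) BW[OF that(1)]] by simp
  qed
  ultimately show thesis using that by blast
qed

lemma transfer_vector:
  fixes k :: "complex^'m \<Rightarrow> complex^'k"
  assumes "slice G2 w0 B" "vholo_on k B" "\<And>g w. g \<in> stab G2 w0 \<Longrightarrow> w \<in> B \<Longrightarrow> k (g *v w) = k w"
  obtains K where "vholo_on K {z. \<exists>w\<in>B. R z w}" "\<And>z w. w \<in> B \<Longrightarrow> R z w \<Longrightarrow> K z = k w"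
proof -
  have "\<exists>K. holo_on K {z. \<exists>w\<in>B. R z w} \<and> (\<forall>z w. w \<in> B \<longrightarrow> R z w \<longrightarrow> K z = k w $ i)" for i
    by (rule transfer[OF assms(1), of "\<lambda>w. k w $ i"]) (use assms(2,3) in \<open>auto simp: vholo_on_def\<close>)
  then have "\<forall>i. \<exists>K. holo_on K {z. \<exists>w\<in>B. R z w} \<and> (\<forall>z w. w \<in> B \<longrightarrow> R z w \<longrightarrow> K z = k w $ i)" by blast
  from choice[OF this] obtain K where K: "\<And>i. holo_on (K i) {z. \<exists>w\<in>B. R z w}"
    "\<And>i z w. w \<in> B \<Longrightarrow> R z w \<Longrightarrow> K i z = k w $ i" by blast
  show thesis
    by (rule that[of "\<lambda>z. \<chi> i. K i z"]) (use K in \<open>auto simp: vholo_on_def vec_eq_iff\<close>)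
qed

text \<open>The relation is closed. As the orbit of a related point is finite, it is separated from the
  unrelated point by a distance.\<close>

lemma not_related_open:
  assumes "\<not> R z w"
  obtains U V where "open U" "open V" "z \<in> U" "w \<in> V" "\<And>u v. u \<in> U \<Longrightarrow> v \<in> V \<Longrightarrow> \<not> R u v"
proof -
  obtain w1 where w1: "R z w1" using total1 by blast
  define d where "d = Min ((\<lambda>g. dist w (g *v w1)) ` G2)"
  have ne: "G2 \<noteq> {}" using B.one_mem by auto
  have d: "d > 0" using assms act2[OF w1] B.finite_G ne by (auto simp: d_def)
  have dle: "d \<le> dist w (g *v w1)" if "g \<in> G2" for g using that B.finite_G by (simp add: d_def)
  define N where "N = (\<Inter>g\<in>G2. (\<lambda>v. g *v v) -` ball (g *v w1) (d / 2))"
  have "open N" unfolding N_def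
    by (intro open_INT B.finite_G ballI open_vimage open_ball B.continuous_on_matrix)
  then have "open {z. \<exists>w\<in>N. R z w}" by (rule open_related)
  moreover have "z \<in> {z. \<exists>w\<in>N. R z w}" using w1 d by (auto simp: N_def intro!: bexI[of _ w1])
  moreover have "\<not> R u v" if u: "u \<in> {z. \<exists>w\<in>N. R z w}" and v: "v \<in> ball w (d / 2)" for u v
  proof
    assume "R u v"
    obtain w' where w': "w' \<in> N" "R u w'" using u by blast
    obtain g where g: "g \<in> G2" "v = g *v w'" using orbit2[OF w'(2)] \<open>R u v\<close> by blast
    then have "dist (g *v w1) v < d / 2" using w' by (auto simp: N_def)
    then have "dist w (g *v w1) < d" using v dist_triangle[of w "g *v w1" v] by (simp add: dist_commute)
    with dle[OF g(1)] show False by simp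
  qed
  moreover have "w \<in> ball w (d / 2)" using d by simp
  ultimately show thesis by (intro that[of "{z. \<exists>w\<in>N. R z w}" "ball w (d / 2)"] open_ball)
qed

text \<open>At a point with trivial stabilizer all functions on a slice are invariant under the stabilizer,
  among them the coordinates, so that these can be transferred in both directions.\<close>

lemma ex_local_lift:
  assumes "R z w" "z \<in> regular_points G1" "w \<in> regular_points G2"
  obtains U V F \<Psi> where "open U" "open V" "z \<in> U" "w \<in> V" "U \<subseteq> regular_points G1" "V \<subseteq> regular_points G2"
    "vholo_on F U" "vholo_on \<Psi> V" "F ` U \<subseteq> V" "\<Psi> ` V \<subseteq> U" "\<And>u. u \<in> U \<Longrightarrow> \<Psi> (F u) = u" "\<And>v. v \<in> V \<Longrightarrow> F (\<Psi> v) = v"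
    "\<And>u. u \<in> U \<Longrightarrow> R u (F u)" "\<And>u v. u \<in> U \<Longrightarrow> v \<in> V \<Longrightarrow> R u v \<Longrightarrow> v = F u"
proof -
  interpret S: correspondence G2 G1 "\<lambda>w z. R z w" e2 e1 by (rule swap)
  obtain B1 where B1: "slice G1 z B1" using A.ex_slice[of UNIV z] by auto
  obtain B2 where B2: "slice G2 w B2" using B.ex_slice[of UNIV w] by auto
  have st: "stab G1 z = {mat 1}" "stab G2 w = {mat 1}"
    using assms by (auto simp: A.regular_iff_stab B.regular_iff_stab)
  have id: "vholo_on (\<lambda>v. v) S" for S by (simp add: vholo_on_def holo_on_nth)
  define O1 where "O1 = {z. \<exists>w\<in>B2. R z w}"
  define O2 where "O2 = {w. \<exists>z\<in>B1. R z w}"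
  obtain F where F: "vholo_on F O1" "\<And>z w. w \<in> B2 \<Longrightarrow> R z w \<Longrightarrow> F z = w"
    unfolding O1_def by (rule transfer_vector[OF B2 id]) (use st in auto)
  obtain \<Psi> where \<Psi>: "vholo_on \<Psi> O2" "\<And>z w. z \<in> B1 \<Longrightarrow> R z w \<Longrightarrow> \<Psi> w = z"
    unfolding O2_def by (rule S.transfer_vector[OF B1 id]) (use st in auto)
  have open1: "open (O1 \<inter> B1)" unfolding O1_def using open_related B1 B2 by (auto simp: slice_def)
  have open2: "open (O2 \<inter> B2)" unfolding O2_def using S.open_related B1 B2 by (auto simp: slice_def)
  have zw: "z \<in> O1 \<inter> B1" "w \<in> O2 \<inter> B2" using B1 B2 assms(1) by (auto simp: O1_def O2_def slice_def)
  have u: "F u \<in> O2 \<inter> B2 \<and> R u (F u) \<and> \<Psi> (F u) = u" if "u \<in> O1 \<inter> B1" for u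
    using that F(2) \<Psi>(2) by (auto simp: O1_def O2_def)
  have v: "\<Psi> v \<in> O1 \<inter> B1 \<and> F (\<Psi> v) = v" if "v \<in> O2 \<inter> B2" for v
    using that F(2) \<Psi>(2) by (auto simp: O1_def O2_def)
  show thesis
  proof (rule that[of "O1 \<inter> B1" "O2 \<inter> B2" F \<Psi>])
    show "O1 \<inter> B1 \<subseteq> regular_points G1" "O2 \<inter> B2 \<subseteq> regular_points G2"
      using A.slice_regular[OF B1 assms(2)] B.slice_regular[OF B2 assms(3)] by auto
    show "vholo_on F (O1 \<inter> B1)" "vholo_on \<Psi> (O2 \<inter> B2)"
      using F(1) \<Psi>(1) by (auto intro: vholo_on_subset)
  qed (use open1 open2 zw u v F(2) in auto)
qed

definition is_lift :: "(complex^'n) set \<Rightarrow> (complex^'n \<Rightarrow> complex^'m) \<Rightarrow> bool" where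
  "is_lift U F \<longleftrightarrow> open U \<and> vholo_on F U \<and> (\<forall>u\<in>U. R u (F u))"

lemma is_lift_subset: "is_lift U F \<Longrightarrow> open W \<Longrightarrow> W \<subseteq> U \<Longrightarrow> is_lift W F"
  by (auto simp: is_lift_def intro: vholo_on_subset)

lemma is_lift_matrix: "is_lift U F \<Longrightarrow> g \<in> G2 \<Longrightarrow> is_lift U (\<lambda>u. g *v F u)"
  unfolding is_lift_def using act2 vholo_on_compose[OF vholo_on_matrix[of g UNIV]] by blast

lemma dif_matrix_comp:
  assumes "vholo_on F U" "u \<in> U"
  shows "dif (\<lambda>u. (g :: complex^'m^'k) *v F u) u x = g *v dif F u x"
  using vdif_compose[OF vholo_on_matrix[of g UNIV] assms(1) _ assms(2)] by (simp add: dif_matrix)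

text \<open>Over regular points two lifts differ by an element of the second group.\<close>

lemma lift_unique:
  assumes "is_lift U F" "is_lift U' F'" "z \<in> U" "z \<in> U'" "F z \<in> regular_points G2"
  obtains g N where "g \<in> G2" "open N" "z \<in> N" "N \<subseteq> U \<inter> U'" "\<And>u. u \<in> N \<Longrightarrow> F' u = g *v F u"
proof -
  have "R z (F z)" "R z (F' z)" using assms by (auto simp: is_lift_def)
  then obtain g where g: "g \<in> G2" "F' z = g *v F z" using orbit2 by blast
  have F'': "is_lift U' (\<lambda>u. matrix_inv g *v F' u)" by (rule is_lift_matrix[OF assms(2) B.inv_mem[OF g(1)]])
  obtain B2 where B2: "slice G2 (F z) B2" using B.ex_slice[of UNIV "F z"] by auto
  have st: "stab G2 (F z) = {mat 1}" using assms by (auto simp: B.regular_iff_stab)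
  define N where "N = (U \<inter> F -` B2) \<inter> (U' \<inter> (\<lambda>u. matrix_inv g *v F' u) -` B2)"
  have "open N"
    unfolding N_def using assms(1) F'' B2 vholo_on_continuous
    by (intro open_Int continuous_open_preimage) (auto simp: is_lift_def slice_def)
  moreover have "z \<in> N" using assms B2 g by (auto simp: N_def slice_def B.inv_apply)
  moreover have "F' u = g *v F u" if u: "u \<in> N" for u
  proof -
    have "R u (F u)" "R u (matrix_inv g *v F' u)" using u assms(1) F'' by (auto simp: N_def is_lift_def)
    then obtain k where k: "k \<in> G2" "matrix_inv g *v F' u = k *v F u" using orbit2 by blast
    then have "k \<in> stab G2 (F z)" using B2 u unfolding slice_def N_def
      by (metis IntD1 IntD2 vimage_eq)
    then have "k = mat 1" using st by simp
    then have "g *v (matrix_inv g *v F' u) = g *v F u" using k(2) by simp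
    then show ?thesis using B.inv_apply(2)[OF g(1)] by simp
  qed
  moreover have "N \<subseteq> U \<inter> U'" by (auto simp: N_def)
  ultimately show thesis by (intro that[OF g(1), of N])
qed

text \<open>By uniqueness a lift coincides near the point with a lift that has a holomorphic inverse.\<close>

lemma lift_inverse:
  assumes "is_lift U F" "z \<in> U" "z \<in> regular_points G1" "F z \<in> regular_points G2"
  obtains N V \<Psi> where "open N" "z \<in> N" "N \<subseteq> U" "N \<subseteq> regular_points G1" "open V" "F ` N \<subseteq> V" "vholo_on \<Psi> V"
    "\<And>u x. u \<in> N \<Longrightarrow> dif \<Psi> (F u) (dif F u x) = x" "\<And>u y. u \<in> N \<Longrightarrow> dif F u (dif \<Psi> (F u) y) = y"
proof -
  have Rz: "R z (F z)" and U: "open U" "vholo_on F U" using assms by (auto simp: is_lift_def)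
  obtain U0 V F0 \<Psi> where L: "open U0" "open V" "z \<in> U0" "F z \<in> V" "U0 \<subseteq> regular_points G1" "V \<subseteq> regular_points G2"
    "vholo_on F0 U0" "vholo_on \<Psi> V" "F0 ` U0 \<subseteq> V" "\<Psi> ` V \<subseteq> U0" "\<And>u. u \<in> U0 \<Longrightarrow> \<Psi> (F0 u) = u" "\<And>v. v \<in> V \<Longrightarrow> F0 (\<Psi> v) = v"
    "\<And>u. u \<in> U0 \<Longrightarrow> R u (F0 u)" "\<And>u v. u \<in> U0 \<Longrightarrow> v \<in> V \<Longrightarrow> R u v \<Longrightarrow> v = F0 u"
    by (rule ex_local_lift[OF Rz assms(3,4)]) (rule that; (assumption | blast))
  define N where "N = (U \<inter> F -` V) \<inter> U0"
  have N: "open N" unfolding N_def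
    by (intro open_Int continuous_open_preimage vholo_on_continuous U L)
  have eq: "F u = F0 u" if "u \<in> N" for u
    using that L(14)[of u "F u"] assms(1) by (auto simp: N_def is_lift_def)
  have d: "dif F u = dif F0 u" if "u \<in> N" for u by (rule dif_cong_open[OF N that eq])
  have id: "dif (\<lambda>x. x) u y = y" for u :: "'x::real_normed_vector" and y by (simp add: frechet_derivative_ident)
  show thesis
  proof (rule that[of N V \<Psi>])
    fix u assume u: "u \<in> N"
    have u0: "u \<in> U0" "F u \<in> V" using u by (auto simp: N_def)
    have "dif (\<lambda>u. \<Psi> (F0 u)) u x = dif (\<lambda>u. u) u x" for x
      by (rule fun_cong[OF dif_cong_open[OF L(1) u0(1)]]) (use L in auto)
    then show "dif \<Psi> (F u) (dif F u x) = x" for x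
      using vdif_compose[OF L(8,7,9) u0(1)] by (simp add: id d[OF u] eq[OF u])
    have "dif (\<lambda>v. F0 (\<Psi> v)) (F u) y = dif (\<lambda>v. v) (F u) y" for y
      by (rule fun_cong[OF dif_cong_open[OF L(2) u0(2)]]) (use L in auto)
    moreover have "\<Psi> (F u) = u" using L(11)[OF u0(1)] eq[OF u] by simp
    ultimately show "dif F u (dif \<Psi> (F u) y) = y" for y
      using vdif_compose[OF L(7,8,10) u0(2)] by (simp add: id d[OF u])
  qed (use N assms L in \<open>auto simp: N_def\<close>)
qed

lemma lift_bij:
  assumes "is_lift U F" "z \<in> U" "z \<in> regular_points G1" "F z \<in> regular_points G2"
  shows "bij (dif F z)"
proof -
  obtain N V \<Psi> where L: "z \<in> N" "\<And>u x. u \<in> N \<Longrightarrow> dif \<Psi> (F u) (dif F u x) = x" "\<And>u y. u \<in> N \<Longrightarrow> dif F u (dif \<Psi> (F u) y) = y"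
    by (rule lift_inverse[OF assms]) blast
  show ?thesis by (rule o_bij[of "dif \<Psi> (F z)"]) (use L in auto)
qed

text \<open>Off the discriminant the singular points form a set of codimension at least two, over which
  the inverse of the derivative of a lift remains bounded.\<close>

lemma lift_inj:
  assumes F: "is_lift U F" and z: "z \<in> U" and U: "U \<subseteq> - discriminant_locus G1"
    and reg: "\<And>u. u \<in> U \<Longrightarrow> u \<in> regular_points G1 \<Longrightarrow> F u \<in> regular_points G2"
  shows "inj (dif F z)"
proof -
  have Uo: "open U" "vholo_on F U" using F by (auto simp: is_lift_def)
  define \<Phi> where "\<Phi> y i u = inv (dif F u) y $ i" for y i u
  have hol: "holo_on (\<Phi> y i) (U - \<Union>(fixed_subspaces G1))" for y i
  proof (rule holo_on_local)
    fix u assume "u \<in> U - \<Union>(fixed_subspaces G1)"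
    then have u: "u \<in> U" "u \<in> regular_points G1" by (auto simp: A.regular_eq)
    obtain N V \<Psi> where L: "open N" "u \<in> N" "N \<subseteq> U" "N \<subseteq> regular_points G1" "open V" "F ` N \<subseteq> V" "vholo_on \<Psi> V"
      "\<And>u x. u \<in> N \<Longrightarrow> dif \<Psi> (F u) (dif F u x) = x" "\<And>u y. u \<in> N \<Longrightarrow> dif F u (dif \<Psi> (F u) y) = y"
      by (rule lift_inverse[OF F u reg[OF u]]) (rule that; (assumption | blast))
    have "holo_on (\<lambda>v. dif (\<lambda>v. \<Psi> v $ i) v y) V"
      by (rule holo_on_dif[OF L(5)]) (use L(7) in \<open>simp add: vholo_on_def\<close>)
    then have "holo_on (\<lambda>u. dif (\<lambda>v. \<Psi> v $ i) (F u) y) N"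
      by (rule holo_on_compose[OF _ vholo_on_subset[OF Uo(2) L(3)] L(6)])
    moreover have "dif (\<lambda>v. \<Psi> v $ i) (F u) y = \<Phi> y i u" if "u \<in> N" for u
    proof -
      have "inj (dif F u)" using L(8)[OF that] by (metis injI)
      then have "inv (dif F u) y = dif \<Psi> (F u) y" using L(9)[OF that] by (metis inv_f_f)
      moreover have "F u \<in> V" using L(6) that by auto
      ultimately show ?thesis using dif_nth[OF L(7)] by (simp add: \<Phi>_def)
    qed
    ultimately have "holo_on (\<Phi> y i) N" by (rule holo_on_cong[OF L(1), rotated])
    then show "\<exists>W. u \<in> W \<and> holo_on (\<Phi> y i) W" using L(2) by blast
  qed
  \<comment> \<open>The open set contains no point of a fixed hyperplane, so that the hypothesis on hyperplanes in
    the boundedness principle is void.\<close>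
  have "\<exists>e>0. \<exists>M. ball z e \<subseteq> U \<and> (\<forall>u\<in>ball z e - \<Union>(fixed_subspaces G1). cmod (\<Phi> y i u) \<le> M)" for y i
  proof (rule bounded_near_subspaces[OF A.finite_fixed_subspaces A.fixed_subspaces_proper Uo(1) z hol])
    fix H W assume "H \<in> fixed_subspaces G1" "linear_hyperplane H" "W \<inter> H \<noteq> {}" "W \<subseteq> U"
    then have "H \<in> reflection_hyperplanes G1" using A.fixed_subspaces_hyperplane_iff by blast
    then have "H \<subseteq> discriminant_locus G1" by (auto simp: discriminant_locus_def)
    then show "\<exists>x\<in>W \<inter> H. \<exists>e>0. \<exists>B. \<forall>u\<in>ball x e - \<Union>(fixed_subspaces G1). cmod (\<Phi> y i u) \<le> B"
      using \<open>W \<inter> H \<noteq> {}\<close> \<open>W \<subseteq> U\<close> U by blast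
  qed
  then obtain e M where e: "\<And>y i. e y i > 0" "\<And>y i u. u \<in> ball z (e y i) \<Longrightarrow> u \<notin> \<Union>(fixed_subspaces G1) \<Longrightarrow> cmod (\<Phi> y i u) \<le> M y i"
    by (metis Diff_iff)
  have le0: "x = 0" if x: "dif F z x = 0" for x
  proof -
    have key: "cmod (x $ i) \<le> 0" for i
    proof -
      define C where "C = (\<Sum>j\<in>UNIV. \<bar>M (axis j 1) i\<bar>)"
      \<comment> \<open>Nonpositive at regular points, where the inverse derivative is bounded by \<open>C\<close>, and by density
        and continuity at the given point.\<close>
      define q where "q u = cmod (x $ i) - C * norm (dif F u x)" for u
      define \<epsilon> where "\<epsilon> = Min (range (\<lambda>j. e (axis j 1) i))"
      have \<epsilon>: "\<epsilon> > 0" using e(1) by (simp add: \<epsilon>_def)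
      have qle: "q u \<le> 0" if u: "u \<in> ball z \<epsilon> \<inter> U" "u \<in> regular_points G1" for u
      proof -
        have bij: "bij (dif F u)" by (rule lift_bij[OF F _ u(2) reg]) (use u in auto)
        have lin: "inv (dif F u) (\<Sum>j\<in>S. c j *s v j) = (\<Sum>j\<in>S. c j *s inv (dif F u) (v j))" if "finite S" for S c v
        proof -
          have "dif F u (\<Sum>j\<in>S. c j *s inv (dif F u) (v j)) = (\<Sum>j\<in>S. c j *s v j)"
          proof -
            have uU: "u \<in> U" using u by simp
            have "linear (dif F u)"
              using vholo_on_has_derivative[OF Uo(2) uU] has_derivative_linear by blast
            then have "dif F u (\<Sum>j\<in>S. c j *s inv (dif F u) (v j)) = (\<Sum>j\<in>S. dif F u (c j *s inv (dif F u) (v j)))"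
              by (rule linear_sum)
            also have "\<dots> = (\<Sum>j\<in>S. c j *s v j)"
              by (intro sum.cong refl) (simp only: vdif_scale[OF Uo(2) uU] surj_f_inv_f[OF bij_is_surj[OF bij]])
            finally show ?thesis .
          qed
          then show ?thesis
            using inv_f_f[OF bij_is_inj[OF bij], of "\<Sum>j\<in>S. c j *s inv (dif F u) (v j)"] by simp
        qed
        have "x = inv (dif F u) (dif F u x)" using bij by (simp add: bij_is_inj)
        also have "\<dots> = inv (dif F u) (\<Sum>j\<in>UNIV. dif F u x $ j *s axis j 1)" by (simp only: basis_expansion)
        also have "\<dots> = (\<Sum>j\<in>UNIV. dif F u x $ j *s inv (dif F u) (axis j 1))" by (rule lin) simp
        finally have "x = (\<Sum>j\<in>UNIV. dif F u x $ j *s inv (dif F u) (axis j 1))" .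
        then have "x $ i = (\<Sum>j\<in>UNIV. dif F u x $ j * \<Phi> (axis j 1) i u)"
          unfolding \<Phi>_def by (drule_tac arg_cong[where f = "\<lambda>v. v $ i"]) (simp only: sum_component vector_smult_component)
        also have "cmod \<dots> \<le> (\<Sum>j\<in>UNIV. norm (dif F u x) * \<bar>M (axis j 1) i\<bar>)"
        proof (rule sum_norm_le)
          fix j :: 'm
          have "u \<in> ball z (e (axis j 1) i)" using u(1) by (auto simp: \<epsilon>_def)
          then have "cmod (\<Phi> (axis j 1) i u) \<le> M (axis j 1) i"
            using e(2)[of u "axis j 1" i] u(2) by (simp add: A.regular_eq)
          then have "cmod (\<Phi> (axis j 1) i u) \<le> \<bar>M (axis j 1) i\<bar>" by linarith
          then show "cmod (dif F u x $ j * \<Phi> (axis j 1) i u) \<le> norm (dif F u x) * \<bar>M (axis j 1) i\<bar>"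
            unfolding norm_mult by (intro mult_mono Finite_Cartesian_Product.norm_nth_le) auto
        qed
        also have "\<dots> = C * norm (dif F u x)" by (simp add: C_def sum_distrib_left mult.commute)
        finally show ?thesis by (simp add: q_def)
      qed
      have hx: "holo_on (\<lambda>u. dif F u x $ j) U" for j
      proof -
        have "holo_on (\<lambda>u. dif (\<lambda>z. F z $ j) u x) U"
          by (rule holo_on_dif[OF Uo(1)]) (use Uo(2) in \<open>simp add: vholo_on_def\<close>)
        then show ?thesis by (rule holo_on_cong[OF Uo(1), rotated]) (simp add: dif_nth[OF Uo(2)])
      qed
      then have "continuous_on U (\<lambda>u. dif F u x)" by (intro vholo_on_continuous) (simp add: vholo_on_def)
      then have qc: "continuous_on U q" unfolding q_def by (intro continuous_intros)
      have "q z \<le> 0"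
      proof (rule ccontr)
        assume "\<not> q z \<le> 0"
        then have "z \<in> (U \<inter> q -` {0<..}) \<inter> ball z \<epsilon>" using z \<epsilon> by simp
        moreover have "open ((U \<inter> q -` {0<..}) \<inter> ball z \<epsilon>)"
          by (intro open_Int continuous_open_preimage qc Uo(1)) auto
        ultimately obtain u where "u \<in> (U \<inter> q -` {0<..}) \<inter> ball z \<epsilon>" "u \<in> regular_points G1"
          using A.regular_dense by blast
        with qle[of u] show False by auto
      qed
      then show ?thesis by (simp add: q_def x)
    qed
    then show ?thesis by (simp add: vec_eq_iff)
  qed
  show ?thesis
  proof (rule injI)
    fix x y assume "dif F z x = dif F z y"
    then have "dif F z (x - y) = 0" by (simp add: vdif_diff[OF Uo(2) z])
    then show "x = y" using le0[of "x - y"] by simp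
  qed
qed

end

context correspondence
begin

text \<open>Near the second point the inverse correspondence is a function, which is invariant under the
  stabilizer of that point. As its derivative is injective, the stabilizer is trivial.\<close>

lemma regular_if_related:
  assumes "R z w" "z \<in> regular_points G1"
  shows "w \<in> regular_points G2"
proof -
  interpret S: correspondence G2 G1 "\<lambda>w z. R z w" e2 e1 by (rule swap)
  obtain B1 where B1: "slice G1 z B1" using A.ex_slice[of UNIV z] by auto
  have st: "stab G1 z = {mat 1}" using assms by (auto simp: A.regular_iff_stab)
  have id: "vholo_on (\<lambda>v. v) S" for S by (simp add: vholo_on_def holo_on_nth)
  define O2 where "O2 = {w. \<exists>z\<in>B1. R z w}"
  obtain \<Psi> where \<Psi>: "vholo_on \<Psi> O2" "\<And>z w. z \<in> B1 \<Longrightarrow> R z w \<Longrightarrow> \<Psi> w = z"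
    unfolding O2_def by (rule S.transfer_vector[OF B1 id]) (use st in auto)
  have O2: "open O2" unfolding O2_def using S.open_related B1 by (auto simp: slice_def)
  have \<Psi>B: "\<Psi> v \<in> B1 \<and> R (\<Psi> v) v" if "v \<in> O2" for v using that \<Psi>(2) by (auto simp: O2_def)
  have B1reg: "B1 \<subseteq> regular_points G1" using A.slice_regular[OF B1 assms(2)] by auto
  have lift: "S.is_lift O2 \<Psi>" using O2 \<Psi>(1) \<Psi>B by (simp add: S.is_lift_def)
  have w: "w \<in> O2" using assms B1 by (auto simp: O2_def slice_def)
  have "inj (dif \<Psi> w)"
  proof (rule S.lift_inj[OF lift w])
    show "O2 \<subseteq> - discriminant_locus G2"
      using discriminant_iff \<Psi>B B1reg A.regular_subset by blast
    show "\<Psi> v \<in> regular_points G1" if "v \<in> O2" for v using \<Psi>B[OF that] B1reg by blast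
  qed
  have "k = mat 1" if k: "k \<in> G2" "k *v w = w" for k
  proof -
    have inv: "k *v v \<in> O2 \<and> \<Psi> (k *v v) = \<Psi> v" if "v \<in> O2" for v
    proof -
      have "R (\<Psi> v) (k *v v)" "\<Psi> v \<in> B1" using \<Psi>B[OF that] act2 k(1) by auto
      then show ?thesis using \<Psi>(2) by (auto simp: O2_def)
    qed
    have "dif \<Psi> w (k *v x) = dif \<Psi> w x" for x
    proof -
      have "dif (\<lambda>v. \<Psi> (k *v v)) w x = dif \<Psi> w x"
        by (rule fun_cong[OF dif_cong_open[OF O2 w]]) (use inv in auto)
      moreover have "dif (\<lambda>v. \<Psi> (k *v v)) w x = dif \<Psi> (k *v w) (dif (\<lambda>v. k *v v) w x)"
        by (rule vdif_compose[OF \<Psi>(1) vholo_on_matrix _ w]) (use inv in auto)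
      ultimately show ?thesis by (simp add: dif_matrix k(2))
    qed
    then have "k *v x = x" for x using \<open>inj (dif \<Psi> w)\<close> by (meson injD)
    then show ?thesis by (simp add: matrix_eq)
  qed
  then show ?thesis by (auto simp: regular_points_def)
qed

lemma regular_iff:
  assumes "R z w"
  shows "z \<in> regular_points G1 \<longleftrightarrow> w \<in> regular_points G2"
proof -
  interpret S: correspondence G2 G1 "\<lambda>w z. R z w" e2 e1 by (rule swap)
  show ?thesis using regular_if_related S.regular_if_related assms by blast
qed

lemma lift_regular: "is_lift U F \<Longrightarrow> u \<in> U \<Longrightarrow> F u \<in> regular_points G2 \<longleftrightarrow> u \<in> regular_points G1"
  using regular_iff by (auto simp: is_lift_def)

lemma ex_lift:
  assumes "R z w" "z \<in> regular_points G1"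
  obtains U F where "is_lift U F" "z \<in> U" "F z = w" "U \<subseteq> regular_points G1"
proof -
  obtain U V F \<Psi> where "open U" "z \<in> U" "w \<in> V" "U \<subseteq> regular_points G1" "vholo_on F U"
    "\<And>u. u \<in> U \<Longrightarrow> R u (F u)" "\<And>u v. u \<in> U \<Longrightarrow> v \<in> V \<Longrightarrow> R u v \<Longrightarrow> v = F u"
    by (rule ex_local_lift[OF assms regular_if_related[OF assms]]) (rule that; (assumption | blast))
  then show thesis using that[of U F] assms by (simp add: is_lift_def)
qed

end

section \<open>The pulled back connection on regular points\<close>

lemma
  assumes "open U" "vholo_on F U"
  shows vholo_on_dif: "vholo_on (\<lambda>u. dif F u y) U"
    and dif_dif_nth: "z \<in> U \<Longrightarrow> dif (\<lambda>u. dif F u y) z x $ i = dif (\<lambda>u. dif (\<lambda>v. F v $ i) u y) z x"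
    and vdif_commute: "z \<in> U \<Longrightarrow> dif (\<lambda>u. dif F u y) z x = dif (\<lambda>u. dif F u x) z y"
proof -
  have h: "holo_on (\<lambda>u. F u $ i) U" for i using assms(2) by (simp add: vholo_on_def)
  have eq: "dif (\<lambda>v. F v $ i) u y = dif F u y $ i" if "u \<in> U" for u i y
    using dif_nth[OF assms(2) that] by simp
  show v: "vholo_on (\<lambda>u. dif F u y) U" for y
    unfolding vholo_on_def
  proof
    fix i show "holo_on (\<lambda>u. dif F u y $ i) U"
      by (rule holo_on_cong[OF assms(1) eq holo_on_dif[OF assms(1) h]])
  qed
  have n: "dif (\<lambda>u. dif F u y) z x $ i = dif (\<lambda>u. dif (\<lambda>v. F v $ i) u y) z x" if z: "z \<in> U" for z x y i
    unfolding dif_nth[OF v z]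
    by (rule fun_cong[OF dif_cong_open[OF assms(1) z]]) (simp add: eq)
  then show "z \<in> U \<Longrightarrow> dif (\<lambda>u. dif F u y) z x $ i = dif (\<lambda>u. dif (\<lambda>v. F v $ i) u y) z x" .
  show "z \<in> U \<Longrightarrow> dif (\<lambda>u. dif F u y) z x = dif (\<lambda>u. dif F u x) z y"
    by (simp add: vec_eq_iff n dif_dif_commute[OF assms(1) h])
qed

lemma dif_apply_expand:
  assumes "holo_on h U" "u \<in> U"
  shows "dif h u v = (\<Sum>j\<in>UNIV. v $ j * dif h u (axis j 1))"
  by (rule clinear_expand[OF holo_on_D(2)[OF assms]])

text \<open>The product rule for the derivative of a function, evaluated at a varying vector.\<close>

lemma
  assumes "open U" "holo_on h U" "vholo_on v U"
  shows holo_on_dif_apply: "holo_on (\<lambda>u. dif h u (v u)) U"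
    and dif_dif_apply: "z \<in> U \<Longrightarrow> dif (\<lambda>u. dif h u (v u)) z x = dif (\<lambda>u. dif h u (v z)) z x + dif h z (dif v z x)"
proof -
  note hd = holo_on_dif[OF assms(1,2)]
  have vn: "holo_on (\<lambda>u. v u $ j) U" for j using assms(3) by (simp add: vholo_on_def)
  have m: "holo_on (\<lambda>u. v u $ j * dif h u (axis j 1)) U" for j by (intro holo_on_mult vn hd)
  have eq: "(\<Sum>j\<in>UNIV. v u $ j * dif h u (axis j 1)) = dif h u (v u)" if "u \<in> U" for u
    by (rule dif_apply_expand[OF assms(2) that, symmetric])
  show "holo_on (\<lambda>u. dif h u (v u)) U"
    by (rule holo_on_cong[OF assms(1) eq holo_on_sum[OF m]])
  assume z: "z \<in> U"
  have "dif (\<lambda>u. dif h u (v u)) z x = dif (\<lambda>u. \<Sum>j\<in>UNIV. v u $ j * dif h u (axis j 1)) z x"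
    by (rule fun_cong[OF dif_cong_open[OF assms(1) z]]) (simp add: eq)
  also have "\<dots> = (\<Sum>j\<in>UNIV. v z $ j * dif (\<lambda>u. dif h u (axis j 1)) z x + dif v z x $ j * dif h z (axis j 1))"
    by (subst dif_sum[OF m z]) (simp add: dif_mult[OF vn hd z] dif_nth[OF assms(3) z])
  also have "\<dots> = (\<Sum>j\<in>UNIV. v z $ j * dif (\<lambda>u. dif h u (axis j 1)) z x) + dif h z (dif v z x)"
    by (simp only: sum.distrib dif_apply_expand[OF assms(2) z, of "dif v z x", symmetric])
  also have "(\<Sum>j\<in>UNIV. v z $ j * dif (\<lambda>u. dif h u (axis j 1)) z x) = dif (\<lambda>u. dif h u (v z)) z x"
  proof -
    have "dif (\<lambda>u. dif h u (v z)) z x = dif (\<lambda>u. \<Sum>j\<in>UNIV. v z $ j * dif h u (axis j 1)) z x"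
      by (rule fun_cong[OF dif_cong_open[OF assms(1) z]]) (rule dif_apply_expand[OF assms(2)])
    also have "\<dots> = (\<Sum>j\<in>UNIV. v z $ j * dif (\<lambda>u. dif h u (axis j 1)) z x)"
      by (subst dif_sum[OF holo_on_mult[OF holo_on_const hd] z])
         (simp add: dif_mult[OF holo_on_const hd z] dif_linear)
    finally show ?thesis by simp
  qed
  finally show "dif (\<lambda>u. dif h u (v u)) z x = dif (\<lambda>u. dif h u (v z)) z x + dif h z (dif v z x)" .
qed

lemma mat_mult_vec: "mat c *v x = c *s (x :: complex^'n)"
proof -
  have "mat c $ i $ j * x $ j = (if i = j then c * x $ j else 0)" for i j by (simp add: mat_def)
  then show ?thesis by (simp add: vec_eq_iff matrix_vector_mult_def)
qed

lemma complex_root_exists: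
  assumes "c \<noteq> 0" "n > 0"
  shows "\<exists>t::complex. t \<noteq> 0 \<and> t ^ n = c"
proof -
  have "exp (Ln c / of_nat n) ^ n = exp (of_nat n * (Ln c / of_nat n))" by (rule exp_of_nat_mult[symmetric])
  also have "\<dots> = c" using assms by simp
  finally show ?thesis by (intro exI[of _ "exp (Ln c / of_nat n)"]) simp
qed

lemma (in finite_matrix_group) regular_act: "g \<in> G \<Longrightarrow> z \<in> regular_points G \<Longrightarrow> g *v z \<in> regular_points G"
proof -
  assume g: "g \<in> G" and z: "z \<in> regular_points G"
  have "k = mat 1" if k: "k \<in> G" "k *v (g *v z) = g *v z" for k
  proof -
    have "(matrix_inv g ** k ** g) *v z = z"
      using k g by (simp add: matrix_vector_mul_assoc[symmetric] inv_apply)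
    then have "matrix_inv g ** k ** g = mat 1"
      using z k g mult_mem inv_mem by (auto simp: regular_points_def)
    then have "g *v ((matrix_inv g ** k ** g) *v (matrix_inv g *v x)) = x" for x
      using g by (simp add: inv_apply)
    then have "k *v x = x" for x using g by (simp add: matrix_vector_mul_assoc[symmetric] inv_apply)
    then show ?thesis by (simp add: matrix_eq)
  qed
  then show ?thesis by (auto simp: regular_points_def)
qed

lemma regular_scale: "c \<noteq> 0 \<Longrightarrow> z \<in> regular_points G \<Longrightarrow> c *s z \<in> regular_points (G :: (complex^'n^'n) set)"
  by (auto simp: regular_points_def vector_scalar_commute vec.scale_cancel_left)

context correspondence
begin

definition lift_connection :: "complex^'n \<Rightarrow> complex^'n \<Rightarrow> complex^'n \<Rightarrow> complex^'n" where
  "lift_connection z x y = (let F = (SOME F. \<exists>U. is_lift U F \<and> z \<in> U) in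
     inv (dif F z) (dif (\<lambda>u. dif F u y) z x))"

text \<open>The defining equation is unchanged when the lift is composed with a linear map. As two lifts
  differ by an element of the second group, it holds for every lift.\<close>

lemma lift_connection:
  assumes F: "is_lift U F" and z: "z \<in> U" "z \<in> regular_points G1"
  shows "dif F z (lift_connection z x y) = dif (\<lambda>u. dif F u y) z x"
proof -
  define F0 where "F0 = (SOME F. \<exists>U. is_lift U F \<and> z \<in> U)"
  have "\<exists>U. is_lift U F0 \<and> z \<in> U" unfolding F0_def by (rule someI[of _ F]) (use F z in blast)
  then obtain U0 where F0: "is_lift U0 F0" "z \<in> U0" by blast
  have r0: "F0 z \<in> regular_points G2" using lift_regular[OF F0] z by simp
  obtain g N where gN: "g \<in> G2" "open N" "z \<in> N" "N \<subseteq> U0 \<inter> U" "\<And>u. u \<in> N \<Longrightarrow> F u = g *v F0 u"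
    by (rule lift_unique[OF F0(1) F F0(2) z(1) r0]) (rule that; (assumption | blast))
  have N0: "vholo_on F0 N" using F0(1) gN(4) by (auto simp: is_lift_def intro: vholo_on_subset)
  have d1: "dif F u y = g *v dif F0 u y" if "u \<in> N" for u y
  proof -
    have "dif F u y = dif (\<lambda>u. g *v F0 u) u y"
      by (rule fun_cong[OF dif_cong_open[OF gN(2) that gN(5)]])
    then show ?thesis by (simp add: dif_matrix_comp[OF N0 that])
  qed
  have d2: "dif (\<lambda>u. dif F u y) z x = g *v dif (\<lambda>u. dif F0 u y) z x"
  proof -
    have "dif (\<lambda>u. dif F u y) z x = dif (\<lambda>u. g *v dif F0 u y) z x"
      by (rule fun_cong[OF dif_cong_open[OF gN(2,3) d1]])
    then show ?thesis by (simp add: dif_matrix_comp[OF vholo_on_dif[OF gN(2) N0] gN(3)])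
  qed
  have "bij (dif F0 z)" by (rule lift_bij[OF F0 z(2) r0])
  then have "dif F0 z (lift_connection z x y) = dif (\<lambda>u. dif F0 u y) z x"
    by (simp add: lift_connection_def F0_def[symmetric] Let_def bij_is_surj surj_f_inv_f)
  then show ?thesis by (simp add: d1[OF gN(3)] d2)
qed

lemma lift_connection_eqI:
  assumes F: "is_lift U F" and z: "z \<in> U" "z \<in> regular_points G1"
    and "dif F z v = dif (\<lambda>u. dif F u y) z x"
  shows "lift_connection z x y = v"
proof -
  have "inj (dif F z)" by (rule bij_is_inj[OF lift_bij[OF F z]]) (simp add: lift_regular[OF F z(1)] z(2))
  moreover have "dif F z (lift_connection z x y) = dif F z v" using lift_connection[OF F z] assms(4) by simp
  ultimately show ?thesis by (rule injD)
qed

lemma ex_lift_at: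
  assumes "z \<in> regular_points G1"
  obtains U F where "is_lift U F" "z \<in> U" "U \<subseteq> regular_points G1" "open U" "vholo_on F U"
proof -
  obtain w where "R z w" using total1 by blast
  from ex_lift[OF this assms] show thesis using that by (metis is_lift_def)
qed

lemma
  assumes z: "z \<in> regular_points G1"
  shows lift_connection_sym: "lift_connection z x y = lift_connection z y x"
    and lift_connection_scale: "lift_connection z x (c *s y) = c *s lift_connection z x y"
proof -
  obtain U F where F: "is_lift U F" "z \<in> U" "open U" "vholo_on F U" using ex_lift_at[OF z] by metis
  note eqI = lift_connection_eqI[OF F(1,2) z] and eq = lift_connection[OF F(1,2) z]
  show sym: "lift_connection z x y = lift_connection z y x" for x y
    by (rule eqI) (simp add: eq vdif_commute[OF F(3,4,2)])
  note v = vholo_on_dif[OF F(3,4)]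
  have "lift_connection z (c *s x) y = c *s lift_connection z x y" for x y
    by (rule eqI) (simp add: eq vdif_scale[OF F(4,2)] vdif_scale[OF v F(2)])
  then show "lift_connection z x (c *s y) = c *s lift_connection z x y" by (metis sym)
qed

lemma vholo_on_lift_connection: "vholo_on (\<lambda>z. lift_connection z x y) (regular_points G1)"
  unfolding vholo_on_def
proof (intro allI holo_on_local)
  fix i z assume z: "z \<in> regular_points G1"
  obtain U F where F: "is_lift U F" "z \<in> U" "open U" "vholo_on F U" using ex_lift_at[OF z] by metis
  have r: "F z \<in> regular_points G2" using lift_regular[OF F(1,2)] z by simp
  obtain N V \<Psi> where L: "open N" "z \<in> N" "N \<subseteq> U" "N \<subseteq> regular_points G1" "open V" "F ` N \<subseteq> V" "vholo_on \<Psi> V"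
    "\<And>u x. u \<in> N \<Longrightarrow> dif \<Psi> (F u) (dif F u x) = x"
    by (rule lift_inverse[OF F(1,2) z r]) (rule that; (assumption | blast))
  have FN: "vholo_on F N" by (rule vholo_on_subset[OF F(4) L(3)])
  have \<Psi>i: "holo_on (\<lambda>v. \<Psi> v $ i) V" using L(7) by (simp add: vholo_on_def)
  have h: "holo_on (\<lambda>u. \<Sum>j\<in>UNIV. dif (\<lambda>u. dif F u y) u x $ j * dif (\<lambda>v. \<Psi> v $ i) (F u) (axis j 1)) N"
  proof (intro holo_on_sum holo_on_mult)
    fix j
    have "vholo_on (\<lambda>u. dif (\<lambda>u. dif F u y) u x) N"
      by (rule vholo_on_dif[OF L(1) vholo_on_dif[OF L(1) FN]])
    then show "holo_on (\<lambda>u. dif (\<lambda>u. dif F u y) u x $ j) N" by (simp add: vholo_on_def)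
    show "holo_on (\<lambda>u. dif (\<lambda>v. \<Psi> v $ i) (F u) (axis j 1)) N"
      by (rule holo_on_compose[OF holo_on_dif[OF L(5) \<Psi>i] FN L(6)])
  qed
  have eq: "(\<Sum>j\<in>UNIV. dif (\<lambda>u. dif F u y) u x $ j * dif (\<lambda>v. \<Psi> v $ i) (F u) (axis j 1)) = lift_connection u x y $ i"
    if u: "u \<in> N" for u
  proof -
    have ur: "u \<in> U" "u \<in> regular_points G1" "F u \<in> V" using u L by auto
    have "lift_connection u x y = dif \<Psi> (F u) (dif (\<lambda>u. dif F u y) u x)"
      using L(8)[OF u, of "lift_connection u x y"] lift_connection[OF F(1) ur(1,2)] by simp
    then show ?thesis
      by (simp only: dif_nth[OF L(7) ur(3)] dif_apply_expand[OF \<Psi>i ur(3), symmetric])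
  qed
  have "holo_on (\<lambda>u. lift_connection u x y $ i) N" by (rule holo_on_cong[OF L(1) eq h])
  then show "\<exists>W. z \<in> W \<and> holo_on (\<lambda>z. lift_connection z x y $ i) W" using L(2) by blast
qed

text \<open>Linear symmetries of the correspondence are symmetries of the connection.\<close>

lemma lift_connection_symmetry:
  fixes N N' :: "complex^'n^'n" and P :: "complex^'m^'m"
  assumes N: "\<And>x. N *v (N' *v x) = x" "\<And>x. N' *v (N *v x) = x"
    and P: "\<And>z w. R z w \<Longrightarrow> R (N *v z) (P *v w)"
    and z: "z \<in> regular_points G1" and Nz: "N *v z \<in> regular_points G1"
  shows "lift_connection (N *v z) (N *v x) (N *v y) = N *v lift_connection z x y"
proof -
  obtain U F where F: "is_lift U F" "z \<in> U" "open U" "vholo_on F U" using ex_lift_at[OF z] by metis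
  define W where "W = (\<lambda>v. N' *v v) -` U"
  define F' where "F' v = P *v F (N' *v v)" for v
  have W: "open W" unfolding W_def by (intro open_vimage F A.continuous_on_matrix)
  have im: "(\<lambda>v. N' *v v) ` W \<subseteq> U" by (auto simp: W_def)
  have NzW: "N *v z \<in> W" using F(2) N by (simp add: W_def)
  have Fc: "vholo_on (\<lambda>v. F (N' *v v)) W" by (rule vholo_on_compose[OF F(4) vholo_on_matrix im])
  have "R v (F' v)" if "v \<in> W" for v
    using P[of "N' *v v" "F (N' *v v)"] F(1) that N by (simp add: F'_def is_lift_def W_def)
  moreover have "vholo_on F' W"
    unfolding F'_def by (rule vholo_on_compose[OF vholo_on_matrix[of P UNIV] Fc]) auto
  ultimately have lift: "is_lift W F'" using W by (simp add: is_lift_def)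
  have d1: "dif F' v y = P *v dif F (N' *v v) (N' *v y)" if v: "v \<in> W" for v y
    unfolding F'_def dif_matrix_comp[OF Fc v] using vdif_compose[OF F(4) vholo_on_matrix im v] by (simp add: dif_matrix)
  note vd = vholo_on_dif[OF F(3,4)]
  have d2: "dif (\<lambda>v. dif F' v y) v x = P *v dif (\<lambda>u. dif F u (N' *v y)) (N' *v v) (N' *v x)" if v: "v \<in> W" for v x y
  proof -
    have "dif (\<lambda>v. dif F' v y) v x = dif (\<lambda>v. P *v dif F (N' *v v) (N' *v y)) v x"
      by (rule fun_cong[OF dif_cong_open[OF W v d1]])
    also have "\<dots> = P *v dif (\<lambda>v. dif F (N' *v v) (N' *v y)) v x"
      by (rule dif_matrix_comp[OF vholo_on_compose[OF vd vholo_on_matrix im] v])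
    finally show ?thesis using vdif_compose[OF vd vholo_on_matrix im v, of "N' *v y" x] by (simp add: dif_matrix)
  qed
  show ?thesis
    by (rule lift_connection_eqI[OF lift NzW Nz])
       (simp add: d1[OF NzW] d2[OF NzW] N lift_connection[OF F(1,2) z])
qed

lemma lift_connection_invariant:
  assumes "g \<in> G1" "z \<in> regular_points G1"
  shows "lift_connection (g *v z) (g *v x) (g *v y) = g *v lift_connection z x y"
  by (rule lift_connection_symmetry[where N' = "matrix_inv g" and P = "mat 1"])
     (use assms A.inv_apply act1 A.regular_act in auto)

text \<open>Every nonzero scalar is of the form \<open>t ^ e2\<close> and so acts as a symmetry of the correspondence. The
  two vector arguments account for two factors.\<close>

lemma lift_connection_homogeneous:
  assumes "c \<noteq> 0" "z \<in> regular_points G1"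
  shows "lift_connection (c *s z) x y = inverse c *s lift_connection z x y"
proof -
  obtain t where t: "t \<noteq> 0" "t ^ e2 = c" using complex_root_exists[OF assms(1) e_pos(2)] by blast
  have "lift_connection (mat c *v z) (mat c *v x) (mat c *v y) = mat c *v lift_connection z x y"
  proof (rule lift_connection_symmetry[where N' = "mat (inverse c)" and P = "mat (t ^ e1)"])
    show "mat c *v (mat (inverse c) *v x) = x" "mat (inverse c) *v (mat c *v x) = x" for x :: "complex^'n"
      using assms(1) by (simp_all add: mat_mult_vec vector_smult_assoc)
    show "R (mat c *v z) (mat (t ^ e1) *v w)" if "R z w" for z w
      using scaling[OF that t(1)] t(2) by (simp add: mat_mult_vec)
    show "z \<in> regular_points G1" by fact
    show "mat c *v z \<in> regular_points G1" using regular_scale[OF assms] by (simp add: mat_mult_vec)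
  qed
  then have *: "lift_connection (c *s z) (c *s x) (c *s y) = c *s lift_connection z x y" by (simp add: mat_mult_vec)
  have cz: "c *s z \<in> regular_points G1" by (rule regular_scale[OF assms])
  have "c *s (c *s lift_connection (c *s z) x y) = c *s lift_connection z x y"
    using * lift_connection_scale[OF cz] lift_connection_sym[OF cz] by metis
  then have "c *s lift_connection (c *s z) x y = lift_connection z x y \<or> c = 0"
    by (simp only: vec.scale_cancel_left)
  then have "c *s lift_connection (c *s z) x y = lift_connection z x y" using assms(1) by blast
  then have "inverse c *s (c *s lift_connection (c *s z) x y) = inverse c *s lift_connection z x y" by simp
  then show ?thesis using assms(1) by (simp add: vector_smult_assoc)
qed

text \<open>The derivative of a lift maps the two sides to the second derivatives, in the two orders, of
  its first derivative in the direction \<open>w\<close>.\<close>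

lemma lift_connection_flat:
  assumes z: "z \<in> regular_points G1"
  shows "dif (\<lambda>u. lift_connection u y w) z x + lift_connection z x (lift_connection z y w)
    = dif (\<lambda>u. lift_connection u x w) z y + lift_connection z y (lift_connection z x w)"
proof -
  obtain U F where F: "is_lift U F" "z \<in> U" "U \<subseteq> regular_points G1" "open U" "vholo_on F U"
    using ex_lift_at[OF z] by metis
  have Fi: "holo_on (\<lambda>u. F u $ i) U" for i using F(5) by (simp add: vholo_on_def)
  have c: "vholo_on (\<lambda>u. lift_connection u y w) U" for y w
    by (rule vholo_on_subset[OF vholo_on_lift_connection F(3)])
  have main: "dif F z (dif (\<lambda>u. lift_connection u y w) z x + lift_connection z x (lift_connection z y w)) $ i
      = dif (\<lambda>u. dif (\<lambda>u. dif (\<lambda>v. F v $ i) u w) u y) z x" for x y i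
  proof -
    have "dif F u (lift_connection u y w) $ i = dif (\<lambda>u. dif (\<lambda>v. F v $ i) u w) u y" if "u \<in> U" for u
      using lift_connection[OF F(1) that] F(3) that dif_dif_nth[OF F(4,5) that] by auto
    then have "dif (\<lambda>v. F v $ i) u (lift_connection u y w) = dif (\<lambda>u. dif (\<lambda>v. F v $ i) u w) u y" if "u \<in> U" for u
      using that dif_nth[OF F(5)] by simp
    then have "dif (\<lambda>u. dif (\<lambda>u. dif (\<lambda>v. F v $ i) u w) u y) z x
        = dif (\<lambda>u. dif (\<lambda>v. F v $ i) u (lift_connection u y w)) z x"
      by (intro fun_cong[OF dif_cong_open[OF F(4,2)]]) simp
    also have "\<dots> = dif (\<lambda>u. dif (\<lambda>v. F v $ i) u (lift_connection z y w)) z x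
        + dif (\<lambda>v. F v $ i) z (dif (\<lambda>u. lift_connection u y w) z x)"
      by (rule dif_dif_apply[OF F(4) Fi c F(2)])
    also have "dif (\<lambda>u. dif (\<lambda>v. F v $ i) u (lift_connection z y w)) z x
        = dif F z (lift_connection z x (lift_connection z y w)) $ i"
      using lift_connection[OF F(1,2) z] dif_dif_nth[OF F(4,5,2)] by simp
    finally show ?thesis by (simp add: vdif_add[OF F(5,2)] dif_nth[OF F(5,2)])
  qed
  have "dif F z (dif (\<lambda>u. lift_connection u y w) z x + lift_connection z x (lift_connection z y w))
      = dif F z (dif (\<lambda>u. lift_connection u x w) z y + lift_connection z y (lift_connection z x w))"
    by (simp add: vec_eq_iff main dif_dif_commute[OF F(4) holo_on_dif[OF F(4) Fi] F(2)])
  moreover have "inj (dif F z)"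
    by (rule bij_is_inj[OF lift_bij[OF F(1,2) z]]) (simp add: lift_regular[OF F(1,2)] z)
  ultimately show ?thesis by (intro injD[of "dif F z"])
qed

text \<open>By uniqueness of lifts, a lift maps \<open>t ^ e2\<close> times the point to \<open>t ^ e1\<close> times its image, for
  \<open>t\<close> near \<open>1\<close>. Differentiation at \<open>1\<close> gives Euler's identity.\<close>

lemma lift_euler:
  assumes F: "is_lift U F" and z: "z \<in> U" "z \<in> regular_points G1"
  shows "of_nat e2 *s dif F z z = of_nat e1 *s F z"
proof -
  have U: "open U" "vholo_on F U" using F by (auto simp: is_lift_def)
  have r: "F z \<in> regular_points G2" using lift_regular[OF F z(1)] z(2) by simp
  obtain B2 where B2: "slice G2 (F z) B2" using B.ex_slice[of UNIV "F z"] by auto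
  have st: "stab G2 (F z) = {mat 1}" using r by (simp add: B.regular_iff_stab)
  define a where "a s = s ^ e2 *s z" for s
  have ca: "continuous_on UNIV a" unfolding a_def by (intro continuous_on_vsmult continuous_intros)
  have cb: "continuous_on UNIV (\<lambda>s. s ^ e1 *s F z)" by (intro continuous_on_vsmult continuous_intros)
  define N where "N = (a -` U \<inter> (F \<circ> a) -` B2) \<inter> (\<lambda>s. s ^ e1 *s F z) -` B2 \<inter> - {0}"
  have N: "open N"
  proof -
    have "open (a -` U)" by (intro open_vimage U ca)
    moreover have "continuous_on (a -` U) (F \<circ> a)"
      by (rule continuous_on_compose[OF continuous_on_subset[OF ca subset_UNIV]])
         (auto intro: continuous_on_subset[OF vholo_on_continuous[OF U(2)]])
    moreover have B2o: "open B2" using B2 by (simp add: slice_def)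
    ultimately have "open (a -` U \<inter> (F \<circ> a) -` B2)" by (metis continuous_open_preimage)
    moreover have "open ((\<lambda>s. s ^ e1 *s F z) -` B2)" by (rule open_vimage[OF B2o cb])
    ultimately show ?thesis unfolding N_def by (simp add: open_Int open_Compl)
  qed
  have N1: "1 \<in> N" using z B2 by (simp add: N_def a_def slice_def)
  have eq: "F (a s) = s ^ e1 *s F z" if s: "s \<in> N" for s
  proof -
    have 1: "R (a s) (F (a s))" using F s by (simp add: N_def is_lift_def)
    have "R (a s) (s ^ e1 *s F z)" unfolding a_def
      by (rule scaling) (use F z s in \<open>auto simp: N_def is_lift_def\<close>)
    then obtain g where g: "g \<in> G2" "s ^ e1 *s F z = g *v F (a s)" using orbit2[OF 1] by blast
    have "F (a s) \<in> B2" "g *v F (a s) \<in> B2" using s g by (auto simp: N_def)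
    then have "g \<in> stab G2 (F z)" using B2 g(1) unfolding slice_def by blast
    then show ?thesis using st g(2) by simp
  qed
  have "of_nat e2 * dif F z z $ i = of_nat e1 * F z $ i" for i
  proof -
    have Fi: "holo_on (\<lambda>u. F u $ i) U" using U(2) by (simp add: vholo_on_def)
    have pow: "((\<lambda>s::complex. s ^ k) has_field_derivative of_nat k) (at 1)" for k
      by (auto intro!: derivative_eq_intros)
    have "((\<lambda>t. F (0 + t *s z) $ i) has_field_derivative dif (\<lambda>u. F u $ i) (0 + 1 *s z) z) (at 1)"
      by (rule holo_on_line[OF Fi]) (use z in simp)
    then have 1: "((\<lambda>t. F (t *s z) $ i) has_field_derivative dif F z z $ i) (at (1 ^ e2))"
      by (simp add: dif_nth[OF U(2) z(1)])
    have d1: "((\<lambda>s. F (a s) $ i) has_field_derivative dif F z z $ i * of_nat e2) (at 1)"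
      using DERIV_chain2[OF 1 pow] by (simp add: a_def)
    have d2: "((\<lambda>s. s ^ e1 * F z $ i) has_field_derivative of_nat e1 * F z $ i) (at 1)"
      by (rule DERIV_cmult_right[OF pow])
    have "((\<lambda>s. F (a s) $ i) has_field_derivative of_nat e1 * F z $ i) (at 1)"
      by (rule has_field_derivative_transform_within_open[OF d2 N N1]) (simp add: eq)
    from DERIV_unique[OF d1 this] show ?thesis by (simp add: mult.commute)
  qed
  then show ?thesis by (simp add: vec_eq_iff)
qed

end

section \<open>Local estimates along a hyperplane\<close>

lemma continuous_on_compact_bound:
  fixes f :: "'a::topological_space \<Rightarrow> 'b::real_normed_vector"
  assumes "compact K" "continuous_on K f"
  obtains B where "\<And>x. x \<in> K \<Longrightarrow> norm (f x) \<le> B"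
proof -
  have "bounded (f ` K)" using assms by (intro compact_imp_bounded compact_continuous_image)
  then show thesis using that unfolding bounded_iff by blast
qed

text \<open>The order of vanishing at the origin is a positive multiple of \<open>e\<close>, by comparison of the leading
  terms. So the quotient by \<open>t ^ e\<close> is bounded at the origin and the maximum principle applies.\<close>

lemma rotation_invariant_vanishing_order:
  fixes q :: "complex \<Rightarrow> complex" and e :: nat
  assumes r: "r > 0" and hol: "q holomorphic_on ball 0 (2 * r)" and M: "\<And>t. t \<in> ball 0 (2 * r) \<Longrightarrow> cmod (q t) \<le> M"
    and q0: "q 0 = 0" and e: "e \<ge> 1"
    and inv: "\<And>t. t \<in> ball 0 (2 * r) \<Longrightarrow> q (exp (2 * of_real pi * \<i> / of_nat e) * t) = q t"
    and t: "cmod t \<le> r"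
  shows "cmod (q t) \<le> M / r ^ e * cmod t ^ e"
proof (cases "q constant_on ball 0 (2 * r)")
  case True
  moreover have "t \<in> ball 0 (2 * r)" "0 \<in> ball 0 (2 * r)" using t r by auto
  ultimately have "q t = q 0" unfolding constant_on_def by metis
  moreover have "M \<ge> 0" using order_trans[OF norm_ge_zero M[of 0]] r by simp
  ultimately show ?thesis using q0 r by simp
next
  case False
  define \<omega> where "\<omega> = exp (2 * of_real pi * \<i> / of_nat e)"
  have b0: "connected (ball (0::complex) (2 * r))" "0 \<in> ball (0::complex) (2 * r)" using r by auto
  obtain g s n where n: "0 < n" "0 < s" "ball (0::complex) s \<subseteq> ball 0 (2 * r)" "g holomorphic_on ball 0 s"
    "\<And>w. w \<in> ball 0 s \<Longrightarrow> q w = (w - 0) ^ n * g w" "\<And>w. w \<in> ball 0 s \<Longrightarrow> g w \<noteq> 0"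
    by (rule holomorphic_factor_zero_nonconstant[OF hol open_ball b0 q0 False]) (rule that; assumption)
  have \<omega>1: "cmod \<omega> = 1" by (simp add: \<omega>_def norm_exp_eq_Re Re_divide_of_nat)
  have gc: "isCont g 0"
    using n(4) n(2) by (metis centre_in_ball continuous_on_interior holomorphic_on_imp_continuous_on interior_ball)
  have eq: "\<omega> ^ n * g (\<omega> * w) = g w" if "w \<in> ball 0 s" "w \<noteq> 0" for w
  proof -
    have "\<omega> * w \<in> ball 0 s" using that \<omega>1 by (simp add: norm_mult)
    then have "(\<omega> * w) ^ n * g (\<omega> * w) = w ^ n * g w"
    proof -
      have "w \<in> ball 0 (2 * r)" using that(1) n(3) by blast
      then have "q (\<omega> * w) = q w" using inv by (simp add: \<omega>_def)
      then show ?thesis using n(5)[OF that(1)] n(5)[OF \<open>\<omega> * w \<in> ball 0 s\<close>] by simp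
    qed
    then show ?thesis using that(2) by (simp add: power_mult_distrib)
  qed
  have "((\<lambda>w. \<omega> ^ n * g (\<omega> * w)) \<longlongrightarrow> \<omega> ^ n * g (\<omega> * 0)) (at 0)"
  proof (intro tendsto_intros)
    have "isCont (\<lambda>w. g (\<omega> * w)) 0"
      using gc by (intro isCont_o2[where f = "\<lambda>w. \<omega> * w" and g = g]) (auto intro!: continuous_intros)
    then show "((\<lambda>w. g (\<omega> * w)) \<longlongrightarrow> g (\<omega> * 0)) (at 0)" by (simp add: isCont_def)
  qed
  moreover have "\<forall>\<^sub>F w in at 0. \<omega> ^ n * g (\<omega> * w) = g w"
    using n(2) eq by (auto simp: eventually_at intro!: exI[of _ s])
  ultimately have "(g \<longlongrightarrow> \<omega> ^ n * g (\<omega> * 0)) (at 0)" using Lim_transform_eventually by blast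
  moreover have "(g \<longlongrightarrow> g 0) (at 0)" using gc by (simp add: isCont_def)
  ultimately have "\<omega> ^ n * g 0 = g 0" using LIM_unique by fastforce
  then have "\<omega> ^ n = 1" using n(6)[of 0] n(2) by simp
  then have "exp (2 * of_real pi * \<i> * of_nat n / of_nat e) = 1"
    by (simp add: \<omega>_def exp_of_nat_mult[symmetric] mult_ac)
  then have "e dvd n" using complex_root_unity_eq_1[OF e] by simp
  then have en: "e \<le> n" using n(1) by (simp add: dvd_imp_le)
  show ?thesis
  proof (cases "t = 0")
    case True then show ?thesis using q0 e by (simp add: power_0_left)
  next
    case t0: False
    have "cmod (q t / t ^ e) \<le> M / r ^ e"
    proof (rule maximum_modulus_punctured[where Z = "{0}" and r = r and q = "\<lambda>t. q t / t ^ e"])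
      have sub: "cball 0 r \<subseteq> ball 0 (2 * r)" using r by auto
      show "continuous_on (cball 0 r - {0}) (\<lambda>t. q t / t ^ e)"
        using sub by (intro continuous_intros holomorphic_on_imp_continuous_on holomorphic_on_subset[OF hol]) auto
      show "(\<lambda>t. q t / t ^ e) holomorphic_on ball 0 r - {0}"
        using r by (intro holomorphic_intros holomorphic_on_subset[OF hol]) auto
      show "cmod (q t / t ^ e) \<le> M / r ^ e" if "cmod t = r" for t
        using that M[of t] r by (simp add: norm_divide norm_power divide_right_mono)
      show "\<exists>B. \<forall>\<^sub>F t in at a. cmod (q t / t ^ e) \<le> B" if "a \<in> {0}" for a
      proof -
        have "continuous_on (cball 0 (s / 2)) (\<lambda>t. t ^ (n - e) * g t)"
          using n(2) by (intro continuous_intros holomorphic_on_imp_continuous_on holomorphic_on_subset[OF n(4)]) auto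
        then obtain B where B: "\<And>t. t \<in> cball 0 (s / 2) \<Longrightarrow> cmod (t ^ (n - e) * g t) \<le> B"
          using continuous_on_compact_bound[OF compact_cball] by blast
        have "\<forall>\<^sub>F t in at 0. cmod (q t / t ^ e) \<le> B"
        proof -
          have "cmod (q t / t ^ e) \<le> B" if "t \<noteq> 0" "cmod t < s / 2" for t
          proof -
            have "q t / t ^ e = t ^ (n - e) * g t"
              using n(5)[of t] that n(2) en by (simp add: power_diff)
            then show ?thesis using B[of t] that by simp
          qed
          then show ?thesis using n(2) by (auto simp: eventually_at intro!: exI[of _ "s / 2"])
        qed
        then show ?thesis using that by auto
      qed
    qed (use r t t0 in auto)
    then show ?thesis using t0 by (simp add: norm_divide norm_power divide_le_eq)
  qed
qed

lemma normal_disc_in_open: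
  fixes p \<alpha> :: "complex^'n"
  assumes "open U" "p \<in> U" "Vector_Spaces.linear (*s) (*) \<phi>" "\<phi> p = 0"
  obtains \<rho> r d where "\<rho> > 0" "cball p \<rho> \<subseteq> U" "r > 0" "d > 0" "ball p d \<subseteq> cball p \<rho>"
    "\<And>z. z \<in> ball p d \<Longrightarrow> cmod (\<phi> z) < r"
    "\<And>z t. z \<in> ball p d \<Longrightarrow> cmod t \<le> 2 * r \<Longrightarrow> (z - \<phi> z *s \<alpha>) + t *s \<alpha> \<in> cball p \<rho>"
proof -
  obtain \<rho> where \<rho>: "\<rho> > 0" "cball p \<rho> \<subseteq> U" using assms(1,2) by (auto simp: open_contains_cball)
  obtain K where K: "K > 0" "\<And>x. cmod (\<phi> x) \<le> norm x * K"
    using bounded_linear.pos_bounded[OF bounded_linear_clinear[OF assms(3)]] by blast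
  define r where "r = \<rho> / (8 * (norm \<alpha> + 1))"
  have a1: "norm \<alpha> + 1 > 0" by (simp add: add_nonneg_pos)
  have r: "r > 0" using \<rho> a1 by (simp add: r_def)
  have ra: "r * norm \<alpha> \<le> \<rho> / 8"
  proof -
    have "r * norm \<alpha> \<le> r * (norm \<alpha> + 1)" using r by simp
    also have "\<dots> = \<rho> / 8" using a1 unfolding r_def by (simp add: divide_simps del: distrib_left_numeral)
    finally show ?thesis .
  qed
  define d where "d = min (\<rho> / 2) (r / K)"
  have d: "d > 0" using \<rho> r K by (simp add: d_def)
  have \<phi>: "cmod (\<phi> z) < r" if "z \<in> ball p d" for z
  proof -
    have "\<phi> z = \<phi> (z - p)" using assms(3,4) by (metis clinear_iff diff_add_cancel add.right_neutral)
    then have "cmod (\<phi> z) \<le> norm (z - p) * K" using K(2) by simp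
    also have "\<dots> < r / K * K" using that K(1) by (intro mult_strict_right_mono) (auto simp: d_def dist_norm norm_minus_commute)
    finally show ?thesis using K(1) by simp
  qed
  have "(z - \<phi> z *s \<alpha>) + t *s \<alpha> \<in> cball p \<rho>" if z: "z \<in> ball p d" and t: "cmod t \<le> 2 * r" for z t
  proof -
    have "norm ((z - \<phi> z *s \<alpha>) + t *s \<alpha> - p) = norm ((z - p) + (t - \<phi> z) *s \<alpha>)"
      by (simp add: vec.scale_left_diff_distrib algebra_simps)
    also have "\<dots> \<le> norm (z - p) + norm ((t - \<phi> z) *s \<alpha>)" by (rule norm_triangle_ineq)
    also have "\<dots> \<le> \<rho> / 2 + 3 * r * norm \<alpha>"
    proof (intro add_mono)
      show "norm (z - p) \<le> \<rho> / 2" using z by (simp add: d_def dist_norm norm_minus_commute)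
      have "cmod (t - \<phi> z) \<le> 3 * r" using norm_triangle_ineq4[of t "\<phi> z"] t \<phi>[OF z] by simp
      then show "norm ((t - \<phi> z) *s \<alpha>) \<le> 3 * r * norm \<alpha>"
        unfolding norm_vector_smult by (intro mult_right_mono) auto
    qed
    also have "\<dots> \<le> \<rho>" using ra \<rho>(1) by simp
    finally show ?thesis by (simp add: dist_norm norm_minus_commute)
  qed
  moreover have "ball p d \<subseteq> cball p \<rho>" using \<rho>(1) by (auto simp: d_def)
  ultimately show thesis using that[OF \<rho> r d _ \<phi>] by blast
qed

text \<open>A function that is invariant under the rotations of order \<open>e\<close> about a hyperplane and vanishes
  there is divisible by the \<open>e\<close>-th power of an equation.\<close>

lemma rotation_invariant_bound:
  fixes g :: "complex^'n \<Rightarrow> complex"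
  assumes "open U" "holo_on g U" "p \<in> U" "Vector_Spaces.linear (*s) (*) \<phi>" "\<phi> p = 0" "\<phi> \<alpha> = 1" "e \<ge> 1"
    and zero: "\<And>z. z \<in> U \<Longrightarrow> \<phi> z = 0 \<Longrightarrow> g z = 0"
    and inv: "\<And>z z'. z \<in> U \<Longrightarrow> z' \<in> U \<Longrightarrow>
      z' = (z - \<phi> z *s \<alpha>) + (exp (2 * of_real pi * \<i> / of_nat e) * \<phi> z) *s \<alpha> \<Longrightarrow> g z' = g z"
  obtains C d where "C > 0" "d > 0" "ball p d \<subseteq> U" "\<And>z. z \<in> ball p d \<Longrightarrow> cmod (g z) \<le> C * cmod (\<phi> z) ^ e"
proof -
  obtain \<rho> r d where b: "\<rho> > 0" "cball p \<rho> \<subseteq> U" "r > 0" "d > 0" "ball p d \<subseteq> cball p \<rho>"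
    "\<And>z. z \<in> ball p d \<Longrightarrow> cmod (\<phi> z) < r"
    "\<And>z t. z \<in> ball p d \<Longrightarrow> cmod t \<le> 2 * r \<Longrightarrow> (z - \<phi> z *s \<alpha>) + t *s \<alpha> \<in> cball p \<rho>"
    by (rule normal_disc_in_open[OF assms(1,3,4,5), of \<alpha>]) (rule that; (assumption | blast))
  have "compact (g ` cball p \<rho>)"
    by (intro compact_continuous_image continuous_on_subset[OF holo_on_continuous[OF assms(2)] b(2)] compact_cball)
  then obtain M where M: "\<And>z. z \<in> cball p \<rho> \<Longrightarrow> cmod (g z) \<le> M"
    using compact_imp_bounded bounded_iff by (metis (no_types, lifting) image_eqI)
  have \<phi>l: "\<phi> (x + y) = \<phi> x + \<phi> y" "\<phi> (c *s x) = c * \<phi> x" for x y c using assms(4) by (auto simp: clinear_iff)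
  have \<phi>d: "\<phi> (x - y) = \<phi> x - \<phi> y" for x y using \<phi>l(1)[of "x - y" y] by simp
  have bd: "cmod (g z) \<le> (M / r ^ e) * cmod (\<phi> z) ^ e" if z: "z \<in> ball p d" for z
  proof -
    define h where "h = z - \<phi> z *s \<alpha>"
    have \<phi>h: "\<phi> (h + t *s \<alpha>) = t" for t by (simp add: h_def \<phi>l \<phi>d assms(6))
    have inU: "h + t *s \<alpha> \<in> U" if "cmod t \<le> 2 * r" for t using b(2,7) z that by (auto simp: h_def)
    have "cmod (g (h + \<phi> z *s \<alpha>)) \<le> M / r ^ e * cmod (\<phi> z) ^ e"
    proof (rule rotation_invariant_vanishing_order[OF b(3) _ _ _ assms(7), where q = "\<lambda>t. g (h + t *s \<alpha>)"])
      show "(\<lambda>t. g (h + t *s \<alpha>)) holomorphic_on ball 0 (2 * r)"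
        by (rule holo_on_line_holomorphic[OF assms(2)]) (use inU in auto)
      show "cmod (g (h + t *s \<alpha>)) \<le> M" if "t \<in> ball 0 (2 * r)" for t
        using M b(7)[OF z, of t] that by (simp add: h_def)
      show "g (h + 0 *s \<alpha>) = 0" using inU[of 0] b(3) \<phi>h[of 0] by (intro zero) auto
      show "g (h + (exp (2 * of_real pi * \<i> / of_nat e) * t) *s \<alpha>) = g (h + t *s \<alpha>)" if t: "t \<in> ball 0 (2 * r)" for t
      proof (rule inv)
        have "cmod (exp (2 * of_real pi * \<i> / of_nat e)) = 1" by (simp add: norm_exp_eq_Re Re_divide_of_nat)
        then show "h + (exp (2 * of_real pi * \<i> / of_nat e) * t) *s \<alpha> \<in> U" using t by (intro inU) (simp add: norm_mult)
      qed (use t inU in \<open>auto simp: \<phi>h\<close>)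
      show "cmod (\<phi> z) \<le> r" using b(6)[OF z] by simp
    qed
    then show ?thesis by (simp add: h_def)
  qed
  have "cmod (g z) \<le> (\<bar>M / r ^ e\<bar> + 1) * cmod (\<phi> z) ^ e" if "z \<in> ball p d" for z
    by (rule order_trans[OF bd[OF that]]) (intro mult_right_mono zero_le_power norm_ge_zero, linarith)
  moreover have "ball p d \<subseteq> U" using b(2,5) by blast
  moreover have "\<bar>M / r ^ e\<bar> + 1 > 0" by linarith
  ultimately show thesis using that b(4) by blast
qed

text \<open>The Cauchy bound remains valid on the complement of a hyperplane, since isolated singularities
  of bounded functions are removable.\<close>

lemma dif_bounded_off_hyperplane:
  fixes g :: "complex^'n \<Rightarrow> complex"
  assumes "Vector_Spaces.linear (*s) (*) \<phi>" "d > 0" "holo_on g (ball p d - {z. \<phi> z = 0})"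
    and M: "\<And>z. z \<in> ball p d \<Longrightarrow> \<phi> z \<noteq> 0 \<Longrightarrow> cmod (g z) \<le> M"
    and z: "z \<in> ball p (d / 2)" "\<phi> z \<noteq> 0"
  shows "cmod (dif g z x) \<le> 4 * M / d * norm x"
proof (cases "x = 0")
  case True
  have "z \<in> ball p d - {z. \<phi> z = 0}" using z assms(2) by auto
  then show ?thesis using holo_on_D(6)[OF assms(3)] True by simp
next
  case False
  have \<phi>l: "\<phi> (x + y) = \<phi> x + \<phi> y" "\<phi> (c *s x) = c * \<phi> x" for x y c using assms(1) by (auto simp: clinear_iff)
  define \<rho> where "\<rho> = d / (2 * norm x)"
  have \<rho>: "\<rho> > 0" using assms(2) False by (simp add: \<rho>_def)
  have inb: "z + t *s x \<in> ball p d" if "t \<in> ball 0 \<rho>" for t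
  proof -
    have "norm (t *s x) < d / 2" using that False by (simp add: norm_vector_smult \<rho>_def field_simps)
    moreover have "dist p (z + t *s x) \<le> dist p z + norm (t *s x)"
      using dist_triangle[of p "z + t *s x" z] by (simp add: dist_norm)
    ultimately show ?thesis using z(1) by simp
  qed
  define a where "a = (if \<phi> x = 0 then 0 else - \<phi> z / \<phi> x)"
  have off: "\<phi> (z + t *s x) \<noteq> 0" if "t \<noteq> a \<or> t = 0" for t
    using that z(2) by (auto simp: \<phi>l a_def field_simps add_eq_0_iff2 split: if_splits)
  define q where "q t = g (z + t *s x)" for t
  have hq: "q holomorphic_on ball 0 \<rho> - ({a} - {0})"
    unfolding q_def by (rule holo_on_line_holomorphic[OF assms(3)]) (use inb off in auto)
  have bq: "cmod (q t) \<le> M" if "t \<in> ball 0 \<rho> - ({a} - {0})" for t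
    unfolding q_def using that inb off by (intro M) auto
  have "\<exists>h. h holomorphic_on ball 0 \<rho> \<and> (\<forall>t\<in>ball 0 \<rho> - ({a} - {0}). h t = q t)"
  proof (cases "a \<in> ball 0 \<rho> - {0}")
    case True
    then have "{a} - {0} = {a}" by auto
    moreover have "\<forall>\<^sub>F t in at a. cmod (q t) \<le> M"
    proof -
      have "\<forall>\<^sub>F t in at a. t \<in> ball 0 \<rho>" using True by (intro eventually_at_in_open') auto
      moreover have "\<forall>\<^sub>F t in at a. t \<noteq> a" by (simp add: eventually_neq_at_within)
      ultimately show ?thesis by eventually_elim (use bq in auto)
    qed
    ultimately show ?thesis
      using holomorphic_on_extend_bounded[of q "ball 0 \<rho>" a] hq True by auto
  next
    case False
    then have "ball 0 \<rho> - ({a} - {0}) = ball 0 \<rho>" by auto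
    then show ?thesis using hq by auto
  qed
  then obtain h where h: "h holomorphic_on ball 0 \<rho>" "\<And>t. t \<in> ball 0 \<rho> - ({a} - {0}) \<Longrightarrow> h t = q t" by blast
  have "infinite {\<rho> / 2<..<\<rho>}" using \<rho> by (intro infinite_Ioo) simp
  then have "{\<rho> / 2<..<\<rho>} - {cmod a} \<noteq> {}" by (metis finite.emptyI finite_insert infinite_remove)
  then obtain s where "s \<in> {\<rho> / 2<..<\<rho>} - {cmod a}" by blast
  then have s: "\<rho> / 2 < s" "s < \<rho>" "s \<noteq> cmod a" by auto
  have "norm ((deriv ^^ 1) h 0) \<le> fact 1 * M / s ^ 1"
  proof (rule Cauchy_inequality)
    show "h holomorphic_on ball 0 s" using h(1) s by (auto elim: holomorphic_on_subset)
    show "continuous_on (cball 0 s) h"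
      using h(1) s by (intro holomorphic_on_imp_continuous_on holomorphic_on_subset[OF h(1)]) auto
    show "0 < s" using s \<rho> by linarith
    show "cmod (h t) \<le> M" if "cmod (0 - t) = s" for t
    proof -
      have "t \<in> ball 0 \<rho> - ({a} - {0})" using that s by auto
      then show ?thesis using h(2) bq by metis
    qed
  qed
  moreover have "deriv h 0 = dif g z x"
  proof -
    have 1: "(q has_field_derivative dif g z x) (at 0)"
      using holo_on_line[OF assms(3), of z 0 x] inb[of 0] \<rho> z(2) by (simp add: q_def[abs_def])
    define W where "W = ball 0 \<rho> - ({a} - {0})"
    have W: "open W" "0 \<in> W" using \<rho> by (auto simp: W_def intro!: open_Diff finite_imp_closed)
    have "(h has_field_derivative dif g z x) (at 0)"
      by (rule has_field_derivative_transform_within_open[OF 1 W]) (use h(2) in \<open>auto simp: W_def\<close>)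
    then show ?thesis by (rule DERIV_imp_deriv)
  qed
  ultimately have *: "cmod (dif g z x) \<le> M / s" by simp
  have "z \<in> ball p d" using z(1) assms(2) by simp
  then have "M \<ge> 0" using order_trans[OF norm_ge_zero M[of z]] z(2) by blast
  then have "M / s \<le> M / (\<rho> / 2)" using s \<rho> by (intro divide_left_mono) auto
  also have "\<dots> = 4 * M / d * norm x" by (simp add: \<rho>_def)
  finally show ?thesis using * by simp
qed

text \<open>The entries of the derivative are continuous; finitely many of them control its operator norm.\<close>

lemma dif_operator_continuous:
  fixes S :: "complex^'n \<Rightarrow> complex^'m"
  assumes "open U" "vholo_on S U" "p \<in> U" "\<epsilon> > 0"
  obtains d where "d > 0" "ball p d \<subseteq> U" "\<And>z h. z \<in> ball p d \<Longrightarrow> norm (dif S z h - dif S p h) \<le> \<epsilon> * norm h"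
proof -
  define \<eta> where "\<eta> = \<epsilon> / real CARD('n)"
  have \<eta>: "\<eta> > 0" using assms(4) by (simp add: \<eta>_def)
  have ex: "\<exists>d>0. \<forall>z\<in>ball p d. z \<in> U \<and> norm (dif S z (axis j 1) - dif S p (axis j 1)) \<le> \<eta>" for j
  proof -
    have "continuous_on U (\<lambda>z. dif S z (axis j 1))"
      by (rule vholo_on_continuous[OF vholo_on_dif[OF assms(1,2)]])
    then have "open (U \<inter> (\<lambda>z. dif S z (axis j 1)) -` ball (dif S p (axis j 1)) \<eta>)"
      by (intro continuous_open_preimage assms(1)) auto
    moreover have "p \<in> U \<inter> (\<lambda>z. dif S z (axis j 1)) -` ball (dif S p (axis j 1)) \<eta>" using assms(3) \<eta> by simp
    ultimately obtain d where "d > 0" "ball p d \<subseteq> U \<inter> (\<lambda>z. dif S z (axis j 1)) -` ball (dif S p (axis j 1)) \<eta>"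
      using open_contains_ball by blast
    then show ?thesis
      by (intro exI[of _ d] conjI ballI) (auto simp: subset_iff dist_norm norm_minus_commute intro: less_imp_le)
  qed
  obtain \<delta> where \<delta>: "\<And>j. \<delta> j > 0" "\<And>j z. z \<in> ball p (\<delta> j) \<Longrightarrow> z \<in> U \<and> norm (dif S z (axis j 1) - dif S p (axis j 1)) \<le> \<eta>"
    using ex by metis
  define d where "d = Min (range \<delta>)"
  have d: "d > 0" "\<And>j. d \<le> \<delta> j" using \<delta>(1) by (simp_all add: d_def)
  have sub: "ball p d \<subseteq> ball p (\<delta> j)" for j using d(2) by (simp add: subset_ball)
  have dU: "ball p d \<subseteq> U" using sub \<delta>(2) by blast
  have "norm (dif S z h - dif S p h) \<le> \<epsilon> * norm h" if z: "z \<in> ball p d" for z h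
  proof -
    have zU: "z \<in> U" using z dU by blast
    have ex: "dif S u h = (\<Sum>j\<in>UNIV. h $ j *s dif S u (axis j 1))" if u: "u \<in> U" for u
    proof -
      have "linear (dif S u)" using vholo_on_has_derivative[OF assms(2) u] has_derivative_linear by blast
      then have "dif S u (\<Sum>j\<in>UNIV. h $ j *s axis j 1) = (\<Sum>j\<in>UNIV. dif S u (h $ j *s axis j 1))"
        by (rule linear_sum)
      then show ?thesis unfolding basis_expansion by (simp only: vdif_scale[OF assms(2) u])
    qed
    have "dif S z h - dif S p h = (\<Sum>j\<in>UNIV. h $ j *s (dif S z (axis j 1) - dif S p (axis j 1)))"
      by (simp only: ex[OF zU] ex[OF assms(3)] sum_subtractf[symmetric] vec.scale_right_diff_distrib)
    also have "norm \<dots> \<le> (\<Sum>j\<in>(UNIV :: 'n set). norm h * \<eta>)"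
    proof (rule sum_norm_le)
      fix j show "norm (h $ j *s (dif S z (axis j 1) - dif S p (axis j 1))) \<le> norm h * \<eta>"
      proof -
        have "z \<in> ball p (\<delta> j)" using z sub by blast
        from \<delta>(2)[OF this] show ?thesis
          unfolding norm_vector_smult by (intro mult_mono Finite_Cartesian_Product.norm_nth_le) auto
      qed
    qed
    also have "\<dots> = \<epsilon> * norm h" by (simp add: \<eta>_def)
    finally show ?thesis .
  qed
  with d(1) dU that show thesis by blast
qed

lemma dif_const: "dif (\<lambda>_. c) z = (\<lambda>_. 0)"
  by (rule dif_eqI) simp

text \<open>Logarithmic differentiation of \<open>\<psi> ^ e' = \<phi> ^ e * u\<close>, twice.\<close>

lemma log_derivative_identity:
  fixes \<phi> u \<psi> :: "complex^'n \<Rightarrow> complex"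
  assumes N: "open N" "z \<in> N" and hol: "holo_on u N" "holo_on \<psi> N" "Vector_Spaces.linear (*s) (*) \<phi>"
    and ne: "\<And>w. w \<in> N \<Longrightarrow> \<phi> w \<noteq> 0" "\<And>w. w \<in> N \<Longrightarrow> u w \<noteq> 0"
    and e: "e \<ge> 1" "e' \<ge> 1"
    and eq: "\<And>w. w \<in> N \<Longrightarrow> \<psi> w ^ e' = \<phi> w ^ e * u w"
    and v: "dif \<psi> z v = dif (\<lambda>w. dif \<psi> w y) z x"
  defines "m \<equiv> \<lambda>y w. dif u w y / u w"
  shows "of_nat e * \<phi> v + \<phi> z * m v z = \<phi> z * dif (m y) z x - of_nat e * \<phi> x * \<phi> y / \<phi> z
    + (of_nat e * \<phi> x + \<phi> z * m x z) * (of_nat e * \<phi> y + \<phi> z * m y z) / (of_nat e' * \<phi> z)"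
proof -
  define E E' where "E = (of_nat e :: complex)" and "E' = (of_nat e' :: complex)"
  have E0: "E' \<noteq> 0" using e by (simp add: E'_def)
  have h\<phi>: "holo_on \<phi> N" by (rule holo_on_linear[OF hol(3)])
  have d\<phi>: "dif \<phi> w = \<phi>" for w by (rule dif_linear[OF bounded_linear_clinear[OF hol(3)]])
  have \<psi>0: "\<psi> w \<noteq> 0" if "w \<in> N" for w using eq[OF that] ne[OF that] e(2) by (auto simp: power_0_left)
  define \<Lambda> where "\<Lambda> y w = (E * \<phi> y * inverse (\<phi> w) + m y w) * inverse E'" for y w
  have d1: "dif \<psi> w y = \<Lambda> y w * \<psi> w" if w: "w \<in> N" for w y
  proof -
    have "dif (\<lambda>w. \<psi> w ^ e') w y = dif (\<lambda>w. \<phi> w ^ e * u w) w y"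
      by (rule fun_cong[OF dif_cong_open[OF N(1) w eq]])
    then have "E' * \<psi> w ^ (e' - 1) * dif \<psi> w y = \<phi> w ^ e * dif u w y + E * \<phi> w ^ (e - 1) * \<phi> y * u w"
      by (simp add: dif_power[OF hol(2) w] dif_mult[OF holo_on_power[OF h\<phi>] hol(1) w] dif_power[OF h\<phi> w] d\<phi> E_def E'_def)
    then have r: "E' * (\<psi> w * \<psi> w ^ (e' - 1)) * dif \<psi> w y = \<psi> w * (\<phi> w ^ e * dif u w y + E * \<phi> w ^ (e - 1) * \<phi> y * u w)"
      by (simp add: mult_ac)
    have s: "\<psi> w * \<psi> w ^ (e' - 1) = \<phi> w ^ e * u w"
      using eq[OF w] e(2) by (simp add: power_eq_if)
    have p: "\<phi> w ^ e = \<phi> w * \<phi> w ^ (e - 1)" using e(1) by (simp add: power_eq_if)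
    have "E' * (\<phi> w * \<phi> w ^ (e - 1) * u w) * dif \<psi> w y
        = \<psi> w * (\<phi> w * \<phi> w ^ (e - 1) * dif u w y + E * \<phi> w ^ (e - 1) * \<phi> y * u w)"
      using r unfolding s unfolding p .
    then have "\<phi> w ^ (e - 1) * (E' * \<phi> w * u w * dif \<psi> w y)
        = \<phi> w ^ (e - 1) * (\<psi> w * (\<phi> w * dif u w y + E * \<phi> y * u w))" by (simp add: algebra_simps)
    then have "E' * \<phi> w * u w * dif \<psi> w y = \<psi> w * (\<phi> w * dif u w y + E * \<phi> y * u w)"
      using ne[OF w] by simp
    then show ?thesis using ne[OF w] E0 by (simp add: \<Lambda>_def m_def field_simps)
  qed
  have hm: "holo_on (m y) N" for y unfolding m_def
    by (intro holo_on_divide holo_on_dif[OF N(1) hol(1)] hol(1) ne(2))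
  have h1: "holo_on (\<lambda>w. E * \<phi> y * inverse (\<phi> w)) N" for y
    by (intro holo_on_mult holo_on_const holo_on_inverse h\<phi> ne(1))
  have h\<Lambda>: "holo_on (\<Lambda> y) N" for y
    unfolding \<Lambda>_def by (intro holo_on_mult holo_on_const holo_on_add h1 hm)
  have d\<Lambda>: "dif (\<Lambda> y) z x = (- E * \<phi> y * \<phi> x / (\<phi> z)\<^sup>2 + dif (m y) z x) * inverse E'"
    unfolding \<Lambda>_def
    by (simp add: dif_mult[OF holo_on_add[OF h1 hm] holo_on_const N(2)] dif_add[OF h1 hm N(2)]
        dif_mult[OF holo_on_const holo_on_inverse[OF h\<phi> ne(1)] N(2)] dif_inverse[OF h\<phi> ne(1) N(2)] dif_const d\<phi>)
  have "dif (\<lambda>w. dif \<psi> w y) z x = dif (\<lambda>w. \<Lambda> y w * \<psi> w) z x"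
    by (rule fun_cong[OF dif_cong_open[OF N d1]])
  also have "\<dots> = \<Lambda> y z * (\<Lambda> x z * \<psi> z) + dif (\<Lambda> y) z x * \<psi> z"
    by (simp add: dif_mult[OF h\<Lambda> hol(2) N(2)] d1[OF N(2)])
  finally have "\<Lambda> v z * \<psi> z = (\<Lambda> y z * \<Lambda> x z + dif (\<Lambda> y) z x) * \<psi> z"
    using v by (simp add: d1[OF N(2)] algebra_simps)
  then have "\<Lambda> v z = \<Lambda> y z * \<Lambda> x z + dif (\<Lambda> y) z x" using \<psi>0[OF N(2)] by simp
  then have lam: "E' * \<phi> z * \<Lambda> v z = E' * \<phi> z * (\<Lambda> y z * \<Lambda> x z + dif (\<Lambda> y) z x)" by simp
  have "E * \<phi> v + \<phi> z * m v z = E' * \<phi> z * \<Lambda> v z"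
    using E0 ne[OF N(2)] by (simp add: \<Lambda>_def field_simps)
  also note lam
  also have "E' * \<phi> z * (\<Lambda> y z * \<Lambda> x z + dif (\<Lambda> y) z x) = \<phi> z * dif (m y) z x - E * \<phi> x * \<phi> y / \<phi> z
    + (E * \<phi> x + \<phi> z * m x z) * (E * \<phi> y + \<phi> z * m y z) / (E' * \<phi> z)"
    unfolding d\<Lambda> \<Lambda>_def using E0 ne[OF N(2)] by (simp add: divide_simps power2_eq_square) (simp add: algebra_simps)
  finally show ?thesis unfolding E_def E'_def .
qed

text \<open>Here \<open>S\<close> are coordinates along the second hyperplane and \<open>\<psi>\<close> is its equation, both composed with a
  lift, and \<open>v\<close> is the value of the connection. The equation for \<open>\<psi>\<close> determines the normal part of \<open>v\<close>
  up to a bounded term, while the equation for \<open>S\<close> bounds its part along the hyperplane. Each estimate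
  involves the other part, but in the first it comes with the factor \<open>\<phi> z\<close>, which is small.\<close>

lemma log_connection_estimate:
  fixes T :: "complex^'n \<Rightarrow> complex" and S :: "complex^'n \<Rightarrow> complex^'m"
  assumes U: "open U" "p \<in> U" and \<phi>: "Vector_Spaces.linear (*s) (*) \<phi>" "\<phi> p = 0" "\<phi> \<alpha> = 1"
    and T: "holo_on T U" and S: "vholo_on S U" and e: "e \<ge> 1" "e' \<ge> 1" and C: "C > 0"
    and T1: "\<And>z. z \<in> U \<Longrightarrow> cmod (T z) \<le> C * cmod (\<phi> z) ^ e" "\<And>z. z \<in> U \<Longrightarrow> cmod (\<phi> z) ^ e \<le> C * cmod (T z)"
    and S1: "\<And>z. z \<in> U \<Longrightarrow> norm (dif S z \<alpha>) \<le> C * cmod (\<phi> z)"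
    and S2: "c0 > 0" "\<And>z h. z \<in> U \<Longrightarrow> \<phi> h = 0 \<Longrightarrow> c0 * norm h \<le> norm (dif S z h)"
  obtains d K where "d > 0" "ball p d \<subseteq> U"
    "\<And>z v \<psi> N. z \<in> ball p d \<Longrightarrow> \<phi> z \<noteq> 0 \<Longrightarrow> open N \<Longrightarrow> z \<in> N \<Longrightarrow> N \<subseteq> U \<Longrightarrow> holo_on \<psi> N \<Longrightarrow>
       (\<And>w. w \<in> N \<Longrightarrow> \<psi> w ^ e' = T w) \<Longrightarrow> dif S z v = dif (\<lambda>w. dif S w y) z x \<Longrightarrow>
       dif \<psi> z v = dif (\<lambda>w. dif \<psi> w y) z x \<Longrightarrow>
       norm (v - ((of_nat e / of_nat e' - 1) * \<phi> x * \<phi> y / \<phi> z) *s \<alpha>) \<le> K"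
proof -
  define E E' where "E = (of_nat e :: complex)" and "E' = (of_nat e' :: complex)"
  have E0: "E' \<noteq> 0" "cmod E \<ge> 1" using e by (simp_all add: E_def E'_def)
  define c where "c = E / E' - 1"
  have \<phi>l: "\<phi> (x + y) = \<phi> x + \<phi> y" "\<phi> (c *s x) = c * \<phi> x" for x y c using \<phi>(1) by (auto simp: clinear_iff)
  have \<phi>d: "\<phi> (x - y) = \<phi> x - \<phi> y" for x y using \<phi>l(1)[of "x - y" y] by simp
  have \<phi>c: "continuous_on V \<phi>" for V
    using bounded_linear_clinear[OF \<phi>(1)] by (simp add: linear_continuous_on)
  have op\<phi>: "open {z. \<phi> z \<noteq> 0}" by (intro open_Collect_neq \<phi>c continuous_on_const)
  obtain d0 where d0: "d0 > 0" "ball p d0 \<subseteq> U" using U open_contains_ball by blast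
  define D where "D = ball p d0 - {z. \<phi> z = 0}"
  have D: "open D" unfolding D_def using op\<phi> by (simp add: Diff_eq Collect_neg_eq[symmetric] open_Int)
  \<comment> \<open>The unit in the normal form. Its logarithmic derivative \<open>m\<close> is bounded across the hyperplane.\<close>
  define u where "u z = T z / \<phi> z ^ e" for z
  have DU: "D \<subseteq> U" using d0 by (auto simp: D_def)
  have hu: "holo_on u D" unfolding u_def
    by (intro holo_on_divide holo_on_subset[OF T DU] holo_on_power holo_on_linear \<phi>(1)) (auto simp: D_def)
  have ub: "cmod (u z) \<le> C" "1 \<le> C * cmod (u z)" if "z \<in> D" for z
  proof -
    have z: "z \<in> U" "\<phi> z \<noteq> 0" using that DU by (auto simp: D_def)
    then have pos: "cmod (\<phi> z) ^ e > 0" by simp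
    show "cmod (u z) \<le> C" using T1(1)[OF z(1)] pos by (simp add: u_def norm_divide norm_power divide_le_eq)
    show "1 \<le> C * cmod (u z)" using T1(2)[OF z(1)] pos by (simp add: u_def norm_divide norm_power le_divide_eq)
  qed
  have u0: "u z \<noteq> 0" if "z \<in> D" for z using ub(2)[OF that] by auto
  define m where "m = (\<lambda>y w. dif u w y / u w)"
  define M1 where "M1 = 4 * C * C / d0"
  have M1: "M1 \<ge> 0" using C d0 by (simp add: M1_def)
  have mb: "cmod (m y z) \<le> M1 * norm y" if z: "z \<in> ball p (d0 / 2)" "\<phi> z \<noteq> 0" for y z
  proof -
    have zD: "z \<in> D" using z d0 by (auto simp: D_def)
    have 1: "cmod (dif u z y) \<le> 4 * C / d0 * norm y"
      by (rule dif_bounded_off_hyperplane[OF \<phi>(1) d0(1) _ _ z]) (use hu ub in \<open>auto simp: D_def\<close>)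
    have "cmod (m y z) = cmod (dif u z y) * (1 / cmod (u z))" by (simp add: m_def norm_divide)
    also have "\<dots> \<le> (4 * C / d0 * norm y) * C"
    proof (intro mult_mono 1)
      show "1 / cmod (u z) \<le> C" using ub(2)[OF zD] u0[OF zD] by (simp add: divide_le_eq)
    qed (use C d0 in auto)
    finally show ?thesis by (simp add: M1_def mult_ac)
  qed
  have hm: "holo_on (m y) D" for y unfolding m_def
    by (intro holo_on_divide holo_on_dif[OF D hu] hu u0)
  define M2 where "M2 = 8 * (M1 * norm y) / d0 * norm x"
  have dmb: "cmod (dif (m y) z x) \<le> M2" if z: "z \<in> ball p (d0 / 4)" "\<phi> z \<noteq> 0" for z
  proof -
    have "cmod (dif (m y) z x) \<le> 4 * (M1 * norm y) / (d0 / 2) * norm x"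
    proof (rule dif_bounded_off_hyperplane[OF \<phi>(1), of "d0 / 2"])
      show "holo_on (m y) (ball p (d0 / 2) - {z. \<phi> z = 0})"
        by (rule holo_on_subset[OF hm]) (use d0 in \<open>auto simp: D_def\<close>)
    qed (use d0 z mb in auto)
    then show ?thesis by (simp add: M2_def)
  qed
  have "continuous_on U (\<lambda>w. dif (\<lambda>w. dif S w y) w x)"
    by (intro vholo_on_continuous vholo_on_dif U S)
  moreover have cb: "cball p (d0 / 2) \<subseteq> U" using d0 by (auto simp: subset_iff)
  ultimately obtain M3 where M3: "\<And>z. z \<in> cball p (d0 / 2) \<Longrightarrow> norm (dif (\<lambda>w. dif S w y) z x) \<le> M3"
    using continuous_on_compact_bound[OF compact_cball continuous_on_subset] by blast
  define b2 where "b2 = \<bar>M3\<bar> + cmod (c * \<phi> x * \<phi> y) * C"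
  define b1 where "b1 = M2 + cmod (E / E') * (cmod (\<phi> x) * (M1 * norm y) + cmod (\<phi> y) * (M1 * norm x))
    + M1 * norm x * (M1 * norm y) / cmod E' + cmod (c * \<phi> x * \<phi> y) * (M1 * norm \<alpha>)"
  \<comment> \<open>Chosen so that for \<open>|\<phi> z| < \<eta>\<close> the estimate of the normal part \<open>Y\<close> of the error contains \<open>Y\<close> itself
    with a factor of at most \<open>1 / 2\<close>, which can be absorbed.\<close>
  define \<eta> where "\<eta> = min 1 (1 / (2 * (M1 * (norm \<alpha> + C / c0) + 1)))"
  have pos1: "M1 * (norm \<alpha> + C / c0) \<ge> 0" using M1 C S2(1) by simp
  then have \<eta>: "\<eta> > 0" by (simp add: \<eta>_def)
  define Y0 where "Y0 = 2 * (b1 + M1 * (b2 / c0))"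
  define K where "K = Y0 * norm \<alpha> + (b2 + C * Y0) / c0"
  obtain d1 where d1: "d1 > 0" "\<And>z. z \<in> ball p d1 \<Longrightarrow> cmod (\<phi> z) < \<eta>"
  proof -
    have "open {z. cmod (\<phi> z) < \<eta>}" by (intro open_Collect_less continuous_intros \<phi>c)
    moreover have "p \<in> {z. cmod (\<phi> z) < \<eta>}" using \<phi>(2) \<eta> by simp
    ultimately obtain d1 where "d1 > 0" "ball p d1 \<subseteq> {z. cmod (\<phi> z) < \<eta>}" using open_contains_ball by blast
    then show thesis using that[of d1] by blast
  qed
  define d where "d = min d1 (d0 / 4)"
  have d: "d > 0" "d \<le> d1" "d \<le> d0 / 4" using d0 d1 by (auto simp: d_def)
  have "norm (v - (c * \<phi> x * \<phi> y / \<phi> z) *s \<alpha>) \<le> K"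
    if z: "z \<in> ball p d" "\<phi> z \<noteq> 0" and N: "open N" "z \<in> N" "N \<subseteq> U" and \<psi>: "holo_on \<psi> N"
      "\<And>w. w \<in> N \<Longrightarrow> \<psi> w ^ e' = T w" and v: "dif S z v = dif (\<lambda>w. dif S w y) z x" "dif \<psi> z v = dif (\<lambda>w. dif \<psi> w y) z x"
    for z v \<psi> N
  proof -
    define Q where "Q = \<phi> z"
    have Q0: "Q \<noteq> 0" using z by (simp add: Q_def)
    have zb: "z \<in> ball p (d0 / 4)" "z \<in> ball p (d0 / 2)" "z \<in> cball p (d0 / 2)" using z(1) d d0(1) by auto
    have zU: "z \<in> U" using zb(3) cb by blast
    have Q\<eta>: "cmod Q < \<eta>" using d1(2)[of z] z(1) d(2) by (simp add: Q_def)
    have Q1: "cmod Q \<le> 1" using Q\<eta> by (simp add: \<eta>_def)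
    have zD: "z \<in> D" using z(2) zb d0 by (auto simp: D_def)
    have id: "E * \<phi> v + \<phi> z * m v z = \<phi> z * dif (m y) z x - E * \<phi> x * \<phi> y / \<phi> z
      + (E * \<phi> x + \<phi> z * m x z) * (E * \<phi> y + \<phi> z * m y z) / (E' * \<phi> z)"
      unfolding E_def E'_def m_def
    proof (rule log_derivative_identity[of "N \<inter> D" z u \<psi> \<phi>])
      show "open (N \<inter> D)" using N D by blast
      show "z \<in> N \<inter> D" using N zD by blast
      show "holo_on u (N \<inter> D)" "holo_on \<psi> (N \<inter> D)" using hu \<psi>(1) by (auto intro: holo_on_subset)
      show "\<psi> w ^ e' = \<phi> w ^ e * u w" if "w \<in> N \<inter> D" for w using that \<psi>(2) by (auto simp: u_def D_def)
    qed (use \<phi> e v u0 in \<open>auto simp: D_def\<close>)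
    \<comment> \<open>The pole, and below the error \<open>v'\<close> with its normal part \<open>Y\<close> and its part \<open>X\<close> along the hyperplane.\<close>
    define t where "t = c * \<phi> x * \<phi> y / Q"
    define v' where "v' = v - t *s \<alpha>"
    have vv: "v = v' + t *s \<alpha>" by (simp add: v'_def)
    have ml: "m (a + b) z = m a z + m b z" "m (k *s a) z = k * m a z" for a b k
      using holo_on_D(3,4)[OF hu zD] by (simp_all add: m_def add_divide_distrib)
    have tQ: "t * Q = c * \<phi> x * \<phi> y" using Q0 by (simp add: t_def)
    have id2: "E * \<phi> v' + Q * m v' z = Q * dif (m y) z x + (E / E') * (\<phi> x * m y z + \<phi> y * m x z)
      + Q * (m x z * m y z) / E' - c * \<phi> x * \<phi> y * m \<alpha> z"
    proof -
      have "E * \<phi> v' + Q * m v' z = E * \<phi> v + Q * m v z - E * t - (t * Q) * m \<alpha> z"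
        unfolding vv ml \<phi>l \<phi>(3) by (simp add: algebra_simps)
      also have "E * \<phi> v + Q * m v z = Q * dif (m y) z x - E * \<phi> x * \<phi> y / Q
        + (E * \<phi> x + Q * m x z) * (E * \<phi> y + Q * m y z) / (E' * Q)" using id by (simp add: Q_def)
      also have "(E * \<phi> x + Q * m x z) * (E * \<phi> y + Q * m y z) / (E' * Q)
        = E * E * \<phi> x * \<phi> y / (E' * Q) + (E / E') * (\<phi> x * m y z + \<phi> y * m x z) + Q * (m x z * m y z) / E'"
        using Q0 E0(1) by (simp add: field_simps)
      finally have fin: "E * \<phi> v' + Q * m v' z = Q * dif (m y) z x - E * \<phi> x * \<phi> y / Q
        + (E * E * \<phi> x * \<phi> y / (E' * Q) + (E / E') * (\<phi> x * m y z + \<phi> y * m x z) + Q * (m x z * m y z) / E')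
        - E * t - (t * Q) * m \<alpha> z" .
      have Et: "E * t = E * E * \<phi> x * \<phi> y / (E' * Q) - E * \<phi> x * \<phi> y / Q"
        using Q0 E0(1) by (simp add: t_def c_def field_simps)
      show ?thesis using fin unfolding tQ Et by simp
    qed
    define Y X where "Y = cmod (\<phi> v')" and "X = norm (v' - \<phi> v' *s \<alpha>)"
    have v'n: "norm v' \<le> Y * norm \<alpha> + X"
      using norm_triangle_ineq[of "\<phi> v' *s \<alpha>" "v' - \<phi> v' *s \<alpha>"] by (simp add: Y_def X_def norm_vector_smult)
    have mz: "cmod (m a z) \<le> M1 * norm a" for a by (rule mb[OF zb(2) z(2)])
    have rhs: "cmod (Q * dif (m y) z x + (E / E') * (\<phi> x * m y z + \<phi> y * m x z)
      + Q * (m x z * m y z) / E' - c * \<phi> x * \<phi> y * m \<alpha> z) \<le> b1"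
    proof -
      have a1: "cmod (Q * dif (m y) z x) \<le> M2"
        using mult_mono[OF Q1 dmb[OF zb(1) z(2)]] by (simp add: norm_mult)
      have a2: "cmod ((E / E') * (\<phi> x * m y z + \<phi> y * m x z)) \<le> cmod (E / E') * (cmod (\<phi> x) * (M1 * norm y) + cmod (\<phi> y) * (M1 * norm x))"
      proof -
        have "cmod (\<phi> x * m y z + \<phi> y * m x z) \<le> cmod (\<phi> x) * (M1 * norm y) + cmod (\<phi> y) * (M1 * norm x)"
          by (rule norm_triangle_mono) (auto simp: norm_mult intro!: mult_left_mono mz)
        then show ?thesis by (subst norm_mult) (rule mult_left_mono, auto)
      qed
      have a3: "cmod (Q * (m x z * m y z) / E') \<le> M1 * norm x * (M1 * norm y) / cmod E'"
      proof -
        have "cmod (m x z) * cmod (m y z) \<le> (M1 * norm x) * (M1 * norm y)"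
          by (intro mult_mono mz) (use M1 in auto)
        from mult_mono[OF Q1 this]
        have "cmod Q * (cmod (m x z) * cmod (m y z)) \<le> 1 * ((M1 * norm x) * (M1 * norm y))" by simp
        then show ?thesis by (simp add: norm_divide norm_mult divide_right_mono)
      qed
      have a4: "cmod (c * \<phi> x * \<phi> y * m \<alpha> z) \<le> cmod (c * \<phi> x * \<phi> y) * (M1 * norm \<alpha>)"
        by (subst norm_mult) (intro mult_left_mono mz, simp)
      show ?thesis unfolding b1_def
        by (rule order_trans[OF norm_triangle_ineq4 add_mono[OF norm_triangle_mono[OF norm_triangle_mono[OF a1 a2] a3] a4]])
    qed
    have Yle: "Y \<le> b1 + cmod Q * (M1 * norm v')"
    proof -
      have "cmod (E * \<phi> v' + Q * m v' z) \<le> b1" unfolding id2 by (rule rhs)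
      then have "cmod (E * \<phi> v') \<le> b1 + cmod (Q * m v' z)"
        using norm_triangle_ineq4[of "E * \<phi> v' + Q * m v' z" "Q * m v' z"] by simp
      also have "cmod (Q * m v' z) \<le> cmod Q * (M1 * norm v')" unfolding norm_mult by (intro mult_left_mono mz) simp
      finally have "cmod E * Y \<le> b1 + cmod Q * (M1 * norm v')" by (simp add: norm_mult Y_def)
      moreover have "1 * Y \<le> cmod E * Y" by (intro mult_right_mono E0) (simp add: Y_def)
      ultimately show ?thesis by linarith
    qed
    have dSl: "dif S z (a + b) = dif S z a + dif S z b" "dif S z (k *s a) = k *s dif S z a" for a b k
      using vdif_add[OF S zU] vdif_scale[OF S zU] by auto
    have Xle: "c0 * X \<le> b2 + C * Y"
    proof -
      have "c0 * X \<le> norm (dif S z (v' - \<phi> v' *s \<alpha>))"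
        unfolding X_def by (rule S2(2)[OF zU]) (simp add: \<phi>d \<phi>l \<phi>(3))
      also have "dif S z (v' - \<phi> v' *s \<alpha>) = dif S z v - (t + \<phi> v') *s dif S z \<alpha>"
      proof -
        have "v' - \<phi> v' *s \<alpha> = v + (- (t + \<phi> v')) *s \<alpha>"
          by (simp add: v'_def vec.scale_left_distrib algebra_simps)
        then have "dif S z (v' - \<phi> v' *s \<alpha>) = dif S z v + (- (t + \<phi> v')) *s dif S z \<alpha>" by (simp only: dSl)
        then show ?thesis by (simp add: vec.scale_minus_left)
      qed
      also have "norm \<dots> \<le> \<bar>M3\<bar> + cmod (t + \<phi> v') * (C * cmod Q)"
      proof (rule order_trans[OF norm_triangle_ineq4 add_mono])
        show "norm (dif S z v) \<le> \<bar>M3\<bar>" using M3[OF zb(3)] v(1) by simp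
        show "norm ((t + \<phi> v') *s dif S z \<alpha>) \<le> cmod (t + \<phi> v') * (C * cmod Q)"
          unfolding norm_vector_smult Q_def by (intro mult_left_mono S1[OF zU]) simp
      qed
      also have "cmod (t + \<phi> v') * (C * cmod Q) \<le> (cmod t + Y) * (C * cmod Q)"
        unfolding Y_def by (intro mult_right_mono norm_triangle_ineq) (use C in auto)
      also have "(cmod t + Y) * (C * cmod Q) = cmod (t * Q) * C + C * Y * cmod Q"
        by (simp add: norm_mult algebra_simps)
      also have "C * Y * cmod Q \<le> C * Y * 1" by (intro mult_left_mono Q1) (use C in \<open>simp add: Y_def\<close>)
      finally show ?thesis unfolding tQ b2_def by simp
    qed
    then have X2: "X \<le> (b2 + C * Y) / c0" using S2(1) by (simp add: le_divide_eq mult.commute)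
    have "norm v' \<le> Y * norm \<alpha> + (b2 + C * Y) / c0" using v'n X2 by linarith
    also have "\<dots> = Y * (norm \<alpha> + C / c0) + b2 / c0" by (simp add: algebra_simps add_divide_distrib)
    finally have v'2: "norm v' \<le> Y * (norm \<alpha> + C / c0) + b2 / c0" .
    have b20: "b2 / c0 \<ge> 0" using S2(1) C by (simp add: b2_def)
    have "cmod Q * (M1 * norm v') \<le> cmod Q * (M1 * (Y * (norm \<alpha> + C / c0) + b2 / c0))"
      by (intro mult_left_mono v'2 M1) simp
    also have "\<dots> = Y * (cmod Q * (M1 * (norm \<alpha> + C / c0))) + cmod Q * (M1 * (b2 / c0))" by (simp add: algebra_simps)
    also have "\<dots> \<le> Y * (1 / 2) + 1 * (M1 * (b2 / c0))"
    proof (intro add_mono mult_left_mono mult_right_mono Q1)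
      have "cmod Q * (M1 * (norm \<alpha> + C / c0)) \<le> 1 / (2 * (M1 * (norm \<alpha> + C / c0) + 1)) * (M1 * (norm \<alpha> + C / c0) + 1)"
        using Q\<eta> pos1 by (intro mult_mono) (auto simp: \<eta>_def)
      also have "\<dots> = 1 / 2" using pos1 by (simp add: divide_simps)
      finally show "cmod Q * (M1 * (norm \<alpha> + C / c0)) \<le> 1 / 2" .
      show "0 \<le> M1 * (b2 / c0)" by (rule mult_nonneg_nonneg[OF M1 b20])
    qed (auto simp: Y_def)
    finally have YY: "Y \<le> Y0" using Yle by (simp add: Y0_def)
    have "norm v' \<le> Y * norm \<alpha> + (b2 + C * Y) / c0" using v'n X2 by linarith
    also have "\<dots> \<le> K" unfolding K_def
      by (intro add_mono mult_right_mono divide_right_mono mult_left_mono YY order_refl) (use C S2(1) in auto)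
    finally show ?thesis by (simp add: v'_def t_def Q_def)
  qed
  moreover have "ball p d \<subseteq> U" using d(3) d0 by (auto simp: subset_iff)
  ultimately show thesis using that[of d K] d(1) unfolding c_def E_def E'_def by blast
qed

lemma hyperplane_frameD:
  assumes "hyperplane_frame G H \<phi> \<alpha>"
  shows "Vector_Spaces.linear (*s) (*) \<phi>" "\<phi> \<alpha> = 1" "\<phi> v = 0 \<longleftrightarrow> v \<in> H"
    "h \<in> H \<Longrightarrow> averaged_inner G \<alpha> h = 0" "card (pointwise_stab G H) \<ge> 2"
    "\<phi> (x + y) = \<phi> x + \<phi> y" "\<phi> (c *s x) = c * \<phi> x" "\<phi> (x - y) = \<phi> x - \<phi> y" "v - \<phi> v *s \<alpha> \<in> H"
    "g \<in> pointwise_stab G H \<Longrightarrow> \<phi> (g *v v) ^ card (pointwise_stab G H) = \<phi> v ^ card (pointwise_stab G H)"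
    "g \<in> pointwise_stab G H \<Longrightarrow> g *v v - \<phi> (g *v v) *s \<alpha> = v - \<phi> v *s \<alpha>"
    "\<exists>g\<in>pointwise_stab G H. \<forall>v. g *v v = (v - \<phi> v *s \<alpha>) + (exp (2 * of_real pi * \<i> / of_nat (card (pointwise_stab G H))) * \<phi> v) *s \<alpha>"
proof -
  let ?e = "card (pointwise_stab G H)"
  have l: "\<phi> (x + y) = \<phi> x + \<phi> y" "\<phi> (c *s x) = c * \<phi> x" for x y c
    using assms by (auto simp: hyperplane_frame_def clinear_iff)
  then show "\<phi> (x + y) = \<phi> x + \<phi> y" "\<phi> (c *s x) = c * \<phi> x" .
  have d: "\<phi> (x - y) = \<phi> x - \<phi> y" for x y using l(1)[of "x - y" y] by simp
  then show "\<phi> (x - y) = \<phi> x - \<phi> y" .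
  have b: "Vector_Spaces.linear (*s) (*) \<phi>" "\<phi> \<alpha> = 1" "\<And>v. \<phi> v = 0 \<longleftrightarrow> v \<in> H" "?e \<ge> 2"
    "\<And>h. h \<in> H \<Longrightarrow> averaged_inner G \<alpha> h = 0"
    "\<And>g. g \<in> pointwise_stab G H \<Longrightarrow> \<exists>\<zeta>. \<zeta> ^ card (pointwise_stab G H) = 1 \<and> (\<forall>v. \<phi> (g *v v) = \<zeta> * \<phi> v) \<and>
        (\<forall>v. g *v v - \<phi> (g *v v) *s \<alpha> = v - \<phi> v *s \<alpha>)"
    "\<And>\<zeta>. \<zeta> ^ ?e = 1 \<Longrightarrow> \<exists>g\<in>pointwise_stab G H. \<forall>v. g *v v = (v - \<phi> v *s \<alpha>) + (\<zeta> * \<phi> v) *s \<alpha>"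
    using assms unfolding hyperplane_frame_def by blast+
  show "Vector_Spaces.linear (*s) (*) \<phi>" "\<phi> \<alpha> = 1" "\<phi> v = 0 \<longleftrightarrow> v \<in> H" "?e \<ge> 2"
    "h \<in> H \<Longrightarrow> averaged_inner G \<alpha> h = 0" by (fact b)+
  show "v - \<phi> v *s \<alpha> \<in> H" unfolding b(3)[symmetric] by (simp add: d l b(2))
  show "g \<in> pointwise_stab G H \<Longrightarrow> g *v v - \<phi> (g *v v) *s \<alpha> = v - \<phi> v *s \<alpha>" using b(6) by blast
  show "\<phi> (g *v v) ^ ?e = \<phi> v ^ ?e" if gK: "g \<in> pointwise_stab G H"
  proof -
    obtain \<zeta> where "\<zeta> ^ ?e = 1" "\<And>v. \<phi> (g *v v) = \<zeta> * \<phi> v" using b(6)[OF gK] by blast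
    then show ?thesis by (simp add: power_mult_distrib)
  qed
  have "exp (2 * of_real pi * \<i> / of_nat ?e) ^ ?e = exp (of_nat ?e * (2 * of_real pi * \<i> / of_nat ?e))"
    by (rule exp_of_nat_mult[symmetric])
  also have "\<dots> = 1" using b(4) by (simp add: exp_two_pi_i mult_ac)
  finally show "\<exists>g\<in>pointwise_stab G H. \<forall>v. g *v v = (v - \<phi> v *s \<alpha>) + (exp (2 * of_real pi * \<i> / of_nat ?e) * \<phi> v) *s \<alpha>"
    by (rule b(7))
qed

text \<open>Points of the hyperplane with the smallest possible stabilizer, which is its pointwise stabilizer.\<close>

definition generic_on :: "(complex^'n^'n) set \<Rightarrow> (complex^'n) set \<Rightarrow> complex^'n \<Rightarrow> bool" where
  "generic_on G H p \<longleftrightarrow> H \<in> reflection_hyperplanes G \<and> p \<in> H \<and> stab G p \<subseteq> pointwise_stab G H"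

lemma (in finite_matrix_group) generic_slice:
  assumes "generic_on G H p" "slice G p B" "x \<in> B"
  shows "x \<in> discriminant_locus G \<longleftrightarrow> x \<in> H"
    and "x \<notin> H \<Longrightarrow> g \<in> stab G x \<Longrightarrow> g = mat 1"
proof -
  have H: "linear_hyperplane H" "H \<in> reflection_hyperplanes G"
    using assms(1) linear_hyperplane_reflection by (auto simp: generic_on_def)
  have fx: "fixed_space g = H" if g: "g \<in> G" "g \<noteq> mat 1" "x \<in> fixed_space g" for g
  proof (rule linear_hyperplane_subset_eq[OF H(1) vec_subspace_fixed_space])
    show "fixed_space g \<noteq> UNIV" using g(2) fixed_space_eq_UNIV by blast
    have "g \<in> stab G x" using g by (auto simp: stab_def fixed_space_def)
    then have "g \<in> pointwise_stab G H"
      using slice_stab_subset[OF assms(2,3)] assms(1) by (auto simp: generic_on_def)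
    then show "H \<subseteq> fixed_space g" by (auto simp: pointwise_stab_def fixed_space_def)
  qed
  show "x \<in> discriminant_locus G \<longleftrightarrow> x \<in> H"
  proof
    assume "x \<in> discriminant_locus G"
    then obtain s where s: "s \<in> G" "linear_hyperplane (fixed_space s)" "x \<in> fixed_space s"
      by (auto simp: discriminant_locus_def reflection_hyperplanes_def reflections_def)
    then have "s \<noteq> mat 1" using not_linear_hyperplane_UNIV fixed_space_eq_UNIV by metis
    then show "x \<in> H" using fx s by blast
  qed (use H(2) in \<open>auto simp: discriminant_locus_def\<close>)
  show "g = mat 1" if "x \<notin> H" "g \<in> stab G x"
    using fx[of g] that by (auto simp: stab_def fixed_space_def)
qed

context correspondence
begin

text \<open>The power of the second equation is invariant under the stabilizer, so that it becomes a function
  near the first point. That function vanishes on the hyperplane and is invariant under the rotations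
  about it, which gives the order of vanishing.\<close>

lemma transferred_equation:
  assumes p: "generic_on G1 H p" "hyperplane_frame G1 H \<phi> \<alpha>" and q: "generic_on G2 H' q" "hyperplane_frame G2 H' \<phi>' \<beta>"
    and pq: "R p q" and B: "slice G2 q B"
  shows "\<exists>T C d. holo_on T {z. \<exists>w\<in>B. R z w} \<and> (\<forall>z w. w \<in> B \<longrightarrow> R z w \<longrightarrow> T z = \<phi>' w ^ card (pointwise_stab G2 H')) \<and>
    C > 0 \<and> d > 0 \<and> ball p d \<subseteq> {z. \<exists>w\<in>B. R z w} \<and>
    (\<forall>z. z \<in> ball p d \<longrightarrow> cmod (T z) \<le> C * cmod (\<phi> z) ^ card (pointwise_stab G1 H))"
proof -
  let ?e = "card (pointwise_stab G1 H)" and ?e' = "card (pointwise_stab G2 H')"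
  note F = hyperplane_frameD[OF p(2)] and F' = hyperplane_frameD[OF q(2)]
  have Bo: "open B" "q \<in> B" using B by (auto simp: slice_def)
  have hk: "holo_on (\<lambda>w. \<phi>' w ^ ?e') B" by (intro holo_on_power holo_on_linear F')
  have inv: "\<phi>' (g *v w) ^ ?e' = \<phi>' w ^ ?e'" if "g \<in> stab G2 q" for g w
    using that q(1) F'(10) by (auto simp: generic_on_def)
  obtain T where T: "holo_on T {z. \<exists>w\<in>B. R z w}" "\<And>z w. w \<in> B \<Longrightarrow> R z w \<Longrightarrow> T z = \<phi>' w ^ ?e'"
    by (rule transfer[OF B hk]) (use inv in auto)
  define U where "U = {z. \<exists>w\<in>B. R z w}"
  have U: "open U" unfolding U_def by (rule open_related[OF Bo(1)])
  have pU: "p \<in> U" using pq Bo by (auto simp: U_def)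
  have pH: "p \<in> H" using p(1) by (simp add: generic_on_def)
  obtain C d where "C > 0" "d > 0" "ball p d \<subseteq> U" "\<And>z. z \<in> ball p d \<Longrightarrow> cmod (T z) \<le> C * cmod (\<phi> z) ^ ?e"
  proof (rule rotation_invariant_bound[OF U T(1)[folded U_def] pU F(1) _ F(2), of ?e])
    show "\<phi> p = 0" using F(3) pH by blast
    show "1 \<le> ?e" using F(5) by linarith
    show "T z = 0" if "z \<in> U" "\<phi> z = 0" for z
    proof -
      have "z \<in> discriminant_locus G1" using that(2) F(3) p(1) by (auto simp: generic_on_def discriminant_locus_def)
      obtain w where w: "w \<in> B" "R z w" using \<open>z \<in> U\<close> by (auto simp: U_def)
      with \<open>z \<in> discriminant_locus G1\<close> have "w \<in> discriminant_locus G2" using discriminant_iff[OF w(2)] by blast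
      then have "\<phi>' w = 0" using B.generic_slice(1)[OF q(1) B w(1)] F'(3) by blast
      then show ?thesis using T(2)[OF w] F'(5) by (simp add: power_0_left)
    qed
    show "T z' = T z" if z: "z \<in> U" "z' \<in> U" "z' = (z - \<phi> z *s \<alpha>) + (exp (2 * of_real pi * \<i> / of_nat ?e) * \<phi> z) *s \<alpha>" for z z'
    proof -
      obtain g where g: "g \<in> pointwise_stab G1 H" "g *v z = z'" using F(12) z(3) by metis
      obtain w where w: "w \<in> B" "R z w" using z(1) by (auto simp: U_def)
      have "R z' w" using act1[OF w(2)] g by (auto simp: pointwise_stab_def)
      then show ?thesis using T(2)[OF w(1)] w(2) by simp
    qed
  qed (rule that; assumption)
  then show ?thesis using T unfolding U_def by blast
qed

definition good_point :: "(complex^'n) set \<Rightarrow> complex^'n \<Rightarrow> bool" where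
  "good_point H p \<longleftrightarrow> generic_on G1 H p \<and> (\<exists>q H'. R p q \<and> generic_on G2 H' q)"

text \<open>In normal form near a good point the correspondence is given by an equation to the power
  \<open>e'\<close>, which is the \<open>e\<close>-th power of an equation times a unit, and by coordinates along the
  hyperplane. The inverse correspondence gives the lower bounds: that the unit has no zero and
  that the coordinates along the hyperplane are immersive.\<close>

lemma good_point_estimate:
  assumes good: "good_point H p" and frame: "hyperplane_frame G1 H \<phi> \<alpha>"
  obtains e' where "1 \<le> e'" "e' \<le> card G2"
    "\<And>x y. \<exists>d>0. \<exists>K. \<forall>z\<in>ball p d. z \<in> regular_points G1 \<longrightarrow>
       norm (lift_connection z x y - ((of_nat (card (pointwise_stab G1 H)) / of_nat e' - 1) * \<phi> x * \<phi> y / \<phi> z) *s \<alpha>) \<le> K"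
proof -
  interpret S: correspondence G2 G1 "\<lambda>w z. R z w" e2 e1 by (rule swap)
  obtain q H' where gp: "generic_on G1 H p" and pq: "R p q" and gq: "generic_on G2 H' q"
    using good by (auto simp: good_point_def)
  obtain \<phi>' \<beta> where frame': "hyperplane_frame G2 H' \<phi>' \<beta>"
    using B.ex_hyperplane_frame[of H'] gq unfolding generic_on_def by blast
  define e e' where "e = card (pointwise_stab G1 H)" and "e' = card (pointwise_stab G2 H')"
  note F = hyperplane_frameD[OF frame, folded e_def] and F' = hyperplane_frameD[OF frame', folded e'_def]
  have pH: "p \<in> H" "q \<in> H'" "stab G1 p \<subseteq> pointwise_stab G1 H" "stab G2 q \<subseteq> pointwise_stab G2 H'"
    using gp gq by (auto simp: generic_on_def)
  have \<phi>p: "\<phi> p = 0" "\<phi>' q = 0" using pH F(3) F'(3) by auto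
  obtain B1 where B1: "slice G1 p B1" using A.ex_slice[of UNIV p] by auto
  then have B1o: "open B1" "p \<in> B1" by (auto simp: slice_def)
  define O2 where "O2 = {w. \<exists>z\<in>B1. R z w}"
  have O2: "open O2" "q \<in> O2" unfolding O2_def using S.open_related[OF B1o(1)] B1o pq by auto
  \<comment> \<open>The functions \<open>t\<close> and \<open>s\<close> on the second space correspond to the power of the first equation and
    to the coordinates along the first hyperplane; \<open>T\<close> and \<open>S\<close> play the same role on the first space.\<close>
  obtain t C2 d2 where t: "holo_on t O2" "\<And>w z. z \<in> B1 \<Longrightarrow> R z w \<Longrightarrow> t w = \<phi> z ^ e"
    "C2 > 0" "d2 > 0" "ball q d2 \<subseteq> O2" "\<And>w. w \<in> ball q d2 \<Longrightarrow> cmod (t w) \<le> C2 * cmod (\<phi>' w) ^ e'"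
    using S.transferred_equation[OF gq frame' gp frame pq B1, folded O2_def e_def e'_def] by blast
  have "vholo_on (\<lambda>z. z - \<phi> z *s \<alpha>) B1" unfolding vholo_on_def
    by (simp add: holo_on_diff[OF holo_on_nth holo_on_mult[OF holo_on_linear[OF F(1)] holo_on_const]])
  then obtain s where s: "vholo_on s O2" "\<And>w z. z \<in> B1 \<Longrightarrow> R z w \<Longrightarrow> s w = z - \<phi> z *s \<alpha>"
    unfolding O2_def by (rule S.transfer_vector[OF B1]) (use pH F(11) in auto)
  obtain B2 where B2: "slice G2 q B2" "B2 \<subseteq> ball q d2" using B.ex_slice[of "ball q d2" q] t(4) by auto
  then have B2o: "open B2" "q \<in> B2" by (auto simp: slice_def)
  define O1 where "O1 = {z. \<exists>w\<in>B2. R z w}"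
  have O1: "open O1" "p \<in> O1" unfolding O1_def using open_related[OF B2o(1)] B2o pq by auto
  obtain T C1 d1 where T: "holo_on T O1" "\<And>z w. w \<in> B2 \<Longrightarrow> R z w \<Longrightarrow> T z = \<phi>' w ^ e'"
    "C1 > 0" "d1 > 0" "ball p d1 \<subseteq> O1" "\<And>z. z \<in> ball p d1 \<Longrightarrow> cmod (T z) \<le> C1 * cmod (\<phi> z) ^ e"
    using transferred_equation[OF gp frame gq frame' pq B2(1), folded O1_def e_def e'_def] by blast
  define P where "P w = w - \<phi>' w *s \<beta>" for w
  have P: "vholo_on P V" for V unfolding vholo_on_def P_def
    by (simp add: holo_on_diff[OF holo_on_nth holo_on_mult[OF holo_on_linear[OF F'(1)] holo_on_const]])
  have Pl: "P (x + y) = P x + P y" "P (c *s x) = c *s P x" for x y c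
    by (simp_all add: P_def F' vec.scale_left_distrib vec.scale_right_diff_distrib)
  have "bounded_linear P"
    unfolding P_def by (intro bounded_linear_sub bounded_linear_ident
        bounded_linear_compose[OF bounded_linear_vsmult_left bounded_linear_clinear[OF F'(1)]])
  then have dP: "dif P w = P" for w by (rule dif_linear)
  obtain S where S: "vholo_on S O1" "\<And>z w. w \<in> B2 \<Longrightarrow> R z w \<Longrightarrow> S z = P w"
    unfolding O1_def by (rule transfer_vector[OF B2(1) P]) (use pH F'(11) in \<open>auto simp: P_def\<close>)
  have T2: "cmod (\<phi> z) ^ e \<le> C2 * cmod (T z)" if z: "z \<in> O1 \<inter> B1" for z
  proof -
    obtain w where w: "w \<in> B2" "R z w" using z by (auto simp: O1_def)
    have "cmod (\<phi> z) ^ e = cmod (t w)" using t(2)[of z w] z w by (simp add: norm_power)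
    also have "\<dots> \<le> C2 * cmod (\<phi>' w) ^ e'" using t(6) w B2 by blast
    also have "\<dots> = C2 * cmod (T z)" using T(2)[OF w] by (simp add: norm_power)
    finally show ?thesis .
  qed
  \<comment> \<open>The discriminants correspond, so a point of the first hyperplane is related to one of the second,
    which is determined by its coordinates along the hyperplane.\<close>
  have SH: "S z \<in> O2 \<and> s (S z) = z" if z: "z \<in> O1 \<inter> B1" "\<phi> z = 0" for z
  proof -
    obtain w where w: "w \<in> B2" "R z w" using z by (auto simp: O1_def)
    have "z \<in> discriminant_locus G1" using z(2) F(3) gp by (auto simp: generic_on_def discriminant_locus_def)
    then have "\<phi>' w = 0" using discriminant_iff[OF w(2)] B.generic_slice(1)[OF gq B2(1) w(1)] F'(3) by blast
    then have "S z = w" using S(2)[OF w] by (simp add: P_def)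
    then show ?thesis using s(2)[of z w] z w by (auto simp: O2_def)
  qed
  have Sp: "S p = q" using S(2)[OF B2o(2) pq] \<phi>p by (simp add: P_def)
  \<comment> \<open>Hence \<open>S\<close> is immersive along the hyperplane.\<close>
  have dsS: "dif s q (dif S p h) = h" if h: "\<phi> h = 0" for h
  proof -
    define W where "W = O1 \<inter> S -` O2 \<inter> B1"
    have W: "open W" unfolding W_def
      by (intro open_Int continuous_open_preimage vholo_on_continuous[OF S(1)] O1 O2 B1o)
    have pW: "p \<in> W" using O1 O2 B1o Sp by (simp add: W_def)
    have SW: "vholo_on S W" "S ` W \<subseteq> O2" using S(1) by (auto simp: W_def intro: vholo_on_subset)
    have "dif s q (dif S p h) $ i = h $ i" for i
    proof -
      have si: "holo_on (\<lambda>w. s w $ i) O2" using s(1) by (simp add: vholo_on_def)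
      note hc = holo_on_compose[OF si SW]
      have "((\<lambda>t. s (S (p + t *s h)) $ i) has_field_derivative dif (\<lambda>z. s (S z) $ i) (p + 0 *s h) h) (at 0)"
        by (rule holo_on_line[OF hc]) (use pW in simp)
      then have 1: "((\<lambda>t. s (S (p + t *s h)) $ i) has_field_derivative dif s q (dif S p h) $ i) (at 0)"
        using dif_compose[OF si SW pW, of h] dif_nth[OF s(1), of q] O2(2) Sp by simp
      have 2: "((\<lambda>t. (p + t *s h) $ i) has_field_derivative h $ i) (at 0)"
        by (auto intro!: derivative_eq_intros)
      have N: "open {t. p + t *s h \<in> W}" "0 \<in> {t. p + t *s h \<in> W}" using open_line[OF W] pW by auto
      have "((\<lambda>t. s (S (p + t *s h)) $ i) has_field_derivative h $ i) (at 0)"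
      proof (rule has_field_derivative_transform_within_open[OF 2 N])
        fix t assume "t \<in> {t. p + t *s h \<in> W}"
        then have "p + t *s h \<in> O1 \<inter> B1" by (auto simp: W_def)
        moreover have "\<phi> (p + t *s h) = 0" using \<phi>p(1) h by (simp only: F(6,7)) simp
        ultimately show "(p + t *s h) $ i = s (S (p + t *s h)) $ i" using SH[of "p + t *s h"] by simp
      qed
      from DERIV_unique[OF 1 this] show ?thesis .
    qed
    then show ?thesis by (simp add: vec_eq_iff)
  qed
  obtain k where k: "k > 0" "\<And>y. norm (dif s q y) \<le> norm y * k"
    using bounded_linear.pos_bounded has_derivative_bounded_linear[OF vholo_on_has_derivative[OF s(1) O2(2)]] by blast
  obtain d3 where d3: "d3 > 0" "ball p d3 \<subseteq> O1" "\<And>z h. z \<in> ball p d3 \<Longrightarrow> norm (dif S z h - dif S p h) \<le> 1 / (2 * k) * norm h"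
  proof -
    have "1 / (2 * k) > 0" using k(1) by simp
    then show thesis
      by (rule dif_operator_continuous[OF O1(1) S(1) O1(2)]) (rule that; (assumption | blast))
  qed
  have S2: "1 / (2 * k) * norm h \<le> norm (dif S z h)" if "z \<in> ball p d3" "\<phi> h = 0" for z h
  proof -
    have "norm h \<le> norm (dif S p h) * k" using k(2)[of "dif S p h"] dsS[OF that(2)] by simp
    then have "1 / k * norm h \<le> norm (dif S p h)" using k(1) by (simp add: field_simps)
    moreover have "norm (dif S p h) \<le> norm (dif S z h) + norm (dif S z h - dif S p h)"
      using norm_triangle_ineq4[of "dif S z h" "dif S z h - dif S p h"] by simp
    moreover have "1 / k * norm h = 1 / (2 * k) * norm h + 1 / (2 * k) * norm h" using k(1) by (simp add: field_simps)
    ultimately show ?thesis using d3(3)[OF that(1), of h] by linarith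
  qed
  \<comment> \<open>The normal derivative of \<open>S\<close> vanishes on the hyperplane, as \<open>S\<close> is invariant under a nontrivial
    rotation about it.\<close>
  have S0: "dif S z \<alpha> $ i = 0" if z: "z \<in> O1" "\<phi> z = 0" for z i
  proof -
    obtain g where g: "g \<in> pointwise_stab G1 H" "\<And>v. g *v v = (v - \<phi> v *s \<alpha>) + (exp (2 * of_real pi * \<i> / of_nat e) * \<phi> v) *s \<alpha>"
      using F(12) by blast
    define \<omega> where "\<omega> = exp (2 * of_real pi * \<i> / of_nat e)"
    have "exp (2 * of_real pi * \<i> * of_nat 1 / of_nat e) \<noteq> 1" using complex_root_unity_eq_1[of e 1] F(5) by auto
    then have \<omega>: "\<omega> \<noteq> 1" by (simp add: \<omega>_def)
    have Si: "holo_on (\<lambda>u. S u $ i) O1" using S(1) by (simp add: vholo_on_def)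
    have 1: "((\<lambda>t. S (z + t *s \<alpha>) $ i) has_field_derivative dif S z \<alpha> $ i) (at 0)"
      using holo_on_line[OF Si, of z 0 \<alpha>] z(1) dif_nth[OF S(1) z(1)] by simp
    have 2: "((\<lambda>t. S (z + (\<omega> * t) *s \<alpha>) $ i) has_field_derivative dif S z \<alpha> $ i * \<omega>) (at 0)"
      by (rule DERIV_chain2[where f = "\<lambda>t. S (z + t *s \<alpha>) $ i" and g = "\<lambda>t. \<omega> * t"])
         (use 1 in simp, rule DERIV_cmult_Id)
    have N: "open {t. z + t *s \<alpha> \<in> O1}" "0 \<in> {t. z + t *s \<alpha> \<in> O1}" using open_line[OF O1(1)] z(1) by auto
    have "((\<lambda>t. S (z + (\<omega> * t) *s \<alpha>) $ i) has_field_derivative dif S z \<alpha> $ i) (at 0)"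
    proof (rule has_field_derivative_transform_within_open[OF 1 N])
      fix t assume "t \<in> {t. z + t *s \<alpha> \<in> O1}"
      then obtain w where w: "w \<in> B2" "R (z + t *s \<alpha>) w" by (auto simp: O1_def)
      have "g *v (z + t *s \<alpha>) = z + (\<omega> * t) *s \<alpha>" by (simp add: g(2) F z(2) \<omega>_def)
      then have "R (z + (\<omega> * t) *s \<alpha>) w" using act1[OF w(2), of g] g(1) by (simp add: pointwise_stab_def)
      then show "S (z + t *s \<alpha>) $ i = S (z + (\<omega> * t) *s \<alpha>) $ i" using S(2)[OF w(1)] w(2) by simp
    qed
    from DERIV_unique[OF 2 this] \<omega> show ?thesis by simp
  qed
  have "\<exists>C d. C > 0 \<and> d > 0 \<and> (\<forall>z\<in>ball p d. cmod (dif S z \<alpha> $ i) \<le> C * cmod (\<phi> z))" for i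
  proof -
    have "holo_on (\<lambda>z. dif S z \<alpha> $ i) O1" using vholo_on_dif[OF O1(1) S(1)] by (simp add: vholo_on_def)
    then obtain C d where Cd: "C > 0" "d > 0" "ball p d \<subseteq> O1" "\<And>z. z \<in> ball p d \<Longrightarrow> cmod (dif S z \<alpha> $ i) \<le> C * cmod (\<phi> z) ^ 1"
    proof (rule rotation_invariant_bound[OF O1(1) _ O1(2) F(1) \<phi>p(1) F(2), of _ 1])
      show "dif S z' \<alpha> $ i = dif S z \<alpha> $ i"
        if "z' = z - \<phi> z *s \<alpha> + (exp (2 * of_real pi * \<i> / of_nat 1) * \<phi> z) *s \<alpha>" for z z'
        using that by (simp add: exp_two_pi_i)
      show "dif S z \<alpha> $ i = 0" if "z \<in> O1" "\<phi> z = 0" for z by (rule S0[OF that])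
      show "(1::nat) \<le> 1" by simp
    qed (rule that; (assumption | blast))
    then show ?thesis by (intro exI[of _ C] exI[of _ d] conjI ballI) (use Cd(4) in auto)
  qed
  then obtain C4 d4 where C4: "\<And>i. C4 i > 0" "\<And>i. d4 i > 0" "\<And>i z. z \<in> ball p (d4 i) \<Longrightarrow> cmod (dif S z \<alpha> $ i) \<le> C4 i * cmod (\<phi> z)"
    by metis
  define d5 where "d5 = Min (range d4)"
  have d5: "d5 > 0" "\<And>i. d5 \<le> d4 i" using C4(2) by (simp_all add: d5_def)
  have S1: "norm (dif S z \<alpha>) \<le> sum C4 UNIV * cmod (\<phi> z)" if "z \<in> ball p d5" for z
  proof -
    have "norm (dif S z \<alpha>) \<le> (\<Sum>i\<in>UNIV. cmod (dif S z \<alpha> $ i))"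
      unfolding norm_vec_def by (rule L2_set_le_sum) simp
    also have "\<dots> \<le> (\<Sum>i\<in>UNIV. C4 i * cmod (\<phi> z))"
    proof (intro sum_mono C4(3))
      fix i show "z \<in> ball p (d4 i)" using that d5(2)[of i] by simp
    qed
    finally show ?thesis by (simp add: sum_distrib_right)
  qed
  define U where "U = ball p d1 \<inter> ball p d3 \<inter> ball p d5 \<inter> (O1 \<inter> B1)"
  define C where "C = C1 + C2 + sum C4 UNIV"
  have sC4: "sum C4 UNIV \<ge> 0" using C4(1) by (intro sum_nonneg) (simp add: less_imp_le)
  have C: "C > 0" "C1 \<le> C" "C2 \<le> C" "sum C4 UNIV \<le> C" using t(3) T(3) sC4 by (auto simp: C_def)
  have U: "open U" "p \<in> U" "U \<subseteq> O1" using O1 B1o T(4) d3(1) d5(1) by (auto simp: U_def)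
  have e1: "1 \<le> e" "1 \<le> e'" using F(5) F'(5) by auto
  show thesis
  proof (rule that[of e'])
    show "1 \<le> e'" by (rule e1)
    show "e' \<le> card G2" unfolding e'_def
      by (rule card_mono[OF B.finite_G]) (auto simp: pointwise_stab_def)
    fix x y
    obtain d K where dK: "d > 0" "ball p d \<subseteq> U"
      "\<And>z v \<psi> N. z \<in> ball p d \<Longrightarrow> \<phi> z \<noteq> 0 \<Longrightarrow> open N \<Longrightarrow> z \<in> N \<Longrightarrow> N \<subseteq> U \<Longrightarrow> holo_on \<psi> N \<Longrightarrow>
       (\<And>w. w \<in> N \<Longrightarrow> \<psi> w ^ e' = T w) \<Longrightarrow> dif S z v = dif (\<lambda>w. dif S w y) z x \<Longrightarrow>
       dif \<psi> z v = dif (\<lambda>w. dif \<psi> w y) z x \<Longrightarrow>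
       norm (v - ((of_nat e / of_nat e' - 1) * \<phi> x * \<phi> y / \<phi> z) *s \<alpha>) \<le> K"
    proof (rule log_connection_estimate[OF U(1,2) F(1) \<phi>p(1) F(2) holo_on_subset[OF T(1) U(3)] vholo_on_subset[OF S(1) U(3)] e1 C(1)])
      show "cmod (T z) \<le> C * cmod (\<phi> z) ^ e" if "z \<in> U" for z
        by (rule order_trans[OF T(6) mult_right_mono[OF C(2)]]) (use that in \<open>auto simp: U_def\<close>)
      show "cmod (\<phi> z) ^ e \<le> C * cmod (T z)" if "z \<in> U" for z
        by (rule order_trans[OF T2 mult_right_mono[OF C(3)]]) (use that in \<open>auto simp: U_def\<close>)
      show "norm (dif S z \<alpha>) \<le> C * cmod (\<phi> z)" if "z \<in> U" for z
        by (rule order_trans[OF S1 mult_right_mono[OF C(4)]]) (use that in \<open>auto simp: U_def\<close>)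
      show "1 / (2 * k) > 0" using k(1) by simp
      show "1 / (2 * k) * norm h \<le> norm (dif S z h)" if "z \<in> U" "\<phi> h = 0" for z h
        by (rule S2) (use that in \<open>auto simp: U_def\<close>)
    qed (rule that; (assumption | blast))
    have "norm (lift_connection z x y - ((of_nat e / of_nat e' - 1) * \<phi> x * \<phi> y / \<phi> z) *s \<alpha>) \<le> K"
      if z: "z \<in> ball p d" "z \<in> regular_points G1" for z
    proof -
      have zU: "z \<in> U" using z dK(2) by blast
      then have zO: "z \<in> O1" "z \<in> B1" by (auto simp: U_def)
      obtain w where w: "w \<in> B2" "R z w" using zO by (auto simp: O1_def)
      obtain V Fl where L: "is_lift V Fl" "z \<in> V" "Fl z = w" using ex_lift[OF w(2) z(2)] by metis
      have Vo: "open V" "vholo_on Fl V" using L by (auto simp: is_lift_def)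
      \<comment> \<open>On \<open>N\<close> the functions \<open>T\<close> and \<open>S\<close> are the power of the second equation and the coordinates along the
        second hyperplane, composed with the lift.\<close>
      define N where "N = (V \<inter> Fl -` B2) \<inter> U"
      have "open (V \<inter> Fl -` B2)" by (intro continuous_open_preimage vholo_on_continuous Vo B2o)
      then have N: "open N" "z \<in> N" "N \<subseteq> U" "N \<subseteq> V"
        unfolding N_def using zU L w U by auto
      have FN: "vholo_on Fl N" by (rule vholo_on_subset[OF Vo(2) N(4)])
      have eq: "T u = \<phi>' (Fl u) ^ e' \<and> S u = P (Fl u)" if "u \<in> N" for u
        using that L(1) T(2) S(2) by (auto simp: N_def is_lift_def)
      have h\<phi>': "holo_on \<phi>' V" for V by (rule holo_on_linear[OF F'(1)])
      have d\<phi>': "dif \<phi>' w = \<phi>'" for w by (rule dif_linear[OF bounded_linear_clinear[OF F'(1)]])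
      have im: "Fl ` N \<subseteq> UNIV" by simp
      have d1: "dif (\<lambda>u. \<phi>' (Fl u)) u y = \<phi>' (dif Fl u y)" if "u \<in> N" for u y
        using dif_compose[OF h\<phi>' FN im that] by (simp add: d\<phi>')
      have d1': "dif S u y = P (dif Fl u y)" if "u \<in> N" for u y
      proof -
        have "dif S u y = dif (\<lambda>u. P (Fl u)) u y"
          by (rule fun_cong[OF dif_cong_open[OF N(1) that]]) (use eq in blast)
        then show ?thesis using vdif_compose[OF P FN im that] by (simp add: dP)
      qed
      note FN2 = vholo_on_dif[OF N(1) FN, of y]
      have im2: "(\<lambda>u. dif Fl u y) ` N \<subseteq> UNIV" by simp
      have "dif (\<lambda>w. dif (\<lambda>u. \<phi>' (Fl u)) w y) z x = dif (\<lambda>w. \<phi>' (dif Fl w y)) z x"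
        by (rule fun_cong[OF dif_cong_open[OF N(1,2)]]) (rule d1)
      also have "\<dots> = \<phi>' (dif (\<lambda>u. dif Fl u y) z x)"
        using dif_compose[OF h\<phi>' FN2 im2 N(2)] by (simp add: d\<phi>')
      finally have d2: "dif (\<lambda>w. dif (\<lambda>u. \<phi>' (Fl u)) w y) z x = \<phi>' (dif (\<lambda>u. dif Fl u y) z x)" .
      have "dif (\<lambda>w. dif S w y) z x = dif (\<lambda>w. P (dif Fl w y)) z x"
        by (rule fun_cong[OF dif_cong_open[OF N(1,2)]]) (rule d1')
      also have "\<dots> = P (dif (\<lambda>u. dif Fl u y) z x)"
        using vdif_compose[OF P FN2 im2 N(2)] by (simp add: dP)
      finally have d2': "dif (\<lambda>w. dif S w y) z x = P (dif (\<lambda>u. dif Fl u y) z x)" .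
      have "z \<notin> discriminant_locus G1" using z(2) A.regular_subset by blast
      then have "\<phi> z \<noteq> 0" using F(3) gp by (auto simp: generic_on_def discriminant_locus_def)
      note con = lift_connection[OF L(1,2) z(2), of x y]
      have h: "holo_on (\<lambda>u. \<phi>' (Fl u)) N" by (rule holo_on_compose[OF h\<phi>' FN im])
      have a: "\<phi>' (Fl w) ^ e' = T w" if "w \<in> N" for w using eq[OF that] by simp
      have b: "dif S z (lift_connection z x y) = dif (\<lambda>w. dif S w y) z x"
        by (simp only: d1'[OF N(2)] con d2')
      have c: "dif (\<lambda>u. \<phi>' (Fl u)) z (lift_connection z x y) = dif (\<lambda>w. dif (\<lambda>u. \<phi>' (Fl u)) w y) z x"
        by (simp only: d1[OF N(2)] con d2)
      show ?thesis by (rule dK(3)[OF z(1) \<open>\<phi> z \<noteq> 0\<close> N(1-3) h a b c])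
    qed
    then show "\<exists>d>0. \<exists>K. \<forall>z\<in>ball p d. z \<in> regular_points G1 \<longrightarrow>
       norm (lift_connection z x y - ((of_nat (card (pointwise_stab G1 H)) / of_nat e' - 1) * \<phi> x * \<phi> y / \<phi> z) *s \<alpha>) \<le> K"
      using dK(1) unfolding e_def by blast
  qed
qed

end

section \<open>Good points are dense\<close>

lemma real_dim_span:
  fixes B :: "(complex^'n) set"
  assumes "finite B" "vec.independent B"
  shows "dim (vec.span B) = 2 * card B"
  using assms
proof (induction B rule: finite_induct)
  case empty
  then show ?case by simp
next
  case (insert a B)
  have ind: "vec.independent B" "a \<notin> vec.span B"
    using insert.prems insert.hyps(2) by (auto simp: vec.independent_insert)
  define S where "S = vec.span B"
  have S: "vec.subspace S" "subspace S" using csubspace_imp_subspace by (auto simp: S_def)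
  have spS: "span S = S" using S(2) by (simp add: span_eq_iff)
  have re: "r *\<^sub>R x = complex_of_real r *s x" for r and x :: "complex^'n"
    by (simp add: vec_eq_iff) (simp add: scaleR_conv_of_real)
  have "vec.span (insert a B) = span (insert a (insert (\<i> *s a) S))"
  proof
    have "subspace (vec.span (insert a B))" by (intro csubspace_imp_subspace) simp
    moreover have "insert a (insert (\<i> *s a) S) \<subseteq> vec.span (insert a B)"
      using vec.span_mono[of B "insert a B"] by (auto simp: S_def intro: vec.span_base vec.span_scale)
    ultimately show "span (insert a (insert (\<i> *s a) S)) \<subseteq> vec.span (insert a B)"
      by (simp add: span_minimal)
    show "vec.span (insert a B) \<subseteq> span (insert a (insert (\<i> *s a) S))"
    proof
      fix x assume "x \<in> vec.span (insert a B)"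
      then obtain k where k: "x - k *s a \<in> S" unfolding S_def using vec.span_breakdown_eq by blast
      have "complex_of_real (Re k) + complex_of_real (Im k) * \<i> = k" by (simp add: complex_eq_iff)
      then have "complex_of_real (Re k) *s a + (complex_of_real (Im k) * \<i>) *s a = k *s a"
        by (simp only: vec.scale_left_distrib[symmetric])
      then have "x = Re k *\<^sub>R a + Im k *\<^sub>R (\<i> *s a) + (x - k *s a)"
        unfolding re vector_smult_assoc by simp
      also have "\<dots> \<in> span (insert a (insert (\<i> *s a) S))"
        by (intro span_add span_scale span_base) (use k in auto)
      finally show "x \<in> span (insert a (insert (\<i> *s a) S))" .
    qed
  qed
  moreover have "\<i> *s a \<notin> span S"
  proof
    assume "\<i> *s a \<in> span S"
    then have "- \<i> *s (\<i> *s a) \<in> S" unfolding spS by (rule vec.subspace_scale[OF S(1)])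
    then show False using ind(2) by (simp add: S_def vector_smult_assoc)
  qed
  moreover have "a \<notin> span (insert (\<i> *s a) S)"
  proof
    assume "a \<in> span (insert (\<i> *s a) S)"
    then obtain k where "a - k *\<^sub>R (\<i> *s a) \<in> S" using span_breakdown_eq[of a "\<i> *s a" S] spS by auto
    then have "(1 - of_real k * \<i>) *s a \<in> S"
      by (simp add: re vector_smult_assoc vec.scale_left_diff_distrib)
    moreover have "1 - of_real k * \<i> \<noteq> 0" by (simp add: complex_eq_iff)
    ultimately have "inverse (1 - of_real k * \<i>) *s ((1 - of_real k * \<i>) *s a) \<in> S" "1 - of_real k * \<i> \<noteq> 0"
      using vec.subspace_scale[OF S(1)] by blast+
    then have "a \<in> S" by (metis left_inverse vector_smult_assoc vector_smult_lid)
    then show False using ind(2) by (simp add: S_def)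
  qed
  ultimately have "dim (vec.span (insert a B)) = dim S + 2" by (simp add: dim_insert)
  then show ?case using insert.IH[OF ind(1)] insert.hyps by (simp add: S_def)
qed

lemma real_dim_csubspace:
  assumes "vec.subspace (L :: (complex^'n) set)"
  shows "dim L = 2 * vec.dim L"
proof -
  obtain B where B: "B \<subseteq> L" "vec.independent B" "L \<subseteq> vec.span B" "card B = vec.dim L"
    using vec.basis_exists[of L] by metis
  have "vec.span B = L" using B assms by (metis subset_antisym vec.span_minimal)
  moreover have "finite B" using B(2) by (rule vec.finiteI_independent)
  ultimately show ?thesis using real_dim_span[of B] B by simp
qed

lemma openin_csubspace_avoid:
  fixes H :: "(complex^'n) set"
  assumes "vec.subspace H" "finite \<M>" "\<And>M. M \<in> \<M> \<Longrightarrow> vec.subspace M \<and> \<not> H \<subseteq> M" "open W" "W \<inter> H \<noteq> {}"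
  shows "\<exists>p\<in>W \<inter> H. p \<notin> \<Union>\<M>"
  using assms(2-5)
proof (induction \<M> arbitrary: W rule: finite_induct)
  case empty then show ?case by auto
next
  case (insert M \<M>)
  have M: "vec.subspace M" "\<not> H \<subseteq> M" using insert.prems(1) by auto
  have "(W - M) \<inter> H \<noteq> {}"
  proof
    assume e: "(W - M) \<inter> H = {}"
    obtain p where p: "p \<in> W" "p \<in> H" using insert.prems(3) by blast
    then have pM: "p \<in> M" using e by blast
    obtain h where h: "h \<in> H" "h \<notin> M" using M(2) by blast
    have "open {t. p + t *s h \<in> W}" "0 \<in> {t. p + t *s h \<in> W}"
      using open_line[OF insert.prems(2)] p by auto
    then obtain r where r: "r > 0" "ball 0 r \<subseteq> {t. p + t *s h \<in> W}" using open_contains_ball by blast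
    define t where "t = complex_of_real (r / 2)"
    have t: "t \<in> ball 0 r" "t \<noteq> 0" using r(1) by (auto simp: t_def)
    then have "p + t *s h \<in> W" "p + t *s h \<in> H"
      using r(2) p(2) h(1) assms(1) by (auto intro: vec.subspace_add vec.subspace_scale)
    then have "p + t *s h \<in> M" using e by blast
    then have "(p + t *s h) - p \<in> M" by (rule vec.subspace_diff[OF M(1) _ pM])
    then have "inverse t *s ((p + t *s h) - p) \<in> M" by (rule vec.subspace_scale[OF M(1)])
    then show False using t(2) h(2) by (simp add: vector_smult_assoc)
  qed
  moreover have "open (W - M)" using insert.prems(2) csubspace_closed[OF M(1)] by auto
  ultimately obtain p where "p \<in> (W - M) \<inter> H" "p \<notin> \<Union>\<M>" using insert.IH[of "W - M"] insert.prems(1) by auto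
  then show ?case by auto
qed

lemma (in finite_matrix_group) generic_dense:
  assumes H: "H \<in> reflection_hyperplanes G" and W: "open W" "W \<inter> H \<noteq> {}"
  shows "\<exists>p\<in>W. generic_on G H p"
proof -
  have sub: "vec.subspace H" using linear_hyperplane_reflection[OF H] by (simp add: linear_hyperplane_def)
  define \<M> where "\<M> = fixed_space ` {g\<in>G. \<not> H \<subseteq> fixed_space g}"
  have "finite \<M>" "\<And>M. M \<in> \<M> \<Longrightarrow> vec.subspace M \<and> \<not> H \<subseteq> M"
    using finite_G vec_subspace_fixed_space by (auto simp: \<M>_def)
  from openin_csubspace_avoid[OF sub this W]
  obtain p where p: "p \<in> W \<inter> H" "p \<notin> \<Union>(fixed_space ` {g\<in>G. \<not> H \<subseteq> fixed_space g})"
    unfolding \<M>_def by blast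
  then have "generic_on G H p"
    using H by (auto simp: generic_on_def stab_def pointwise_stab_def fixed_space_def)
  then show ?thesis using p by blast
qed

lemma (in finite_matrix_group) slice_generic:
  "generic_on G H p \<Longrightarrow> slice G p B \<Longrightarrow> x \<in> B \<Longrightarrow> x \<in> H \<Longrightarrow> generic_on G H x"
  using slice_stab_subset[of p B x] by (auto simp: generic_on_def)

context correspondence
begin

lemma card_le: "CARD('n) \<le> CARD('m)"
proof -
  obtain z where z: "z \<in> regular_points G1" using A.regular_dense[of UNIV] by auto
  obtain w where w: "R z w" using total1 by blast
  obtain U F \<Psi> where L: "vholo_on (F :: complex^'n \<Rightarrow> complex^'m) U" "open U" "z \<in> U" "\<And>u. u \<in> U \<Longrightarrow> \<Psi> (F u) = u"
    by (rule ex_local_lift[OF w z regular_if_related[OF w z]]) (rule that; (assumption | blast))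
  have "DIM(complex^'n) \<le> DIM(complex^'m)"
    by (rule invariance_of_dimension[OF vholo_on_continuous[OF L(1)] L(2)])
       (use L in \<open>auto intro: inj_on_inverseI\<close>)
  then show ?thesis by simp
qed

lemma card_eq: "CARD('n) = CARD('m)"
proof -
  interpret S: correspondence G2 G1 "\<lambda>w z. R z w" e2 e1 by (rule swap)
  show ?thesis using card_le S.card_le by linarith
qed

text \<open>Where the stabilizer of the image is as small as possible, the correspondence maps the
  hyperplane injectively into the fixed space of that stabilizer. By invariance of dimension this
  fixed space is a hyperplane.\<close>

lemma good_point_dense:
  assumes H: "H \<in> reflection_hyperplanes G1" and W: "open W" "W \<inter> H \<noteq> {}"
  shows "\<exists>p\<in>W \<inter> H. good_point H p"
proof -
  have lH: "linear_hyperplane H" by (rule A.linear_hyperplane_reflection[OF H])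
  then have subH: "vec.subspace H" by (simp add: linear_hyperplane_def)
  obtain p0 where p0: "p0 \<in> W" "generic_on G1 H p0" using A.generic_dense[OF H W] by blast
  obtain B1 where B1: "slice G1 p0 B1" "B1 \<subseteq> W" using A.ex_slice[OF W(1) p0(1)] by blast
  have B1o: "open B1" "p0 \<in> B1" using B1 by (auto simp: slice_def)
  have "\<exists>x. (fst x \<in> B1 \<inter> H \<and> R (fst x) (snd x)) \<and>
      (\<forall>y. fst y \<in> B1 \<inter> H \<and> R (fst y) (snd y) \<longrightarrow> card (stab G2 (snd x)) \<le> card (stab G2 (snd y)))"
  proof (rule ex_has_least_nat)
    show "fst (p0, SOME w. R p0 w) \<in> B1 \<inter> H \<and> R (fst (p0, SOME w. R p0 w)) (snd (p0, SOME w. R p0 w))"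
      using B1o p0(2) someI_ex[OF total1[of p0]] by (simp add: generic_on_def)
  qed
  then obtain u0 w0 where u0: "u0 \<in> B1" "u0 \<in> H" "R u0 w0"
    and min: "\<And>u w. u \<in> B1 \<Longrightarrow> u \<in> H \<Longrightarrow> R u w \<Longrightarrow> card (stab G2 w0) \<le> card (stab G2 w)" by auto
  obtain B2 where B2: "slice G2 w0 B2" using B.ex_slice[of UNIV w0] by auto
  then have B2o: "open B2" "w0 \<in> B2" by (auto simp: slice_def)
  define L where "L = \<Inter>(fixed_space ` stab G2 w0)"
  have L: "vec.subspace L" unfolding L_def
    by (rule vec.subspace_Inter) (auto simp: vec_subspace_fixed_space)
  define S where "S = H \<inter> ({z. \<exists>w\<in>B2. R z w} \<inter> B1)"
  have w: "w \<in> L" if "u \<in> B1" "u \<in> H" "R u w" "w \<in> B2" for u w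
  proof -
    have "stab G2 w \<subseteq> stab G2 w0" by (rule B.slice_stab_subset[OF B2 that(4)])
    then have "stab G2 w = stab G2 w0"
      using min[OF that(1-3)] by (metis B.finite_stab card_seteq)
    then show ?thesis by (auto simp: L_def fixed_space_def stab_def)
  qed
  \<comment> \<open>The correspondence on the hyperplane, as a function with values near \<open>w0\<close>.\<close>
  define \<sigma> where "\<sigma> u = (SOME w. w \<in> B2 \<and> R u w)" for u
  have \<sigma>: "\<sigma> u \<in> B2 \<and> R u (\<sigma> u)" if "u \<in> S" for u
    unfolding \<sigma>_def by (rule someI_ex) (use that in \<open>auto simp: S_def\<close>)
  have \<sigma>eq: "\<sigma> u = w" if u: "u \<in> S" "w \<in> B2" "R u w" for u w
  proof -
    obtain g where g: "g \<in> G2" "\<sigma> u = g *v w" using orbit2[OF u(3)] \<sigma>[OF u(1)] by blast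
    then have "g \<in> stab G2 w0" using B2 \<sigma>[OF u(1)] u(2) unfolding slice_def by metis
    moreover have "w \<in> L" using w u by (auto simp: S_def)
    ultimately show ?thesis using g(2) by (auto simp: L_def fixed_space_def)
  qed
  have "dim H \<le> dim L"
  proof (rule invariance_of_dimension_subspaces)
    show "openin (top_of_set H) S" unfolding S_def
      by (intro openin_open_Int open_Int open_related B2o B1o)
    show "subspace H" "subspace L" using subH L by (auto intro: csubspace_imp_subspace)
    show "\<sigma> \<in> S \<rightarrow> L" using \<sigma> w by (auto simp: S_def)
    show "S \<noteq> {}" using u0 B2o by (auto simp: S_def)
    show "inj_on \<sigma> S"
    proof (rule inj_onI)
      fix u u' assume u: "u \<in> S" "u' \<in> S" "\<sigma> u = \<sigma> u'"
      then obtain g where g: "g \<in> G1" "u' = g *v u" using orbit1[of u "\<sigma> u" u'] \<sigma>[of u] \<sigma>[of u'] by auto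
      have "u \<in> B1" "u' \<in> B1" "u \<in> H" using u by (auto simp: S_def)
      then have "g \<in> stab G1 p0" using B1(1) g unfolding slice_def by metis
      then have "g *v u = u" using p0(2) \<open>u \<in> H\<close> by (auto simp: generic_on_def pointwise_stab_def)
      then show "u = u'" using g by simp
    qed
    show "continuous_on S \<sigma>"
      unfolding continuous_on_open_invariant
    proof (intro allI impI)
      fix N :: "(complex^'m) set" assume N: "open N"
      have "\<sigma> u \<in> N \<longleftrightarrow> (\<exists>w\<in>B2 \<inter> N. R u w)" if "u \<in> S" for u
        using \<sigma>[OF that] \<sigma>eq[OF that] by blast
      then have "{z. \<exists>w\<in>B2 \<inter> N. R z w} \<inter> S = \<sigma> -` N \<inter> S" by auto
      moreover have "open {z. \<exists>w\<in>B2 \<inter> N. R z w}" using B2o N by (intro open_related) auto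
      ultimately show "\<exists>A. open A \<and> A \<inter> S = \<sigma> -` N \<inter> S" by blast
    qed
  qed
  then have "vec.dim H \<le> vec.dim L" using real_dim_csubspace[OF subH] real_dim_csubspace[OF L] by simp
  then have dL: "CARD('m) - 1 \<le> vec.dim L" using lH card_eq by (simp add: linear_hyperplane_def)
  have "u0 \<in> discriminant_locus G1" using u0 H by (auto simp: discriminant_locus_def)
  then have "w0 \<in> discriminant_locus G2" using discriminant_iff[OF u0(3)] by blast
  then obtain H' where H': "H' \<in> reflection_hyperplanes G2" "w0 \<in> H'" by (auto simp: discriminant_locus_def)
  then obtain s where s: "s \<in> G2" "H' = fixed_space s" by (auto simp: reflection_hyperplanes_def reflections_def)
  have LH': "L \<subseteq> H'" using H'(2) s by (auto simp: L_def stab_def fixed_space_def)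
  have lH': "linear_hyperplane H'" by (rule B.linear_hyperplane_reflection[OF H'(1)])
  have "vec.dim L \<le> vec.dim H'" by (rule vec.dim_subset[OF LH'])
  then have "linear_hyperplane L" using dL lH' L by (simp add: linear_hyperplane_def)
  then have "H' = L"
    using linear_hyperplane_subset_eq[of L H'] LH' lH' not_linear_hyperplane_UNIV
    by (metis linear_hyperplane_def)
  then have "stab G2 w0 \<subseteq> pointwise_stab G2 H'"
    by (auto simp: L_def pointwise_stab_def fixed_space_def stab_def)
  then have "generic_on G2 H' w0" using H' by (simp add: generic_on_def)
  moreover have "generic_on G1 H u0" by (rule A.slice_generic[OF p0(2) B1(1) u0(1,2)])
  ultimately have "good_point H u0" using u0(3) by (auto simp: good_point_def)
  then show ?thesis using u0 B1(2) by blast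
qed

end


section \<open>The residue along a hyperplane is constant\<close>

context correspondence
begin

definition pole_estimate :: "(complex^'n \<Rightarrow> complex) \<Rightarrow> complex^'n \<Rightarrow> complex \<Rightarrow> complex^'n \<Rightarrow> bool" where
  "pole_estimate \<phi> \<alpha> c p \<longleftrightarrow> (\<forall>x y. \<exists>d>0. \<exists>K. \<forall>z\<in>ball p d. z \<in> regular_points G1 \<longrightarrow>
     norm (lift_connection z x y - (c * \<phi> x * \<phi> y / \<phi> z) *s \<alpha>) \<le> K)"

lemma generic_normal_disc:
  assumes p: "generic_on G1 H p" and frame: "hyperplane_frame G1 H \<phi> \<alpha>"
  obtains r d where "r > 0" "d > 0"
    "\<And>z t. z \<in> ball p d \<Longrightarrow> z \<in> H \<Longrightarrow> t \<in> ball 0 (2 * r) \<Longrightarrow> t \<noteq> 0 \<Longrightarrow> z + t *s \<alpha> \<in> regular_points G1"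
proof -
  note F = hyperplane_frameD[OF frame]
  obtain B1 where B1: "slice G1 p B1" using A.ex_slice[of UNIV p] by auto
  have B1o: "open B1" "p \<in> B1" using B1 by (auto simp: slice_def)
  have "\<phi> p = 0" using p F(3) by (auto simp: generic_on_def)
  obtain \<rho> r d where b: "\<rho> > 0" "cball p \<rho> \<subseteq> B1" "r > 0" "d > 0" "ball p d \<subseteq> cball p \<rho>"
    "\<And>z. z \<in> ball p d \<Longrightarrow> cmod (\<phi> z) < r"
    "\<And>z t. z \<in> ball p d \<Longrightarrow> cmod t \<le> 2 * r \<Longrightarrow> (z - \<phi> z *s \<alpha>) + t *s \<alpha> \<in> cball p \<rho>"
    by (rule normal_disc_in_open[OF B1o F(1) \<open>\<phi> p = 0\<close>, of \<alpha>]) (rule that; (assumption | blast))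
  have "z + t *s \<alpha> \<in> regular_points G1" if "z \<in> ball p d" "z \<in> H" "t \<in> ball 0 (2 * r)" "t \<noteq> 0" for z t
  proof -
    have "\<phi> z = 0" using that(2) F(3) by blast
    then have 1: "z + t *s \<alpha> \<in> B1" "\<phi> (z + t *s \<alpha>) = t" using b(7)[OF that(1), of t] b(2) that(3) by (auto simp: F(2,6,7))
    then have "z + t *s \<alpha> \<notin> H" using F(3) that(4) by metis
    then have "stab G1 (z + t *s \<alpha>) \<subseteq> {mat 1}" using A.generic_slice(2)[OF p B1 1(1)] by blast
    then show ?thesis using A.one_mem_stab by (auto simp: A.regular_iff_stab)
  qed
  then show thesis using that[of r d] b by blast
qed

text \<open>On the normal disc the equation is the coordinate of the disc, and a bounded error term has no
  residue.\<close>

lemma residue_pole_estimate: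
  assumes p: "generic_on G1 H p" and frame: "hyperplane_frame G1 H \<phi> \<alpha>" and est: "pole_estimate \<phi> \<alpha> c p"
  shows "residue (\<lambda>t. \<phi> (lift_connection (p + t *s \<alpha>) \<alpha> \<alpha>)) 0 = c"
proof -
  note F = hyperplane_frameD[OF frame]
  obtain r d where rd: "r > 0" "d > 0"
    "\<And>z t. z \<in> ball p d \<Longrightarrow> z \<in> H \<Longrightarrow> t \<in> ball 0 (2 * r) \<Longrightarrow> t \<noteq> 0 \<Longrightarrow> z + t *s \<alpha> \<in> regular_points G1"
    by (rule generic_normal_disc[OF p frame]) (rule that; (assumption | blast))
  have pH: "p \<in> H" using p by (simp add: generic_on_def)
  then have \<phi>p: "\<phi> p = 0" using F(3) by blast
  define f where "f t = \<phi> (lift_connection (p + t *s \<alpha>) \<alpha> \<alpha>)" for t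
  have reg: "p + t *s \<alpha> \<in> regular_points G1" if "t \<in> ball 0 (2 * r) - {0}" for t
    using rd(3)[of p t] rd(2) pH that by auto
  have h: "holo_on (\<lambda>z. \<phi> (lift_connection z \<alpha> \<alpha>)) (regular_points G1)"
    by (rule holo_on_compose[OF holo_on_linear[OF F(1)] vholo_on_lift_connection subset_UNIV])
  have fh: "f holomorphic_on ball 0 (2 * r) - {0}" unfolding f_def
    by (rule holo_on_line_holomorphic[OF h reg])
  obtain d' K where K: "d' > 0" "\<And>z. z \<in> ball p d' \<Longrightarrow> z \<in> regular_points G1 \<Longrightarrow>
      norm (lift_connection z \<alpha> \<alpha> - (c * \<phi> \<alpha> * \<phi> \<alpha> / \<phi> z) *s \<alpha>) \<le> K"
    using est unfolding pole_estimate_def by meson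
  obtain k where k: "k > 0" "\<And>x. cmod (\<phi> x) \<le> norm x * k"
    using bounded_linear.pos_bounded[OF bounded_linear_clinear[OF F(1)]] by blast
  define g where "g t = f t - c / t" for t
  have gh: "g holomorphic_on ball 0 (2 * r) - {0}" unfolding g_def
    by (intro holomorphic_intros fh) auto
  have "\<forall>\<^sub>F t in at 0. cmod (g t) \<le> K * k"
  proof -
    have "open {t. p + t *s \<alpha> \<in> ball p d'}" "0 \<in> {t. p + t *s \<alpha> \<in> ball p d'}"
      using open_line[of "ball p d'"] K(1) by auto
    then have 1: "\<forall>\<^sub>F t in at 0. t \<in> {t. p + t *s \<alpha> \<in> ball p d'}" by (rule eventually_at_in_open')
    have 2: "\<forall>\<^sub>F t in at 0. t \<in> ball 0 (2 * r)" using rd(1) by (intro eventually_at_in_open') auto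
    have 3: "\<forall>\<^sub>F t in at 0. t \<noteq> (0::complex)" by (simp add: eventually_neq_at_within)
    from 1 2 3 show ?thesis
    proof eventually_elim
      case (elim t)
      have \<phi>t: "\<phi> (p + t *s \<alpha>) = t" by (simp add: F(2,6,7) \<phi>p)
      have "norm (lift_connection (p + t *s \<alpha>) \<alpha> \<alpha> - (c / t) *s \<alpha>) \<le> K"
        using K(2)[of "p + t *s \<alpha>"] reg[of t] elim by (simp add: \<phi>t F(2))
      moreover have "g t = \<phi> (lift_connection (p + t *s \<alpha>) \<alpha> \<alpha> - (c / t) *s \<alpha>)"
        by (simp add: g_def f_def F(2,7,8))
      ultimately show ?case using k(2)[of "lift_connection (p + t *s \<alpha>) \<alpha> \<alpha> - (c / t) *s \<alpha>"] k(1)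
        by (metis mult_right_mono order_trans less_imp_le)
    qed
  qed
  then obtain g' where g': "g' holomorphic_on ball 0 (2 * r)" "\<And>t. t \<in> ball 0 (2 * r) - {0} \<Longrightarrow> g' t = g t"
    using holomorphic_on_extend_bounded[OF gh] rd(1) by auto
  have "residue f 0 = residue (\<lambda>t. (c + t * g' t) / (t - 0)) 0"
  proof (rule residue_cong)
    have "\<forall>\<^sub>F t in at 0. t \<in> ball 0 (2 * r)" using rd(1) by (intro eventually_at_in_open') auto
    moreover have "\<forall>\<^sub>F t in at 0. t \<noteq> (0::complex)" by (simp add: eventually_neq_at_within)
    ultimately show "\<forall>\<^sub>F t in at 0. f t = (c + t * g' t) / (t - 0)"
    proof eventually_elim
      case (elim t)
      then have "f t = c / t + g' t" using g'(2)[of t] by (simp add: g_def)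
      then show ?case using elim by (simp add: field_simps)
    qed
  qed simp
  also have "\<dots> = c + 0 * g' 0"
    by (rule residue_simple[OF open_ball[of 0 "2 * r"]]) (use rd(1) in \<open>auto intro!: holomorphic_intros g'(1)\<close>)
  finally show ?thesis by (simp add: f_def[abs_def])
qed

text \<open>For base points near the given one, the residue is the integral over one and the same circle,
  along which the integrand is continuous in the base point.\<close>

lemma residue_continuous:
  assumes p: "generic_on G1 H p" and frame: "hyperplane_frame G1 H \<phi> \<alpha>"
  shows "continuous (at p within H) (\<lambda>p. residue (\<lambda>t. \<phi> (lift_connection (p + t *s \<alpha>) \<alpha> \<alpha>)) 0)"
proof -
  note F = hyperplane_frameD[OF frame]
  obtain r d where rd: "r > 0" "d > 0"
    "\<And>z t. z \<in> ball p d \<Longrightarrow> z \<in> H \<Longrightarrow> t \<in> ball 0 (2 * r) \<Longrightarrow> t \<noteq> 0 \<Longrightarrow> z + t *s \<alpha> \<in> regular_points G1"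
    by (rule generic_normal_disc[OF p frame]) (rule that; (assumption | blast))
  define f where "f z t = \<phi> (lift_connection (z + t *s \<alpha>) \<alpha> \<alpha>)" for z t
  define D where "D = ball p d \<inter> H"
  have pD: "p \<in> D" using p rd(2) by (simp add: D_def generic_on_def)
  have h: "holo_on (\<lambda>z. \<phi> (lift_connection z \<alpha> \<alpha>)) (regular_points G1)"
    by (rule holo_on_compose[OF holo_on_linear[OF F(1)] vholo_on_lift_connection subset_UNIV])
  have fh: "f z holomorphic_on ball 0 (2 * r) - {0}" if "z \<in> D" for z unfolding f_def
    by (rule holo_on_line_holomorphic[OF h]) (use rd(3) that in \<open>auto simp: D_def\<close>)
  have ci: "(f z has_contour_integral 2 * pi * \<i> * residue (f z) 0) (circlepath 0 r)" if "z \<in> D" for z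
    by (rule base_residue[OF open_ball[of 0 "2 * r"] _ rd(1) fh[OF that]]) (use rd(1) in auto)
  have cont: "continuous_on (D \<times> sphere 0 r) (\<lambda>(z, t). f z t)"
  proof -
    have "continuous_on (D \<times> sphere 0 r) ((\<lambda>z. \<phi> (lift_connection z \<alpha> \<alpha>)) \<circ> (\<lambda>(z, t). z + t *s \<alpha>))"
    proof (rule continuous_on_compose)
      show "continuous_on (D \<times> sphere 0 r) (\<lambda>(z, t). z + t *s \<alpha>)"
        by (simp add: case_prod_unfold) (intro continuous_intros continuous_on_vsmult)
      show "continuous_on ((\<lambda>(z, t). z + t *s \<alpha>) ` (D \<times> sphere 0 r)) (\<lambda>z. \<phi> (lift_connection z \<alpha> \<alpha>))"
        by (rule continuous_on_subset[OF holo_on_continuous[OF h]]) (use rd in \<open>auto simp: D_def\<close>)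
    qed
    then show ?thesis by (simp add: f_def o_def case_prod_unfold)
  qed
  have inD: "\<forall>\<^sub>F z in at p within D. z \<in> D" unfolding eventually_at_topological by auto
  have "((\<lambda>z. contour_integral (circlepath 0 r) (f z)) \<longlongrightarrow> contour_integral (circlepath 0 r) (f p)) (at p within D)"
  proof (cases "at p within D = bot")
    case False
    show ?thesis
    proof (rule contour_integral_uniform_limit_circlepath(2)[OF _ _ False rd(1)])
      show "\<forall>\<^sub>F z in at p within D. f z contour_integrable_on circlepath 0 r"
        using inD by (rule eventually_mono) (use ci in \<open>auto simp: contour_integrable_on_def\<close>)
      show "uniform_limit (sphere 0 r) f (f p) (at p within D)"
      proof (rule uniform_limitI)
        fix e :: real assume e: "e > 0"
        obtain X0 where X0: "p \<in> X0" "open X0" "\<forall>x\<in>X0 \<inter> D. \<forall>t\<in>sphere 0 r. dist ((\<lambda>(z, t). f z t) (x, t)) ((\<lambda>(z, t). f z t) (p, t)) \<le> e / 2"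
          using continuous_on_prod_compactE[OF cont compact_sphere pD, of "e / 2"] e by auto
        have "\<forall>\<^sub>F z in at p within D. z \<in> X0 \<inter> D"
          using X0 by (auto simp: eventually_at_topological)
        then show "\<forall>\<^sub>F z in at p within D. \<forall>t\<in>sphere 0 r. dist (f z t) (f p t) < e"
          by (rule eventually_mono) (use X0(3) e in \<open>force\<close>)
      qed
    qed
  qed simp
  then have "((\<lambda>z. contour_integral (circlepath 0 r) (f z) / (2 * pi * \<i>)) \<longlongrightarrow> contour_integral (circlepath 0 r) (f p) / (2 * pi * \<i>)) (at p within D)"
    by (intro tendsto_intros) auto
  moreover have res: "contour_integral (circlepath 0 r) (f z) / (2 * pi * \<i>) = residue (f z) 0" if "z \<in> D" for z
    using contour_integral_unique[OF ci[OF that]] by simp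
  moreover have "\<forall>\<^sub>F z in at p within D. contour_integral (circlepath 0 r) (f z) / (2 * pi * \<i>) = residue (f z) 0"
    using res by (auto simp: eventually_at_filter)
  ultimately have "((\<lambda>z. residue (f z) 0) \<longlongrightarrow> residue (f p) 0) (at p within D)"
    using res[OF pD] Lim_transform_eventually by fastforce
  moreover have "at p within D = at p within H"
    by (rule at_within_nhd[of p "ball p d"]) (use rd(2) in \<open>auto simp: D_def\<close>)
  ultimately show ?thesis by (simp add: continuous_within f_def[abs_def])
qed

text \<open>The residue is continuous on the generic points and takes finitely many values on the dense set of
  good points, so it takes finitely many values. The complex line through two generic points
  consists of generic points except for finitely many, so that the residue is constant along it.\<close>

lemma ex_constant_pole:
  assumes H: "H \<in> reflection_hyperplanes G1" and frame: "hyperplane_frame G1 H \<phi> \<alpha>"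
  shows "\<exists>c. \<forall>p. good_point H p \<longrightarrow> pole_estimate \<phi> \<alpha> c p"
proof -
  define V where "V = (\<lambda>k. of_nat (card (pointwise_stab G1 H)) / of_nat k - 1 :: complex) ` {1..card G2}"
  define \<rho> where "\<rho> p = residue (\<lambda>t. \<phi> (lift_connection (p + t *s \<alpha>) \<alpha> \<alpha>)) 0" for p
  have lH: "linear_hyperplane H" by (rule A.linear_hyperplane_reflection[OF H])
  then have subH: "vec.subspace H" by (simp add: linear_hyperplane_def)
  have good: "\<rho> p \<in> V \<and> pole_estimate \<phi> \<alpha> (\<rho> p) p" if p: "good_point H p" for p
  proof -
    obtain e' where e'': "1 \<le> e'" "e' \<le> card G2"
      "\<And>x y. \<exists>d>0. \<exists>K. \<forall>z\<in>ball p d. z \<in> regular_points G1 \<longrightarrow>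
       norm (lift_connection z x y - ((of_nat (card (pointwise_stab G1 H)) / of_nat e' - 1) * \<phi> x * \<phi> y / \<phi> z) *s \<alpha>) \<le> K"
      by (rule good_point_estimate[OF p frame]) (rule that; (assumption | blast))
    then have e': "1 \<le> e'" "e' \<le> card G2" "pole_estimate \<phi> \<alpha> (of_nat (card (pointwise_stab G1 H)) / of_nat e' - 1) p"
      unfolding pole_estimate_def by blast+
    moreover have "generic_on G1 H p" using p by (simp add: good_point_def)
    ultimately have "\<rho> p = of_nat (card (pointwise_stab G1 H)) / of_nat e' - 1"
      unfolding \<rho>_def using residue_pole_estimate[OF _ frame] by blast
    then show ?thesis using e' by (auto simp: V_def)
  qed
  have finV: "finite V" by (simp add: V_def)
  have inV: "\<rho> p \<in> V" if p: "generic_on G1 H p" for p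
  proof (rule ccontr)
    assume "\<rho> p \<notin> V"
    moreover have "open (- V)" using finV by (simp add: finite_imp_closed open_Compl)
    ultimately have "\<forall>\<^sub>F z in at p within H. \<rho> z \<in> - V"
      using residue_continuous[OF p frame] unfolding continuous_within \<rho>_def by (intro topological_tendstoD) auto
    then obtain W where W: "open W" "p \<in> W" "\<And>z. z \<in> W \<Longrightarrow> z \<noteq> p \<Longrightarrow> z \<in> H \<Longrightarrow> \<rho> z \<notin> V"
      unfolding eventually_at_topological by auto
    have "W \<inter> H \<noteq> {}" using W(2) p by (auto simp: generic_on_def)
    then obtain z where "z \<in> W \<inter> H" "good_point H z" using good_point_dense[OF H W(1)] by blast
    then show False using W(3)[of z] good[of z] \<open>\<rho> p \<notin> V\<close> by auto
  qed
  have const: "\<rho> p1 = \<rho> p2" if p: "generic_on G1 H p1" "generic_on G1 H p2" for p1 p2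
  proof -
    define l where "l t = p1 + t *s (p2 - p1)" for t
    have lH: "l t \<in> H" for t using p subH unfolding l_def generic_on_def
      by (intro vec.subspace_add vec.subspace_scale vec.subspace_diff) auto
    define T where "T = {t. generic_on G1 H (l t)}"
    define \<M> where "\<M> = fixed_space ` {g\<in>G1. \<not> H \<subseteq> fixed_space g}"
    have gen: "generic_on G1 H z \<longleftrightarrow> z \<notin> \<Union>\<M>" if "z \<in> H" for z
      using that H by (auto simp: generic_on_def \<M>_def stab_def pointwise_stab_def fixed_space_def)
    have "p1 \<notin> \<Union>\<M>" using gen[of p1] p(1) by (auto simp: generic_on_def)
    then have "finite {t. l t \<in> \<Union>\<M>}" unfolding l_def
      using A.finite_G vec_subspace_fixed_space
      by (intro finite_line_meets_csubspaces_outside) (auto simp: \<M>_def)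
    moreover have "T = UNIV - {t. l t \<in> \<Union>\<M>}" using gen[OF lH] by (auto simp: T_def)
    ultimately have "connected T"
      using connected_open_diff_countable[of "UNIV :: complex set", OF _ open_UNIV connected_UNIV] by (simp add: countable_finite)
    moreover have "continuous_on T (\<lambda>t. \<rho> (l t))"
      unfolding continuous_on_eq_continuous_within
    proof
      fix t assume "t \<in> T"
      then have c: "continuous (at (l t) within H) \<rho>"
        using residue_continuous[OF _ frame] by (simp add: T_def \<rho>_def[abs_def])
      have cl: "continuous (at t within T) l" unfolding l_def
        by (rule continuous_on_imp_continuous_within[OF _ subset_UNIV])
           (auto intro!: continuous_intros continuous_on_vsmult)
      have "continuous (at (l t) within l ` T) \<rho>" by (rule continuous_within_subset[OF c]) (use lH in auto)
      then show "continuous (at t within T) (\<lambda>t. \<rho> (l t))"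
        using continuous_within_compose[OF cl] by (simp add: o_def)
    qed
    moreover have "finite ((\<lambda>t. \<rho> (l t)) ` T)"
      by (rule finite_subset[OF _ finV]) (use inV in \<open>auto simp: T_def\<close>)
    ultimately have "(\<lambda>t. \<rho> (l t)) constant_on T" by (rule continuous_finite_range_constant)
    moreover have "0 \<in> T" "1 \<in> T" using p by (auto simp: T_def l_def)
    ultimately have "\<rho> (l 0) = \<rho> (l 1)" unfolding constant_on_def by metis
    then show ?thesis by (simp add: l_def)
  qed
  show ?thesis
  proof (cases "\<exists>p. good_point H p")
    case True
    then obtain p0 where "good_point H p0" by blast
    then show ?thesis using const good unfolding good_point_def by metis
  qed blast
qed

end

section \<open>The connection is a Dunkl connection\<close>

lemma (in finite_matrix_group) generic_not_other_hyperplane: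
  assumes "generic_on G H p" "H' \<in> reflection_hyperplanes G" "p \<in> H'"
  shows "H' = H"
proof -
  obtain s where s: "s \<in> G" "H' = fixed_space s"
    using assms(2) by (auto simp: reflection_hyperplanes_def reflections_def)
  then have "s \<in> stab G p" using assms(3) by (auto simp: stab_def fixed_space_def)
  then have "H \<subseteq> H'" using assms(1) s by (auto simp: generic_on_def pointwise_stab_def fixed_space_def)
  moreover have "vec.subspace H'" "H' \<noteq> UNIV"
    using linear_hyperplane_reflection[OF assms(2)] not_linear_hyperplane_UNIV by (auto simp: linear_hyperplane_def)
  ultimately show ?thesis
    using linear_hyperplane_subset_eq[of H H'] linear_hyperplane_reflection[of H] assms(1) by (auto simp: generic_on_def)
qed

definition dunkl_form :: "(complex^'n) set set \<Rightarrow> ((complex^'n) set \<Rightarrow> complex^'n \<Rightarrow> complex) \<Rightarrow>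
    ((complex^'n) set \<Rightarrow> complex^'n) \<Rightarrow> ((complex^'n) set \<Rightarrow> complex) \<Rightarrow> 'n connection_form" where
  "dunkl_form \<H> \<phi> \<alpha> \<kappa> z x y = - (\<Sum>H\<in>\<H>. ((\<phi> H x / \<phi> H z) * \<kappa> H) *s (\<phi> H y *s \<alpha> H))"

context correspondence
begin

text \<open>The difference of the two sides is bounded near a dense set of points of each hyperplane and
  therefore near the origin.\<close>

lemma lift_connection_eq_dunkl_form:
  assumes frame: "\<And>H. H \<in> reflection_hyperplanes G1 \<Longrightarrow> hyperplane_frame G1 H (\<phi> H) (\<alpha> H)"
    and est: "\<And>H p. H \<in> reflection_hyperplanes G1 \<Longrightarrow> good_point H p \<Longrightarrow> pole_estimate (\<phi> H) (\<alpha> H) (- \<kappa> H) p"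
    and z0: "z0 \<in> regular_points G1"
  shows "lift_connection z0 x y = dunkl_form (reflection_hyperplanes G1) \<phi> \<alpha> \<kappa> z0 x y"
proof -
  define \<H> where "\<H> = reflection_hyperplanes G1"
  have fin: "finite \<H>" using A.finite_reflection_hyperplanes by (simp add: \<H>_def)
  note F = hyperplane_frameD[OF frame]
  have ne: "\<phi> H z \<noteq> 0" if "H \<in> \<H>" "z \<in> regular_points G1" for H z
    using F(3)[of H z] that A.regular_subset by (auto simp: \<H>_def discriminant_locus_def)
  have "(lift_connection z0 x y - dunkl_form \<H> \<phi> \<alpha> \<kappa> z0 x y) $ i = 0" for i
  proof -
    define T where "T H z = ((\<phi> H x / \<phi> H z) * \<kappa> H) * (\<phi> H y * \<alpha> H $ i)" for H z
    define b where "b z = lift_connection z x y $ i + (\<Sum>H\<in>\<H>. T H z)" for z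
    have b: "(lift_connection z x y - dunkl_form \<H> \<phi> \<alpha> \<kappa> z x y) $ i = b z" for z
      by (simp add: b_def dunkl_form_def T_def mult.assoc)
    have reg: "regular_points G1 = UNIV - \<Union>(fixed_subspaces G1)" by (auto simp: A.regular_eq)
    have hT: "holo_on (T H) V" if "H \<in> \<H>" "\<And>z. z \<in> V \<Longrightarrow> \<phi> H z \<noteq> 0" for H V
      unfolding T_def using that(1) F(1)
      by (intro holo_on_mult holo_on_divide holo_on_const holo_on_linear that(2)) (auto simp: \<H>_def)
    have hb: "holo_on b (UNIV - \<Union>(fixed_subspaces G1))"
      unfolding b_def reg[symmetric]
    proof (intro holo_on_add holo_on_sum)
      show "holo_on (\<lambda>z. lift_connection z x y $ i) (regular_points G1)"
        using vholo_on_lift_connection by (simp add: vholo_on_def)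
      show "holo_on (T H) (regular_points G1)" if "H \<in> \<H>" for H by (rule hT[OF that ne[OF that]])
    qed
    have "\<exists>e>0. \<exists>M. ball (0 :: complex^'n) e \<subseteq> UNIV \<and> (\<forall>z\<in>ball 0 e - \<Union>(fixed_subspaces G1). cmod (b z) \<le> M)"
    proof (rule bounded_near_subspaces[OF A.finite_fixed_subspaces A.fixed_subspaces_proper open_UNIV UNIV_I hb])
      fix H W assume "H \<in> fixed_subspaces G1" "linear_hyperplane H" and W: "open W" "W \<inter> H \<noteq> {}"
      then have H1: "H \<in> reflection_hyperplanes G1" using A.fixed_subspaces_hyperplane_iff by blast
      then have H: "H \<in> \<H>" by (simp add: \<H>_def)
      obtain p where p: "p \<in> W \<inter> H" "good_point H p" using good_point_dense[OF H1 W] by blast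
      have gen: "generic_on G1 H p" using p(2) by (simp add: good_point_def)
      obtain d K where K: "d > 0" "\<And>z. z \<in> ball p d \<Longrightarrow> z \<in> regular_points G1 \<Longrightarrow>
          norm (lift_connection z x y - (- \<kappa> H * \<phi> H x * \<phi> H y / \<phi> H z) *s \<alpha> H) \<le> K"
        using est[OF H1 p(2)] unfolding pole_estimate_def by meson
      have "\<exists>d>0. \<exists>B. \<forall>z\<in>ball p d. cmod (T H' z) \<le> B" if H': "H' \<in> \<H> - {H}" for H'
      proof -
        have H'1: "H' \<in> reflection_hyperplanes G1" "H' \<noteq> H" using H' by (auto simp: \<H>_def)
        define V where "V = {z. \<phi> H' z \<noteq> 0}"
        have "open V" unfolding V_def
          using bounded_linear_clinear[OF F(1)[OF H'1(1)]]
          by (intro open_Collect_neq linear_continuous_on continuous_on_const)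
        moreover have "p \<in> V"
          using A.generic_not_other_hyperplane[OF gen H'1(1)] H'1 F(3)[OF H'1(1), of p] by (auto simp: V_def)
        ultimately obtain \<rho> where \<rho>: "\<rho> > 0" "cball p \<rho> \<subseteq> V" by (auto simp: open_contains_cball)
        have "holo_on (T H') V" using H' by (intro hT) (auto simp: V_def)
        then obtain B where "\<And>z. z \<in> cball p \<rho> \<Longrightarrow> cmod (T H' z) \<le> B"
          using continuous_on_compact_bound[OF compact_cball continuous_on_subset[OF holo_on_continuous \<rho>(2)]] by blast
        then show ?thesis using \<rho>(1) by (intro exI[of _ \<rho>] conjI exI[of _ B]) auto
      qed
      then obtain \<delta> B where \<delta>: "\<And>H'. H' \<in> \<H> - {H} \<Longrightarrow> \<delta> H' > 0"
        "\<And>H' z. H' \<in> \<H> - {H} \<Longrightarrow> z \<in> ball p (\<delta> H') \<Longrightarrow> cmod (T H' z) \<le> B H'" by metis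
      define e where "e = Min (insert d (\<delta> ` (\<H> - {H})))"
      have e: "e > 0" "e \<le> d" "\<And>H'. H' \<in> \<H> - {H} \<Longrightarrow> e \<le> \<delta> H'"
        using fin \<delta>(1) K(1) by (auto simp: e_def)
      have "cmod (b z) \<le> K + (\<Sum>H'\<in>\<H> - {H}. B H')" if z: "z \<in> ball p e - \<Union>(fixed_subspaces G1)" for z
      proof -
        have zr: "z \<in> regular_points G1" "z \<in> ball p d" using z e(2) by (auto simp: reg)
        have "b z = (lift_connection z x y $ i + T H z) + (\<Sum>H'\<in>\<H> - {H}. T H' z)"
          using sum.remove[OF fin H, of "\<lambda>H. T H z"] by (simp add: b_def)
        moreover have "lift_connection z x y $ i + T H z
            = (lift_connection z x y - (- \<kappa> H * \<phi> H x * \<phi> H y / \<phi> H z) *s \<alpha> H) $ i"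
          by (simp add: T_def)
        moreover have "cmod ((lift_connection z x y - (- \<kappa> H * \<phi> H x * \<phi> H y / \<phi> H z) *s \<alpha> H) $ i) \<le> K"
          using K(2)[OF zr(2,1)] Finite_Cartesian_Product.norm_nth_le order_trans by blast
        moreover have "cmod (\<Sum>H'\<in>\<H> - {H}. T H' z) \<le> (\<Sum>H'\<in>\<H> - {H}. B H')"
        proof (rule sum_norm_le)
          fix H' assume H': "H' \<in> \<H> - {H}"
          have "z \<in> ball p (\<delta> H')" using z e(3)[OF H'] by auto
          then show "cmod (T H' z) \<le> B H'" by (rule \<delta>(2)[OF H'])
        qed
        ultimately show ?thesis using norm_triangle_mono by metis
      qed
      then show "\<exists>p\<in>W \<inter> H. \<exists>e>0. \<exists>B. \<forall>z\<in>ball p e - \<Union>(fixed_subspaces G1). cmod (b z) \<le> B"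
        using p(1) e(1) by blast
    qed
    then obtain e M where e: "e > 0" "\<And>z. z \<in> ball 0 e \<Longrightarrow> z \<in> regular_points G1 \<Longrightarrow> cmod (b z) \<le> M"
      unfolding reg by blast
    \<comment> \<open>A function of degree \<open>-1\<close> that is bounded near the origin vanishes.\<close>
    have hom: "b (c *s z0) = inverse c * b z0" if "c \<noteq> 0" for c
    proof -
      have "T H (c *s z0) = inverse c * T H z0" if "H \<in> \<H>" for H
        using F(7)[of H] that by (simp add: T_def \<H>_def divide_inverse mult_ac)
      then show ?thesis
        using lift_connection_homogeneous[OF that z0, of x y]
        by (simp add: b_def sum_distrib_left distrib_left)
    qed
    have le: "cmod (b z0) \<le> t * M" if t: "0 < t" "t * norm z0 < e" for t
    proof -
      have "complex_of_real t *s z0 \<in> regular_points G1" using regular_scale[of "complex_of_real t"] t z0 by simp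
      moreover have "complex_of_real t *s z0 \<in> ball 0 e" using t by (simp add: norm_vector_smult)
      ultimately have "cmod (b (complex_of_real t *s z0)) \<le> M" by (intro e(2))
      then have "cmod (b z0) / t \<le> M"
        using hom[of "complex_of_real t"] t(1) by (simp add: norm_mult norm_inverse divide_inverse mult.commute)
      then show ?thesis using t(1) by (simp add: divide_le_eq mult.commute)
    qed
    have "cmod (b z0) \<le> 0"
    proof (rule field_le_epsilon)
      fix \<epsilon> :: real assume \<epsilon>: "\<epsilon> > 0"
      define t where "t = min (e / (2 * (norm z0 + 1))) (\<epsilon> / (\<bar>M\<bar> + 1))"
      have p: "norm z0 + 1 > 0" "\<bar>M\<bar> + 1 > 0" by (auto simp: add_nonneg_pos)
      have t: "t > 0" using e(1) \<epsilon> p by (simp add: t_def)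
      have "t * norm z0 \<le> t * (norm z0 + 1)" using t by simp
      also have "\<dots> \<le> e / (2 * (norm z0 + 1)) * (norm z0 + 1)"
        using p(1) by (intro mult_right_mono) (auto simp: t_def)
      also have "\<dots> = e / 2" using p(1) by (simp add: divide_simps)
      also have "\<dots> < e" using e(1) by simp
      finally have 1: "t * norm z0 < e" .
      have "t * M \<le> t * (\<bar>M\<bar> + 1)" using t by (intro mult_left_mono) auto
      also have "\<dots> \<le> \<epsilon> / (\<bar>M\<bar> + 1) * (\<bar>M\<bar> + 1)" using p(2) by (intro mult_right_mono) (auto simp: t_def)
      also have "\<dots> = \<epsilon>" using p(2) by simp
      finally show "cmod (b z0) \<le> 0 + \<epsilon>" using le[OF t 1] by linarith
    qed
    then show ?thesis using b by simp
  qed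
  then show ?thesis by (simp add: vec_eq_iff \<H>_def)
qed

lemma ex_dunkl_form:
  obtains \<phi> \<alpha> \<kappa> where
    "\<And>H. H \<in> reflection_hyperplanes G1 \<Longrightarrow> hyperplane_frame G1 H (\<phi> H) (\<alpha> H)"
    "\<And>z x y. z \<in> regular_points G1 \<Longrightarrow>
       lift_connection z x y = dunkl_form (reflection_hyperplanes G1) \<phi> \<alpha> \<kappa> z x y"
proof -
  have "\<exists>\<phi> \<alpha> c. H \<in> reflection_hyperplanes G1 \<longrightarrow>
      hyperplane_frame G1 H \<phi> \<alpha> \<and> (\<forall>p. good_point H p \<longrightarrow> pole_estimate \<phi> \<alpha> (- c) p)" for H
  proof (cases "H \<in> reflection_hyperplanes G1")
    case True
    obtain \<phi> \<alpha> where f: "hyperplane_frame G1 H \<phi> \<alpha>" using A.ex_hyperplane_frame[OF True] by blast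
    obtain c where "\<forall>p. good_point H p \<longrightarrow> pole_estimate \<phi> \<alpha> c p" using ex_constant_pole[OF True f] by blast
    then have "\<forall>p. good_point H p \<longrightarrow> pole_estimate \<phi> \<alpha> (- (- c)) p" by simp
    then show ?thesis using f by blast
  qed blast
  then obtain \<phi> \<alpha> \<kappa> where k: "\<And>H. H \<in> reflection_hyperplanes G1 \<Longrightarrow> hyperplane_frame G1 H (\<phi> H) (\<alpha> H)"
    "\<And>H p. H \<in> reflection_hyperplanes G1 \<Longrightarrow> good_point H p \<Longrightarrow> pole_estimate (\<phi> H) (\<alpha> H) (- \<kappa> H) p"
    by metis
  show thesis using that[of \<phi> \<alpha> \<kappa>] k lift_connection_eq_dunkl_form[OF k] by blast
qed

end

lemma (in finite_matrix_group) vholo_on_dunkl_form: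
  assumes frame: "\<And>H. H \<in> reflection_hyperplanes G \<Longrightarrow> hyperplane_frame G H (\<phi> H) (\<alpha> H)"
  shows "vholo_on (\<lambda>z. dunkl_form (reflection_hyperplanes G) \<phi> \<alpha> \<kappa> z x y) (- discriminant_locus G)"
  unfolding vholo_on_def
proof
  fix i
  define \<H> where "\<H> = reflection_hyperplanes G"
  note F = hyperplane_frameD[OF frame]
  have "holo_on (\<lambda>z. 0 - (\<Sum>H\<in>\<H>. ((\<phi> H x / \<phi> H z) * \<kappa> H) * (\<phi> H y * \<alpha> H $ i))) (- discriminant_locus G)"
  proof (intro holo_on_diff holo_on_sum holo_on_mult holo_on_divide holo_on_const)
    fix H assume "H \<in> \<H>"
    then have H: "H \<in> reflection_hyperplanes G" by (simp add: \<H>_def)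
    show "holo_on (\<phi> H) (- discriminant_locus G)" by (rule holo_on_linear[OF F(1)[OF H]])
    show "\<phi> H z \<noteq> 0" if "z \<in> - discriminant_locus G" for z
      using F(3)[OF H, of z] that H by (auto simp: discriminant_locus_def)
  qed
  then show "holo_on (\<lambda>z. dunkl_form (reflection_hyperplanes G) \<phi> \<alpha> \<kappa> z x y $ i) (- discriminant_locus G)"
    by (simp add: dunkl_form_def \<H>_def mult.assoc)
qed

lemma (in finite_matrix_group) continuous_eq_on_complement:
  fixes f g :: "complex^'n \<Rightarrow> 'b::real_normed_vector"
  assumes "continuous_on U f" "continuous_on U g" "open U"
    and "\<And>u. u \<in> U \<Longrightarrow> u \<in> regular_points G \<Longrightarrow> f u = g u" "z \<in> U"
  shows "f z = g z"
proof (rule ccontr)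
  assume ne: "f z \<noteq> g z"
  have "open (U \<inter> (\<lambda>u. f u - g u) -` (- {0}))"
    by (intro continuous_open_preimage continuous_intros assms)
  moreover have "z \<in> U \<inter> (\<lambda>u. f u - g u) -` (- {0})" using ne assms(5) by simp
  ultimately obtain u where "u \<in> U \<inter> (\<lambda>u. f u - g u) -` (- {0})" "u \<in> regular_points G"
    using regular_dense by blast
  then show False using assms(4)[of u] by simp
qed

lemma linear_dunkl_form:
  assumes "\<And>H. H \<in> \<H> \<Longrightarrow> Vector_Spaces.linear (*s) (*) (\<phi> H)"
  shows "dunkl_form \<H> \<phi> \<alpha> \<kappa> z x (y + y') = dunkl_form \<H> \<phi> \<alpha> \<kappa> z x y + dunkl_form \<H> \<phi> \<alpha> \<kappa> z x y'"
    and "dunkl_form \<H> \<phi> \<alpha> \<kappa> z x (c *s y) = c *s dunkl_form \<H> \<phi> \<alpha> \<kappa> z x y"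
proof -
  have l: "\<phi> H (x + y) = \<phi> H x + \<phi> H y" "\<phi> H (c *s x) = c * \<phi> H x" if "H \<in> \<H>" for H x y c
    using assms[OF that] by (auto simp: clinear_iff)
  have "(\<Sum>H\<in>\<H>. ((\<phi> H x / \<phi> H z) * \<kappa> H) *s (\<phi> H (y + y') *s \<alpha> H))
      = (\<Sum>H\<in>\<H>. ((\<phi> H x / \<phi> H z) * \<kappa> H) *s (\<phi> H y *s \<alpha> H) + ((\<phi> H x / \<phi> H z) * \<kappa> H) *s (\<phi> H y' *s \<alpha> H))"
    by (rule sum.cong) (simp_all add: l vec.scale_left_distrib vec.scale_right_distrib)
  then show "dunkl_form \<H> \<phi> \<alpha> \<kappa> z x (y + y') = dunkl_form \<H> \<phi> \<alpha> \<kappa> z x y + dunkl_form \<H> \<phi> \<alpha> \<kappa> z x y'"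
    by (simp add: dunkl_form_def sum.distrib)
  have "(\<Sum>H\<in>\<H>. ((\<phi> H x / \<phi> H z) * \<kappa> H) *s (\<phi> H (c *s y) *s \<alpha> H))
      = (\<Sum>H\<in>\<H>. c *s (((\<phi> H x / \<phi> H z) * \<kappa> H) *s (\<phi> H y *s \<alpha> H)))"
    by (rule sum.cong) (simp_all add: l vector_smult_assoc mult_ac)
  then show "dunkl_form \<H> \<phi> \<alpha> \<kappa> z x (c *s y) = c *s dunkl_form \<H> \<phi> \<alpha> \<kappa> z x y"
    by (simp add: dunkl_form_def vec.scale_sum_right vec.scale_minus_right)
qed

text \<open>An endomorphism-valued holomorphic function is differentiated along with its argument.\<close>

lemma vholo_on_apply_linear:
  fixes A :: "complex^'n \<Rightarrow> complex^'k \<Rightarrow> complex^'m"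
  assumes "\<And>y. vholo_on (\<lambda>z. A z y) U" "vholo_on v U"
    and "\<And>z y y'. z \<in> U \<Longrightarrow> A z (y + y') = A z y + A z y'" "\<And>z c y. z \<in> U \<Longrightarrow> A z (c *s y) = c *s A z y"
    and "open U"
  shows "vholo_on (\<lambda>z. A z (v z)) U"
proof -
  have ex: "(\<Sum>j\<in>UNIV. v z $ j *s A z (axis j 1)) = A z (v z)" if "z \<in> U" for z
  proof -
    have lin: "A z (\<Sum>j\<in>S. c j *s b j) = (\<Sum>j\<in>S. c j *s A z (b j))" if "finite S" for S :: "'k set" and c b
      using that
    proof (induction S rule: finite_induct)
      case empty
      show ?case using assms(4)[OF \<open>z \<in> U\<close>, of 0 0] by simp
    qed (simp add: assms(3,4)[OF \<open>z \<in> U\<close>])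
    have "A z (v z) = A z (\<Sum>j\<in>UNIV. v z $ j *s axis j 1)" by (simp only: basis_expansion)
    then show ?thesis using lin[of UNIV] by simp
  qed
  have "vholo_on (\<lambda>z. \<Sum>j\<in>UNIV. v z $ j *s A z (axis j 1)) U"
    using assms(1,2) by (auto simp: vholo_on_def intro!: holo_on_sum holo_on_mult)
  then show ?thesis by (rule vholo_on_cong[OF assms(5) ex, rotated])
qed

section \<open>Extending lifts to the complement of the discriminant\<close>

context correspondence
begin

text \<open>At regular points the function differs from a local lift by an element of the second group, so
  that the regular points near which it is a lift form an open and closed subset of the connected set
  of regular points of the domain. The other points follow as the relation is closed.\<close>

lemma lift_continuation:
  assumes U: "convex U" "open U" "vholo_on F U" and W: "open W" "W \<noteq> {}" "W \<subseteq> U" "\<And>u. u \<in> W \<Longrightarrow> R u (F u)"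
    and z: "z \<in> U"
  shows "R z (F z)"
proof -
  define X where "X = {v \<in> U \<inter> regular_points G1. \<exists>N. open N \<and> v \<in> N \<and> N \<subseteq> U \<and> (\<forall>u\<in>N. R u (F u))}"
  have step: "\<exists>N. open N \<and> v \<in> N \<and> N \<subseteq> U \<inter> regular_points G1 \<and> (N \<inter> X \<noteq> {} \<longrightarrow> N \<subseteq> X)"
    if v: "v \<in> U \<inter> regular_points G1" for v
  proof -
    obtain V F1 where V: "is_lift V F1" "v \<in> V" "V \<subseteq> regular_points G1" "open V" "vholo_on F1 V"
      using ex_lift_at v by blast
    have "open (U \<inter> V)" "v \<in> U \<inter> V" using U V v by auto
    then obtain r where r: "r > 0" "ball v r \<subseteq> U \<inter> V" using open_contains_ball by blast
    have "ball v r \<subseteq> X" if ne: "ball v r \<inter> X \<noteq> {}"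
    proof -
      obtain v' where v': "v' \<in> ball v r" "v' \<in> X" using ne by blast
      then obtain N' where N': "open N'" "v' \<in> N'" "N' \<subseteq> U" "\<And>u. u \<in> N' \<Longrightarrow> R u (F u)" by (auto simp: X_def)
      have l1: "is_lift (N' \<inter> ball v r) F"
        using N' U(3) by (auto simp: is_lift_def intro: vholo_on_subset)
      have l2: "is_lift (ball v r) F1" by (rule is_lift_subset[OF V(1)]) (use r in auto)
      have "v' \<in> regular_points G1" using v' by (simp add: X_def)
      then have "F v' \<in> regular_points G2" using regular_if_related N' by blast
      moreover have "v' \<in> N' \<inter> ball v r" using v' N' by simp
      ultimately obtain g N where gN: "g \<in> G2" "open N" "v' \<in> N" "N \<subseteq> (N' \<inter> ball v r) \<inter> ball v r" "\<And>u. u \<in> N \<Longrightarrow> F1 u = g *v F u"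
        using lift_unique[OF l1 l2 _ v'(1)] by blast
      have gF: "vholo_on (\<lambda>u. g *v F u) (ball v r)"
        using vholo_on_compose[OF vholo_on_matrix[of g UNIV] vholo_on_subset[OF U(3), of "ball v r"]] r(2) by auto
      have eq: "F1 u = g *v F u" if u: "u \<in> ball v r" for u
      proof -
        have "F1 u $ i - (g *v F u) $ i = 0" for i
        proof (rule holo_on_identity[OF convex_ball open_ball _ gN(2)])
          show "holo_on (\<lambda>u. F1 u $ i - (g *v F u) $ i) (ball v r)"
            using gF l2 by (intro holo_on_diff) (auto simp: is_lift_def vholo_on_def)
        qed (use gN u in auto)
        then show ?thesis by (simp add: vec_eq_iff)
      qed
      have "R u (F u)" if u: "u \<in> ball v r" for u
      proof -
        have "R u (F1 u)" using l2 u by (auto simp: is_lift_def)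
        then have "R u (g *v F u)" unfolding eq[OF u] .
        then have "R u (matrix_inv g *v (g *v F u))" by (rule act2[OF _ B.inv_mem[OF gN(1)]])
        then show ?thesis by (simp add: B.inv_apply[OF gN(1)])
      qed
      then show ?thesis using r V(3) unfolding X_def by (auto intro!: exI[of _ "ball v r"])
    qed
    then show ?thesis using r V(3) by (intro exI[of _ "ball v r"]) auto
  qed
  define Y where "Y = (U \<inter> regular_points G1) - X"
  have XS: "X \<subseteq> U \<inter> regular_points G1" by (auto simp: X_def)
  have "\<exists>N. open N \<and> v \<in> N \<and> N \<subseteq> X" if "v \<in> X" for v using step[of v] that XS by blast
  then have "open X" by (subst open_subopen) blast
  have "\<exists>N. open N \<and> v \<in> N \<and> N \<subseteq> Y" if "v \<in> Y" for v using step[of v] that by (fastforce simp: Y_def)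
  then have "open Y" by (subst open_subopen) blast
  obtain w where w: "w \<in> W" "w \<in> regular_points G1" using A.regular_dense[OF W(1,2)] by blast
  then have "w \<in> X" using W by (auto simp: X_def)
  have "X \<inter> (U \<inter> regular_points G1) = {} \<or> Y \<inter> (U \<inter> regular_points G1) = {}"
    by (rule connectedD[OF A.connected_regular_convex[OF U(1,2)] \<open>open X\<close> \<open>open Y\<close>]) (auto simp: Y_def)
  then have "Y = {}" using \<open>w \<in> X\<close> XS by (auto simp: Y_def)
  then have reg: "R u (F u)" if "u \<in> U" "u \<in> regular_points G1" for u using that by (auto simp: Y_def X_def)
  show ?thesis
  proof (rule ccontr)
    assume "\<not> R z (F z)"
    then obtain A B where AB: "open A" "open B" "z \<in> A" "F z \<in> B" "\<And>u v. u \<in> A \<Longrightarrow> v \<in> B \<Longrightarrow> \<not> R u v"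
      by (rule not_related_open) (rule that; (assumption | blast))
    have "open ((U \<inter> F -` B) \<inter> A)"
      by (intro open_Int continuous_open_preimage vholo_on_continuous U AB)
    moreover have "z \<in> (U \<inter> F -` B) \<inter> A" using z AB by simp
    ultimately obtain u where "u \<in> (U \<inter> F -` B) \<inter> A" "u \<in> regular_points G1" using A.regular_dense by blast
    then show False using AB(5) reg by blast
  qed
qed

end

text \<open>Picard iteration for a linear integral equation along rays, with holomorphic parameters. The bound
  on the coefficients makes it a contraction by the factor \<open>1 / 2\<close> on every ball about the origin, so
  that solutions on smaller balls are restrictions of the limit.\<close>

lemma ex_radial_solution:
  fixes K :: "'n::finite \<Rightarrow> 'n \<Rightarrow> real \<Rightarrow> complex^'k \<Rightarrow> complex" and c :: "complex^'n"
  assumes \<rho>: "\<rho> > 0"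
    and cont: "\<And>i j. continuous_on ({0..1} \<times> ball 0 \<rho>) (\<lambda>(s, v). K j i s v)"
    and holo: "\<And>i j s. s \<in> {0..1} \<Longrightarrow> holo_on (K j i s) (ball 0 \<rho>)"
    and bound: "\<And>j s v. s \<in> {0..1} \<Longrightarrow> v \<in> ball 0 \<rho> \<Longrightarrow> (\<Sum>i\<in>UNIV. cmod (K j i s v)) \<le> 1 / 2"
  obtains Y :: "complex^'k \<Rightarrow> complex^'n" where "vholo_on Y (ball 0 \<rho>)"
    "\<And>\<epsilon> Z D v. 0 < \<epsilon> \<Longrightarrow> \<epsilon> \<le> \<rho> \<Longrightarrow> continuous_on (ball 0 \<epsilon>) Z \<Longrightarrow> (\<And>v i. v \<in> ball 0 \<epsilon> \<Longrightarrow> cmod (Z v $ i) \<le> D) \<Longrightarrow>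
      (\<And>v j. v \<in> ball 0 \<epsilon> \<Longrightarrow>
         Z v $ j = c $ j + integral {0..1} (\<lambda>s. \<Sum>i\<in>UNIV. Z (of_real s *s v) $ i * K j i s v)) \<Longrightarrow>
      v \<in> ball 0 \<epsilon> \<Longrightarrow> Z v = Y v"
proof -
  define P where "P Y v = (\<chi> j. c $ j + integral {0..1} (\<lambda>s. \<Sum>i\<in>UNIV. Y (of_real s *s v) $ i * K j i s v))"
    for Y :: "complex^'k \<Rightarrow> complex^'n" and v
  have sv: "of_real s *s v \<in> ball (0 :: complex^'k) \<epsilon>" if "s \<in> {0..1}" "v \<in> ball 0 \<epsilon>" for s v \<epsilon>
  proof -
    have "\<bar>s\<bar> * norm v \<le> 1 * norm v" using that(1) by (intro mult_right_mono) auto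
    then show ?thesis using that(2) by (simp add: norm_vector_smult)
  qed
  have cint: "continuous_on ({0..1} \<times> ball 0 \<epsilon>) (\<lambda>(s, v). \<Sum>i\<in>UNIV. Y (of_real s *s v) $ i * K j i s v)"
    if "continuous_on (ball 0 \<epsilon>) Y" "\<epsilon> \<le> \<rho>" for Y :: "complex^'k \<Rightarrow> complex^'n" and j \<epsilon>
  proof -
    have "continuous_on ({0..1} \<times> ball 0 \<epsilon>) (Y \<circ> (\<lambda>(s, v). of_real s *s v))"
    proof (rule continuous_on_compose)
      show "continuous_on ({0..1} \<times> ball (0 :: complex^'k) \<epsilon>) (\<lambda>(s, v). complex_of_real s *s v)"
        by (simp add: case_prod_unfold) (intro continuous_intros continuous_on_vsmult)
      show "continuous_on ((\<lambda>(s, v). complex_of_real s *s v) ` ({0..1} \<times> ball 0 \<epsilon>)) Y"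
        by (rule continuous_on_subset[OF that(1)]) (use sv in auto)
    qed
    then have 1: "continuous_on ({0..1} \<times> ball 0 \<epsilon>) (\<lambda>x. Y (of_real (fst x) *s snd x))"
      by (simp add: o_def case_prod_unfold)
    have "ball (0 :: complex^'k) \<epsilon> \<subseteq> ball 0 \<rho>" using that(2) by (rule subset_ball)
    then have "{0..1} \<times> ball (0 :: complex^'k) \<epsilon> \<subseteq> {0..1::real} \<times> ball 0 \<rho>" by blast
    then have 2: "continuous_on ({0..1} \<times> ball 0 \<epsilon>) (\<lambda>x. K j i (fst x) (snd x))" for i
      using continuous_on_subset[OF cont[of j i]] by (simp add: case_prod_unfold)
    show ?thesis unfolding case_prod_unfold by (intro continuous_intros 1 2)
  qed
  have cint1: "continuous_on {0..1} (\<lambda>s. \<Sum>i\<in>UNIV. Y (of_real s *s v) $ i * K j i s v)"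
    if "continuous_on (ball 0 \<epsilon>) Y" "\<epsilon> \<le> \<rho>" "v \<in> ball 0 \<epsilon>" for Y :: "complex^'k \<Rightarrow> complex^'n" and j \<epsilon> v
  proof -
    have "continuous_on {0..1} ((\<lambda>(s, v). \<Sum>i\<in>UNIV. Y (of_real s *s v) $ i * K j i s v) \<circ> (\<lambda>s. (s, v)))"
      by (rule continuous_on_compose)
         (auto intro!: continuous_intros continuous_on_subset[OF cint[OF that(1,2)]] simp: that(3)[simplified])
    then show ?thesis by (simp add: o_def)
  qed
  have Ph: "vholo_on (P Y) (ball 0 \<rho>)" if Y: "vholo_on Y (ball 0 \<rho>)" for Y
    unfolding vholo_on_def P_def vec_lambda_beta
  proof (intro allI holo_on_add holo_on_const holo_on_integral open_ball holo_on_sum holo_on_mult)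
    fix j
    show "continuous_on ({0..1} \<times> ball 0 \<rho>) (\<lambda>(s, v). \<Sum>i\<in>UNIV. Y (of_real s *s v) $ i * K j i s v)"
      by (rule cint[OF vholo_on_continuous[OF Y] order_refl])
    fix s :: real and i assume s: "s \<in> {0..1}"
    have "vholo_on (\<lambda>v :: complex^'k. complex_of_real s *s v) (ball 0 \<rho>)" using vholo_on_affine[of 0 "of_real s"] by simp
    then show "holo_on (\<lambda>v. Y (of_real s *s v) $ i) (ball 0 \<rho>)"
      by (rule holo_on_compose[of "\<lambda>v. Y v $ i" "ball 0 \<rho>", rotated]) (use Y s sv in \<open>auto simp: vholo_on_def\<close>)
    show "holo_on (K j i s) (ball 0 \<rho>)" by (rule holo[OF s])
  qed
  have contr: "cmod (P Y v $ j - P Z v $ j) \<le> q / 2"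
    if YZ: "continuous_on (ball 0 \<epsilon>) Y" "continuous_on (ball 0 \<epsilon>) Z" "\<epsilon> \<le> \<rho>"
      and q: "\<And>v i. v \<in> ball 0 \<epsilon> \<Longrightarrow> cmod (Y v $ i - Z v $ i) \<le> q" and v: "v \<in> ball 0 \<epsilon>"
    for Y Z :: "complex^'k \<Rightarrow> complex^'n" and q \<epsilon> v j
  proof -
    let ?f = "\<lambda>Y s. \<Sum>i\<in>UNIV. Y (of_real s *s v) $ i * K j i s v"
    have vr: "v \<in> ball 0 \<rho>" using v YZ(3) by auto
    have q0: "q \<ge> 0" using order_trans[OF norm_ge_zero q[OF v]] .
    have "P Y v $ j - P Z v $ j = integral {0..1} (\<lambda>s. ?f Y s - ?f Z s)"
      using Henstock_Kurzweil_Integration.integral_diff[OF integrable_continuous_real[OF cint1[OF YZ(1,3) v]]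
          integrable_continuous_real[OF cint1[OF YZ(2,3) v]]]
      by (simp add: P_def)
    also have "cmod \<dots> \<le> q / 2 * (1 - 0)"
    proof (rule integral_bound)
      show "continuous_on {0..1} (\<lambda>s. ?f Y s - ?f Z s)"
        by (rule continuous_on_diff[OF cint1[OF YZ(1,3) v] cint1[OF YZ(2,3) v]])
      fix s :: real assume s: "s \<in> {0..1}"
      have "?f Y s - ?f Z s = (\<Sum>i\<in>UNIV. (Y (of_real s *s v) $ i - Z (of_real s *s v) $ i) * K j i s v)"
        by (simp add: sum_subtractf left_diff_distrib)
      also have "cmod \<dots> \<le> (\<Sum>i\<in>UNIV. q * cmod (K j i s v))"
        by (rule sum_norm_le) (auto simp: norm_mult intro!: mult_right_mono q sv[OF s v])
      also have "\<dots> = q * (\<Sum>i\<in>UNIV. cmod (K j i s v))" by (simp add: sum_distrib_left)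
      also have "\<dots> \<le> q * (1 / 2)" by (intro mult_left_mono bound s vr q0)
      finally show "cmod (?f Y s - ?f Z s) \<le> q / 2" by simp
    qed simp
    finally show ?thesis by simp
  qed
  define y where "y k = (P ^^ k) (\<lambda>_. c)" for k
  have y0: "y 0 = (\<lambda>_. c)" and yS: "y (Suc k) = P (y k)" for k by (simp_all add: y_def)
  have yh: "vholo_on (y k) (ball 0 \<rho>)" for k
  proof (induction k)
    case 0 show ?case by (simp add: y0 vholo_on_def holo_on_const)
  next
    case (Suc k) then show ?case by (simp add: yS Ph)
  qed
  have yc: "continuous_on (ball 0 \<epsilon>) (y k)" if "\<epsilon> \<le> \<rho>" for k \<epsilon>
    by (rule continuous_on_subset[OF vholo_on_continuous[OF yh]]) (use that in auto)
  define C where "C = norm c"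
  have step1: "cmod (y 1 v $ j - y 0 v $ j) \<le> C" if v: "v \<in> ball 0 \<rho>" for v j
  proof -
    have z: "P (\<lambda>_. 0) v $ j = c $ j" by (simp add: P_def)
    have "cmod (P (\<lambda>_. c) v $ j - P (\<lambda>_. 0) v $ j) \<le> C / 2"
      by (rule contr[of \<rho>]) (use v in \<open>auto simp: C_def Finite_Cartesian_Product.norm_nth_le intro!: continuous_intros\<close>)
    moreover have "C \<ge> 0" by (simp add: C_def)
    ultimately show ?thesis using z by (simp add: y0 yS)
  qed
  have dec: "cmod (y (Suc k) v $ j - y k v $ j) \<le> C * (1 / 2) ^ k" if "v \<in> ball 0 \<rho>" for k v j
    using that
  proof (induction k arbitrary: v j)
    case 0 then show ?case using step1 by simp
  next
    case (Suc k)
    have "cmod (P (y (Suc k)) v $ j - P (y k) v $ j) \<le> (C * (1 / 2) ^ k) / 2"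
      by (rule contr[OF yc yc order_refl Suc.IH Suc.prems]) auto
    then show ?case by (simp add: yS)
  qed
  have "\<exists>l. uniform_limit (ball 0 \<rho>) (\<lambda>k v. y k v $ j) l sequentially" for j
  proof -
    have "uniform_limit (ball 0 \<rho>) (\<lambda>n v. \<Sum>k<n. y (Suc k) v $ j - y k v $ j)
        (\<lambda>v. suminf (\<lambda>k. y (Suc k) v $ j - y k v $ j)) sequentially"
      by (rule Weierstrass_m_test[where M = "\<lambda>k. C * (1 / 2) ^ k"])
         (auto simp: dec intro!: summable_mult summable_geometric)
    then have "uniform_limit (ball 0 \<rho>) (\<lambda>n v. y 0 v $ j + (\<Sum>k<n. y (Suc k) v $ j - y k v $ j))
        (\<lambda>v. y 0 v $ j + suminf (\<lambda>k. y (Suc k) v $ j - y k v $ j)) sequentially"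
      by (intro uniform_limit_intros)
    moreover have "y 0 v $ j + (\<Sum>k<n. y (Suc k) v $ j - y k v $ j) = y n v $ j" for n v
      using sum_lessThan_telescope[of "\<lambda>k. y k v $ j" n] by simp
    ultimately show ?thesis by auto
  qed
  then obtain l where l: "\<And>j. uniform_limit (ball 0 \<rho>) (\<lambda>k v. y k v $ j) (l j) sequentially" by metis
  show thesis
  proof (rule that[of "\<lambda>v. \<chi> j. l j v"])
    show "vholo_on (\<lambda>v. \<chi> j. l j v) (ball 0 \<rho>)"
      unfolding vholo_on_def
    proof
      fix j
      show "holo_on (\<lambda>v. (\<chi> j. l j v) $ j) (ball 0 \<rho>)"
        using holo_on_uniform_limit(1)[OF open_ball _ l, of j] yh by (simp add: vholo_on_def)
    qed
    fix \<epsilon> D :: real and Z :: "complex^'k \<Rightarrow> complex^'n" and v :: "complex^'k"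
    assume \<epsilon>: "0 < \<epsilon>" "\<epsilon> \<le> \<rho>" and Z: "continuous_on (ball 0 \<epsilon>) Z" "\<And>v i. v \<in> ball 0 \<epsilon> \<Longrightarrow> cmod (Z v $ i) \<le> D"
      "\<And>v j. v \<in> ball 0 \<epsilon> \<Longrightarrow> Z v $ j = c $ j + integral {0..1} (\<lambda>s. \<Sum>i\<in>UNIV. Z (of_real s *s v) $ i * K j i s v)"
      and v: "v \<in> ball 0 \<epsilon>"
    have ZP: "Z v $ j = P Z v $ j" if "v \<in> ball 0 \<epsilon>" for v j using Z(3)[OF that] by (simp add: P_def)
    have diff: "cmod (y k v $ j - Z v $ j) \<le> (C + D) * (1 / 2) ^ k" if "v \<in> ball 0 \<epsilon>" for k v j
      using that
    proof (induction k arbitrary: v j)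
      case 0
      have "cmod (c $ j) \<le> C" by (simp add: C_def Finite_Cartesian_Product.norm_nth_le)
      then show ?case using norm_triangle_ineq4[of "c $ j" "Z v $ j"] Z(2)[OF 0, of j] by (simp add: y0)
    next
      case (Suc k)
      have "cmod (P (y k) v $ j - P Z v $ j) \<le> ((C + D) * (1 / 2) ^ k) / 2"
        by (rule contr[OF yc[OF \<epsilon>(2)] Z(1) \<epsilon>(2) Suc.IH Suc.prems])
      then show ?case using ZP[OF Suc.prems] by (simp add: yS)
    qed
    have "Z v $ j = l j v" for j
    proof -
      have "(\<lambda>k. y k v $ j) \<longlonglongrightarrow> l j v" using tendsto_uniform_limitI[OF l] v \<epsilon>(2) by auto
      moreover have "(\<lambda>k. y k v $ j) \<longlonglongrightarrow> Z v $ j"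
      proof -
        have "(\<lambda>k. (C + D) * (1 / 2) ^ k) \<longlonglongrightarrow> (C + D) * 0"
          by (intro tendsto_intros LIMSEQ_realpow_zero) auto
        then have "(\<lambda>k. y k v $ j - Z v $ j) \<longlonglongrightarrow> 0"
          by (intro Lim_null_comparison[OF always_eventually[OF allI[OF diff[OF v]]]]) simp
        then show ?thesis by (simp add: LIM_zero_iff)
      qed
      ultimately show ?thesis using LIMSEQ_unique by blast
    qed
    then show "Z v = (\<chi> j. l j v)" by (simp add: vec_eq_iff)
  qed
qed

text \<open>The form \<open>A\<close> continues the connection holomorphically to the complement of the discriminant.\<close>

locale extended_correspondence = correspondence G1 G2 R e1 e2
  for G1 :: "(complex^'n^'n) set" and G2 :: "(complex^'m^'m) set" and R e1 e2 +
  fixes A :: "complex^'n \<Rightarrow> complex^'n \<Rightarrow> complex^'n \<Rightarrow> complex^'n"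
  assumes agree: "z \<in> regular_points G1 \<Longrightarrow> lift_connection z x y = A z x y"
    and vholo_on_A: "vholo_on (\<lambda>z. A z x y) (- discriminant_locus G1)"
    and A_sym: "A z x y = A z y x"
    and A_add: "A z x (y + y') = A z x y + A z x y'"
    and A_scale: "A z x (c *s y) = c *s A z x y"
begin

lemma A_expand: "A z v y = (\<Sum>l\<in>UNIV. v $ l *s A z (axis l 1) y)"
proof -
  have l0: "A z y 0 = 0" using A_scale[of z y 0 0] by simp
  have lin: "A z y (\<Sum>l\<in>S. v $ l *s axis l 1) = (\<Sum>l\<in>S. v $ l *s A z y (axis l 1))" if "finite S" for S :: "'n set"
    using that by (induction S rule: finite_induct) (simp_all add: l0 A_add A_scale)
  have "A z v y = A z y (\<Sum>l\<in>UNIV. v $ l *s axis l 1)" unfolding basis_expansion by (rule A_sym)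
  also have "\<dots> = (\<Sum>l\<in>UNIV. v $ l *s A z y (axis l 1))" by (rule lin) simp
  finally show ?thesis by (simp only: A_sym[of z y])
qed

lemma open_off_discriminant: "open (- discriminant_locus G1)"
  by (rule A.open_complement_discriminant)

text \<open>Both sides are holomorphic and agree at the regular points, which are dense.\<close>

lemma lift_connection_equation:
  assumes F: "is_lift U F" and U: "U \<subseteq> - discriminant_locus G1" and u: "u \<in> U"
  shows "dif F u (A u x y) = dif (\<lambda>v. dif F v y) u x"
proof -
  have Uo: "open U" "vholo_on F U" using F by (auto simp: is_lift_def)
  have AU: "vholo_on (\<lambda>z. A z x y) U" by (rule vholo_on_subset[OF vholo_on_A U])
  have "vholo_on (\<lambda>u. dif F u (A u x y)) U"
    unfolding vholo_on_def
  proof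
    fix i
    have Fi: "holo_on (\<lambda>z. F z $ i) U" using Uo(2) by (simp add: vholo_on_def)
    show "holo_on (\<lambda>u. dif F u (A u x y) $ i) U"
      by (rule holo_on_cong[OF Uo(1) _ holo_on_dif_apply[OF Uo(1) Fi AU]]) (simp add: dif_nth[OF Uo(2)])
  qed
  then show ?thesis
    using A.continuous_eq_on_complement[OF vholo_on_continuous vholo_on_continuous[OF vholo_on_dif[OF Uo(1) vholo_on_dif[OF Uo]]] Uo(1) _ u]
      lift_connection[OF F] agree by simp
qed

lemma lift_bij_off_discriminant:
  assumes F: "is_lift U F" and U: "U \<subseteq> - discriminant_locus G1" and u: "u \<in> U"
  shows "bij (dif F u)"
proof -
  have inj: "inj (dif F u)" by (rule lift_inj[OF F u U]) (simp add: lift_regular[OF F])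
  have "vholo_on F U" using F by (simp add: is_lift_def)
  then have lin: "linear (dif F u)" using vholo_on_has_derivative u has_derivative_linear by blast
  have "dim (range (dif F u)) = dim (UNIV :: (complex^'n) set)"
    by (rule dim_image_eq[OF lin]) (use inj in simp)
  then have "dim (range (dif F u)) = DIM(complex^'m)" using card_eq by simp
  then have "span (range (dif F u)) = UNIV" by (simp only: dim_eq_full)
  moreover have "subspace (range (dif F u))" by (rule linear_subspace_image[OF lin subspace_UNIV])
  ultimately have "range (dif F u) = UNIV" by (metis span_eq_iff)
  with inj show ?thesis by (simp add: bij_def)
qed

text \<open>Near a point off the discriminant, the differential of a lift satisfies a linear equation
  along rays, with holomorphic coefficients. The homogeneity of the lift recovers it from its
  differential. The radius depends only on a bound for the coefficients near the point, and not on
  where the lift is given.\<close>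

lemma ex_lift_extension:
  assumes z: "z \<notin> discriminant_locus G1"
  obtains \<rho> where "\<rho> > 0" "ball z (2 * \<rho>) \<subseteq> - discriminant_locus G1"
    "\<And>u U0 F0. u \<in> ball z \<rho> \<Longrightarrow> is_lift U0 F0 \<Longrightarrow> u \<in> U0 \<Longrightarrow> U0 \<subseteq> regular_points G1 \<Longrightarrow>
       \<exists>F \<epsilon>. \<epsilon> > 0 \<and> ball u \<epsilon> \<subseteq> ball u \<rho> \<inter> U0 \<and> vholo_on F (ball u \<rho>) \<and> (\<forall>v\<in>ball u \<epsilon>. F v = F0 v)"
proof -
  define V where "V = - discriminant_locus G1"
  obtain \<rho>0 where \<rho>0: "\<rho>0 > 0" "cball z (2 * \<rho>0) \<subseteq> V"
  proof -
    obtain s where "s > 0" "cball z s \<subseteq> V" using open_off_discriminant z open_contains_cball unfolding V_def by blast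
    then show thesis using that[of "s / 2"] by simp
  qed
  define a where "a l j i w = A w (axis l 1) (axis j 1) $ i" for l j i w
  have ah: "holo_on (a l j i) V" for l j i
  proof -
    have "a l j i = (\<lambda>w. A w (axis l 1) (axis j 1) $ i)" by (simp add: a_def fun_eq_iff)
    then show ?thesis using vholo_on_A[of "axis l 1" "axis j 1"] by (simp add: vholo_on_def V_def)
  qed
  have "\<exists>B. \<forall>w\<in>cball z (2 * \<rho>0). cmod (a l j i w) \<le> B" for l j i
    by (rule continuous_on_compact_bound[OF compact_cball continuous_on_subset[OF holo_on_continuous[OF ah] \<rho>0(2)]]) blast
  then obtain B where B: "\<And>l j i w. w \<in> cball z (2 * \<rho>0) \<Longrightarrow> cmod (a l j i w) \<le> B l j i" by metis
  define C where "C = (\<Sum>j\<in>UNIV. \<Sum>i\<in>UNIV. \<Sum>l\<in>UNIV. \<bar>B l j i\<bar>)"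
  have C: "C \<ge> 0" by (simp add: C_def sum_nonneg)
  \<comment> \<open>Small enough for the coefficients along rays of this length to be bounded by \<open>1 / 2\<close> in total.\<close>
  define \<rho> where "\<rho> = min \<rho>0 (1 / (2 * (C + 1)))"
  have \<rho>: "\<rho> > 0" "\<rho> \<le> \<rho>0" using \<rho>0(1) C by (auto simp: \<rho>_def)
  have \<rho>C: "\<rho> * C \<le> 1 / 2"
  proof -
    have "\<rho> * C \<le> 1 / (2 * (C + 1)) * (C + 1)" using C \<rho>(1) by (intro mult_mono) (auto simp: \<rho>_def)
    also have "\<dots> = 1 / 2" using C by (simp add: divide_simps)
    finally show ?thesis .
  qed
  show thesis
  proof (rule that[of \<rho>])
    show "\<rho> > 0" by (rule \<rho>)
    have "ball z (2 * \<rho>) \<subseteq> cball z (2 * \<rho>0)" using \<rho>(2) by auto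
    then show "ball z (2 * \<rho>) \<subseteq> - discriminant_locus G1" using \<rho>0(2) unfolding V_def by (rule order_trans)
    fix u U0 F0 assume u: "u \<in> ball z \<rho>" and F0: "is_lift U0 F0" "u \<in> U0" and U0: "U0 \<subseteq> regular_points G1"
    have U0o: "open U0" "vholo_on F0 U0" using F0 by (auto simp: is_lift_def)
    have inb: "u + v \<in> cball z (2 * \<rho>0)" if "v \<in> ball 0 \<rho>" for v
      using u that \<rho>(2) dist_triangle[of z "u + v" u] by (simp add: dist_norm)
    have sv: "of_real s *s v \<in> ball (0 :: complex^'n) \<epsilon>" if "s \<in> {0..1}" "v \<in> ball 0 \<epsilon>" for s v \<epsilon>
    proof -
      have "\<bar>s\<bar> * norm v \<le> 1 * norm v" using that(1) by (intro mult_right_mono) auto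
      then show ?thesis using that(2) by (simp add: norm_vector_smult)
    qed
    define K where "K j i s v = (\<Sum>l\<in>UNIV. v $ l * a l j i (u + of_real s *s v))" for j i s v
    have KA: "K j i s v = A (u + of_real s *s v) v (axis j 1) $ i" for j i s v
      unfolding K_def a_def by (subst (2) A_expand) (simp add: sum_component)
    have Kh: "holo_on (K j i s) (ball 0 \<rho>)" if s: "s \<in> {0..1}" for j i s
      unfolding K_def
      by (intro holo_on_sum holo_on_mult holo_on_nth holo_on_compose[OF ah vholo_on_affine])
         (use inb[OF sv[OF s]] \<rho>0(2) in auto)
    have Kc: "continuous_on ({0..1} \<times> ball 0 \<rho>) (\<lambda>(s, v). K j i s v)" for j i
    proof -
      have "continuous_on ({0..1} \<times> ball 0 \<rho>) (a l j i \<circ> (\<lambda>(s, v). u + of_real s *s v))" for l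
      proof (rule continuous_on_compose)
        show "continuous_on ({0..1} \<times> ball 0 \<rho>) (\<lambda>(s, v). u + complex_of_real s *s v)"
          by (simp add: case_prod_unfold) (intro continuous_intros continuous_on_vsmult)
        show "continuous_on ((\<lambda>(s, v). u + complex_of_real s *s v) ` ({0..1} \<times> ball 0 \<rho>)) (a l j i)"
          by (rule continuous_on_subset[OF holo_on_continuous[OF ah]]) (use inb[OF sv] \<rho>0(2) in auto)
      qed
      then have "continuous_on ({0..1} \<times> ball 0 \<rho>) (\<lambda>x. a l j i (u + of_real (fst x) *s snd x))" for l
        by (simp add: o_def case_prod_unfold)
      then show ?thesis unfolding K_def case_prod_unfold by (intro continuous_intros)
    qed
    have Kb: "(\<Sum>i\<in>UNIV. cmod (K j i s v)) \<le> 1 / 2" if s: "s \<in> {0..1}" and v: "v \<in> ball 0 \<rho>" for j s v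
    proof -
      have "(\<Sum>i\<in>UNIV. cmod (K j i s v)) \<le> (\<Sum>i\<in>UNIV. \<Sum>l\<in>UNIV. \<rho> * \<bar>B l j i\<bar>)"
        unfolding K_def
      proof (intro sum_mono sum_norm_le)
        fix i l :: 'n
        have "cmod (a l j i (u + of_real s *s v)) \<le> \<bar>B l j i\<bar>"
          using B[OF inb[OF sv[OF s v]], of l j i] by linarith
        moreover have "cmod (v $ l) \<le> \<rho>"
          using Finite_Cartesian_Product.norm_nth_le[of v l] v by simp
        ultimately show "cmod (v $ l * a l j i (u + of_real s *s v)) \<le> \<rho> * \<bar>B l j i\<bar>"
          unfolding norm_mult using \<rho>(1) by (intro mult_mono) auto
      qed
      also have "\<dots> = \<rho> * (\<Sum>i\<in>UNIV. \<Sum>l\<in>UNIV. \<bar>B l j i\<bar>)" by (simp add: sum_distrib_left)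
      also have "\<dots> \<le> \<rho> * C"
        unfolding C_def using \<rho>(1)
        by (intro mult_left_mono member_le_sum[of j UNIV "\<lambda>j. \<Sum>i\<in>UNIV. \<Sum>l\<in>UNIV. \<bar>B l j i\<bar>"]) (auto intro!: sum_nonneg)
      also note \<rho>C
      finally show ?thesis .
    qed
    define c where "c r = (\<chi> j. dif F0 u (axis j 1) $ r)" for r
    define Q where "Q r Y \<longleftrightarrow> vholo_on Y (ball 0 \<rho>) \<and>
        (\<forall>\<epsilon> Z D. 0 < \<epsilon> \<longrightarrow> \<epsilon> \<le> \<rho> \<longrightarrow> continuous_on (ball 0 \<epsilon>) Z \<longrightarrow>
          (\<forall>v i. v \<in> ball 0 \<epsilon> \<longrightarrow> cmod (Z v $ i) \<le> D) \<longrightarrow>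
          (\<forall>v j. v \<in> ball 0 \<epsilon> \<longrightarrow> Z v $ j = c r $ j + integral {0..1} (\<lambda>s. \<Sum>i\<in>UNIV. Z (of_real s *s v) $ i * K j i s v)) \<longrightarrow>
          (\<forall>v\<in>ball 0 \<epsilon>. Z v = Y v))" for r Y
    have "\<exists>Y. Q r Y" for r
      by (rule ex_radial_solution[where K = K and c = "c r", OF \<rho>(1) Kc Kh Kb])
         (assumption | unfold Q_def, blast)+
    then obtain Y where Y: "\<And>r. Q r (Y r)" by metis
    have Yh: "vholo_on (Y r) (ball 0 \<rho>)" for r using Y[of r] by (simp add: Q_def)
    obtain \<epsilon> where \<epsilon>: "\<epsilon> > 0" "\<epsilon> \<le> \<rho>" "cball u \<epsilon> \<subseteq> U0"
    proof -
      obtain s where "s > 0" "cball u s \<subseteq> U0" using U0o(1) F0(2) open_contains_cball by blast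
      then show thesis using that[of "min s \<rho>"] \<rho>(1) subset_cball[of "min s \<rho>" s u] by (auto simp del: cball_subset_cball_iff)
    qed
    have Fr: "holo_on (\<lambda>w. F0 w $ r) U0" for r using U0o(2) by (simp add: vholo_on_def)
    have YF: "dif F0 (u + v) (axis j 1) $ r = Y r v $ j" if v: "v \<in> ball 0 \<epsilon>" for v j r
    proof -
      define Z where "Z v = (\<chi> j. dif F0 (u + v) (axis j 1) $ r)" for v
      have uv: "u + v \<in> U0" if "v \<in> ball 0 \<epsilon>" for v using that \<epsilon>(3) by (auto simp: dist_norm)
      have hj: "holo_on (\<lambda>w. dif (\<lambda>w. F0 w $ r) w (axis j 1)) U0" for j by (rule holo_on_dif[OF U0o(1) Fr])
      have nth: "Z v $ j = dif (\<lambda>w. F0 w $ r) (u + v) (axis j 1)" if "v \<in> ball 0 \<epsilon>" for v j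
        using dif_nth[OF U0o(2) uv[OF that]] by (simp add: Z_def)
      have Zc: "continuous_on (cball 0 \<epsilon>) Z"
      proof -
        have uvc: "(\<lambda>v. u + v) ` cball 0 \<epsilon> \<subseteq> U0" using \<epsilon>(3) by (auto simp: dist_norm)
        have "continuous_on (cball 0 \<epsilon>) (\<lambda>v. dif F0 (u + v) (axis j 1) $ r)" for j
        proof -
          have "continuous_on U0 (\<lambda>w. dif F0 w (axis j 1) $ r)"
            using vholo_on_dif[OF U0o, of "axis j 1"] by (intro holo_on_continuous) (simp add: vholo_on_def)
          then have "continuous_on (cball 0 \<epsilon>) ((\<lambda>w. dif F0 w (axis j 1) $ r) \<circ> (\<lambda>v. u + v))"
            by (rule continuous_on_compose[OF continuous_on_add[OF continuous_on_const continuous_on_id] continuous_on_subset[OF _ uvc]])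
          then show ?thesis by (simp add: o_def)
        qed
        then show ?thesis unfolding Z_def by (rule continuous_on_vec_lambda)
      qed
      obtain D where D: "\<And>v. v \<in> cball 0 \<epsilon> \<Longrightarrow> norm (Z v) \<le> D"
        using continuous_on_compact_bound[OF compact_cball Zc] by blast
      have ie: "Z v $ j = c r $ j + integral {0..1} (\<lambda>s. \<Sum>i\<in>UNIV. Z (of_real s *s v) $ i * K j i s v)"
        if v: "v \<in> ball 0 \<epsilon>" for v j
      proof -
        have "((\<lambda>s. \<Sum>i\<in>UNIV. Z (of_real s *s v) $ i * K j i s v) has_integral
            dif (\<lambda>w. F0 w $ r) (u + of_real 1 *s v) (axis j 1) - dif (\<lambda>w. F0 w $ r) (u + of_real 0 *s v) (axis j 1)) {0..1}"
        proof (rule fundamental_theorem_of_calculus)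
          fix s :: real assume s: "s \<in> {0..1}"
          have w: "u + of_real s *s v \<in> U0" by (rule uv[OF sv[OF s v]])
          have wr: "u + of_real s *s v \<in> regular_points G1" using w U0 by blast
          have "((\<lambda>t. dif (\<lambda>w. F0 w $ r) (u + t *s v) (axis j 1)) has_field_derivative
              dif (\<lambda>w. dif (\<lambda>w. F0 w $ r) w (axis j 1)) (u + of_real s *s v) v) (at (of_real s))"
            by (rule holo_on_line[OF hj w])
          then have "((\<lambda>s. dif (\<lambda>w. F0 w $ r) (u + of_real s *s v) (axis j 1)) has_vector_derivative
              dif (\<lambda>w. dif (\<lambda>w. F0 w $ r) w (axis j 1)) (u + of_real s *s v) v) (at s within {0..1})"
            by (rule has_vector_derivative_real_field)
          moreover have "dif (\<lambda>w. dif (\<lambda>w. F0 w $ r) w (axis j 1)) (u + of_real s *s v) v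
              = dif F0 (u + of_real s *s v) (A (u + of_real s *s v) v (axis j 1)) $ r"
            using lift_connection[OF F0(1) w wr, of v "axis j 1"] agree[OF wr] dif_dif_nth[OF U0o w] by simp
          moreover have "\<dots> = (\<Sum>i\<in>UNIV. Z (of_real s *s v) $ i * K j i s v)"
            unfolding dif_nth[OF U0o(2) w] KA nth[OF sv[OF s v]]
            by (subst dif_apply_expand[OF Fr w]) (simp add: mult.commute)
          ultimately show "((\<lambda>s. dif (\<lambda>w. F0 w $ r) (u + of_real s *s v) (axis j 1)) has_vector_derivative
              (\<Sum>i\<in>UNIV. Z (of_real s *s v) $ i * K j i s v)) (at s within {0..1})" by simp
        qed simp
        then have "integral {0..1} (\<lambda>s. \<Sum>i\<in>UNIV. Z (of_real s *s v) $ i * K j i s v)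
            = dif (\<lambda>w. F0 w $ r) (u + v) (axis j 1) - dif (\<lambda>w. F0 w $ r) u (axis j 1)"
          by (simp add: integral_unique)
        then show ?thesis using nth[OF v] dif_nth[OF U0o(2) F0(2)] by (simp add: c_def)
      qed
      have "continuous_on (ball 0 \<epsilon>) Z" by (rule continuous_on_subset[OF Zc]) auto
      moreover have "cmod (Z v $ i) \<le> D" if "v \<in> ball 0 \<epsilon>" for v i
      proof -
        have "cmod (Z v $ i) \<le> norm (Z v)" by (rule Finite_Cartesian_Product.norm_nth_le)
        also have "\<dots> \<le> D" using that by (intro D) auto
        finally show ?thesis .
      qed
      ultimately have "Z v = Y r v"
        using Y[of r, unfolded Q_def, THEN conjunct2, rule_format, OF \<epsilon>(1,2), of Z D v] ie v by blast
      then show ?thesis by (simp add: Z_def vec_eq_iff)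
    qed
    \<comment> \<open>Euler's identity, with the solution \<open>Y\<close> in place of the differential of the lift.\<close>
    define F where "F w = (\<chi> r. of_nat e2 / of_nat e1 * (\<Sum>j\<in>UNIV. w $ j * Y r (w - u) $ j))" for w
    have "vholo_on F (ball u \<rho>)"
      unfolding vholo_on_def F_def vec_lambda_beta
    proof (intro allI holo_on_mult holo_on_const holo_on_sum holo_on_nth)
      fix r j
      have "vholo_on (\<lambda>w. w - u) (ball u \<rho>)" using vholo_on_affine[of "- u" 1] by simp
      moreover have "(\<lambda>w. w - u) ` ball u \<rho> \<subseteq> ball 0 \<rho>" by (auto simp: dist_norm norm_minus_commute)
      ultimately have "vholo_on (\<lambda>w. Y r (w - u)) (ball u \<rho>)" by (rule vholo_on_compose[OF Yh])
      then show "holo_on (\<lambda>w. Y r (w - u) $ j) (ball u \<rho>)" by (simp add: vholo_on_def)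
    qed
    moreover have "F w = F0 w" if w: "w \<in> ball u \<epsilon>" for w
    proof -
      have wU: "w \<in> U0" using w \<epsilon>(3) by auto
      then have wr: "w \<in> regular_points G1" using U0 by blast
      have "w - u \<in> ball 0 \<epsilon>" using w by (simp add: dist_norm norm_minus_commute)
      from YF[OF this] have y: "Y r (w - u) $ j = dif (\<lambda>w. F0 w $ r) w (axis j 1)" for r j
        using dif_nth[OF U0o(2) wU] by simp
      have "F w $ r = F0 w $ r" for r
      proof -
        have "(\<Sum>j\<in>UNIV. w $ j * Y r (w - u) $ j) = dif F0 w w $ r"
          unfolding y dif_nth[OF U0o(2) wU] by (rule dif_apply_expand[OF Fr wU, symmetric])
        moreover have "of_nat e2 * dif F0 w w $ r = of_nat e1 * F0 w $ r"
          using arg_cong[OF lift_euler[OF F0(1) wU wr], of "\<lambda>v. v $ r"] by simp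
        ultimately show ?thesis using e_pos by (simp add: F_def field_simps)
      qed
      then show ?thesis by (simp add: vec_eq_iff)
    qed
    moreover have "ball u \<epsilon> \<subseteq> ball u \<rho> \<inter> U0" using \<epsilon> by (auto simp: subset_iff)
    ultimately show "\<exists>F \<epsilon>. \<epsilon> > 0 \<and> ball u \<epsilon> \<subseteq> ball u \<rho> \<inter> U0 \<and> vholo_on F (ball u \<rho>) \<and> (\<forall>v\<in>ball u \<epsilon>. F v = F0 v)"
      using \<epsilon>(1) by blast
  qed
qed

text \<open>A lift at a regular point close to the given one extends to a ball that contains the given point.
  An element of the second group adjusts its value there.\<close>

lemma ex_lift_off_discriminant:
  assumes zw: "R z w" and z: "z \<notin> discriminant_locus G1"
  obtains r F where "r > 0" "ball z r \<subseteq> - discriminant_locus G1" "is_lift (ball z r) F" "F z = w"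
proof -
  obtain \<rho> where \<rho>: "\<rho> > 0" "ball z (2 * \<rho>) \<subseteq> - discriminant_locus G1"
    "\<And>u U0 F0. u \<in> ball z \<rho> \<Longrightarrow> is_lift U0 F0 \<Longrightarrow> u \<in> U0 \<Longrightarrow> U0 \<subseteq> regular_points G1 \<Longrightarrow>
       \<exists>F \<epsilon>. \<epsilon> > 0 \<and> ball u \<epsilon> \<subseteq> ball u \<rho> \<inter> U0 \<and> vholo_on F (ball u \<rho>) \<and> (\<forall>v\<in>ball u \<epsilon>. F v = F0 v)"
    by (rule ex_lift_extension[OF z]) (rule that; (assumption | blast))
  obtain u where u: "u \<in> ball z \<rho>" "u \<in> regular_points G1" using A.regular_dense[of "ball z \<rho>"] \<rho>(1) by auto
  obtain U0 F0 where F0: "is_lift U0 F0" "u \<in> U0" "U0 \<subseteq> regular_points G1" using ex_lift_at[OF u(2)] by metis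
  obtain F \<epsilon> where F: "\<epsilon> > 0" "ball u \<epsilon> \<subseteq> ball u \<rho> \<inter> U0" "vholo_on F (ball u \<rho>)" "\<And>v. v \<in> ball u \<epsilon> \<Longrightarrow> F v = F0 v"
    using \<rho>(3)[OF u(1) F0] by blast
  have R: "R v (F v)" if "v \<in> ball u \<rho>" for v
  proof (rule lift_continuation[OF convex_ball open_ball F(3) open_ball _ _ _ that])
    show "ball u \<epsilon> \<noteq> {}" "ball u \<epsilon> \<subseteq> ball u \<rho>" using F(1,2) by auto
    show "R v (F v)" if "v \<in> ball u \<epsilon>" for v using that F(2,4) F0(1) by (auto simp: is_lift_def)
  qed
  have zu: "z \<in> ball u \<rho>" using u(1) by (simp add: dist_commute)
  then obtain r where r: "r > 0" "ball z r \<subseteq> ball u \<rho>" using open_contains_ball open_ball by blast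
  obtain g where g: "g \<in> G2" "w = g *v F z" using orbit2[OF R[OF zu]] zw by blast
  have "is_lift (ball z r) F" using R F(3) r(2) by (auto simp: is_lift_def intro: vholo_on_subset)
  then have "is_lift (ball z r) (\<lambda>v. g *v F v)" by (rule is_lift_matrix[OF _ g(1)])
  moreover have "ball u \<rho> \<subseteq> ball z (2 * \<rho>)"
  proof
    fix v assume "v \<in> ball u \<rho>"
    then show "v \<in> ball z (2 * \<rho>)" using u(1) dist_triangle[of z v u] by simp
  qed
  then have "ball z r \<subseteq> - discriminant_locus G1" using r(2) \<rho>(2) by blast
  ultimately show thesis using that r(1) g(2) by blast
qed

lemma lift_locally_biholomorphic:
  assumes "is_lift U F" "U \<subseteq> - discriminant_locus G1"
  shows "locally_biholomorphic U F"
  using assms lift_bij_off_discriminant[OF assms] by (auto simp: locally_biholomorphic_def is_lift_def vholo_on_def)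

lemma lift_pullback:
  assumes "is_lift U F" "U \<subseteq> - discriminant_locus G1" "u \<in> U"
  shows "A u x y = pullback_connection F (\<lambda>_ _ _. 0) u x y"
proof -
  have "inj (dif F u)" by (rule bij_is_inj[OF lift_bij_off_discriminant[OF assms]])
  then have "inv (dif F u) (dif (\<lambda>v. dif F v y) u x) = A u x y"
    using lift_connection_equation[OF assms] by (metis inv_f_f)
  then show ?thesis by (simp add: pullback_connection_def)
qed

lemma lift_developing_branch:
  assumes F: "is_lift U F" and U: "U \<subseteq> - discriminant_locus G1"
  shows "developing_branch A U F"
proof -
  have Uo: "open U" "vholo_on F U" using F by (auto simp: is_lift_def)
  have "dif (\<lambda>u. dif (\<lambda>z. F z $ i) u y) z x - dif (\<lambda>z. F z $ i) z (A z x y) = 0" if z: "z \<in> U" for i z x y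
    using arg_cong[OF lift_connection_equation[OF F U z, of x y], of "\<lambda>v. v $ i"]
    by (simp add: dif_dif_nth[OF Uo z] dif_nth[OF Uo(2) z])
  then show ?thesis
    using lift_locally_biholomorphic[OF F U] by (simp add: developing_branch_def flat_differential_def)
qed

text \<open>A holomorphic function on a convex set that is a lift on a nonempty open subset is a lift.\<close>

lemma developing_map_lift:
  assumes F0: "is_lift U0 F0" and dev: "developing_map (- discriminant_locus G1) A U0 F0 U F"
  shows "convex U \<and> U \<subseteq> - discriminant_locus G1 \<and> is_lift U F"
  using dev
proof (induction rule: developing_map.induct)
  case start then show ?case using F0 by blast
next
  case (continue U F U' F')
  have U': "open U'" "vholo_on F' U'"
    using continue.hyps(4) by (auto simp: developing_branch_def locally_biholomorphic_def vholo_on_def)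
  have U: "open U" "\<And>u. u \<in> U \<Longrightarrow> R u (F u)" using continue.IH by (auto simp: is_lift_def)
  have "R u (F' u)" if "u \<in> U'" for u
  proof (rule lift_continuation[OF continue.hyps(2) U' _ continue.hyps(5) _ _ that])
    show "open (U \<inter> U')" using U U' by blast
    show "R u (F' u)" if "u \<in> U \<inter> U'" for u using continue.hyps(6)[OF that] U(2)[of u] that by simp
  qed auto
  then show ?case using continue.hyps(2,3) U' by (simp add: is_lift_def)
qed

text \<open>The set of points reached by continuation is open and closed off the discriminant: a reached
  branch and a local lift differ by an element of the second group on the convex overlap.\<close>

lemma ex_developing_map:
  obtains U0 F0 where "is_lift U0 F0"
    "\<And>z. z \<notin> discriminant_locus G1 \<Longrightarrow> \<exists>U F. developing_map (- discriminant_locus G1) A U0 F0 U F \<and> z \<in> U"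
proof -
  define V where "V = - discriminant_locus G1"
  obtain z0 where "z0 \<in> regular_points G1" using A.regular_dense[of UNIV] by auto
  then have z0: "z0 \<notin> discriminant_locus G1" using A.regular_subset by blast
  obtain w0 where "R z0 w0" using total1 by blast
  then obtain r0 F0 where F0: "r0 > 0" "ball z0 r0 \<subseteq> V" "is_lift (ball z0 r0) F0"
    using ex_lift_off_discriminant[OF _ z0] unfolding V_def by metis
  define U0 where "U0 = ball z0 r0"
  define X where "X = {z. \<exists>U F. developing_map V A U0 F0 U F \<and> z \<in> U}"
  have dev: "convex U \<and> U \<subseteq> V \<and> is_lift U F" if "developing_map V A U0 F0 U F" for U F
    using developing_map_lift[of U0 F0] that F0(3) by (simp add: V_def U0_def)
  have start: "developing_map V A U0 F0 U0 F0"
    by (rule developing_map.start) (use F0 lift_developing_branch[OF F0(3)] in \<open>auto simp: U0_def V_def\<close>)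
  have step: "\<exists>r>0. ball z r \<subseteq> V \<and> (ball z r \<inter> X \<noteq> {} \<longrightarrow> ball z r \<subseteq> X)" if z: "z \<in> V" for z
  proof -
    obtain w where "R z w" using total1 by blast
    then obtain r F1 where r: "r > 0" "ball z r \<subseteq> V" "is_lift (ball z r) F1"
      using ex_lift_off_discriminant z unfolding V_def by (metis ComplD)
    have "ball z r \<subseteq> X" if meets: "ball z r \<inter> X \<noteq> {}"
    proof -
      obtain U F where UF: "developing_map V A U0 F0 U F" "U \<inter> ball z r \<noteq> {}"
        using meets unfolding X_def by blast
      have U: "convex U" "U \<subseteq> V" "is_lift U F" "open U" "vholo_on F U" using dev[OF UF(1)] by (auto simp: is_lift_def)
      obtain v where v: "v \<in> U \<inter> ball z r" "v \<in> regular_points G1"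
        using A.regular_dense[of "U \<inter> ball z r"] UF(2) U(4) by blast
      have "F1 v \<in> regular_points G2" using lift_regular[OF r(3)] v by blast
      then obtain g N where gN: "g \<in> G2" "open N" "v \<in> N" "N \<subseteq> ball z r \<inter> U" "\<And>u. u \<in> N \<Longrightarrow> F u = g *v F1 u"
        using lift_unique[OF r(3) U(3), of v] v by blast
      have gF: "is_lift (ball z r) (\<lambda>u. g *v F1 u)" by (rule is_lift_matrix[OF r(3) gN(1)])
      have gFh: "vholo_on (\<lambda>u. g *v F1 u) (ball z r)" using gF by (simp add: is_lift_def)
      have eq: "F u = g *v F1 u" if u: "u \<in> U \<inter> ball z r" for u
      proof -
        have "F u $ i - (g *v F1 u) $ i = 0" for i
        proof (rule holo_on_identity[of "U \<inter> ball z r" _ N])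
          show "convex (U \<inter> ball z r)" using U(1) by (simp add: convex_Int)
          show "open (U \<inter> ball z r)" using U(4) by auto
          show "holo_on (\<lambda>u. F u $ i - (g *v F1 u) $ i) (U \<inter> ball z r)"
            using U(5) gFh by (intro holo_on_diff) (auto simp: vholo_on_def intro: holo_on_subset)
        qed (use gN u in auto)
        then show ?thesis by (simp add: vec_eq_iff)
      qed
      have "developing_map V A U0 F0 (ball z r) (\<lambda>u. g *v F1 u)"
        by (rule developing_map.continue[OF UF(1) convex_ball r(2) _ UF(2) eq])
           (use lift_developing_branch[OF gF] r(2) in \<open>auto simp: V_def\<close>)
      then show ?thesis by (auto simp: X_def)
    qed
    then show ?thesis using r by blast
  qed
  have XV: "X \<subseteq> V" using dev by (auto simp: X_def)
  have oX: "open X"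
  proof (subst open_subopen, intro ballI)
    fix z assume "z \<in> X"
    then show "\<exists>T. open T \<and> z \<in> T \<and> T \<subseteq> X" using step[of z] XV
      by (metis (no_types, lifting) IntI centre_in_ball empty_iff open_ball subsetD)
  qed
  have oY: "open (V - X)"
  proof (subst open_subopen, intro ballI)
    fix z assume z: "z \<in> V - X"
    then obtain r where r: "r > 0" "ball z r \<subseteq> V" "ball z r \<inter> X \<noteq> {} \<longrightarrow> ball z r \<subseteq> X" using step[of z] by blast
    have zb: "z \<in> ball z r" using r(1) by simp
    moreover have "ball z r \<inter> X = {}" using r(3) zb z by blast
    ultimately show "\<exists>T. open T \<and> z \<in> T \<and> T \<subseteq> V - X" using r(2) by (intro exI[of _ "ball z r"]) auto
  qed
  have "connected V" unfolding V_def by (rule A.connected_complement_discriminant)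
  then have "X \<inter> V = {} \<or> (V - X) \<inter> V = {}" by (rule connectedD[OF _ oX oY]) auto
  moreover have "z0 \<in> X" using start F0(1) by (auto simp: X_def U0_def)
  ultimately have "V \<subseteq> X" using XV by blast
  then show thesis
    using that[of U0 F0] F0(3) unfolding X_def V_def U0_def by blast
qed

end

context correspondence
begin

lemma act_discriminant: "g \<in> G1 \<Longrightarrow> g *v z \<in> discriminant_locus G1 \<longleftrightarrow> z \<in> discriminant_locus G1"
  using total1[of z] act1 discriminant_iff by metis

text \<open>Flatness and invariance of the Dunkl form follow from those of the connection on the dense set of
  regular points.\<close>

lemma dunkl_connection_from_correspondence:
  "\<exists>A. dunkl_connection (reflection_hyperplanes G1) A \<and> invariant_connection G1 (- discriminant_locus G1) A \<and>
     (\<forall>z w. z \<notin> discriminant_locus G1 \<longrightarrow> R z w \<longrightarrow>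
        (\<exists>U F. z \<in> U \<and> U \<subseteq> - discriminant_locus G1 \<and> F ` U \<subseteq> - discriminant_locus G2 \<and>
           F z = w \<and> locally_biholomorphic U F \<and> (\<forall>u\<in>U. R u (F u)) \<and>
           (\<forall>u\<in>U. \<forall>x y. A u x y = pullback_connection F (\<lambda>_ _ _. 0) u x y))) \<and>
     (\<exists>U\<^sub>0 F\<^sub>0.
        (\<forall>z\<in>- discriminant_locus G1. \<exists>U F. developing_map (- discriminant_locus G1) A U\<^sub>0 F\<^sub>0 U F \<and> z \<in> U) \<and>
        (\<forall>U (F :: complex^'n \<Rightarrow> complex^'m). developing_map (- discriminant_locus G1) A U\<^sub>0 F\<^sub>0 U F \<longrightarrow> (\<forall>z\<in>U. R z (F z))))"
proof -
  define \<H> where "\<H> = reflection_hyperplanes G1"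
  define V where "V = - discriminant_locus G1"
  have oV: "open V" unfolding V_def by (rule A.open_complement_discriminant)
  obtain \<phi> \<alpha> \<kappa> where frame: "\<And>H. H \<in> \<H> \<Longrightarrow> hyperplane_frame G1 H (\<phi> H) (\<alpha> H)"
    and eq: "\<And>z x y. z \<in> regular_points G1 \<Longrightarrow> lift_connection z x y = dunkl_form \<H> \<phi> \<alpha> \<kappa> z x y"
    using ex_dunkl_form[folded \<H>_def] by blast
  note F = hyperplane_frameD[OF frame]
  define A where "A = dunkl_form \<H> \<phi> \<alpha> \<kappa>"
  have Ah: "vholo_on (\<lambda>z. A z x y) V" for x y
    unfolding A_def V_def \<H>_def by (rule A.vholo_on_dunkl_form) (use frame in \<open>simp add: \<H>_def\<close>)
  have Al: "A z x (y + y') = A z x y + A z x y'" "A z x (c *s y) = c *s A z x y" for z x y y' c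
    unfolding A_def by (rule linear_dunkl_form; use F(1) in blast)+
  interpret E: extended_correspondence G1 G2 R e1 e2 A
  proof
    show "lift_connection z x y = A z x y" if "z \<in> regular_points G1" for z x y using eq[OF that] by (simp add: A_def)
    show "vholo_on (\<lambda>z. A z x y) (- discriminant_locus G1)" for x y using Ah by (simp add: V_def)
    show "A z x y = A z y x" for z x y by (simp add: A_def dunkl_form_def vector_smult_assoc mult_ac)
  qed (fact Al)+
  have flat: "flat_on V A"
    unfolding flat_on_def
  proof (intro ballI allI)
    fix z x y w assume z: "z \<in> V"
    have cd1: "cov_deriv A (\<lambda>_. y) (\<lambda>_. w) = (\<lambda>u. A u y w)" for y w
      by (rule ext) (simp add: cov_deriv_def dif_const)
    have cd: "cov_deriv A (\<lambda>_. x) (cov_deriv A (\<lambda>_. y) (\<lambda>_. w)) z = dif (\<lambda>u. A u y w) z x + A z x (A z y w)" for x y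
      unfolding cd1 by (simp add: cov_deriv_def)
    have c: "continuous_on V (\<lambda>z. dif (\<lambda>u. A u y w) z x + A z x (A z y w))" for x y
      by (intro continuous_on_add vholo_on_continuous vholo_on_dif oV Ah
          vholo_on_apply_linear[where A = "\<lambda>z. A z x"]) (simp_all add: Al)
    have "dif (\<lambda>u. A u y w) z x + A z x (A z y w) = dif (\<lambda>u. A u x w) z y + A z y (A z x w)"
    proof (rule A.continuous_eq_on_complement[OF c c oV _ z])
      fix u assume u: "u \<in> regular_points G1"
      have "dif (\<lambda>v. lift_connection v y w) u = dif (\<lambda>v. A v y w) u" for y
        by (rule dif_cong_open[OF A.open_regular u]) (rule E.agree)
      then show "dif (\<lambda>u. A u y w) u x + A u x (A u y w) = dif (\<lambda>u. A u x w) u y + A u y (A u x w)"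
        using lift_connection_flat[OF u, of y w x] E.agree[OF u] by simp
    qed
    then show "cov_deriv A (\<lambda>_. x) (cov_deriv A (\<lambda>_. y) (\<lambda>_. w)) z - cov_deriv A (\<lambda>_. y) (cov_deriv A (\<lambda>_. x) (\<lambda>_. w)) z = 0"
      by (simp add: cd)
  qed
  have dunkl: "dunkl_connection \<H> A"
    unfolding dunkl_connection_def
  proof (intro conjI ballI exI[of _ "averaged_inner G1"] exI[of _ \<phi>] exI[of _ \<kappa>] exI[of _ "\<lambda>H v. \<phi> H v *s \<alpha> H"] allI)
    show "finite \<H>" using A.finite_reflection_hyperplanes by (simp add: \<H>_def)
    show "linear_hyperplane H" if "H \<in> \<H>" for H using that A.linear_hyperplane_reflection by (simp add: \<H>_def)
    show "hermitian_inner (averaged_inner G1)" by (rule A.hermitian_averaged_inner)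
    show "flat_on (- \<Union>\<H>) A" using flat by (simp add: V_def \<H>_def discriminant_locus_def)
    show "Vector_Spaces.linear (*s) (*) (\<phi> H)" if "H \<in> \<H>" for H by (rule F(1)[OF that])
    show "{v. \<phi> H v = 0} = H" if "H \<in> \<H>" for H using F(3)[OF that] by blast
    show "orth_projection_with_kernel (averaged_inner G1) H (\<lambda>v. \<phi> H v *s \<alpha> H)" if "H \<in> \<H>" for H
      using F(9)[OF that] F(4)[OF that] by (simp add: orth_projection_with_kernel_def A.averaged_inner_scale)
    show "A z x y = - (\<Sum>H\<in>\<H>. (\<phi> H x / \<phi> H z * \<kappa> H) *s (\<phi> H y *s \<alpha> H))" for z x y
      by (simp only: A_def dunkl_form_def)
  qed
  have inv: "invariant_connection G1 V A"
    unfolding invariant_connection_def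
  proof (intro ballI allI)
    fix g z x y assume g: "g \<in> G1" and z: "z \<in> V"
    have gV: "(\<lambda>v. g *v v) ` V \<subseteq> V" using act_discriminant[OF g] by (auto simp: V_def)
    have c1: "continuous_on V (\<lambda>v. A (g *v v) (g *v x) (g *v y))"
      by (rule vholo_on_continuous[OF vholo_on_compose[OF Ah vholo_on_matrix gV]])
    have c2: "continuous_on V (\<lambda>v. g *v A v x y)"
      by (rule vholo_on_continuous[OF vholo_on_compose[OF vholo_on_matrix Ah subset_UNIV]])
    have "A (g *v z) (g *v x) (g *v y) = g *v A z x y"
    proof (rule A.continuous_eq_on_complement[OF c1 c2 oV _ z])
      fix u assume u: "u \<in> regular_points G1"
      show "A (g *v u) (g *v x) (g *v y) = g *v A u x y"
        using lift_connection_invariant[OF g u, of x y] E.agree[OF u] E.agree[OF A.regular_act[OF g u]] by simp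
    qed
    moreover have "inj (\<lambda>v. g *v v)" using A.mem_inj[OF g] by (auto simp: inj_on_def)
    then have "inv (\<lambda>v. g *v v) (g *v v) = v" for v by (rule inv_f_f)
    ultimately show "pullback_connection (\<lambda>v. g *v v) A z x y = A z x y"
      by (simp add: pullback_connection_def dif_matrix dif_const)
  qed
  have lifts: "\<exists>U F. z \<in> U \<and> U \<subseteq> - discriminant_locus G1 \<and> F ` U \<subseteq> - discriminant_locus G2 \<and>
      F z = w \<and> locally_biholomorphic U F \<and> (\<forall>u\<in>U. R u (F u)) \<and>
      (\<forall>u\<in>U. \<forall>x y. A u x y = pullback_connection F (\<lambda>_ _ _. 0) u x y)"
    if z: "z \<notin> discriminant_locus G1" and zw: "R z w" for z w
  proof -
    obtain r Fl where L: "r > 0" "ball z r \<subseteq> - discriminant_locus G1" "is_lift (ball z r) Fl" "Fl z = w"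
      by (rule E.ex_lift_off_discriminant[OF zw z]) (rule that; (assumption | blast))
    have R: "R u (Fl u)" if "u \<in> ball z r" for u using that L(3) by (simp add: is_lift_def)
    have "Fl ` ball z r \<subseteq> - discriminant_locus G2" using R discriminant_iff L(2) by blast
    then show ?thesis
      using L R E.lift_locally_biholomorphic[OF L(3,2)] E.lift_pullback[OF L(3,2)]
      by (intro exI[of _ "ball z r"] exI[of _ Fl]) auto
  qed
  obtain U0 F0 where dev: "is_lift U0 F0"
    "\<And>z. z \<notin> discriminant_locus G1 \<Longrightarrow> \<exists>U F. developing_map (- discriminant_locus G1) A U0 F0 U F \<and> z \<in> U"
    by (rule E.ex_developing_map) (rule that; (assumption | blast))
  have "R z (F z)" if "developing_map (- discriminant_locus G1) A U0 F0 U F" "z \<in> U" for U and F :: "complex^'n \<Rightarrow> complex^'m" and z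
    using E.developing_map_lift[OF dev(1) that(1)] that(2) by (simp add: is_lift_def)
  then show ?thesis
    using dunkl inv lifts dev(2) unfolding \<H>_def V_def
    by (intro exI[of _ A] conjI exI[of _ U0] exI[of _ F0]) blast+
qed

end

section \<open>Isomorphisms of orbit spaces\<close>

text \<open>Conjugation by a group element permutes the reflections, hence their hyperplanes.\<close>

lemma (in finite_matrix_group) discriminant_act:
  assumes g: "g \<in> G" and z: "z \<in> discriminant_locus G"
  shows "g *v z \<in> discriminant_locus G"
proof -
  obtain s where s: "s \<in> G" "linear_hyperplane (fixed_space s)" "z \<in> fixed_space s"
    using z by (auto simp: discriminant_locus_def reflection_hyperplanes_def reflections_def)
  define t where "t = g ** s ** matrix_inv g"
  have lin: "Vector_Spaces.linear (*s) (*s) ((*v) g)" by (rule matrix_vector_mul_linear_gen)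
  have fixed: "fixed_space t = (*v) g ` fixed_space s"
  proof (intro set_eqI iffI)
    fix v assume "v \<in> fixed_space t"
    then have "g *v (s *v (matrix_inv g *v v)) = v" by (simp add: t_def fixed_space_def matrix_vector_mul_assoc matrix_mul_assoc)
    then have "s *v (matrix_inv g *v v) = matrix_inv g *v v" using inv_apply(1)[OF g] by metis
    then show "v \<in> (*v) g ` fixed_space s"
      using inv_apply(2)[OF g, of v] by (intro image_eqI[of _ _ "matrix_inv g *v v"]) (auto simp: fixed_space_def)
  next
    fix v assume "v \<in> (*v) g ` fixed_space s"
    then obtain u where u: "v = g *v u" "s *v u = u" by (auto simp: fixed_space_def)
    have "t *v v = g *v (s *v (matrix_inv g *v (g *v u)))"
      by (simp only: t_def u(1) matrix_vector_mul_assoc matrix_mul_assoc)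
    then show "v \<in> fixed_space t" using u inv_apply(1)[OF g] by (simp add: fixed_space_def)
  qed
  have "inj_on ((*v) g) (vec.span (fixed_space s))" using mem_inj[OF g] by (auto simp: inj_on_def)
  then have "vec.dim (fixed_space t) = vec.dim (fixed_space s)"
    unfolding fixed by (rule vec.dim_image_eq[OF lin])
  then have "linear_hyperplane (fixed_space t)"
    using s(2) vec_subspace_fixed_space by (simp add: linear_hyperplane_def)
  moreover have "t \<in> G" unfolding t_def using g s(1) mult_mem inv_mem by blast
  ultimately have "fixed_space t \<in> reflection_hyperplanes G"
    by (auto simp: reflection_hyperplanes_def reflections_def)
  moreover have "g *v z \<in> fixed_space t" using s(3) fixed by blast
  ultimately show ?thesis unfolding discriminant_locus_def by blast
qed

text \<open>An invariant open set is the preimage of a set of orbits, and an invariant function on it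
  comes from a function of orbits.\<close>

lemma
  assumes G2: "finite_matrix_group G2" and f: "orbit_morphism G1 G2 f"
    and W: "open W" "\<And>g w. g \<in> G2 \<Longrightarrow> w \<in> W \<Longrightarrow> g *v w \<in> W"
  shows open_orbit_morphism_pull: "open {z. \<exists>w\<in>W. mat_orbit G2 w = f (mat_orbit G1 z)}"
    and holo_orbit_morphism_pull:
      "holo_on h W \<Longrightarrow> (\<And>g w. g \<in> G2 \<Longrightarrow> w \<in> W \<Longrightarrow> h (g *v w) = h w) \<Longrightarrow>
        (\<And>z w. mat_orbit G2 w = f (mat_orbit G1 z) \<Longrightarrow> w \<in> W \<Longrightarrow> K z = h w) \<Longrightarrow>
        holo_on K {z. \<exists>w\<in>W. mat_orbit G2 w = f (mat_orbit G1 z)}"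
proof -
  interpret G2: finite_matrix_group G2 by (rule G2)
  define W' where "W' = mat_orbit G2 ` W"
  have pre: "mat_orbit G2 -` W' = W"
    using W(2) G2.mat_orbit_eq_iff unfolding W'_def by (auto simp: image_iff) metis
  then have W': "orbit_open G2 W'" using W(1) by (auto simp: orbit_open_def W'_def orbit_space_def)
  have pull: "mat_orbit G1 -` (f -` W' \<inter> orbit_space G1) = {z. \<exists>w\<in>W. mat_orbit G2 w = f (mat_orbit G1 z)}"
    by (auto simp: W'_def orbit_space_def)
  have "orbit_open G1 (f -` W' \<inter> orbit_space G1)" using f W' by (simp add: orbit_morphism_def)
  then show op: "open {z. \<exists>w\<in>W. mat_orbit G2 w = f (mat_orbit G1 z)}" by (simp only: orbit_open_def pull)
  assume h: "holo_on h W" and inv: "\<And>g w. g \<in> G2 \<Longrightarrow> w \<in> W \<Longrightarrow> h (g *v w) = h w"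
    and K: "\<And>z w. mat_orbit G2 w = f (mat_orbit G1 z) \<Longrightarrow> w \<in> W \<Longrightarrow> K z = h w"
  define k where "k X = h (SOME w. w \<in> X)" for X
  have k: "k (mat_orbit G2 w) = h w" if w: "w \<in> W" for w
  proof -
    have "(SOME v. v \<in> mat_orbit G2 w) \<in> mat_orbit G2 w" using G2.self_mem_orbit by (rule someI)
    then show ?thesis using inv w G2.mem_orbit_iff unfolding k_def by metis
  qed
  have "holo_on (\<lambda>w. k (mat_orbit G2 w)) W" by (rule holo_on_cong[OF W(1) _ h]) (simp add: k)
  then have "orbit_holo_on G2 k W'" by (simp add: orbit_holo_on_def pre)
  then have "orbit_holo_on G1 (\<lambda>X. k (f X)) (f -` W' \<inter> orbit_space G1)"
    using f W' by (simp add: orbit_morphism_def)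
  then have kf: "holo_on (\<lambda>z. k (f (mat_orbit G1 z))) {z. \<exists>w\<in>W. mat_orbit G2 w = f (mat_orbit G1 z)}"
    by (simp only: orbit_holo_on_def pull)
  show "holo_on K {z. \<exists>w\<in>W. mat_orbit G2 w = f (mat_orbit G1 z)}"
  proof (rule holo_on_cong[OF op])
    fix z assume "z \<in> {z. \<exists>w\<in>W. mat_orbit G2 w = f (mat_orbit G1 z)}"
    then obtain w where w: "w \<in> W" "mat_orbit G2 w = f (mat_orbit G1 z)" by blast
    then show "k (f (mat_orbit G1 z)) = K z" using K[OF w(2,1)] k[OF w(1)] by simp
  qed (rule kf)
qed

text \<open>The effective actions of \<open>t ^ (e1 * e2)\<close> are scalar multiplications by \<open>t ^ e2\<close> and by \<open>t ^ e1\<close> on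
  the two vector spaces, where \<open>e1\<close> and \<open>e2\<close> are the numbers of scalars that act trivially.\<close>

lemma correspondence_orbit_iso:
  fixes G1 :: "(complex^'n^'n) set" and G2 :: "(complex^'m^'m) set"
  assumes G1: "finite_reflection_group G1" and G2: "finite_reflection_group G2"
    and f: "orbit_iso G1 G2 f"
    and disc: "f ` (mat_orbit G1 ` discriminant_locus G1) = mat_orbit G2 ` discriminant_locus G2"
    and equiv: "effectively_equivariant G1 G2 f"
  shows "correspondence G1 G2 (\<lambda>z w. mat_orbit G2 w = f (mat_orbit G1 z))
    (card (trivial_scalars G1)) (card (trivial_scalars G2))"
proof -
  interpret A: finite_matrix_group G1 using G1 by unfold_locales (auto simp: finite_reflection_group_def)
  interpret B: finite_matrix_group G2 using G2 by unfold_locales (auto simp: finite_reflection_group_def)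
  let ?g = "inv_into (orbit_space G1) f"
  have bij: "bij_betw f (orbit_space G1) (orbit_space G2)"
    and m1: "orbit_morphism G1 G2 f" and m2: "orbit_morphism G2 G1 ?g"
    using f by (auto simp: orbit_iso_def)
  have orb: "mat_orbit G1 z \<in> orbit_space G1" "mat_orbit G2 w \<in> orbit_space G2" for z w
    by (auto simp: orbit_space_def)
  have inj: "f (mat_orbit G1 z) = f (mat_orbit G1 z') \<longleftrightarrow> mat_orbit G1 z = mat_orbit G1 z'" for z z'
    using bij orb unfolding bij_betw_def inj_on_def by metis
  have flip: "mat_orbit G2 w = f (mat_orbit G1 z) \<longleftrightarrow> mat_orbit G1 z = ?g (mat_orbit G2 w)" for z w
    using bij orb by (metis bij_betw_inv_into_left bij_betw_inv_into_right)
  have D1: "z \<in> discriminant_locus G1" if "mat_orbit G1 z \<in> mat_orbit G1 ` discriminant_locus G1" for z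
    using that A.mat_orbit_eq_iff A.discriminant_act by (metis (no_types, lifting) imageE)
  have D2: "w \<in> discriminant_locus G2" if "mat_orbit G2 w \<in> mat_orbit G2 ` discriminant_locus G2" for w
    using that B.mat_orbit_eq_iff B.discriminant_act by (metis (no_types, lifting) imageE)
  show ?thesis
  proof (unfold_locales, goal_cases)
    case (1 z)
    have "f (mat_orbit G1 z) \<in> orbit_space G2" using bij orb by (auto simp: bij_betw_def)
    then show ?case by (auto simp: orbit_space_def)
  next
    case (2 w)
    have "?g (mat_orbit G2 w) \<in> orbit_space G1"
      using bij_betw_inv_into[OF bij] orb by (auto simp: bij_betw_def)
    then show ?case unfolding flip by (auto simp: orbit_space_def)
  next
    case (3 z w z')
    then show ?case using inj A.mat_orbit_eq_iff by metis
  next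
    case (4 z w w')
    then show ?case using B.mat_orbit_eq_iff by metis
  next
    case (5 Z)
    then show ?case unfolding flip by (rule open_orbit_morphism_pull[OF A.finite_matrix_group_axioms m2])
  next
    case (6 W)
    then show ?case by (rule open_orbit_morphism_pull[OF B.finite_matrix_group_axioms m1])
  next
    case (7 Z h K)
    from 7(5) have "K w = h z" if "mat_orbit G1 z = ?g (mat_orbit G2 w)" "z \<in> Z" for z w
      using that unfolding flip by blast
    with 7(1-4) show ?case unfolding flip by (intro holo_orbit_morphism_pull[OF A.finite_matrix_group_axioms m2])
  next
    case (8 W h K)
    then show ?case by (intro holo_orbit_morphism_pull[OF B.finite_matrix_group_axioms m1])
  next
    case (9 z w)
    show ?case
    proof
      assume "z \<in> discriminant_locus G1"
      then have "mat_orbit G2 w \<in> mat_orbit G2 ` discriminant_locus G2" unfolding disc[symmetric] 9 by blast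
      then show "w \<in> discriminant_locus G2" by (rule D2)
    next
      assume "w \<in> discriminant_locus G2"
      then have "f (mat_orbit G1 z) \<in> f ` (mat_orbit G1 ` discriminant_locus G1)" unfolding disc 9[symmetric] by blast
      then obtain z' where "z' \<in> discriminant_locus G1" "f (mat_orbit G1 z) = f (mat_orbit G1 z')" by blast
      then show "z \<in> discriminant_locus G1" using inj[of z z'] D1[of z] by blast
    qed
  next
    case (10 z w t)
    let ?e1 = "card (trivial_scalars G1)" and ?e2 = "card (trivial_scalars G2)"
    have "mat_orbit G2 (t ^ ?e1 *s w) = effective_action G2 ((t ^ ?e1) ^ ?e2) (mat_orbit G2 w)"
      using effective_action_orbit[OF B.finite_G B.group_G, of "t ^ ?e1" w] 10(2) by simp
    also have "(t ^ ?e1) ^ ?e2 = (t ^ ?e2) ^ ?e1" by (simp add: power_mult[symmetric] mult.commute)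
    also have "effective_action G2 ((t ^ ?e2) ^ ?e1) (mat_orbit G2 w) = f (effective_action G1 ((t ^ ?e2) ^ ?e1) (mat_orbit G1 z))"
      using equiv 10 orb by (simp add: effectively_equivariant_def)
    also have "\<dots> = f (mat_orbit G1 (t ^ ?e2 *s z))"
      using effective_action_orbit[OF A.finite_G A.group_G, of "t ^ ?e2" z] 10(2) by simp
    finally show ?case .
  next
    case 11
    show ?case by (rule trivial_scalars_eq_roots_of_unity(1)[OF A.finite_G A.group_G])
  next
    case 12
    show ?case by (rule trivial_scalars_eq_roots_of_unity(1)[OF B.finite_G B.group_G])
  qed
qed

theorem theorem5p3:
  fixes G1 :: "(complex^'n^'n) set" and G2 :: "(complex^'m^'m) set"
    and f :: "(complex^'n) set \<Rightarrow> (complex^'m) set"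
  assumes "finite_reflection_group G1" and "finite_reflection_group G2"
    and "irreducible_arrangement (reflection_hyperplanes G1)"
    and "irreducible_arrangement (reflection_hyperplanes G2)"
    and "\<Inter>(reflection_hyperplanes G1) = {0}" and "\<Inter>(reflection_hyperplanes G2) = {0}"
    and "orbit_iso G1 G2 f"
    and "f ` (mat_orbit G1 ` discriminant_locus G1) = mat_orbit G2 ` discriminant_locus G2"
    and "effectively_equivariant G1 G2 f"
  shows "(\<exists>A. dunkl_connection (reflection_hyperplanes G1) A \<and>
              invariant_connection G1 (- discriminant_locus G1) A \<and>
              obtained_from_developing_map G1 G2 f A) \<and>
         (\<exists>B. dunkl_connection (reflection_hyperplanes G2) B \<and>
              invariant_connection G2 (- discriminant_locus G2) B \<and>
              obtained_from_developing_map G2 G1 (inv_into (orbit_space G1) f) B)"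
proof -
  let ?R = "\<lambda>z w. mat_orbit G2 w = f (mat_orbit G1 z)"
  let ?e1 = "card (trivial_scalars G1)" and ?e2 = "card (trivial_scalars G2)"
  interpret C: correspondence G1 G2 ?R ?e1 ?e2
    using assms(1,2,7-9) by (rule correspondence_orbit_iso)
  interpret D: correspondence G2 G1 "\<lambda>w z. ?R z w" ?e2 ?e1 by (rule C.swap)
  have bij: "bij_betw f (orbit_space G1) (orbit_space G2)" using assms(7) by (simp add: orbit_iso_def)
  have "mat_orbit G1 z \<in> orbit_space G1" "mat_orbit G2 w \<in> orbit_space G2" for z w
    by (auto simp: orbit_space_def)
  then have flip: "mat_orbit G1 z = inv_into (orbit_space G1) f (mat_orbit G2 w) \<longleftrightarrow> ?R z w" for z w
    using bij by (metis bij_betw_inv_into_left bij_betw_inv_into_right)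
  show ?thesis
    unfolding obtained_from_developing_map_def lift_of_pullback_def flip
    by (rule conjI[OF C.dunkl_connection_from_correspondence D.dunkl_connection_from_correspondence])
qed

end
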